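(* Let $n\geq 2$ and $d\geq 2$ be integers, and let $F=\sum_{\lambda\vdash d}c_\lambda e_\lambda(x)\in\mathbb{U}[x_1,\ldots,x_n]$ be the generic homogeneous symmetric polynomial of degree $d$ in $n$ variables over $\mathbb{U}=\mathbb{Z}[c_\lambda:\lambda\vdash d]$. Set $F^{\{i\}}:=\partial F/\partial x_i$ for $i=1,\ldots,n$, and let $a(n,d):=\frac{(d-1)^n-(-1)^n}{d}\in\mathbb{Z}$. With $F^{I}$, $F_\lambda^{I}$, $m_\lambda$, $l(\lambda)$, $\mathrm{Res}$ and $\mathrm{Disc}$ as defined in the context, the following equalities hold. (1) If $d>n$, then $$d^{a(n,d)}\,\mathrm{Disc}(F)=\prod_{\lambda\vdash n}\mathrm{Res}\left(F_\lambda^{\{1\}},F_\lambda^{\{1,2\}},\ldots,F_\lambda^{\{1,2,\ldots,l(\lambda)-1\}},F_\lambda^{\{1,2,\ldots,l(\lambda)\}}\right)^{m_\lambda}.$$ (2) If $d\leq n$, then $$d^{a(n,d)}\,\mathrm{Disc}(F)=\left(F^{\{1,\ldots,d\}}\right)^{m_0}\prod_{\substack{\lambda\vdash n\\ l(\lambda)<d}}\mathrm{Res}\left(F_\lambda^{\{1\}},F_\lambda^{\{1,2\}},\ldots,F_\lambda^{\{1,2,\ldots,l(\lambda)-1\}},F_\lambda^{\{1,2,\ldots,l(\lambda)\}}\right)^{m_\lambda},$$ where $$m_0:=n(d-1)^{n-1}-\sum_{\substack{\lambda\vdash n\\ l(\lambda)<d}}m_\lambda\left(\sum_{j=1}^{l(\lambda)}\frac{(d-1)(d-2)\cdots(d-l(\lambda))}{d-j}\right).$$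 Moreover, in this case $F^{\{1,\ldots,d\}}=(-1)^{d-1}c_{(d)}$, where $c_{(d)}$ is the coefficient $c_\lambda$ for the partition $\lambda=(d)$, so that $$d^{a(n,d)}\,\mathrm{Disc}(F)=(-1)^{\varepsilon}\left(c_{(d)}\right)^{m_0}\prod_{\substack{\lambda\vdash n\\ l(\lambda)<d}}\mathrm{Res}\left(F_\lambda^{\{1\}},F_\lambda^{\{1,2\}},\ldots,F_\lambda^{\{1,2,\ldots,l(\lambda)-1\}},F_\lambda^{\{1,2,\ldots,l(\lambda)\}}\right)^{m_\lambda},$$ where $\varepsilon=n-1$ if $d=2$ and $\varepsilon=0$ if $d\geq 3$.
   Context: Notation: $[p]=\{1,\ldots,p\}$. A partition $\lambda\vdash p$ is a weakly decreasing sequence $\lambda_1\geq\cdots\geq\lambda_k>0$ of integers of sum $p$; $l(\lambda)=k$ is its length. Symmetric polynomials. $e_p(x)=e_p(x_1,\ldots,x_n)$ is the $p$-th elementary symmetric polynomial ($e_0=1$, $e_p=0$ for $p>n$) and $e_\lambda:=e_{\lambda_1}e_{\lambda_2}\cdots e_{\lambda_k}$ for a partition $\lambda=(\lambda_1,\ldots,\lambda_k)$. The $e_\lambda$ with $\lambda\vdash d$ and $\lambda_1\leq n$ form a $\mathbb{Z}$-basis of the homogeneous symmetric polynomials of degree $d$ in $n$ variables; the $c_\lambda$ are indeterminates. Divided differences. Let $A$ be a commutative ring and let $P^{\{1\}},\ldots,P^{\{m\}}\in A[x_1,\ldots,x_m]$ be homogeneous of the same degree $\delta\ge 1$ such that $P^{\{i\}}-P^{\{j\}}$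 is divisible by $x_i-x_j$ for all $i,j\in[m]$. For any subset $\{i_1,\ldots,i_k\}\subset[m]$ of $k\geq 2$ distinct elements, the divided difference $P^{\{i_1,\ldots,i_k\}}$ is the unique homogeneous polynomial of degree $\delta-k+1$ (it is $0$ if $k>\delta+1$) such that $\prod_{1\le s<r\le k}(x_{i_r}-x_{i_s})\cdot P^{\{i_1,\ldots,i_k\}}$ equals the determinant of the $k\times k$ matrix whose $r$-th row is $(1,x_{i_r},\ldots,x_{i_r}^{k-2},P^{\{i_r\}})$. For $m=1$ only $P^{\{1\}}$ itself occurs. The partial derivatives $F^{\{i\}}$ are homogeneous of degree $d-1$ and satisfy $F^{\{i\}}(x_{\sigma(1)},\ldots,x_{\sigma(n)})=F^{\{\sigma(i)\}}$ for all $\sigma\in\mathfrak{S}_n$, which implies the divisibility condition; their divided differences are denoted $F^{I}$, $I\subset[n]$. Specialization along $\lambda\vdash n$. Let $\rho_\lambda:\mathbb{U}[x_1,\ldots,x_n]\to\mathbb{U}[y_1,\ldots,y_{l(\lambda)}]$ be the $\mathbb{U}$-algebra morphism sending the first $\lambda_1$ variables to $y_1$, the next $\lambda_2$ variables to $y_2$, ..., the last $\lambda_{l(\lambda)}$ variables to $y_{l(\lambda)}$. For $i\in[l(\lambda)]$ set $F_\lambda^{\{i\}}:=\rho_\lambda(F^{\{j\}})$ for any $j$ with $\rho_\lambda(x_j)=y_i$ (independent of the choice of $j$). These polynomials in $y_1,\ldots,y_{l(\lambda)}$ again satisfy that $F_\lambda^{\{i\}}-F_\lambda^{\{j\}}$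 is divisible by $y_i-y_j$; their divided differences are denoted $F_\lambda^{I}$, $I\subset[l(\lambda)]$. The integer $m_\lambda$ is $$m_\lambda:=\frac{1}{\prod_{j=1}^n s_j!}\cdot\frac{n!}{\lambda_1!\lambda_2!\cdots\lambda_{l(\lambda)}!},$$ where $s_j$ is the number of indices $i$ with $\lambda_i=j$. Resultant. For $m\ge1$ and positive integers $d_1,\ldots,d_m$, let $f_i=\sum_{|\alpha|=d_i}u_{i,\alpha}x^\alpha$ be the generic homogeneous polynomials of degrees $d_1,\ldots,d_m$ in $m$ variables over $\mathbb{Z}[u_{i,\alpha}]$. The degree zero part of the ideal $(f_1,\ldots,f_m):(x_1,\ldots,x_m)^\infty$ is a principal ideal of $\mathbb{Z}[u_{i,\alpha}]$; the universal resultant is its unique generator whose specialization at $f_i=x_i^{d_i}$ for all $i$ is $1$. For homogeneous $g_1,\ldots,g_m$ of degrees $d_1,\ldots,d_m$ in $m$ variables over any commutative ring $S$, $\mathrm{Res}(g_1,\ldots,g_m)\in S$ is the image of the universal resultant under specialization of coefficients. Discriminant. For the generic homogeneous polynomial $f=\sum_{|\alpha|=d}u_\alpha x^\alpha$ of degree $d\geq2$ in $n\geq 2$ variables, $\mathrm{Disc}(f)$ is the unique element of $\mathbb{Z}[u_\alpha]$ with $d^{a(n,d)}\mathrm{Disc}(f)=\mathrm{Res}(\partial f/\partial x_1,\ldots,\partial f/\partial x_n)$; for a homogeneous polynomial $g$ of degree $d$ over any commutative ring $S$, $\mathrm{Disc}(g)\in S$ is the image of $\mathrm{Disc}(f)$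 under specialization of coefficients. *)

theory Defs
  imports "HOL-Library.Poly_Mapping" "Jordan_Normal_Form.Determinant"
begin

section \<open>Multivariate polynomials\<close>

text \<open>
  Monomials are exponent functions of finite support, polynomials are finitely supported maps from
  monomials to coefficients; the ring structure is the convolution product of
  \<^theory>\<open>HOL-Library.Poly_Mapping\<close>. The variables are indexed by a whole type; a polynomial
  ring in a smaller set of variables is represented as a subset, see \<open>mpolys\<close>.
\<close>

type_synonym ('i, 'a) mpoly = "('i \<Rightarrow>\<^sub>0 nat) \<Rightarrow>\<^sub>0 'a"

definition mconst :: "'a::zero \<Rightarrow> ('i, 'a) mpoly" where
  "mconst a = Poly_Mapping.single 0 a"

definition mmonom :: "('i \<Rightarrow>\<^sub>0 nat) \<Rightarrow> ('i, 'a::zero_neq_one) mpoly" where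
  "mmonom \<alpha> = Poly_Mapping.single \<alpha> 1"

definition mvar :: "'i \<Rightarrow> ('i, 'a::zero_neq_one) mpoly" where
  "mvar i = mmonom (Poly_Mapping.single i 1)"

definition mdeg :: "('i \<Rightarrow>\<^sub>0 nat) \<Rightarrow> nat" where
  "mdeg \<alpha> = (\<Sum>i\<in>Poly_Mapping.keys \<alpha>. Poly_Mapping.lookup \<alpha> i)"

definition monoms :: "'i set \<Rightarrow> nat \<Rightarrow> ('i \<Rightarrow>\<^sub>0 nat) set" where
  "monoms V k = {\<alpha>. Poly_Mapping.keys \<alpha> \<subseteq> V \<and> mdeg \<alpha> = k}"

definition mpolys :: "'a set \<Rightarrow> 'i set \<Rightarrow> ('i, 'a::zero) mpoly set" where
  "mpolys A V = {p. \<forall>\<alpha>\<in>Poly_Mapping.keys p.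
     Poly_Mapping.lookup p \<alpha> \<in> A \<and> Poly_Mapping.keys \<alpha> \<subseteq> V}"

text \<open>The zero polynomial is homogeneous of every degree.\<close>

definition mhomogeneous :: "nat \<Rightarrow> ('i, 'a::zero) mpoly \<Rightarrow> bool" where
  "mhomogeneous k p \<longleftrightarrow> (\<forall>\<alpha>\<in>Poly_Mapping.keys p. mdeg \<alpha> = k)"

text \<open>
  For a ring morphism \<open>h\<close> on coefficients, \<open>meval h \<phi>\<close> is the ring morphism extending \<open>h\<close> with
  \<open>mvar i \<mapsto> \<phi> i\<close>.
\<close>

definition meval :: "('a::zero \<Rightarrow> 'b::comm_semiring_1) \<Rightarrow> ('i \<Rightarrow> 'b) \<Rightarrow> ('i, 'a) mpoly \<Rightarrow> 'b" where
  "meval h \<phi> p = (\<Sum>\<alpha>\<in>Poly_Mapping.keys p.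
     h (Poly_Mapping.lookup p \<alpha>) * (\<Prod>i\<in>Poly_Mapping.keys \<alpha>. \<phi> i ^ Poly_Mapping.lookup \<alpha> i))"

definition mpderiv :: "'i \<Rightarrow> ('i, 'a::comm_semiring_1) mpoly \<Rightarrow> ('i, 'a) mpoly" where
  "mpderiv i p = (\<Sum>\<alpha>\<in>Poly_Mapping.keys p.
     Poly_Mapping.single (\<alpha> - Poly_Mapping.single i 1)
       (of_nat (Poly_Mapping.lookup \<alpha> i) * Poly_Mapping.lookup p \<alpha>))"

section \<open>The universal resultant\<close>

text \<open>
  The index \<open>(i, \<alpha>)\<close> stands for the coefficient \<open>u\<^sub>i\<^sub>,\<^sub>\<alpha>\<close> of the \<open>i\<close>-th generic form,
  \<open>1 \<le> i \<le> m\<close>, which is homogeneous of degree \<open>ds i\<close> in the variables \<open>x\<^sub>1, \<dots>, x\<^sub>m\<close>.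
\<close>

type_synonym uvar = "nat \<times> (nat \<Rightarrow>\<^sub>0 nat)"

definition coeff_ring :: "nat \<Rightarrow> (nat \<Rightarrow> nat) \<Rightarrow> (uvar, int) mpoly set" where
  "coeff_ring m ds = mpolys UNIV (SIGMA i:{1..m}. monoms {1..m} (ds i))"

definition generic_form :: "nat \<Rightarrow> (nat \<Rightarrow> nat) \<Rightarrow> nat \<Rightarrow> (nat, (uvar, int) mpoly) mpoly" where
  "generic_form m ds i = (\<Sum>\<alpha>\<in>monoms {1..m} (ds i). mconst (mvar (i, \<alpha>)) * mmonom \<alpha>)"

definition generic_ideal :: "nat \<Rightarrow> (nat \<Rightarrow> nat) \<Rightarrow> (nat, (uvar, int) mpoly) mpoly set" where
  "generic_ideal m ds =
     {\<Sum>i=1..m. h i * generic_form m ds i | h. \<forall>i\<in>{1..m}. h i \<in> mpolys (coeff_ring m ds) {1..m}}"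

text \<open>
  The saturation of the ideal by \<open>(x\<^sub>1, \<dots>, x\<^sub>m)\<close>: the \<open>N\<close>-th power of the latter is generated by
  the monomials of degree \<open>N\<close>.
\<close>

definition generic_saturation :: "nat \<Rightarrow> (nat \<Rightarrow> nat) \<Rightarrow> (nat, (uvar, int) mpoly) mpoly set" where
  "generic_saturation m ds =
     {p \<in> mpolys (coeff_ring m ds) {1..m}.
        \<exists>N. \<forall>\<beta>\<in>monoms {1..m} N. mmonom \<beta> * p \<in> generic_ideal m ds}"

text \<open>
  The last condition normalizes the generator by specializing \<open>f\<^sub>i\<close> to \<open>x\<^sub>i ^ ds i\<close>.
\<close>

definition universal_resultant :: "nat \<Rightarrow> (nat \<Rightarrow> nat) \<Rightarrow> (uvar, int) mpoly" where
  "universal_resultant m ds = (THE R.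
     R \<in> coeff_ring m ds \<and>
     {r \<in> coeff_ring m ds. mconst r \<in> generic_saturation m ds} = {q * R | q. q \<in> coeff_ring m ds} \<and>
     meval of_int (\<lambda>(i, \<alpha>). if \<alpha> = Poly_Mapping.single i (ds i) then 1 else 0) R = (1::int))"

text \<open>
  The degrees are passed explicitly since they are not determined by the forms (which may vanish).
\<close>

definition resultant_forms ::
    "nat \<Rightarrow> (nat \<Rightarrow> nat) \<Rightarrow> (nat \<Rightarrow> (nat, 'a::comm_ring_1) mpoly) \<Rightarrow> 'a" where
  "resultant_forms m ds g =
     meval of_int (\<lambda>(i, \<alpha>). Poly_Mapping.lookup (g i) \<alpha>) (universal_resultant m ds)"

section \<open>The discriminant\<close>

text \<open>The integer \<open>a(n,d)\<close>; the division is exact and the quotient nonnegative.\<close>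

definition disc_exponent :: "nat \<Rightarrow> nat \<Rightarrow> nat" where
  "disc_exponent n d = nat (((int d - 1) ^ n - (-1) ^ n) div int d)"

definition universal_discriminant :: "nat \<Rightarrow> nat \<Rightarrow> (nat \<Rightarrow>\<^sub>0 nat, int) mpoly" where
  "universal_discriminant n d = (THE D.
     D \<in> mpolys UNIV (monoms {1..n} d) \<and>
     of_nat d ^ disc_exponent n d * D =
       resultant_forms n (\<lambda>_. d - 1)
         (\<lambda>i. mpderiv i (\<Sum>\<alpha>\<in>monoms {1..n} d. mconst (mvar \<alpha>) * mmonom \<alpha>)))"

definition discriminant_form :: "nat \<Rightarrow> nat \<Rightarrow> (nat, 'a::comm_ring_1) mpoly \<Rightarrow> 'a" where
  "discriminant_form n d g = meval of_int (Poly_Mapping.lookup g) (universal_discriminant n d)"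

section \<open>Divided differences\<close>

text \<open>
  The divided difference of the forms \<open>P i\<close> of degree \<open>\<delta>\<close> at the distinct indices \<open>is\<close>. Rows and
  columns are numbered from 0. The Vandermonde factor is not a zero divisor, so there is at most
  one solution, even when stray variables are admitted. It does not depend on the order
  of \<open>is\<close>, and for \<open>is = [i]\<close> it is \<open>P i\<close>.
\<close>

definition divided_difference ::
    "nat \<Rightarrow> (nat \<Rightarrow> (nat, 'a::comm_ring_1) mpoly) \<Rightarrow> nat list \<Rightarrow> (nat, 'a) mpoly" where
  "divided_difference \<delta> P is = (if length is > \<delta> + 1 then 0 else
     (THE Q. mhomogeneous (\<delta> + 1 - length is) Q \<and>
        (\<Prod>r<length is. \<Prod>s<r. mvar (is ! r) - mvar (is ! s)) * Q =
        det (mat (length is) (length is)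
          (\<lambda>(r, c). if c = length is - 1 then P (is ! r) else mvar (is ! r) ^ c))))"

section \<open>Partitions and the generic symmetric polynomial\<close>

definition partitions :: "nat \<Rightarrow> nat list set" where
  "partitions p = {\<mu>. sorted_wrt (\<ge>) \<mu> \<and> (\<forall>k\<in>set \<mu>. k > 0) \<and> sum_list \<mu> = p}"

text \<open>The integer \<open>m\<^sub>\<mu>\<close> for a partition of \<open>n = sum_list \<mu>\<close>; the division is exact.\<close>

definition partition_mult :: "nat list \<Rightarrow> nat" where
  "partition_mult \<mu> = fact (sum_list \<mu>) div
     ((\<Prod>j=1..sum_list \<mu>. fact (count_list \<mu> j)) * prod_list (map fact \<mu>))"

definition elem_sym :: "nat \<Rightarrow> nat \<Rightarrow> (nat, 'a::comm_ring_1) mpoly" where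
  "elem_sym n p = (\<Sum>S | S \<subseteq> {1..n} \<and> card S = p. \<Prod>i\<in>S. mvar i)"

text \<open>
  The coefficient ring \<open>\<int>[c\<^sub>\<mu>]\<close> of the generic symmetric polynomial is represented inside the
  integer polynomials whose variables are indexed by all lists; only partitions of \<open>d\<close> occur.
\<close>

type_synonym cring = "(nat list, int) mpoly"

definition sym_generic :: "nat \<Rightarrow> nat \<Rightarrow> (nat, cring) mpoly" where
  "sym_generic n d =
     (\<Sum>\<mu>\<in>partitions d. mconst (mvar \<mu>) * prod_list (map (elem_sym n) \<mu>))"

definition sym_partial :: "nat \<Rightarrow> nat \<Rightarrow> nat \<Rightarrow> (nat, cring) mpoly" where
  "sym_partial n d i = mpderiv i (sym_generic n d)"

text \<open>
  The position \<open>j \<in> {1..sum_list \<mu>}\<close> lies in block \<open>i\<close> if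
  \<open>\<mu>\<^sub>1 + \<dots> + \<mu>\<^sub>i\<^sub>-\<^sub>1 < j \<le> \<mu>\<^sub>1 + \<dots> + \<mu>\<^sub>i\<close>.
\<close>

definition block_of :: "nat list \<Rightarrow> nat \<Rightarrow> nat" where
  "block_of \<mu> j = (LEAST i. j \<le> sum_list (take i \<mu>))"

definition specialize :: "nat list \<Rightarrow> (nat, 'a::comm_ring_1) mpoly \<Rightarrow> (nat, 'a) mpoly" where
  "specialize \<mu> = meval mconst (\<lambda>j. mvar (block_of \<mu> j))"

definition sym_partial_spec :: "nat \<Rightarrow> nat \<Rightarrow> nat list \<Rightarrow> nat \<Rightarrow> (nat, cring) mpoly" where
  "sym_partial_spec n d \<mu> i =
     specialize \<mu> (sym_partial n d (SOME j. j \<in> {1..n} \<and> block_of \<mu> j = i))"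

text \<open>
  The resultant of the divided differences at \<open>{1}, {1,2}, \<dots>, {1,\<dots>,l(\<mu>)}\<close> of the specialized
  partial derivatives; the \<open>k\<close>-th one has degree \<open>(d - 1) - k + 1 = d - k\<close>.
\<close>

definition partition_resultant :: "nat \<Rightarrow> nat \<Rightarrow> nat list \<Rightarrow> cring" where
  "partition_resultant n d \<mu> = resultant_forms (length \<mu>) (\<lambda>k. d - k)
     (\<lambda>k. divided_difference (d - 1) (sym_partial_spec n d \<mu>) [1..<k + 1])"

text \<open>The integer \<open>m\<^sub>0\<close>; every division is exact, \<open>d - j\<close> being a factor of the product.\<close>

definition coeff_exponent :: "nat \<Rightarrow> nat \<Rightarrow> int" where
  "coeff_exponent n d = int n * (int d - 1) ^ (n - 1) -
     (\<Sum>\<mu> | \<mu> \<in> partitions n \<and> length \<mu> < d. int (partition_mult \<mu>) *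
        (\<Sum>j=1..length \<mu>. (\<Prod>t=1..length \<mu>. int d - int t) div (int d - int j)))"

end

theory Submission
  imports Defs "HOL-Library.Product_Lexorder" "HOL-Library.List_Lexorder" "HOL-Library.Nat_Bijection"
    "HOL-Combinatorics.Transposition"
begin

text \<open>
  All partial derivatives of \<open>F\<close> are values of one polynomial \<open>B\<^sub>0 + B\<^sub>1 X + \<dots> + B\<^sub>d\<^sub>-\<^sub>1 X\<^sup>d\<^sup>-\<^sup>1\<close> with
  symmetric coefficients, at \<open>X = x\<^sub>i\<close>. The difference of the forms at \<open>x\<^sub>q\<close> and \<open>x\<^sub>a\<close> is \<open>x\<^sub>q - x\<^sub>a\<close>
  times a divided difference, so by multiplicativity the resultant is the product of one in which
  \<open>x\<^sub>q\<close> is identified with \<open>x\<^sub>a\<close> and one in which the divided difference replaces the form at \<open>x\<^sub>q\<close>.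
  A divided difference of degree 0 is the constant \<open>(-1)\<^sup>d\<^sup>-\<^sup>1 c\<close>, with \<open>c\<close> the coefficient belonging to
  the partition \<open>(d)\<close>, and splits off as a power. Iterating this, one ends with one resultant for every
  set partition of the variables into fewer than \<open>d\<close> blocks. It depends on the block sizes only:
  changing the order of two blocks exchanges two forms of consecutive degrees, one of which is even.
  The exponent of the constant is found by comparing degrees along the same recursion.

  The resultant is the generator of the ideal of inertia forms. This ideal is prime, as it consists of
  the polynomials vanishing at a generic zero; it contains no nonzero polynomial free of
  a certain coefficient, hence is principal; and it contains Macaulay's determinants, which bound the degrees.
  That \<open>d\<close> to the power \<open>a(n,d)\<close> divides the resultant of the partial derivatives follows by induction
  on \<open>n\<close> from Euler's relation, since a form of Katz and Sarnak shows that no prime divisor of \<open>d\<close>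
  divides the resultant of a form and all but one of its partial derivatives.
\<close>

text \<open>Identities between resultants are proved for generic forms over the integers and then
  specialized. The usual pattern: one resultant divides the other because the latter is an inertia
  form of the larger ideal; exact degrees in the coefficients of each single form, or divisibility
  in both directions, leave an integer as cofactor; and at powers of the variables, where resultants
  are 1, this integer turns out to be 1. Multiplicativity up to a cofactor is what first yields
  those exact degrees.

  The variables of a polynomial range over a whole type, so a ring in finitely many variables is a
  subset and not a type. Factorization is therefore developed relative to subsets closed under
  factors, with pseudo-division in place of fraction fields.

  Each time the constant splits off, its exponent is (d - 1)!, the product of the degrees of all
  other forms at that moment; this is even for d \<ge> 3, which explains the sign. The recursion
  only gives the total exponent as a recursive sum; its closed form comes from the known total
  degree of resultants.\<close>

abbreviation coef :: "('k \<Rightarrow>\<^sub>0 'a::zero) \<Rightarrow> 'k \<Rightarrow> 'a" where "coef \<equiv> Poly_Mapping.lookup"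
abbreviation supp :: "('k \<Rightarrow>\<^sub>0 'a::zero) \<Rightarrow> 'k set" where "supp \<equiv> Poly_Mapping.keys"
abbreviation psingle :: "'k \<Rightarrow> 'a \<Rightarrow> ('k \<Rightarrow>\<^sub>0 'a::zero)" where "psingle \<equiv> Poly_Mapping.single"

section \<open>Multivariate polynomials\<close>

lemma sum_single_coef:
  fixes p :: "'k \<Rightarrow>\<^sub>0 'a::comm_monoid_add"
  assumes "finite S" "supp p \<subseteq> S"
  shows "(\<Sum>a\<in>S. psingle a (coef p a)) = p"
proof (rule poly_mapping_eqI)
  fix k
  have "coef (\<Sum>a\<in>S. psingle a (coef p a)) k = (\<Sum>a\<in>S. if a = k then coef p a else 0)"
    by (simp add: lookup_sum lookup_single when_def)
  also have "\<dots> = coef p k"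
    using assms by (auto simp: sum.delta in_keys_iff)
  finally show "coef (\<Sum>a\<in>S. psingle a (coef p a)) k = coef p k" .
qed

lemma poly_mapping_induct [case_names zero single add]:
  fixes p :: "'k \<Rightarrow>\<^sub>0 'a::comm_monoid_add"
  assumes "P 0" "\<And>a c. P (psingle a c)" "\<And>p q. P p \<Longrightarrow> P q \<Longrightarrow> P (p + q)"
  shows "P p"
proof -
  have "P (\<Sum>a\<in>S. psingle a (coef p a))" if "finite S" for S
    using that by (induction S) (auto intro: assms)
  from this[of "supp p"] show ?thesis by (simp add: sum_single_coef)
qed

definition mon_eval :: "('i \<Rightarrow> 'b::comm_semiring_1) \<Rightarrow> ('i \<Rightarrow>\<^sub>0 nat) \<Rightarrow> 'b" where
  "mon_eval \<phi> \<alpha> = (\<Prod>i\<in>supp \<alpha>. \<phi> i ^ coef \<alpha> i)"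

lemma mon_eval_superset:
  assumes "finite S" "supp \<alpha> \<subseteq> S"
  shows "mon_eval \<phi> \<alpha> = (\<Prod>i\<in>S. \<phi> i ^ coef \<alpha> i)"
  unfolding mon_eval_def
  by (rule prod.mono_neutral_left) (use assms in \<open>auto simp: in_keys_iff\<close>)

lemma mon_eval_0 [simp]: "mon_eval \<phi> 0 = 1"
  by (simp add: mon_eval_def)

lemma mon_eval_add: "mon_eval \<phi> (\<alpha> + \<beta>) = mon_eval \<phi> \<alpha> * mon_eval \<phi> \<beta>"
proof -
  define S where "S = supp \<alpha> \<union> supp \<beta>"
  have f: "finite S" by (simp add: S_def)
  have "supp (\<alpha> + \<beta>) \<subseteq> S" unfolding S_def by (rule keys_add)
  then show ?thesis
    using f by (subst (1 2 3) mon_eval_superset[of S])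
      (auto simp: S_def lookup_add power_add prod.distrib)
qed

lemma mon_eval_single [simp]: "mon_eval \<phi> (psingle i k) = \<phi> i ^ k"
  by (simp add: mon_eval_def)

lemma mon_eval_cong: "(\<And>i. i \<in> supp \<alpha> \<Longrightarrow> \<phi> i = \<psi> i) \<Longrightarrow> mon_eval \<phi> \<alpha> = mon_eval \<psi> \<alpha>"
  unfolding mon_eval_def by (rule prod.cong) auto

lemma mon_eval_hom:
  assumes "comm_ring_hom f"
  shows "f (mon_eval \<phi> \<alpha>) = mon_eval (\<lambda>i. f (\<phi> i)) \<alpha>"
proof -
  interpret f: comm_ring_hom f by fact
  show ?thesis by (simp add: mon_eval_def f.hom_prod f.hom_power)
qed

lemma mmonom_0 [simp]: "mmonom 0 = 1"
  by (simp add: mmonom_def)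

lemma mmonom_add: "mmonom (\<alpha> + \<beta>) = mmonom \<alpha> * (mmonom \<beta> :: ('i, 'a::comm_semiring_1) mpoly)"
  by (simp add: mmonom_def mult_single)

lemma mconst_0 [simp]: "mconst 0 = 0"
  by (simp add: mconst_def)

lemma mconst_1 [simp]: "mconst 1 = 1"
  by (simp add: mconst_def)

lemma mconst_add: "mconst (a + b) = mconst a + (mconst b :: ('i, 'a::comm_ring_1) mpoly)"
  by (simp add: mconst_def single_add)

lemma mconst_mult: "mconst (a * b) = mconst a * (mconst b :: ('i, 'a::comm_ring_1) mpoly)"
  by (simp add: mconst_def mult_single)

lemma comm_ring_hom_mconst: "comm_ring_hom (mconst :: 'a::comm_ring_1 \<Rightarrow> ('i, 'a) mpoly)"
  by unfold_locales (auto simp: mconst_add mconst_mult)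

lemma comm_ring_hom_of_int: "comm_ring_hom (of_int :: int \<Rightarrow> 'a::comm_ring_1)"
  by unfold_locales auto

lemma comm_ring_hom_comp: "comm_ring_hom f \<Longrightarrow> comm_ring_hom g \<Longrightarrow> comm_ring_hom (\<lambda>x. f (g x))"
proof -
  assume "comm_ring_hom f" "comm_ring_hom g"
  then interpret f: comm_ring_hom f + g: comm_ring_hom g .
  show ?thesis by unfold_locales (simp_all add: f.hom_add g.hom_add f.hom_mult g.hom_mult)
qed

lemma comm_ring_hom_id: "comm_ring_hom (\<lambda>x. x)"
  by unfold_locales auto

lemma psingle_eq: "psingle \<alpha> c = mconst c * mmonom \<alpha>" for c :: "'a::comm_semiring_1"
  by (simp add: mconst_def mmonom_def mult_single)

lemma coef_mmonom: "coef (mmonom \<alpha> :: ('i, 'a::zero_neq_one) mpoly) \<beta> = (if \<alpha> = \<beta> then 1 else 0)"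
  by (simp add: mmonom_def lookup_single when_def)

lemma coef_mconst: "coef (mconst c) \<beta> = (if \<beta> = 0 then c else 0)"
  by (auto simp: mconst_def lookup_single when_def)

lemma mconst_eq_iff [simp]: "mconst a = mconst b \<longleftrightarrow> a = b"
  by (metis coef_mconst)

lemma mconst_eq_0_iff [simp]: "mconst a = 0 \<longleftrightarrow> a = 0"
  by (metis mconst_0 mconst_eq_iff)

lemma coef_mconst_mult: "coef (mconst c * p) \<beta> = c * coef p \<beta>" for c :: "'a::comm_semiring_1"
proof (induction p rule: poly_mapping_induct)
  case (single a d)
  then show ?case by (auto simp: mconst_def mult_single lookup_single when_def)
qed (auto simp: distrib_left lookup_add)

lemma mmonom_power: "mmonom (psingle i k) = (mvar i :: ('i, 'a::comm_semiring_1) mpoly) ^ k"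
proof (induction k)
  case (Suc k)
  have "psingle i (Suc k) = psingle i 1 + psingle i k" by (simp flip: single_add)
  then show ?case using Suc by (simp add: mmonom_add mvar_def)
qed simp

lemma mmonom_eq_mon_eval: "mmonom \<alpha> = mon_eval (mvar :: 'i \<Rightarrow> ('i, 'a::comm_semiring_1) mpoly) \<alpha>"
  by (induction \<alpha> rule: poly_mapping_induct)
     (simp_all add: mmonom_power mmonom_add mon_eval_add)

lemma meval_superset:
  fixes h :: "'a::comm_semiring_1 \<Rightarrow> 'b::comm_semiring_1"
  assumes "h 0 = 0" "finite S" "supp p \<subseteq> S"
  shows "meval h \<phi> p = (\<Sum>\<alpha>\<in>S. h (coef p \<alpha>) * mon_eval \<phi> \<alpha>)"
  unfolding meval_def mon_eval_def[symmetric]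
  by (rule sum.mono_neutral_left) (use assms in \<open>auto simp: in_keys_iff\<close>)

lemma meval_psingle:
  fixes h :: "'a::comm_semiring_1 \<Rightarrow> 'b::comm_semiring_1"
  assumes "h 0 = 0"
  shows "meval h \<phi> (psingle \<alpha> c) = h c * mon_eval \<phi> \<alpha>"
  using meval_superset[of h "{\<alpha>}" "psingle \<alpha> c" \<phi>] assms by simp

lemma meval_mconst [simp]:
  fixes h :: "'a::comm_semiring_1 \<Rightarrow> 'b::comm_semiring_1"
  assumes "h 0 = 0"
  shows "meval h \<phi> (mconst c) = h c"
  by (simp add: mconst_def meval_psingle assms)

lemma meval_add:
  fixes h :: "'a::comm_semiring_1 \<Rightarrow> 'b::comm_semiring_1"
  assumes "h 0 = 0" "\<And>a b. h (a + b) = h a + h b"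
  shows "meval h \<phi> (p + q) = meval h \<phi> p + meval h \<phi> q"
proof -
  define S where "S = supp p \<union> supp q"
  have f: "finite S" by (simp add: S_def)
  have "supp (p + q) \<subseteq> S" unfolding S_def by (rule keys_add)
  then show ?thesis
    using f by (simp add: meval_superset[of h S] assms S_def lookup_add distrib_right sum.distrib)
qed

lemma comm_ring_hom_meval:
  fixes h :: "'a::comm_ring_1 \<Rightarrow> 'b::comm_ring_1"
  assumes "comm_ring_hom h"
  shows "comm_ring_hom (meval h \<phi>)"
proof -
  interpret h: comm_ring_hom h by fact
  have add: "meval h \<phi> (p + q) = meval h \<phi> p + meval h \<phi> q" for p q
    by (rule meval_add) (auto simp: h.hom_add)
  have zero: "meval h \<phi> 0 = 0" by (simp add: meval_def)
  have one: "meval h \<phi> 1 = 1"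
    using meval_mconst[of h \<phi> 1] by simp
  have mult: "meval h \<phi> (p * q) = meval h \<phi> p * meval h \<phi> q" for p q
  proof (induction p rule: poly_mapping_induct)
    case (single a c)
    show ?case
    proof (induction q rule: poly_mapping_induct)
      case (single b d)
      then show ?case
        by (simp add: mult_single meval_psingle mon_eval_add h.hom_mult mult_ac)
    qed (simp_all add: zero add distrib_left)
  qed (simp_all add: zero add distrib_right)
  show ?thesis
    by unfold_locales (auto simp: add zero one mult)
qed

lemma meval_mmonom:
  assumes "comm_ring_hom h"
  shows "meval h \<phi> (mmonom \<alpha>) = mon_eval \<phi> \<alpha>"
proof -
  interpret h: comm_ring_hom h by fact
  show ?thesis by (simp add: mmonom_def meval_psingle)
qed

lemma meval_mvar [simp]:
  assumes "comm_ring_hom h"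
  shows "meval h \<phi> (mvar i) = \<phi> i"
  by (simp add: mvar_def meval_mmonom assms)

lemma mpoly_hom_expand:
  fixes f :: "('i, 'a::comm_ring_1) mpoly \<Rightarrow> 'b::comm_ring_1"
  assumes "comm_ring_hom f"
  shows "f p = (\<Sum>\<alpha>\<in>supp p. f (mconst (coef p \<alpha>)) * mon_eval (\<lambda>i. f (mvar i)) \<alpha>)"
proof -
  interpret f: comm_ring_hom f by fact
  have "f p = f (\<Sum>\<alpha>\<in>supp p. psingle \<alpha> (coef p \<alpha>))"
    by (simp add: sum_single_coef)
  also have "\<dots> = (\<Sum>\<alpha>\<in>supp p. f (mconst (coef p \<alpha>)) * mon_eval (\<lambda>i. f (mvar i)) \<alpha>)"
    by (simp add: psingle_eq f.hom_sum f.hom_mult mmonom_eq_mon_eval mon_eval_hom[OF assms])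
  finally show ?thesis .
qed

text \<open>Only the coefficients and variables that occur in p are compared, so morphisms that
  agree on a subring can be treated too, as in \<open>as_poly_const\<close>.\<close>

lemma mpoly_hom_eqI:
  fixes f g :: "('i, 'a::comm_ring_1) mpoly \<Rightarrow> 'b::comm_ring_1"
  assumes "comm_ring_hom f" "comm_ring_hom g"
    and "\<And>\<alpha>. \<alpha> \<in> supp p \<Longrightarrow> f (mconst (coef p \<alpha>)) = g (mconst (coef p \<alpha>))"
    and "\<And>\<alpha> i. \<alpha> \<in> supp p \<Longrightarrow> i \<in> supp \<alpha> \<Longrightarrow> f (mvar i) = g (mvar i)"
  shows "f p = g p"
proof -
  have "mon_eval (\<lambda>i. f (mvar i)) \<alpha> = mon_eval (\<lambda>i. g (mvar i)) \<alpha>" if "\<alpha> \<in> supp p" for \<alpha>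
    by (rule mon_eval_cong) (use that assms(4) in blast)
  then show ?thesis
    by (simp add: mpoly_hom_expand[OF assms(1), of p] mpoly_hom_expand[OF assms(2), of p] assms(3)
        cong: sum.cong)
qed

lemma meval_cong:
  assumes "\<And>\<alpha>. \<alpha> \<in> supp p \<Longrightarrow> h (coef p \<alpha>) = h' (coef p \<alpha>)"
    and "\<And>\<alpha> i. \<alpha> \<in> supp p \<Longrightarrow> i \<in> supp \<alpha> \<Longrightarrow> \<phi> i = \<psi> i"
  shows "meval h \<phi> p = meval h' \<psi> p"
  unfolding meval_def by (intro sum.cong prod.cong arg_cong2[where f="(*)"]) (auto simp: assms)

lemma hom_meval:
  assumes "comm_ring_hom f" "comm_ring_hom h"
  shows "f (meval h \<phi> p) = meval (\<lambda>c. f (h c)) (\<lambda>i. f (\<phi> i)) p"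
proof -
  interpret f: comm_ring_hom f by fact
  interpret h: comm_ring_hom h by fact
  show ?thesis
    by (simp add: meval_def f.hom_sum f.hom_mult f.hom_prod f.hom_power)
qed

lemma meval_meval:
  assumes "comm_ring_hom f" "comm_ring_hom g"
  shows "meval f \<psi> (meval g \<phi> p) = meval (\<lambda>c. meval f \<psi> (g c)) (\<lambda>i. meval f \<psi> (\<phi> i)) p"
  by (rule hom_meval) (simp_all add: assms comm_ring_hom_meval)

lemma meval_mconst_mvar [simp]:
  fixes p :: "('i, 'a::comm_ring_1) mpoly"
  shows "meval mconst mvar p = p"
  by (rule mpoly_hom_eqI[OF comm_ring_hom_meval[OF comm_ring_hom_mconst] comm_ring_hom_id]) (simp_all add: comm_ring_hom_mconst)

lemma of_int_hom_unique:
  assumes "comm_ring_hom (f :: int \<Rightarrow> 'a::comm_ring_1)" shows "f = of_int"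
proof
  fix x interpret f: comm_ring_hom f by fact
  show "f x = of_int x" using f.hom_of_int[of x] by simp
qed

lemma int_mpoly_hom:
  assumes "comm_ring_hom (f :: ('i, int) mpoly \<Rightarrow> 'a::comm_ring_1)"
  shows "f p = meval of_int (\<lambda>i. f (mvar i)) p"
proof -
  have "(\<lambda>c. f (mconst c)) = of_int"
    by (rule of_int_hom_unique) (rule comm_ring_hom_comp[OF assms comm_ring_hom_mconst])
  then have *: "f (mconst c) = of_int c" for c by metis
  show ?thesis
    by (rule mpoly_hom_eqI[OF assms comm_ring_hom_meval[OF comm_ring_hom_of_int]])
       (simp_all add: comm_ring_hom_of_int *)
qed

subsection \<open>Polynomials in a set of variables\<close>

abbreviation polys :: "'i set \<Rightarrow> ('i, 'a::zero) mpoly set" where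
  "polys V \<equiv> mpolys UNIV V"

lemma polys_iff: "p \<in> polys V \<longleftrightarrow> (\<forall>\<alpha>\<in>supp p. supp \<alpha> \<subseteq> V)"
  by (simp add: mpolys_def)

lemma mpolys_zero [simp]: "0 \<in> mpolys A V"
  by (simp add: mpolys_def)

lemma polys_add: "p \<in> polys V \<Longrightarrow> q \<in> polys V \<Longrightarrow> p + q \<in> polys V"
  for p q :: "('i, 'a::comm_monoid_add) mpoly"
  using keys_add[of p q] by (fastforce simp: polys_iff)

lemma polys_mult: "p \<in> polys V \<Longrightarrow> q \<in> polys V \<Longrightarrow> p * q \<in> polys V"
  for p q :: "('i, 'a::comm_semiring_1) mpoly"
proof -
  assume *: "p \<in> polys V" "q \<in> polys V"
  have "supp \<gamma> \<subseteq> V" if g: "\<gamma> \<in> supp (p * q)" for \<gamma>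
  proof -
    obtain \<alpha> \<beta> where "\<gamma> = \<alpha> + \<beta>" "\<alpha> \<in> supp p" "\<beta> \<in> supp q"
      using keys_mult[of p q] g by blast
    then show ?thesis using * keys_add[of \<alpha> \<beta>] unfolding polys_iff by blast
  qed
  then show ?thesis by (auto simp: polys_iff)
qed

lemma polys_uminus: "p \<in> polys V \<Longrightarrow> - p \<in> polys V" for p :: "('i, 'a::ab_group_add) mpoly"
  by (simp add: polys_iff in_keys_iff)

lemma polys_diff: "p \<in> polys V \<Longrightarrow> q \<in> polys V \<Longrightarrow> p - q \<in> polys V" for p :: "('i, 'a::ab_group_add) mpoly"
  using polys_add[of p V "- q"] polys_uminus[of q V] by simp

lemma polys_mconst [simp]: "mconst c \<in> polys V"
  by (auto simp: polys_iff mconst_def)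

lemma polys_one [simp]: "(1 :: ('i, 'a::comm_semiring_1) mpoly) \<in> polys V"
  by (auto simp: polys_iff)

lemma polys_mmonom: "supp \<alpha> \<subseteq> V \<Longrightarrow> mmonom \<alpha> \<in> polys V"
  by (auto simp: polys_iff mmonom_def)

lemma polys_mvar: "i \<in> V \<Longrightarrow> mvar i \<in> polys V"
  by (simp add: mvar_def polys_mmonom)

lemma polys_sum: "(\<And>x. x \<in> S \<Longrightarrow> f x \<in> polys V) \<Longrightarrow> sum f S \<in> polys V"
  for f :: "_ \<Rightarrow> ('i, 'a::comm_monoid_add) mpoly"
  by (induction S rule: infinite_finite_induct) (auto intro: polys_add)

lemma polys_prod: "(\<And>x. x \<in> S \<Longrightarrow> f x \<in> polys V) \<Longrightarrow> prod f S \<in> polys V"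
  for f :: "_ \<Rightarrow> ('i, 'a::comm_semiring_1) mpoly"
  by (induction S rule: infinite_finite_induct) (auto intro: polys_mult)

lemma polys_power: "p \<in> polys V \<Longrightarrow> p ^ k \<in> polys V"
  for p :: "('i, 'a::comm_semiring_1) mpoly"
  by (induction k) (auto intro: polys_mult)

lemma polys_mono: "p \<in> polys V \<Longrightarrow> V \<subseteq> W \<Longrightarrow> p \<in> polys W"
  by (auto simp: polys_iff)

lemma polys_finite: "\<exists>V. finite V \<and> p \<in> polys V"
  by (rule exI[of _ "\<Union>(supp ` supp p)"]) (auto simp: polys_iff)

lemma polys_meval:
  fixes p :: "('i, 'a::comm_ring_1) mpoly"
  assumes "p \<in> polys V" "\<And>i. i \<in> V \<Longrightarrow> \<phi> i \<in> polys W" "\<And>c. h c \<in> polys W"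
  shows "meval h \<phi> p \<in> polys W"
  unfolding meval_def
  by (intro polys_sum polys_mult polys_prod polys_power assms) (use assms in \<open>auto simp: polys_iff\<close>)

text \<open>The retraction that kills the variables outside V. Applied to an identity it removes
  stray variables from witnesses that are only known to exist in the full ring.\<close>

definition mproj :: "'i set \<Rightarrow> ('i, 'a::comm_ring_1) mpoly \<Rightarrow> ('i, 'a) mpoly" where
  "mproj V = meval mconst (\<lambda>i. if i \<in> V then mvar i else 0)"

lemma comm_ring_hom_mproj: "comm_ring_hom (mproj V)"
  unfolding mproj_def by (intro comm_ring_hom_meval comm_ring_hom_mconst)

lemma mproj_polys [simp]: "mproj V p \<in> polys V"
  unfolding mproj_def by (rule polys_meval[of p UNIV]) (auto simp: polys_iff[of _ UNIV] polys_mvar)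

lemma mproj_ident: "p \<in> polys V \<Longrightarrow> mproj V p = p"
proof -
  assume p: "p \<in> polys V"
  have "mproj V p = meval mconst mvar p"
    unfolding mproj_def by (rule meval_cong) (use p in \<open>auto simp: polys_iff\<close>)
  then show ?thesis by simp
qed

subsection \<open>Homogeneous polynomials\<close>

lemma mdeg_superset: "finite S \<Longrightarrow> supp \<alpha> \<subseteq> S \<Longrightarrow> mdeg \<alpha> = (\<Sum>i\<in>S. coef \<alpha> i)"
  unfolding mdeg_def by (rule sum.mono_neutral_left) (auto simp: in_keys_iff)

lemma mdeg_add: "mdeg (\<alpha> + \<beta>) = mdeg \<alpha> + mdeg \<beta>"
proof -
  define S where "S = supp \<alpha> \<union> supp \<beta>"
  have f: "finite S" by (simp add: S_def)
  have "supp (\<alpha> + \<beta>) \<subseteq> S" unfolding S_def by (rule keys_add)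
  then show ?thesis
    using f by (subst (1 2 3) mdeg_superset[of S]) (auto simp: S_def lookup_add sum.distrib)
qed

lemma mdeg_0 [simp]: "mdeg 0 = 0" by (simp add: mdeg_def)

lemma mdeg_single [simp]: "mdeg (psingle i k) = k"
  by (simp add: mdeg_def)

lemma mdeg_eq_0_iff: "mdeg \<alpha> = 0 \<longleftrightarrow> \<alpha> = 0"
  by (auto simp: mdeg_def in_keys_iff intro!: poly_mapping_eqI)

lemma coef_le_mdeg: "coef \<alpha> i \<le> mdeg \<alpha>"
  by (cases "i \<in> supp \<alpha>") (auto simp: mdeg_def in_keys_iff intro: member_le_sum)

lemma finite_monoms:
  assumes "finite V"
  shows "finite (monoms V k)"
proof -
  have inj: "inj_on coef (monoms V k)" by (auto intro: inj_onI poly_mapping_eqI)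
  have "coef ` monoms V k \<subseteq> {f. \<forall>x. (x \<in> V \<longrightarrow> f x \<in> {0..k}) \<and> (x \<notin> V \<longrightarrow> f x = 0)}"
  proof safe
    fix x \<alpha> assume "\<alpha> \<in> monoms V k"
    then show "coef \<alpha> x \<in> {0..k}" using coef_le_mdeg[of \<alpha> x] by (auto simp: monoms_def)
  next
    fix x \<alpha> assume "\<alpha> \<in> monoms V k" "x \<notin> V"
    then show "coef \<alpha> x = 0" by (auto simp: monoms_def in_keys_iff)
  qed
  then show ?thesis
    using finite_set_of_finite_funs[OF assms, of "{0..k}" 0] finite_imageD[OF _ inj]
    by (meson finite_atLeastAtMost finite_subset)
qed

lemma mhomogeneous_0 [simp]: "mhomogeneous k 0"
  by (simp add: mhomogeneous_def)

lemma mhomogeneous_add: "mhomogeneous k p \<Longrightarrow> mhomogeneous k q \<Longrightarrow> mhomogeneous k (p + q)"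
  for p q :: "('i, 'a::comm_monoid_add) mpoly"
  using keys_add[of p q] by (fastforce simp: mhomogeneous_def)

lemma mhomogeneous_uminus: "mhomogeneous k p \<Longrightarrow> mhomogeneous k (- p)"
  for p :: "('i, 'a::ab_group_add) mpoly"
  by (simp add: mhomogeneous_def in_keys_iff)

lemma mhomogeneous_diff: "mhomogeneous k p \<Longrightarrow> mhomogeneous k q \<Longrightarrow> mhomogeneous k (p - q)"
  for p q :: "('i, 'a::ab_group_add) mpoly"
  using mhomogeneous_add[of k p "- q"] mhomogeneous_uminus[of k q] by simp

lemma mhomogeneous_mult: "mhomogeneous k p \<Longrightarrow> mhomogeneous l q \<Longrightarrow> mhomogeneous (k + l) (p * q)"
  for p q :: "('i, 'a::comm_semiring_1) mpoly"
  using keys_mult[of p q] by (fastforce simp: mhomogeneous_def mdeg_add)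

lemma mhomogeneous_sum: "(\<And>x. x \<in> S \<Longrightarrow> mhomogeneous k (f x)) \<Longrightarrow> mhomogeneous k (sum f S)"
  for f :: "_ \<Rightarrow> ('i, 'a::comm_monoid_add) mpoly"
  by (induction S rule: infinite_finite_induct) (auto intro: mhomogeneous_add)

lemma mhomogeneous_1 [simp]: "mhomogeneous 0 (1 :: ('i, 'a::comm_semiring_1) mpoly)"
  by (auto simp: mhomogeneous_def)

lemma mhomogeneous_prod: "(\<And>x. x \<in> S \<Longrightarrow> mhomogeneous (k x) (f x)) \<Longrightarrow> mhomogeneous (sum k S) (prod f S)"
  for f :: "_ \<Rightarrow> ('i, 'a::comm_semiring_1) mpoly"
proof (induction S rule: infinite_finite_induct)
  case (insert x F)
  then show ?case by (simp add: mhomogeneous_mult)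
qed simp_all

lemma mhomogeneous_mconst [simp]: "mhomogeneous 0 (mconst c)"
  by (auto simp: mhomogeneous_def mconst_def)

lemma mhomogeneous_mconst_mult: "mhomogeneous k p \<Longrightarrow> mhomogeneous k (mconst c * p)"
  for p :: "('i, 'a::comm_semiring_1) mpoly"
  using mhomogeneous_mult[of 0 "mconst c" k p] by simp

lemma mhomogeneous_mmonom: "mhomogeneous (mdeg \<alpha>) (mmonom \<alpha>)"
  by (auto simp: mhomogeneous_def mmonom_def)

lemma mhomogeneous_mvar [simp]: "mhomogeneous (Suc 0) (mvar i)"
  using mhomogeneous_mmonom[of "psingle i 1"] by (simp add: mvar_def)

lemma mhomogeneous_power: "mhomogeneous k p \<Longrightarrow> mhomogeneous (k * n) (p ^ n)"
  for p :: "('i, 'a::comm_semiring_1) mpoly"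
  by (induction n) (auto intro: mhomogeneous_mult)

lemma mhomogeneous_mon_eval:
  fixes \<phi> :: "'i \<Rightarrow> ('j, 'a::comm_semiring_1) mpoly"
  assumes "\<And>i. i \<in> supp \<alpha> \<Longrightarrow> mhomogeneous 1 (\<phi> i)"
  shows "mhomogeneous (mdeg \<alpha>) (mon_eval \<phi> \<alpha>)"
  unfolding mon_eval_def mdeg_def
proof (rule mhomogeneous_prod)
  fix i assume "i \<in> supp \<alpha>"
  then show "mhomogeneous (coef \<alpha> i) (\<phi> i ^ coef \<alpha> i)"
    using mhomogeneous_power[OF assms, of i "coef \<alpha> i"] by simp
qed

lemma mhomogeneous_subst:
  fixes p :: "('i, 'a::comm_ring_1) mpoly" and h :: "'a \<Rightarrow> ('j, 'b::comm_ring_1) mpoly"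
  assumes "mhomogeneous k p" "p \<in> polys V" "\<And>i. i \<in> V \<Longrightarrow> mhomogeneous 1 (\<phi> i)"
    "\<And>c. mhomogeneous 0 (h c)"
  shows "mhomogeneous k (meval h \<phi> p)"
  unfolding meval_def mon_eval_def[symmetric]
proof (rule mhomogeneous_sum)
  fix \<alpha> assume a: "\<alpha> \<in> supp p"
  have "mhomogeneous (mdeg \<alpha>) (mon_eval \<phi> \<alpha>)"
    by (rule mhomogeneous_mon_eval) (use a assms in \<open>auto simp: polys_iff\<close>)
  then have "mhomogeneous (0 + mdeg \<alpha>) (h (coef p \<alpha>) * mon_eval \<phi> \<alpha>)"
    by (intro mhomogeneous_mult assms)
  then show "mhomogeneous k (h (coef p \<alpha>) * mon_eval \<phi> \<alpha>)"
    using a assms(1) by (simp add: mhomogeneous_def)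
qed

lemma mhomogeneous_0_polys_const:
  assumes "mhomogeneous 0 p"
  shows "p = mconst (coef p 0)"
  using assms unfolding mhomogeneous_def mdeg_eq_0_iff
  by (intro poly_mapping_eqI) (auto simp: coef_mconst in_keys_iff)

lemma form_expand:
  fixes p :: "('i, 'a::comm_ring_1) mpoly"
  assumes "finite V" "mhomogeneous k p" "p \<in> polys V"
  shows "p = (\<Sum>\<alpha>\<in>monoms V k. mconst (coef p \<alpha>) * mmonom \<alpha>)"
proof -
  have "supp p \<subseteq> monoms V k"
    using assms by (auto simp: mhomogeneous_def polys_iff monoms_def)
  from sum_single_coef[OF finite_monoms[OF assms(1)] this] show ?thesis
    by (simp add: psingle_eq)
qed

definition hom_part :: "nat \<Rightarrow> ('i, 'a::comm_ring_1) mpoly \<Rightarrow> ('i, 'a) mpoly" where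
  "hom_part k p = (\<Sum>\<alpha> | \<alpha> \<in> supp p \<and> mdeg \<alpha> = k. psingle \<alpha> (coef p \<alpha>))"

lemma coef_hom_part: "coef (hom_part k p) \<alpha> = (if mdeg \<alpha> = k then coef p \<alpha> else 0)"
proof -
  have "coef (hom_part k p) \<alpha> = (\<Sum>\<beta> | \<beta> \<in> supp p \<and> mdeg \<beta> = k. if \<beta> = \<alpha> then coef p \<beta> else 0)"
    by (simp add: hom_part_def lookup_sum lookup_single when_def)
  also have "\<dots> = (if mdeg \<alpha> = k then coef p \<alpha> else 0)"
    by (auto simp: sum.delta in_keys_iff)
  finally show ?thesis .
qed

lemma hom_part_add: "hom_part k (p + q) = hom_part k p + hom_part k q"
  by (rule poly_mapping_eqI) (simp add: coef_hom_part lookup_add)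

lemma hom_part_sum: "hom_part k (sum f S) = (\<Sum>x\<in>S. hom_part k (f x))"
  by (rule poly_mapping_eqI) (simp add: coef_hom_part lookup_sum)

lemma mhomogeneous_hom_part: "mhomogeneous k (hom_part k p)"
  by (auto simp: mhomogeneous_def in_keys_iff coef_hom_part split: if_splits)

lemma hom_part_self: "mhomogeneous k p \<Longrightarrow> hom_part k p = p"
  by (rule poly_mapping_eqI) (auto simp: coef_hom_part mhomogeneous_def in_keys_iff)

lemma polys_hom_part: "p \<in> polys V \<Longrightarrow> hom_part k p \<in> polys V"
  by (auto simp: polys_iff in_keys_iff coef_hom_part split: if_splits)

text \<open>Lets the cofactors of a homogeneous element of an ideal with homogeneous generators be
  replaced by homogeneous ones.\<close>

lemma hom_part_mult:
  fixes g h :: "('i, 'a::comm_ring_1) mpoly"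
  assumes "mhomogeneous l g"
  shows "hom_part k (h * g) = (if l \<le> k then hom_part (k - l) h * g else 0)"
proof -
  have *: "hom_part k (psingle \<alpha> c * psingle \<beta> d) =
      (if l \<le> k then hom_part (k - l) (psingle \<alpha> c) * psingle \<beta> d else 0)" if "mdeg \<beta> = l" for \<alpha> \<beta> and c d :: 'a
  proof (cases "mdeg \<alpha> + l = k")
    case True
    then have "mhomogeneous k (psingle (\<alpha> + \<beta>) (c * d))" "mhomogeneous (k - l) (psingle \<alpha> c)"
      using that by (auto simp: mhomogeneous_def mdeg_add)
    then show ?thesis using True by (auto simp: mult_single hom_part_self)
  next
    case False
    then have "hom_part k (psingle (\<alpha> + \<beta>) (c * d)) = 0" "l \<le> k \<longrightarrow> hom_part (k - l) (psingle \<alpha> c) = 0"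
      using that by (auto intro!: poly_mapping_eqI simp: coef_hom_part lookup_single when_def mdeg_add)
    then show ?thesis by (simp add: mult_single)
  qed
  have hp0: "hom_part k 0 = (0 :: ('i, 'a) mpoly)" for k
    by (simp add: hom_part_def)
  have "hom_part k (h * (\<Sum>\<beta>\<in>S. psingle \<beta> (coef g \<beta>))) =
    (if l \<le> k then hom_part (k - l) h * (\<Sum>\<beta>\<in>S. psingle \<beta> (coef g \<beta>)) else 0)" if "S \<subseteq> supp g" for S
    using finite_subset[OF that finite_keys] that
  proof (induction S)
    case empty then show ?case by (simp add: hp0)
  next
    case (insert b S)
    have d: "mdeg b = l" using insert.prems assms by (auto simp: mhomogeneous_def)
    have "hom_part k (h * psingle b e) = (if l \<le> k then hom_part (k - l) h * psingle b e else 0)" for e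
      by (induction h rule: poly_mapping_induct)
         (auto simp: hp0 * d distrib_right hom_part_add)
    then show ?case using insert by (auto simp: distrib_left hom_part_add)
  qed
  from this[of "supp g"] show ?thesis by (simp add: sum_single_coef)
qed

section \<open>Unique factorization\<close>

text \<open>Abstracts a ring of polynomials in a fixed set of variables inside the full ring. The
  property passes to \<open>polys_over\<close>, which makes an induction on the number of variables
  possible.\<close>

locale factor_closed =
  fixes A :: "'a::idom set"
  assumes one_closed: "1 \<in> A"
    and diff_closed: "a \<in> A \<Longrightarrow> b \<in> A \<Longrightarrow> a - b \<in> A"
    and mult_closed: "a \<in> A \<Longrightarrow> b \<in> A \<Longrightarrow> a * b \<in> A"
    and factor_mem: "a \<in> A \<Longrightarrow> a \<noteq> 0 \<Longrightarrow> a * c \<in> A \<Longrightarrow> c \<in> A"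
begin

lemma zero_closed: "0 \<in> A"
  using diff_closed[OF one_closed one_closed] by simp

lemma uminus_closed: "a \<in> A \<Longrightarrow> - a \<in> A"
  using diff_closed[OF zero_closed, of a] by simp

lemma add_closed: "a \<in> A \<Longrightarrow> b \<in> A \<Longrightarrow> a + b \<in> A"
  using diff_closed[of a "- b"] uminus_closed[of b] by simp

lemma sum_closed: "(\<And>x. x \<in> S \<Longrightarrow> f x \<in> A) \<Longrightarrow> sum f S \<in> A"
  by (induction S rule: infinite_finite_induct) (auto intro: add_closed zero_closed)

lemma power_closed: "a \<in> A \<Longrightarrow> a ^ k \<in> A"
  by (induction k) (auto intro: one_closed mult_closed)

end

definition polys_over :: "'a::zero set \<Rightarrow> 'a poly set" where
  "polys_over A = {p. \<forall>i. coeff p i \<in> A}"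

lemma const_dvd_one_iff: "[:a:] dvd 1 \<longleftrightarrow> a dvd 1" for a :: "'a::idom"
  by (simp add: is_unit_const_poly_iff)

text \<open>In a factor-closed subring divisibility is that of the ambient ring.\<close>

definition rel_prime_elem :: "'a::comm_ring_1 set \<Rightarrow> 'a \<Rightarrow> bool" where
  "rel_prime_elem A p \<longleftrightarrow> p \<in> A \<and> p \<noteq> 0 \<and> \<not> p dvd 1 \<and>
     (\<forall>a\<in>A. \<forall>b\<in>A. p dvd a * b \<longrightarrow> p dvd a \<or> p dvd b)"

text \<open>The index counts prime factors with multiplicity. It is the measure for
  \<open>exists_primitive\<close>, where the primes common to all coefficients are divided out one
  by one.\<close>

inductive prime_product :: "'a::comm_ring_1 set \<Rightarrow> nat \<Rightarrow> 'a \<Rightarrow> bool" for A where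
  unit: "a \<in> A \<Longrightarrow> a dvd 1 \<Longrightarrow> prime_product A 0 a"
| mult: "rel_prime_elem A p \<Longrightarrow> prime_product A n b \<Longrightarrow> prime_product A (Suc n) (p * b)"

definition factorial_on :: "'a::comm_ring_1 set \<Rightarrow> bool" where
  "factorial_on A \<longleftrightarrow> (\<forall>a\<in>A - {0}. \<exists>n. prime_product A n a)"

context factor_closed
begin

lemma prime_product_mem: "prime_product A n a \<Longrightarrow> a \<in> A"
  by (induction rule: prime_product.induct) (auto simp: rel_prime_elem_def mult_closed)

lemma prime_product_unit_mult:
  "prime_product A n b \<Longrightarrow> u \<in> A \<Longrightarrow> u dvd 1 \<Longrightarrow> prime_product A n (u * b)"
proof (induction rule: prime_product.induct)
  case (unit a)
  then have "u * a dvd 1 * 1" by (intro mult_dvd_mono)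
  with unit show ?case by (auto intro!: prime_product.unit mult_closed)
next
  case (mult p n b)
  then show ?case using prime_product.mult[of A p n "u * b"] by (simp add: mult_ac)
qed

lemma prime_product_mult:
  "prime_product A n a \<Longrightarrow> prime_product A m b \<Longrightarrow> prime_product A (n + m) (a * b)"
proof (induction rule: prime_product.induct)
  case (unit a) then show ?case by (simp add: prime_product_unit_mult)
next
  case (mult p n c)
  then show ?case using prime_product.mult[of A p "n + m" "c * b"] by (simp add: mult_ac)
qed

text \<open>p divides the first prime q or the rest. In the first case q is p times a unit: q
  divides p or the cofactor, and the latter would make p a unit.\<close>

lemma prime_product_divide:
  assumes "prime_product A n a" "rel_prime_elem A p" "p dvd a"
  shows "\<exists>m b. a = p * b \<and> prime_product A m b \<and> m < n"
  using assms(1,3)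
proof (induction rule: prime_product.induct)
  case (unit a)
  then show ?case using assms(2) dvd_trans by (auto simp: rel_prime_elem_def)
next
  case (mult q n b)
  have mem: "q \<in> A" "b \<in> A" "p \<in> A" using mult prime_product_mem assms(2) by (auto simp: rel_prime_elem_def)
  from mult.prems mem assms(2) consider "p dvd b" | "p dvd q" by (auto simp: rel_prime_elem_def)
  then show ?case
  proof cases
    case 1
    from mult.IH[OF this] obtain m c where "b = p * c" "prime_product A m c" "m < n" by blast
    then show ?thesis
      using prime_product.mult[OF mult.hyps(1), of m c] by (intro exI[of _ "Suc m"] exI[of _ "q * c"]) auto
  next
    case 2
    then obtain u where u: "q = p * u" by blast
    have uA: "u \<in> A" using factor_mem[of p u] u mem assms(2) by (auto simp: rel_prime_elem_def)
    have "q dvd p \<or> q dvd u" using mult.hyps(1) u mem uA unfolding rel_prime_elem_def by (metis dvd_refl)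
    moreover have "\<not> q dvd u"
    proof
      assume "q dvd u"
      then obtain w where "u = q * w" by blast
      then have "q * 1 = q * (p * w)" using u by (simp add: mult_ac)
      then have "1 = p * w" using mult.hyps(1) unfolding rel_prime_elem_def mult_cancel_left by blast
      then show False using assms(2) unfolding rel_prime_elem_def by (metis dvd_triv_left)
    qed
    ultimately obtain w where w: "p = q * w" by blast
    have "q * 1 = q * (w * u)" by (subst u, subst w) (simp add: mult_ac)
    then have "1 = w * u" using mult.hyps(1) unfolding rel_prime_elem_def mult_cancel_left by blast
    then have "u dvd 1" by (metis dvd_triv_right)
    from prime_product_unit_mult[OF mult.hyps(2) uA this] show ?thesis using u
      by (intro exI[of _ n] exI[of _ "u * b"]) (auto simp: mult_ac)
  qed
qed

lemma polys_over_coeff: "p \<in> polys_over A \<Longrightarrow> coeff p i \<in> A"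
  by (simp add: polys_over_def)

lemma polys_over_const: "a \<in> A \<Longrightarrow> [:a:] \<in> polys_over A"
  by (auto simp: polys_over_def coeff_pCons zero_closed split: nat.split)

lemma polys_over_const_iff: "[:a:] \<in> polys_over A \<longleftrightarrow> a \<in> A"
  using polys_over_const polys_over_coeff[of "[:a:]" 0] by auto

lemma polys_over_monom: "a \<in> A \<Longrightarrow> monom a n \<in> polys_over A"
  by (auto simp: polys_over_def zero_closed)

text \<open>Leading coefficients multiply, so that of c lies in A; removing the leading monomial
  from c keeps the product in the subring and lowers the degree.\<close>

lemma factor_closed_polys_over: "factor_closed (polys_over A)"
proof unfold_locales
  show "1 \<in> polys_over A"
    using polys_over_const[OF one_closed] by (simp add: one_pCons)
  show diff: "a - b \<in> polys_over A" if "a \<in> polys_over A" "b \<in> polys_over A" for a b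
    using that by (auto simp: polys_over_def diff_closed)
  show mult: "a * b \<in> polys_over A" if "a \<in> polys_over A" "b \<in> polys_over A" for a b
    using that by (auto simp: polys_over_def coeff_mult intro!: sum_closed mult_closed)
  show "c \<in> polys_over A" if "a \<in> polys_over A" "a \<noteq> 0" "a * c \<in> polys_over A" for a c
    using that(3)
  proof (induction "degree c" arbitrary: c rule: less_induct)
    case less
    show ?case
    proof (cases "c = 0")
      case True then show ?thesis by (simp add: polys_over_def zero_closed)
    next
      case False
      have "lead_coeff a * lead_coeff c \<in> A"
        using polys_over_coeff[OF less.prems, of "degree (a * c)"] by (simp add: lead_coeff_mult)
      then have lc: "lead_coeff c \<in> A"
        by (rule factor_mem[rotated 2]) (use that(1,2) in \<open>simp_all add: polys_over_coeff\<close>)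
      define m where "m = monom (lead_coeff c) (degree c)"
      have m: "m \<in> polys_over A" using lc by (simp add: m_def polys_over_monom)
      have "a * (c - m) \<in> polys_over A"
        using diff[OF less.prems mult[OF that(1) m]] by (simp add: algebra_simps)
      moreover have "degree (c - m) < degree c \<or> c - m = 0"
      proof (cases "degree c = 0")
        case True
        then show ?thesis by (simp add: m_def poly_eq_iff) (metis coeff_eq_0 bot_nat_0.not_eq_extremum)
      next
        case False
        have "degree (c - m) \<le> degree c" by (intro degree_diff_le) (auto simp: m_def degree_monom_le)
        moreover have "coeff (c - m) (degree c) = 0" by (simp add: m_def)
        ultimately have "degree (c - m) \<noteq> degree c \<or> c - m = 0" by (metis leading_coeff_0_iff)
        with \<open>degree (c - m) \<le> degree c\<close> show ?thesis by auto
      qed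
      ultimately have "c - m \<in> polys_over A"
        using less.hyps[of "c - m"] by (auto simp: polys_over_def zero_closed)
      then have "coeff (c - m) i + coeff m i \<in> A" for i
        using m by (intro add_closed polys_over_coeff)
      then show ?thesis by (simp add: polys_over_def)
    qed
  qed
qed

text \<open>Gauss's lemma. If i and j are the first indices at which p fails to divide the
  coefficients of a and of b, then all terms but one in the coefficient of index i + j of the
  product are divisible by p.\<close>

lemma rel_prime_elem_const:
  assumes p: "rel_prime_elem A p"
  shows "rel_prime_elem (polys_over A) [:p:]"
  unfolding rel_prime_elem_def
proof (intro conjI ballI impI)
  show "[:p:] \<in> polys_over A" "[:p:] \<noteq> 0" "\<not> [:p:] dvd 1"
    using p by (auto simp: rel_prime_elem_def polys_over_const const_dvd_one_iff)
  fix a b assume ab: "a \<in> polys_over A" "b \<in> polys_over A" "[:p:] dvd a * b"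
  show "[:p:] dvd a \<or> [:p:] dvd b"
  proof (rule ccontr)
    assume "\<not> ?thesis"
    then have ex: "\<exists>i. \<not> p dvd coeff a i" "\<exists>i. \<not> p dvd coeff b i"
      by (auto simp: const_poly_dvd_iff)
    define i j where "i = (LEAST i. \<not> p dvd coeff a i)" and "j = (LEAST i. \<not> p dvd coeff b i)"
    have i: "\<not> p dvd coeff a i" "\<And>k. k < i \<Longrightarrow> p dvd coeff a k"
      using LeastI_ex[OF ex(1)] not_less_Least unfolding i_def by blast+
    have j: "\<not> p dvd coeff b j" "\<And>k. k < j \<Longrightarrow> p dvd coeff b k"
      using LeastI_ex[OF ex(2)] not_less_Least unfolding j_def by blast+
    have "p dvd coeff (a * b) (i + j)" using ab(3) by (auto simp: const_poly_dvd_iff)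
    also have "coeff (a * b) (i + j) = (\<Sum>k\<le>i + j. coeff a k * coeff b (i + j - k))"
      by (simp add: coeff_mult)
    also have "\<dots> = coeff a i * coeff b j + (\<Sum>k\<in>{..i + j} - {i}. coeff a k * coeff b (i + j - k))"
      by (subst sum.remove[of _ i]) auto
    finally have "p dvd coeff a i * coeff b j + (\<Sum>k\<in>{..i + j} - {i}. coeff a k * coeff b (i + j - k))" .
    moreover have "p dvd (\<Sum>k\<in>{..i + j} - {i}. coeff a k * coeff b (i + j - k))"
    proof (rule dvd_sum)
      fix k assume "k \<in> {..i + j} - {i}"
      then have "k < i \<or> i + j - k < j" by auto
      then show "p dvd coeff a k * coeff b (i + j - k)" using i(2) j(2) by auto
    qed
    ultimately have "p dvd coeff a i * coeff b j" by (simp add: dvd_add_left_iff)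
    then show False using p i(1) j(1) polys_over_coeff[OF ab(1)] polys_over_coeff[OF ab(2)]
      by (auto simp: rel_prime_elem_def)
  qed
qed

lemma prime_product_const: "prime_product A n a \<Longrightarrow> prime_product (polys_over A) n [:a:]"
proof (induction rule: prime_product.induct)
  case (unit a)
  then show ?case
    by (intro prime_product.unit polys_over_const) (auto simp: const_dvd_one_iff)
next
  case (mult p n b)
  then show ?case
    using prime_product.mult[OF rel_prime_elem_const[of p], of n "[:b:]"] by (simp add: mult.commute)
qed

text \<open>Division with remainder without a fraction field: the power of the leading coefficient
  clears the denominators.\<close>

lemma pseudo_division:
  assumes h: "h \<in> polys_over A" "h \<noteq> 0" and g: "g \<in> polys_over A"
  shows "\<exists>k q r. q \<in> polys_over A \<and> r \<in> polys_over A \<and> [:lead_coeff h ^ k:] * g = q * h + r \<and>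
     (r = 0 \<or> degree r < degree h)"
  using g
proof (induction "degree g" arbitrary: g rule: less_induct)
  case less
  interpret P: factor_closed "polys_over A" by (rule factor_closed_polys_over)
  note g = less.prems
  show ?case
  proof (cases "g = 0 \<or> degree g < degree h")
    case True
    then show ?thesis using g P.zero_closed by (intro exI[of _ 0] exI[of _ g]) auto
  next
    case False
    define m where "m = monom (lead_coeff g) (degree g - degree h)"
    define g' where "g' = [:lead_coeff h:] * g - m * h"
    have lc: "lead_coeff g \<in> A" "lead_coeff h \<in> A" using g h by (simp_all add: polys_over_coeff)
    have m: "m \<in> polys_over A" using lc by (simp add: m_def polys_over_monom)
    have g': "g' \<in> polys_over A" unfolding g'_def
      using g h m lc by (intro P.diff_closed P.mult_closed polys_over_const) auto
    have "degree (m * h) \<le> degree g"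
      using degree_mult_le[of m h] degree_monom_le[of "lead_coeff g" "degree g - degree h"] False
      unfolding m_def by linarith
    then have dle: "degree g' \<le> degree g" unfolding g'_def by (intro degree_diff_le) auto
    have "coeff (m * h) (degree g) = lead_coeff g * lead_coeff h"
      using False by (simp add: m_def coeff_monom_mult)
    then have c0: "coeff g' (degree g) = 0" by (simp add: g'_def)
    show ?thesis
    proof (cases "g' = 0")
      case True
      then show ?thesis using m P.zero_closed by (intro exI[of _ 1] exI[of _ m] exI[of _ 0]) (auto simp: g'_def)
    next
      case False
      then have "degree g' < degree g" using c0 dle by (metis leading_coeff_0_iff le_neq_implies_less)
      from less.hyps[OF this g'] obtain k q r where
        *: "q \<in> polys_over A" "r \<in> polys_over A" "[:lead_coeff h ^ k:] * g' = q * h + r"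
          "r = 0 \<or> degree r < degree h" by blast
      have "[:lead_coeff h ^ Suc k:] * g = [:lead_coeff h ^ k:] * ([:lead_coeff h:] * g)"
        by (simp add: mult_ac)
      also have "\<dots> = ([:lead_coeff h ^ k:] * m + q) * h + r"
      proof -
        have "[:lead_coeff h:] * g = g' + m * h" by (simp add: g'_def)
        then show ?thesis using *(3) by (simp only: distrib_left distrib_right mult.assoc[symmetric]) (simp add: add_ac)
      qed
      finally have "[:lead_coeff h ^ Suc k:] * g = ([:lead_coeff h ^ k:] * m + q) * h + r" .
      moreover have "[:lead_coeff h ^ k:] * m + q \<in> polys_over A"
        using * m lc by (intro P.add_closed P.mult_closed polys_over_const power_closed) auto
      ultimately show ?thesis using * by blast
    qed
  qed
qed

definition primitive_over :: "'a poly \<Rightarrow> bool" where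
  "primitive_over f \<longleftrightarrow> (\<forall>p. rel_prime_elem A p \<longrightarrow> \<not> [:p:] dvd f)"

text \<open>The primes of c are cancelled one after the other: each divides s * f but not the
  primitive f, so it divides s.\<close>

lemma cancel_const:
  assumes "prime_product A n c" "[:c:] * g = s * f" "primitive_over f"
    "f \<in> polys_over A" "s \<in> polys_over A"
  shows "f dvd g"
  using assms(1,2,5)
proof (induction arbitrary: s rule: prime_product.induct)
  case (unit a)
  then obtain a' where a': "1 = a * a'" by blast
  have "g = [:a':] * ([:a:] * g)" using a' by (simp add: mult.commute)
  then show ?case using unit by (simp del: mult_pCons_left)
next
  case (mult p n b)
  interpret P: factor_closed "polys_over A" by (rule factor_closed_polys_over)
  have "[:p * b:] = [:p:] * [:b:]" by simp
  then have *: "[:p:] * ([:b:] * g) = s * f" using mult.prems(1) by (simp only: mult.assoc)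
  then have "[:p:] dvd s * f" by (metis dvd_triv_left)
  then have "[:p:] dvd s"
    using rel_prime_elem_const[OF mult.hyps(1)] assms(3,4) mult.prems(2) mult.hyps(1)
    unfolding rel_prime_elem_def[of "polys_over A"] primitive_over_def by blast
  then obtain s' where s': "s = [:p:] * s'" by blast
  have p: "[:p:] \<in> polys_over A" "[:p:] \<noteq> 0"
    using mult.hyps(1) by (auto simp: rel_prime_elem_def polys_over_const)
  have "s' \<in> polys_over A" using P.factor_mem[OF p] mult.prems(2) s' by metis
  moreover have "[:p:] * ([:b:] * g) = [:p:] * (s' * f)" using * s' by (simp only: mult.assoc)
  then have "[:b:] * g = s' * f" using p(2) by (simp only: mult_cancel_left) blast
  ultimately show ?case using mult.IH by blast
qed

text \<open>Each prime of c divides q or h and is cancelled there. Only constants are removed, so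
  the degrees stay; that h' still divides h is what later connects f with other multiples of
  h.\<close>

lemma split_const:
  assumes "prime_product A n c" "[:c:] * f = q * h"
    "q \<in> polys_over A" "h \<in> polys_over A"
  shows "\<exists>q' h'. f = q' * h' \<and> q' \<in> polys_over A \<and> h' \<in> polys_over A \<and>
     degree q' = degree q \<and> degree h' = degree h \<and> h' dvd h"
  using assms
proof (induction arbitrary: q h rule: prime_product.induct)
  case (unit a)
  interpret P: factor_closed "polys_over A" by (rule factor_closed_polys_over)
  from unit obtain a' where a': "1 = a * a'" by blast
  have "a' \<in> A" using factor_mem[OF unit(1), of a'] a' one_closed by fastforce
  moreover have "f = [:a':] * ([:a:] * f)" using a' by (simp add: mult.commute)
  then have "f = ([:a':] * q) * h" using unit.prems by (simp only: mult.assoc)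
  moreover have "a' \<noteq> 0" using a' by auto
  then have "degree ([:a':] * q) = degree q" by simp
  moreover have "[:a':] * q \<in> polys_over A"
    using \<open>a' \<in> A\<close> unit.prems by (intro P.mult_closed polys_over_const)
  ultimately show ?case using unit.prems(3) dvd_refl by blast
next
  case (mult p n b)
  interpret P: factor_closed "polys_over A" by (rule factor_closed_polys_over)
  have "[:p * b:] = [:p:] * [:b:]" by simp
  then have *: "[:p:] * ([:b:] * f) = q * h" using mult.prems(1) by (simp only: mult.assoc)
  then have "[:p:] dvd q * h" by (metis dvd_triv_left)
  then consider "[:p:] dvd q" | "[:p:] dvd h"
    using rel_prime_elem_const[OF mult.hyps(1)] mult.prems(2,3) by (auto simp: rel_prime_elem_def)
  then show ?case
  proof cases
    case 1
    then obtain s where s: "q = [:p:] * s" by blast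
    have p: "[:p:] \<in> polys_over A" "[:p:] \<noteq> 0"
      using mult.hyps(1) by (auto simp: rel_prime_elem_def polys_over_const)
    have "s \<in> polys_over A" using P.factor_mem[OF p] mult.prems(2) s by metis
    moreover have "[:p:] * ([:b:] * f) = [:p:] * (s * h)" using * s by (simp only: mult.assoc)
    then have "[:b:] * f = s * h" using p(2) by (simp only: mult_cancel_left) blast
    moreover have "degree q = degree s" using s p by auto
    ultimately show ?thesis using mult.IH[of s h] mult.prems by auto
  next
    case 2
    then obtain s where s: "h = [:p:] * s" by blast
    have p: "[:p:] \<in> polys_over A" "[:p:] \<noteq> 0"
      using mult.hyps(1) by (auto simp: rel_prime_elem_def polys_over_const)
    have "s \<in> polys_over A" using P.factor_mem[OF p] mult.prems(3) s by metis
    moreover have "[:p:] * ([:b:] * f) = [:p:] * (q * s)" using * s by (simp only: mult_ac)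
    then have "[:b:] * f = q * s" using p(2) by (simp only: mult_cancel_left) blast
    moreover have "degree h = degree s" using s p by auto
    moreover have "s dvd h" by (simp only: s dvd_triv_right)
    ultimately show ?thesis using mult.IH[of q s] mult.prems dvd_trans by metis
  qed
qed

text \<open>A prime that divides f divides its leading coefficient, so the number of prime factors
  of the latter bounds the process.\<close>

lemma exists_primitive:
  assumes "prime_product A n (lead_coeff f)" "f \<in> polys_over A" "f \<noteq> 0"
  shows "\<exists>m c f'. f = [:c:] * f' \<and> prime_product A m c \<and> f' \<in> polys_over A \<and> primitive_over f'"
  using assms
proof (induction n arbitrary: f rule: less_induct)
  case (less n)
  interpret P: factor_closed "polys_over A" by (rule factor_closed_polys_over)
  show ?case
  proof (cases "primitive_over f")
    case True
    then show ?thesis using less.prems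
      by (intro exI[of _ 0] exI[of _ 1] exI[of _ f]) (auto intro!: prime_product.unit one_closed simp: one_pCons[symmetric])
  next
    case False
    then obtain p where p: "rel_prime_elem A p" "[:p:] dvd f" by (auto simp: primitive_over_def)
    then obtain g where g: "f = [:p:] * g" by blast
    have p': "[:p:] \<in> polys_over A" "[:p:] \<noteq> 0" "p \<noteq> 0"
      using p by (auto simp: rel_prime_elem_def polys_over_const)
    have gA: "g \<in> polys_over A" using P.factor_mem[OF p'(1,2)] g less.prems by metis
    have lc: "lead_coeff f = p * lead_coeff g" using g p' by simp
    then obtain m b where "lead_coeff f = p * b" "prime_product A m b" "m < n"
      using prime_product_divide[OF less.prems(1) p(1)] by auto
    moreover from this lc p' have "b = lead_coeff g" by simp
    ultimately obtain l c f' where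
      *: "g = [:c:] * f'" "prime_product A l c" "f' \<in> polys_over A" "primitive_over f'"
      using less.IH[of m g] gA g less.prems by auto
    have "f = [:p * c:] * f'" using g *(1) by (simp add: mult.commute)
    then show ?thesis using * prime_product.mult[OF p(1) *(2)] by blast
  qed
qed

text \<open>Replaces the Euclidean argument over the fraction field. An element h of least degree in
  the ideal J of f and a divides both up to constants. Irreducibility of f leaves two cases. Either
  h has the degree of f, and then f divides h and hence a. Or h is a constant; then this constant is
  a combination of f and a, and multiplying by b shows that f divides b.\<close>

lemma rel_prime_elem_primitive_irreducible:
  assumes fac: "factorial_on A"
    and f: "f \<in> polys_over A" "primitive_over f" "degree f > 0"
    and irr: "\<And>g h. g \<in> polys_over A \<Longrightarrow> h \<in> polys_over A \<Longrightarrow> f = g * h \<Longrightarrow> degree g = 0 \<or> degree h = 0"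
  shows "rel_prime_elem (polys_over A) f"
  unfolding rel_prime_elem_def
proof (intro conjI ballI impI)
  interpret P: factor_closed "polys_over A" by (rule factor_closed_polys_over)
  show "f \<in> polys_over A" by fact
  show f0: "f \<noteq> 0" using f by auto
  show "\<not> f dvd 1" using f by (metis degree_1 dvd_imp_degree_le le_0_eq less_irrefl one_neq_zero)
  fix a b assume ab: "a \<in> polys_over A" "b \<in> polys_over A" "f dvd a * b"
  show "f dvd a \<or> f dvd b"
  proof (rule ccontr)
    assume contra: "\<not> (f dvd a \<or> f dvd b)"
    define J where "J = {p * f + q * a | p q. p \<in> polys_over A \<and> q \<in> polys_over A}"
    have JA: "J \<subseteq> polys_over A" using ab f by (auto simp: J_def intro!: P.add_closed P.mult_closed)
    have fJ: "f \<in> J" unfolding J_def using P.one_closed P.zero_closed by (intro CollectI exI[of _ 1] exI[of _ 0]) auto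
    have aJ: "a \<in> J" unfolding J_def using P.one_closed P.zero_closed by (intro CollectI exI[of _ 0] exI[of _ 1]) auto
    define d where "d = (LEAST k. \<exists>h\<in>J. h \<noteq> 0 \<and> degree h = k)"
    have "\<exists>k. \<exists>h\<in>J. h \<noteq> 0 \<and> degree h = k" using fJ f0 by blast
    from LeastI_ex[OF this] obtain h where h: "h \<in> J" "h \<noteq> 0" "degree h = d" unfolding d_def by blast
    have least: "d \<le> degree g" if "g \<in> J" "g \<noteq> 0" for g
      unfolding d_def by (rule Least_le) (use that in blast)
    have hA: "h \<in> polys_over A" using h JA by auto
    have key: "\<exists>n c q. prime_product A n c \<and> q \<in> polys_over A \<and> [:c:] * g = q * h" if g: "g \<in> J" for g
    proof -
      obtain k q r where *: "q \<in> polys_over A" "r \<in> polys_over A"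
        "[:lead_coeff h ^ k:] * g = q * h + r" "r = 0 \<or> degree r < degree h"
        using pseudo_division[OF hA h(2), of g] g JA by blast
      have lc: "[:lead_coeff h ^ k:] \<in> polys_over A" "lead_coeff h ^ k \<in> A"
        using hA by (auto intro!: polys_over_const power_closed polys_over_coeff)
      from g h(1) obtain p1 q1 p2 q2 where
        1: "g = p1 * f + q1 * a" "h = p2 * f + q2 * a" "p1 \<in> polys_over A" "q1 \<in> polys_over A"
          "p2 \<in> polys_over A" "q2 \<in> polys_over A" unfolding J_def by blast
      have "r = [:lead_coeff h ^ k:] * g - q * h" using *(3) by simp
      also have "\<dots> = ([:lead_coeff h ^ k:] * p1 - q * p2) * f + ([:lead_coeff h ^ k:] * q1 - q * q2) * a"
        unfolding 1(1) by (subst (2) 1(2)) (simp only: ring_distribs mult_ac, simp)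
      finally have "r = ([:lead_coeff h ^ k:] * p1 - q * p2) * f + ([:lead_coeff h ^ k:] * q1 - q * q2) * a" .
      moreover have "[:lead_coeff h ^ k:] * p1 - q * p2 \<in> polys_over A" "[:lead_coeff h ^ k:] * q1 - q * q2 \<in> polys_over A"
        by (intro P.diff_closed P.mult_closed 1(3-6) *(1) lc(1))+
      ultimately have "r \<in> J" unfolding J_def by blast
      then have "r = 0" using least[of r] *(4) h(3) by linarith
      moreover have "lead_coeff h ^ k \<in> A - {0}" using lc h(2) by simp
      then obtain n where "prime_product A n (lead_coeff h ^ k)"
        using fac unfolding factorial_on_def by blast
      ultimately show ?thesis using * by auto
    qed
    obtain n c q where q: "prime_product A n c" "q \<in> polys_over A" "[:c:] * f = q * h"
      using key[OF fJ] by blast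
    from split_const[OF q(1,3,2) hA] obtain q' h' where
      q': "f = q' * h'" "q' \<in> polys_over A" "h' \<in> polys_over A" "degree q' = degree q"
        "degree h' = degree h" "h' dvd h" by blast
    from irr[OF q'(2,3,1)] show False
    proof
      assume "degree q' = 0"
      then obtain u where u: "q' = [:u:]" by (rule degree_eq_zeroE)
      have "u \<in> A" "u \<noteq> 0" using q' u f0 polys_over_const_iff by auto
      then obtain m where "prime_product A m u" using fac unfolding factorial_on_def by blast
      \<comment> \<open>A prime factor of this constant would divide the primitive f.\<close>
      then have "u dvd 1"
      proof cases
        case (mult p n b)
        then have "[:p:] dvd f" using q' u by (simp add: const_poly_dvd_iff)
        then show ?thesis using f mult by (auto simp: primitive_over_def)
      qed auto
      then obtain u' where "1 = u * u'" by blast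
      then have "h' = [:u':] * f" using q'(1) u by (simp add: mult.commute)
      then have "f dvd h'" by (metis dvd_triv_right)
      then have "f dvd h" using q'(6) dvd_trans by blast
      then obtain s where s: "h = f * s" by blast
      have sA: "s \<in> polys_over A" using P.factor_mem[OF f(1) f0] hA s by metis
      obtain n c q2 where q2: "prime_product A n c" "q2 \<in> polys_over A" "[:c:] * a = q2 * h"
        using key[OF aJ] by blast
      have "[:c:] * a = (q2 * s) * f" using q2(3) s by (simp only: mult_ac)
      from cancel_const[OF q2(1) this f(2,1) P.mult_closed[OF q2(2) sA]] show False using contra by blast
    next
      assume "degree h' = 0"
      then have "degree h = 0" using q' by simp
      then obtain e where e: "h = [:e:]" by (rule degree_eq_zeroE)
      have "e \<in> A" "e \<noteq> 0" using hA h(2) e polys_over_const_iff by auto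
      then obtain m where m: "prime_product A m e" using fac unfolding factorial_on_def by blast
      from h(1) obtain p2 q2 where 2: "h = p2 * f + q2 * a" "p2 \<in> polys_over A" "q2 \<in> polys_over A"
        unfolding J_def by blast
      from ab(3) obtain t where t: "a * b = f * t" by blast
      have tA: "t \<in> polys_over A" using P.factor_mem[OF f(1) f0] ab t by (metis P.mult_closed)
      have "[:e:] * b = p2 * f * b + q2 * (a * b)"
        unfolding e[symmetric] by (subst 2(1)) (simp add: algebra_simps)
      also have "\<dots> = (p2 * b + q2 * t) * f" by (subst t) (simp add: algebra_simps)
      finally have "[:e:] * b = (p2 * b + q2 * t) * f" .
      from cancel_const[OF m this f(2,1)] have "f dvd b"
        using 2 ab tA by (auto intro!: P.add_closed P.mult_closed)
      then show False using contra by blast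
    qed
  qed
qed

text \<open>Induction on the degree. If there is no splitting into two factors of positive degree,
  the primitive part is prime and the constant factor is factored in A.\<close>

theorem factorial_on_polys_over:
  assumes fac: "factorial_on A"
  shows "factorial_on (polys_over A)"
  unfolding factorial_on_def
proof
  interpret P: factor_closed "polys_over A" by (rule factor_closed_polys_over)
  fix f assume "f \<in> polys_over A - {0}"
  then show "\<exists>n. prime_product (polys_over A) n f"
  proof (induction "degree f" arbitrary: f rule: less_induct)
    case less
    then have f: "f \<in> polys_over A" "f \<noteq> 0" by auto
    show ?case
    proof (cases "degree f = 0")
      case True
      then obtain a where "f = [:a:]" by (rule degree_eq_zeroE)
      then have a: "f = [:a:]" "a \<in> A" "a \<noteq> 0" using f by (auto simp: polys_over_const_iff)
      then obtain n where "prime_product A n a" using fac unfolding factorial_on_def by blast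
      then show ?thesis using prime_product_const a by blast
    next
      case pos: False
      show ?thesis
      proof (cases "\<exists>g h. g \<in> polys_over A \<and> h \<in> polys_over A \<and> f = g * h \<and> degree g \<noteq> 0 \<and> degree h \<noteq> 0")
        case True
        then obtain g h where gh: "g \<in> polys_over A" "h \<in> polys_over A" "f = g * h" "degree g \<noteq> 0" "degree h \<noteq> 0"
          by blast
        then have "degree f = degree g + degree h" "g \<noteq> 0" "h \<noteq> 0" using f by (auto simp: degree_mult_eq)
        then obtain n m where "prime_product (polys_over A) n g" "prime_product (polys_over A) m h"
          using less.hyps[of g] less.hyps[of h] gh by auto
        then show ?thesis using P.prime_product_mult gh by blast
      next
        case False
        have "lead_coeff f \<in> A - {0}" using f by (simp add: polys_over_coeff)
        then obtain n where "prime_product A n (lead_coeff f)" using fac unfolding factorial_on_def by blast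
        from exists_primitive[OF this f] obtain m c f' where
          *: "f = [:c:] * f'" "prime_product A m c" "f' \<in> polys_over A" "primitive_over f'" by blast
        have c0: "c \<noteq> 0" "f' \<noteq> 0" using * f by auto
        have d: "degree f' > 0" using pos *(1) c0 by simp
        have "rel_prime_elem (polys_over A) f'"
        proof (rule rel_prime_elem_primitive_irreducible[OF fac *(3,4) d])
          fix g h assume gh: "g \<in> polys_over A" "h \<in> polys_over A" "f' = g * h"
          have "f = ([:c:] * g) * h" using *(1) gh by simp
          moreover have "[:c:] * g \<in> polys_over A"
            using gh prime_product_mem[OF *(2)] by (intro P.mult_closed polys_over_const)
          moreover have "degree ([:c:] * g) = degree g" using c0 by simp
          ultimately show "degree g = 0 \<or> degree h = 0" using False gh by metis
        qed
        from prime_product.mult[OF this prime_product_const[OF *(2)]] show ?thesis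
          using *(1) by (auto simp: mult.commute)
      qed
    qed
  qed
qed

end

section \<open>Factorization of integer polynomials in finitely many variables\<close>

lemma factor_closed_polys: "factor_closed (polys W :: ('i::linorder, 'a::idom) mpoly set)"
proof unfold_locales
  interpret pr: comm_ring_hom "mproj W :: ('i, 'a) mpoly \<Rightarrow> _" by (rule comm_ring_hom_mproj)
  fix a c :: "('i, 'a) mpoly"
  assume a: "a \<in> polys W" "a \<noteq> 0" "a * c \<in> polys W"
  \<comment> \<open>The retraction fixes a and a * c, so after cancelling a it fixes c.\<close>
  have "a * c = mproj W (a * c)" using a by (simp add: mproj_ident)
  also have "\<dots> = a * mproj W c" using a by (simp add: pr.hom_mult mproj_ident)
  finally have "c = mproj W c" using a by simp
  then show "c \<in> polys W" by (metis mproj_polys)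
qed (auto intro: polys_diff polys_mult)

text \<open>Coefficients are taken in the full ring, so that no type changes. Evaluation at
  \<open>mvar y\<close> goes back, and \<open>polys_over\<close> records that y has left the
  coefficients.\<close>

definition as_poly :: "'i \<Rightarrow> ('i, 'a::comm_ring_1) mpoly \<Rightarrow> ('i, 'a) mpoly poly" where
  "as_poly y = meval (\<lambda>c. [:mconst c:]) (\<lambda>i. if i = y then [:0, 1:] else [:mvar i:])"

lemma comm_ring_hom_const_poly: "comm_ring_hom (\<lambda>c :: 'a::comm_ring_1. [:c:])"
  by unfold_locales (auto simp: one_pCons)

lemma comm_ring_hom_poly: "comm_ring_hom (\<lambda>p :: 'a::comm_ring_1 poly. poly p x)"
  by unfold_locales auto

lemma comm_ring_hom_as_poly: "comm_ring_hom (as_poly y)"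
  unfolding as_poly_def
  by (intro comm_ring_hom_meval comm_ring_hom_comp[OF comm_ring_hom_const_poly comm_ring_hom_mconst])

lemma as_poly_mvar: "as_poly y (mvar i) = (if i = y then [:0, 1:] else [:mvar i:])"
  unfolding as_poly_def
  by (simp add: comm_ring_hom_comp[OF comm_ring_hom_const_poly comm_ring_hom_mconst])

lemma as_poly_mconst: "as_poly y (mconst c) = [:mconst c:]"
  unfolding as_poly_def by simp

lemma poly_as_poly [simp]: "poly (as_poly y p) (mvar y) = p"
  by (rule mpoly_hom_eqI[OF comm_ring_hom_comp[OF comm_ring_hom_poly comm_ring_hom_as_poly] comm_ring_hom_id])
     (auto simp: as_poly_mvar as_poly_mconst)

lemma as_poly_const: "p \<in> polys W \<Longrightarrow> y \<notin> W \<Longrightarrow> as_poly y p = [:p:]"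
  by (rule mpoly_hom_eqI[OF comm_ring_hom_as_poly comm_ring_hom_const_poly])
     (auto simp: as_poly_mvar as_poly_mconst polys_iff)

lemma as_poly_polys_over:
  fixes p :: "('i::linorder, 'a::idom) mpoly"
  assumes "p \<in> polys (insert y W)"
  shows "as_poly y p \<in> polys_over (polys W)"
proof -
  interpret W: factor_closed "polys W :: ('i, 'a) mpoly set" by (rule factor_closed_polys)
  interpret P: factor_closed "polys_over (polys W) :: ('i, 'a) mpoly poly set"
    by (rule W.factor_closed_polys_over)
  interpret e: comm_ring_hom "as_poly y :: ('i, 'a) mpoly \<Rightarrow> _" by (rule comm_ring_hom_as_poly)
  have prod: "prod f S \<in> polys_over (polys W)" if "\<And>x. x \<in> S \<Longrightarrow> f x \<in> polys_over (polys W)"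
    for f :: "'i \<Rightarrow> ('i, 'a) mpoly poly" and S
    using that by (induction S rule: infinite_finite_induct) (auto intro: P.one_closed P.mult_closed)
  have v: "as_poly y (mvar i :: ('i, 'a) mpoly) \<in> polys_over (polys W)" if "i \<in> insert y W" for i
  proof (cases "i = y")
    case True
    have "monom 1 1 \<in> polys_over (polys W :: ('i, 'a) mpoly set)" by (rule W.polys_over_monom) (rule W.one_closed)
    then show ?thesis using True by (simp add: as_poly_mvar monom_altdef)
  next
    case False
    then show ?thesis using that by (simp add: as_poly_mvar W.polys_over_const polys_mvar)
  qed
  have "as_poly y p = (\<Sum>\<alpha>\<in>supp p. as_poly y (mconst (coef p \<alpha>)) * mon_eval (\<lambda>i. as_poly y (mvar i)) \<alpha>)"
    by (rule mpoly_hom_expand) (rule comm_ring_hom_as_poly)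
  also have "\<dots> \<in> polys_over (polys W)"
    unfolding mon_eval_def
    by (intro P.sum_closed P.mult_closed prod P.power_closed v)
       (use assms in \<open>auto simp: as_poly_mconst polys_iff[of p] intro!: W.polys_over_const\<close>)
  finally show ?thesis .
qed

lemma as_poly_poly:
  fixes q :: "('i::linorder, 'a::idom) mpoly poly"
  assumes "q \<in> polys_over (polys W)" "y \<notin> W"
  shows "as_poly y (poly q (mvar y)) = q"
proof -
  interpret e: comm_ring_hom "as_poly y :: ('i, 'a) mpoly \<Rightarrow> _" by (rule comm_ring_hom_as_poly)
  have "as_poly y (poly q (mvar y)) = (\<Sum>i\<le>degree q. as_poly y (coeff q i) * [:0, 1:] ^ i)"
    by (simp add: poly_altdef e.hom_sum e.hom_mult e.hom_power as_poly_mvar)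
  also have "\<dots> = (\<Sum>i\<le>degree q. monom (coeff q i) i)"
    using assms by (intro sum.cong refl)
      (simp add: as_poly_const[OF _ assms(2)] polys_over_def monom_altdef)
  also have "\<dots> = q" by (rule poly_as_sum_of_monoms)
  finally show ?thesis .
qed

lemma poly_polys_over:
  fixes q :: "('i::linorder, 'a::idom) mpoly poly"
  assumes "q \<in> polys_over (polys W)"
  shows "poly q (mvar y) \<in> polys (insert y W)"
  unfolding poly_altdef
  by (rule polys_sum, rule polys_mult[OF polys_mono[of _ W] polys_power[OF polys_mvar]])
     (use assms in \<open>auto simp: polys_over_def\<close>)

text \<open>Transport along \<open>as_poly\<close> and evaluation at \<open>mvar y\<close>, which
  preserve divisibility in both directions.\<close>

lemma rel_prime_elem_poly:
  fixes p :: "('i::linorder, 'a::idom) mpoly poly"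
  assumes p: "rel_prime_elem (polys_over (polys W)) p" and y: "y \<notin> W"
  shows "rel_prime_elem (polys (insert y W)) (poly p (mvar y))"
proof -
  interpret e: comm_ring_hom "as_poly y :: ('i, 'a) mpoly \<Rightarrow> _" by (rule comm_ring_hom_as_poly)
  interpret v: comm_ring_hom "\<lambda>q :: ('i, 'a) mpoly poly. poly q (mvar y)" by (rule comm_ring_hom_poly)
  have pe: "as_poly y (poly p (mvar y)) = p"
    using as_poly_poly[OF _ y, of p] p by (auto simp: rel_prime_elem_def)
  have dvd_iff: "poly p (mvar y) dvd a \<longleftrightarrow> p dvd as_poly y a" for a
    using e.hom_dvd[of "poly p (mvar y)" a] v.hom_dvd[of p "as_poly y a"]
    unfolding pe by auto
  have "poly p (mvar y) \<noteq> 0"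
    using pe p by (metis e.hom_zero rel_prime_elem_def)
  then show ?thesis
    using p poly_polys_over[of p W y] as_poly_polys_over[of _ y W]
    by (auto simp: rel_prime_elem_def dvd_iff e.hom_mult)
qed

lemma rel_prime_elem_insert:
  fixes p :: "('i::linorder, 'a::idom) mpoly"
  assumes "rel_prime_elem (polys W) p"
  shows "rel_prime_elem (polys (insert y W)) p"
proof (cases "y \<in> W")
  case True then show ?thesis using assms by (simp add: insert_absorb)
next
  case False
  interpret W: factor_closed "polys W :: ('i, 'a) mpoly set" by (rule factor_closed_polys)
  show ?thesis using rel_prime_elem_poly[OF W.rel_prime_elem_const[OF assms] False] by simp
qed

lemma factorial_on_insert:
  fixes W :: "'i::linorder set"
  assumes "factorial_on (polys W :: ('i, 'a::idom) mpoly set)"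
  shows "factorial_on (polys (insert y W) :: ('i, 'a) mpoly set)"
proof (cases "y \<in> W")
  case True then show ?thesis using assms by (simp add: insert_absorb)
next
  case False
  interpret W: factor_closed "polys W :: ('i, 'a) mpoly set" by (rule factor_closed_polys)
  interpret e: comm_ring_hom "as_poly y :: ('i, 'a) mpoly \<Rightarrow> _" by (rule comm_ring_hom_as_poly)
  interpret v: comm_ring_hom "\<lambda>q :: ('i, 'a) mpoly poly. poly q (mvar y)" by (rule comm_ring_hom_poly)
  have pp: "prime_product (polys (insert y W)) n (poly q (mvar y))"
    if "prime_product (polys_over (polys W)) n q" for n and q :: "('i, 'a) mpoly poly"
    using that
  proof (induction rule: prime_product.induct)
    case (unit q)
    then show ?case using v.hom_dvd[of q 1] by (auto intro: prime_product.unit poly_polys_over)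
  next
    case (mult p n b)
    then show ?case using prime_product.mult[OF rel_prime_elem_poly[OF mult.hyps(1) False]] by simp
  qed
  show ?thesis unfolding factorial_on_def
  proof
    fix a :: "('i, 'a) mpoly" assume a: "a \<in> polys (insert y W) - {0}"
    then have "as_poly y a \<noteq> 0" using poly_as_poly[of y a] by (metis DiffD2 poly_0 singletonI)
    then obtain n where "prime_product (polys_over (polys W)) n (as_poly y a)"
      using W.factorial_on_polys_over[OF assms] as_poly_polys_over[of a y W] a
      unfolding factorial_on_def by auto
    from pp[OF this] show "\<exists>n. prime_product (polys (insert y W)) n a" by auto
  qed
qed

lemma mconst_dvd_iff: "mconst a dvd (mconst b :: ('i, 'a::comm_ring_1) mpoly) \<longleftrightarrow> a dvd b"
proof
  assume "mconst a dvd (mconst b :: ('i, 'a) mpoly)"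
  then obtain q where "mconst b = mconst a * (q :: ('i, 'a) mpoly)" by blast
  then have "coef (mconst b :: ('i, 'a) mpoly) 0 = a * coef q 0" by (simp only: coef_mconst_mult)
  then show "a dvd b" by (simp add: coef_mconst)
next
  assume "a dvd b"
  then show "mconst a dvd (mconst b :: ('i, 'a) mpoly)" by (auto simp: mconst_mult)
qed

lemma polys_empty_iff: "p \<in> polys {} \<longleftrightarrow> (\<exists>c. p = mconst c)"
proof
  assume "p \<in> polys {}"
  then have "mhomogeneous 0 p" by (auto simp: polys_iff mhomogeneous_def mdeg_eq_0_iff)
  then show "\<exists>c. p = mconst c" using mhomogeneous_0_polys_const by blast
qed auto

lemma rel_prime_elem_int:
  assumes "prime (p :: int)"
  shows "rel_prime_elem (polys {}) (mconst p :: ('i::linorder, int) mpoly)"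
proof -
  have u: "mconst p dvd (1 :: ('i, int) mpoly) \<longleftrightarrow> p dvd 1"
    using mconst_dvd_iff[of p 1] by simp
  have "mconst p dvd a \<or> mconst p dvd b"
    if "a \<in> polys {}" "b \<in> polys {}" "mconst p dvd a * b" for a b :: "('i, int) mpoly"
    using that assms by (auto simp: polys_empty_iff mconst_dvd_iff prime_dvd_mult_iff simp flip: mconst_mult)
  then show ?thesis
    using assms u by (auto simp: rel_prime_elem_def)
qed

lemma factorial_on_consts: "factorial_on (polys {} :: ('i::linorder, int) mpoly set)"
proof -
  have "c \<noteq> 0 \<longrightarrow> (\<exists>n. prime_product (polys {}) n (mconst c :: ('i, int) mpoly))" for c :: int
  proof (induction c rule: prime_divisors_induct)
    case (unit c)
    then have "mconst c dvd (1 :: ('i, int) mpoly)" using mconst_dvd_iff[of c 1] by simp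
    then show ?case using prime_product.unit[of "mconst c" "polys {}"] by auto
  next
    case (factor p c)
    then show ?case using prime_product.mult[OF rel_prime_elem_int[of p]] by (auto simp: mconst_mult)
  qed simp
  then have "\<exists>n. prime_product (polys {}) n a" if "a \<in> polys {} - {0}" for a :: "('i, int) mpoly"
    using that polys_empty_iff[of a] by fastforce
  then show ?thesis unfolding factorial_on_def by blast
qed

lemma factorial_on_polys:
  "finite W \<Longrightarrow> factorial_on (polys W :: ('i::linorder, int) mpoly set)"
  by (induction W rule: finite_induct) (auto intro: factorial_on_consts factorial_on_insert)

text \<open>Two given polynomials involve only finitely many variables, and primality persists when
  these are adjoined.\<close>

lemma rel_prime_elem_imp_prime_elem:
  fixes p :: "('i::linorder, 'a::idom) mpoly"
  assumes "rel_prime_elem (polys W) p" "finite W"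
  shows "prime_elem p"
proof -
  have *: "rel_prime_elem (polys (W \<union> S)) p" if "finite S" for S
    using that by (induction S) (auto simp: assms rel_prime_elem_insert)
  show ?thesis
  proof (rule prime_elemI)
    fix a b assume ab: "p dvd a * b"
    obtain S1 S2 where "finite S1" "a \<in> polys S1" "finite S2" "b \<in> polys S2"
      using polys_finite by metis
    then have "rel_prime_elem (polys (W \<union> (S1 \<union> S2))) p" "a \<in> polys (W \<union> (S1 \<union> S2))" "b \<in> polys (W \<union> (S1 \<union> S2))"
      by (auto intro!: * intro: polys_mono)
    then show "p dvd a \<or> p dvd b" using ab by (auto simp: rel_prime_elem_def)
  qed (use assms in \<open>auto simp: rel_prime_elem_def\<close>)
qed

lemma prime_elem_mconst_int:
  "prime (p :: int) \<Longrightarrow> prime_elem (mconst p :: ('i::linorder, int) mpoly)"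
  using rel_prime_elem_imp_prime_elem[OF rel_prime_elem_int] by blast

text \<open>S stands for membership in a prime ideal. Applied to the kernel of the generic zero and
  a Macaulay determinant, it singles out the irreducible factor that is the resultant up to
  sign.\<close>

lemma exists_prime_factor_in:
  fixes a :: "('i::linorder, int) mpoly"
  assumes "a \<noteq> 0" "S a" and mult: "\<And>x y. S (x * y) \<Longrightarrow> S x \<or> S y" and unit: "\<And>x. x dvd 1 \<Longrightarrow> \<not> S x"
  shows "\<exists>p. prime_elem p \<and> S p \<and> p dvd a"
proof -
  obtain W where W: "finite W" "a \<in> polys W" using polys_finite by blast
  then obtain n where "prime_product (polys W) n a"
    using factorial_on_polys assms(1) unfolding factorial_on_def by blast
  then show ?thesis using assms(2)
  proof (induction rule: prime_product.induct)
    case (mult p n b)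
    then show ?case using assms(3)[of p b] rel_prime_elem_imp_prime_elem[OF mult.hyps(1) W(1)] by (auto intro: dvd_mult)
  qed (use unit in auto)
qed

section \<open>Degrees in a set of variables\<close>

definition wt :: "'i set \<Rightarrow> ('i \<Rightarrow>\<^sub>0 nat) \<Rightarrow> nat" where
  "wt X \<alpha> = (\<Sum>v\<in>supp \<alpha>. if v \<in> X then coef \<alpha> v else 0)"

text \<open>The variables in X are multiplied by a new indeterminate. Thus \<open>degX\<close> is
  the degree of a univariate polynomial, which over a domain is additive on products.\<close>

definition scale_vars :: "'i set \<Rightarrow> ('i, 'a::comm_ring_1) mpoly \<Rightarrow> ('i, 'a) mpoly poly" where
  "scale_vars X = meval (\<lambda>c. [:mconst c:]) (\<lambda>v. if v \<in> X then [:0, mvar v:] else [:mvar v:])"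

definition degX :: "'i set \<Rightarrow> ('i, 'a::comm_ring_1) mpoly \<Rightarrow> nat" where
  "degX X p = degree (scale_vars X p)"

lemma comm_ring_hom_const_mconst: "comm_ring_hom (\<lambda>c :: 'a::comm_ring_1. [:mconst c:])"
  by (rule comm_ring_hom_comp[OF comm_ring_hom_const_poly comm_ring_hom_mconst])

lemma comm_ring_hom_scale_vars: "comm_ring_hom (scale_vars X)"
  unfolding scale_vars_def by (intro comm_ring_hom_meval comm_ring_hom_const_mconst)

lemma scale_vars_mvar: "scale_vars X (mvar v) = (if v \<in> X then [:0, mvar v:] else [:mvar v:])"
  by (simp add: scale_vars_def comm_ring_hom_const_mconst)

lemma prod_monom: "(\<Prod>x\<in>S. monom (f x) (k x)) = monom (prod f S) (sum k S)"
  for f :: "_ \<Rightarrow> 'a::comm_semiring_1"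
  by (induction S rule: infinite_finite_induct) (auto simp: mult_monom monom_0 one_pCons)

lemma monom_power': "monom (c :: 'a::comm_semiring_1) n ^ k = monom (c ^ k) (n * k)"
  by (induction k) (auto simp: mult_monom monom_0 one_pCons)

lemma scale_vars_psingle:
  fixes c :: "'b::comm_ring_1" and X :: "'a set"
  shows "scale_vars X (psingle \<alpha> c) = monom (psingle \<alpha> c) (wt X \<alpha>)"
proof -
  have "(if v \<in> X then [:0, mvar v:] else [:mvar v:]) = (monom (mvar v) (if v \<in> X then 1 else 0) :: ('a, 'b) mpoly poly)" for v
    by (simp add: monom_0 monom_Suc)
  then have "scale_vars X (psingle \<alpha> c) =
      [:mconst c:] * (\<Prod>v\<in>supp \<alpha>. monom (mvar v) (if v \<in> X then 1 else 0) ^ coef \<alpha> v)"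
    unfolding scale_vars_def
    by (subst meval_psingle) (simp_all add: mon_eval_def)
  also have "\<dots> = [:mconst c:] * monom (mon_eval mvar \<alpha>) (wt X \<alpha>)"
    by (simp add: monom_power' prod_monom mon_eval_def wt_def if_distrib[of "\<lambda>k. k * _"] cong: if_cong)
  also have "\<dots> = monom (psingle \<alpha> c) (wt X \<alpha>)"
    by (simp add: psingle_eq mmonom_eq_mon_eval smult_monom)
  finally show ?thesis .
qed

lemma coef_coeff_scale_vars:
  fixes p :: "('a, 'b::comm_ring_1) mpoly"
  shows "coef (coeff (scale_vars X p) k) \<alpha> = (if wt X \<alpha> = k then coef p \<alpha> else 0)"
proof -
  interpret s: comm_ring_hom "scale_vars X :: ('a, 'b) mpoly \<Rightarrow> _" by (rule comm_ring_hom_scale_vars)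
  show ?thesis
  proof (induction p rule: poly_mapping_induct)
    case (single a c)
    then show ?case by (auto simp: scale_vars_psingle lookup_single when_def)
  qed (auto simp: s.hom_add lookup_add)
qed

lemma wt_le_degX: "\<alpha> \<in> supp p \<Longrightarrow> wt X \<alpha> \<le> degX X p"
  unfolding degX_def
  by (rule le_degree) (metis coef_coeff_scale_vars in_keys_iff lookup_zero)

lemma degX_leI: "(\<And>\<alpha>. \<alpha> \<in> supp p \<Longrightarrow> wt X \<alpha> \<le> n) \<Longrightarrow> degX X p \<le> n"
  unfolding degX_def
  by (rule degree_le) (fastforce intro!: poly_mapping_eqI simp: coef_coeff_scale_vars in_keys_iff)

lemma degX_le_iff: "degX X p \<le> n \<longleftrightarrow> (\<forall>\<alpha>\<in>supp p. wt X \<alpha> \<le> n)"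
  using degX_leI wt_le_degX order_trans by metis

lemma wt_eq_0_iff: "wt X \<alpha> = 0 \<longleftrightarrow> supp \<alpha> \<inter> X = {}"
  by (auto simp: wt_def in_keys_iff)

lemma degX_eq_0_iff: "degX X p = 0 \<longleftrightarrow> p \<in> polys (- X)"
  using degX_le_iff[of X p 0] by (auto simp: wt_eq_0_iff polys_iff)

lemma degX_mvar_le: "degX X (mvar v) \<le> (if v \<in> X then 1 else 0)"
  by (simp add: degX_def scale_vars_mvar)

lemma degX_mult:
  fixes p q :: "('i::linorder, 'a::idom) mpoly"
  assumes "p \<noteq> 0" "q \<noteq> 0"
  shows "degX X (p * q) = degX X p + degX X q"
proof -
  interpret s: comm_ring_hom "scale_vars X :: ('i, 'a) mpoly \<Rightarrow> _" by (rule comm_ring_hom_scale_vars)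
  have "scale_vars X r \<noteq> 0" if "r \<noteq> 0" for r :: "('i, 'a) mpoly"
  proof
    assume "scale_vars X r = 0"
    then have "coef r \<alpha> = 0" for \<alpha> using coef_coeff_scale_vars[of X r "wt X \<alpha>" \<alpha>] by simp
    then show False using that by (auto intro: poly_mapping_eqI)
  qed
  then show ?thesis using assms by (simp add: degX_def s.hom_mult degree_mult_eq)
qed

lemma degX_mult_le:
  fixes p :: "('a, 'b::comm_ring_1) mpoly"
  shows "degX X (p * q) \<le> degX X p + degX X q"
  unfolding degX_def
proof -
  interpret s: comm_ring_hom "scale_vars X :: ('a, 'b) mpoly \<Rightarrow> _" by (rule comm_ring_hom_scale_vars)
  show "degree (scale_vars X (p * q)) \<le> degree (scale_vars X p) + degree (scale_vars X q)"
    by (simp add: s.hom_mult degree_mult_le)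
qed

lemma degX_add_le:
  fixes p :: "('a, 'b::comm_ring_1) mpoly"
  shows "degX X p \<le> n \<Longrightarrow> degX X q \<le> n \<Longrightarrow> degX X (p + q) \<le> n"
proof -
  interpret s: comm_ring_hom "scale_vars X :: ('a, 'b) mpoly \<Rightarrow> _" by (rule comm_ring_hom_scale_vars)
  show "degX X p \<le> n \<Longrightarrow> degX X q \<le> n \<Longrightarrow> degX X (p + q) \<le> n"
    by (simp add: degX_def s.hom_add degree_add_le)
qed

lemma degX_0 [simp]: "degX X 0 = 0"
  by (simp add: degX_eq_0_iff)

lemma degX_uminus [simp]:
  fixes p :: "('a, 'b::comm_ring_1) mpoly"
  shows "degX X (- p) = degX X p"
proof -
  interpret s: comm_ring_hom "scale_vars X :: ('a, 'b) mpoly \<Rightarrow> _" by (rule comm_ring_hom_scale_vars)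
  show ?thesis by (simp add: degX_def s.hom_uminus)
qed

lemma degX_mconst [simp]: "degX X (mconst c) = 0"
  by (simp add: degX_eq_0_iff)

lemma degX_sum_le: "(\<And>x. x \<in> S \<Longrightarrow> degX X (f x) \<le> n) \<Longrightarrow> degX X (sum f S) \<le> n"
  by (induction S rule: infinite_finite_induct) (auto intro: degX_add_le)

lemma degX_1 [simp]: "degX X 1 = 0"
  by (simp add: degX_eq_0_iff)

lemma degX_power_le: "degX X p \<le> m \<Longrightarrow> degX X (p ^ k) \<le> m * k"
proof (induction k)
  case (Suc k)
  then show ?case using degX_mult_le[of X p "p ^ k"] by simp
qed simp

lemma degX_prod_le: "(\<And>x. x \<in> S \<Longrightarrow> degX X (f x) \<le> n x) \<Longrightarrow> degX X (prod f S) \<le> sum n S"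
proof (induction S rule: infinite_finite_induct)
  case (insert x F)
  then have "degX X (f x) \<le> n x" "degX X (prod f F) \<le> sum n F" by auto
  then show ?case using degX_mult_le[of X "f x" "prod f F"] insert(1,2) by simp
qed auto

lemma degX_meval_le:
  fixes p :: "('i, int) mpoly" and \<phi> :: "'i \<Rightarrow> ('j, 'a::comm_ring_1) mpoly"
  assumes "\<And>v. degX Y (\<phi> v) \<le> (if v \<in> X then 1 else 0)"
  shows "degX Y (meval of_int \<phi> p) \<le> degX X p"
  unfolding meval_def mon_eval_def[symmetric]
proof (rule degX_sum_le)
  fix \<alpha> assume a: "\<alpha> \<in> supp p"
  have "degX Y (mon_eval \<phi> \<alpha>) \<le> wt X \<alpha>"
    unfolding mon_eval_def wt_def
  proof (rule degX_prod_le)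
    fix v
    show "degX Y (\<phi> v ^ coef \<alpha> v) \<le> (if v \<in> X then coef \<alpha> v else 0)"
      using degX_power_le[OF assms, of v "coef \<alpha> v"] by (auto split: if_splits)
  qed
  moreover have "of_int c = (mconst (of_int c) :: ('j, 'a) mpoly)" for c
    by (simp add: mconst_def)
  then have "degX Y (of_int c :: ('j, 'a) mpoly) = 0" for c by (metis degX_mconst)
  ultimately show "degX Y (of_int (coef p \<alpha>) * mon_eval \<phi> \<alpha>) \<le> degX X p"
    using degX_mult_le[of Y "of_int (coef p \<alpha>)" "mon_eval \<phi> \<alpha>"] wt_le_degX[OF a, of X]
    by (metis add_0 order_trans)
qed

lemma unit_is_const:
  fixes q :: "('i::linorder, int) mpoly"
  assumes "q dvd 1"
  obtains c where "q = mconst c" "c = 1 \<or> c = -1"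
proof -
  obtain r where r: "1 = q * r" using assms by blast
  then have "degX UNIV q + degX UNIV r = 0"
    using degX_mult[of q r UNIV] by (metis degX_1 mult_zero_left mult_zero_right zero_neq_one)
  then have "q \<in> polys {}" by (simp add: degX_eq_0_iff)
  then obtain c where c: "q = mconst c" using polys_empty_iff by blast
  have "mconst c dvd (mconst 1 :: ('i, int) mpoly)" using assms c by simp
  then have "c dvd 1" by (simp only: mconst_dvd_iff)
  then show ?thesis using that[OF c] by (auto simp: abs_if split: if_splits)
qed

lemma coef_sum_inj:
  assumes "finite S" "inj_on m S" "a \<in> S"
  shows "coef (\<Sum>x\<in>S. psingle (m x) (c x)) (m a) = c a"
proof -
  have "coef (\<Sum>x\<in>S. psingle (m x) (c x)) (m a) = (\<Sum>x\<in>S. if x = a then c x else 0)"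
    unfolding lookup_sum lookup_single when_def
    by (intro sum.cong refl) (use assms in \<open>auto dest: inj_onD\<close>)
  then show ?thesis using assms by simp
qed

section \<open>Inertia forms\<close>

text \<open>The cofactors are arbitrary, also with variables outside V and with any coefficients;
  retractions and homogeneous parts bring them into shape when needed.\<close>

definition form_ideal :: "nat set \<Rightarrow> (nat \<Rightarrow> (nat, 'a::comm_ring_1) mpoly) \<Rightarrow> (nat, 'a) mpoly set" where
  "form_ideal V g = {\<Sum>i\<in>V. h i * g i | h. True}"

lemma form_ideal_0 [simp]: "0 \<in> form_ideal V g"
  unfolding form_ideal_def by (intro CollectI exI[of _ "\<lambda>_. 0"]) auto

lemma form_ideal_add: "p \<in> form_ideal V g \<Longrightarrow> q \<in> form_ideal V g \<Longrightarrow> p + q \<in> form_ideal V g"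
  unfolding form_ideal_def
proof safe
  fix h k
  show "\<exists>l. (\<Sum>i\<in>V. h i * g i) + (\<Sum>i\<in>V. k i * g i) = (\<Sum>i\<in>V. l i * g i) \<and> True"
    by (intro exI[of _ "\<lambda>i. h i + k i"]) (simp add: distrib_right sum.distrib)
qed

lemma form_ideal_mult: "p \<in> form_ideal V g \<Longrightarrow> q * p \<in> form_ideal V g"
  unfolding form_ideal_def
proof safe
  fix h
  show "\<exists>l. q * (\<Sum>i\<in>V. h i * g i) = (\<Sum>i\<in>V. l i * g i) \<and> True"
    by (intro exI[of _ "\<lambda>i. q * h i"]) (simp add: sum_distrib_left mult.assoc)
qed

lemma form_ideal_sum: "(\<And>x. x \<in> S \<Longrightarrow> f x \<in> form_ideal V g) \<Longrightarrow> sum f S \<in> form_ideal V g"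
  by (induction S rule: infinite_finite_induct) (auto intro: form_ideal_add)

lemma form_ideal_gen: "finite V \<Longrightarrow> i \<in> V \<Longrightarrow> g i \<in> form_ideal V g"
  unfolding form_ideal_def
  by (intro CollectI exI[of _ "\<lambda>j. if j = i then 1 else 0"]) (auto simp: if_distrib[of "\<lambda>x. x * _"] sum.delta cong: if_cong)

lemma form_ideal_mono: "p \<in> form_ideal V g \<Longrightarrow> (\<And>i. i \<in> V \<Longrightarrow> g i \<in> form_ideal W g') \<Longrightarrow> p \<in> form_ideal W g'"
  by (auto simp: form_ideal_def[of V g] intro!: form_ideal_sum form_ideal_mult)

lemma form_ideal_hom:
  assumes "comm_ring_hom f" "p \<in> form_ideal V g"
  shows "f p \<in> form_ideal V (\<lambda>i. f (g i))"
proof -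
  interpret f: comm_ring_hom f by fact
  obtain h where "p = (\<Sum>i\<in>V. h i * g i)" using assms(2) by (auto simp: form_ideal_def)
  then have "f p = (\<Sum>i\<in>V. f (h i) * f (g i))" by (simp add: f.hom_sum f.hom_mult)
  then show ?thesis unfolding form_ideal_def by (intro CollectI exI[of _ "\<lambda>i. f (h i)"]) auto
qed

definition inertia :: "nat set \<Rightarrow> (nat \<Rightarrow> (nat, 'a::comm_ring_1) mpoly) \<Rightarrow> 'a \<Rightarrow> bool" where
  "inertia V g r \<longleftrightarrow> (\<exists>N. \<forall>\<beta>\<in>monoms V N. mmonom \<beta> * mconst r \<in> form_ideal V g)"

type_synonym ures = "(uvar, int) mpoly"

text \<open>The label i is not tied to V: labels outside V give generic forms with fresh
  coefficients, which serve as second factors and as cofactors.\<close>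

definition gform :: "nat set \<Rightarrow> nat \<Rightarrow> nat \<Rightarrow> (nat, ures) mpoly" where
  "gform V k i = (\<Sum>\<alpha>\<in>monoms V k. mconst (mvar (i, \<alpha>)) * mmonom \<alpha>)"

abbreviation gforms :: "nat set \<Rightarrow> (nat \<Rightarrow> nat) \<Rightarrow> nat \<Rightarrow> (nat, ures) mpoly" where
  "gforms V ds i \<equiv> gform V (ds i) i"

definition coefvars :: "nat set \<Rightarrow> (nat \<Rightarrow> nat) \<Rightarrow> uvar set" where
  "coefvars V ds = (SIGMA i:V. monoms V (ds i))"

definition xvars :: "nat \<Rightarrow> uvar set" where
  "xvars i = {i} \<times> UNIV"

definition dehom :: "nat \<Rightarrow> (nat, 'a::comm_ring_1) mpoly \<Rightarrow> (nat, 'a) mpoly" where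
  "dehom v = meval mconst (\<lambda>j. if j = v then 1 else mvar j)"

lemma comm_ring_hom_dehom: "comm_ring_hom (dehom v)"
  unfolding dehom_def by (intro comm_ring_hom_meval comm_ring_hom_mconst)

lemma dehom_mconst [simp]: "dehom v (mconst c) = mconst c"
  by (simp add: dehom_def)

lemma dehom_mvar: "dehom v (mvar j) = (if j = v then 1 else mvar j)"
  by (simp add: dehom_def comm_ring_hom_mconst)

lemma dehom_psingle:
  "dehom v (psingle \<alpha> c) = psingle (\<alpha> - psingle v (coef \<alpha> v)) c" for c :: "'a::comm_ring_1"
proof -
  interpret d: comm_ring_hom "dehom v :: (nat, 'a) mpoly \<Rightarrow> _" by (rule comm_ring_hom_dehom)
  define \<beta> where "\<beta> = \<alpha> - psingle v (coef \<alpha> v)"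
  have ab: "\<alpha> = psingle v (coef \<alpha> v) + \<beta>"
    by (rule poly_mapping_eqI) (auto simp: \<beta>_def lookup_add lookup_minus lookup_single when_def)
  have b0: "v \<notin> supp \<beta>" by (simp add: \<beta>_def in_keys_iff lookup_minus)
  have "dehom v (mmonom \<beta> :: (nat, 'a) mpoly) = mon_eval (\<lambda>j. dehom v (mvar j)) \<beta>"
    by (simp add: mmonom_eq_mon_eval mon_eval_hom[OF comm_ring_hom_dehom])
  also have "\<dots> = mon_eval mvar \<beta>"
    by (rule mon_eval_cong) (use b0 in \<open>auto simp: dehom_mvar\<close>)
  finally have b: "dehom v (mmonom \<beta> :: (nat, 'a) mpoly) = mmonom \<beta>" by (simp add: mmonom_eq_mon_eval)
  have "dehom v (psingle \<alpha> c) = mconst c * (dehom v (mvar v) ^ coef \<alpha> v * mmonom \<beta>)"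
    unfolding psingle_eq by (subst ab) (simp only: mmonom_add mmonom_power d.hom_mult d.hom_power b dehom_mconst)
  then show ?thesis by (simp add: dehom_mvar psingle_eq \<beta>_def)
qed

text \<open>The lost exponent of v is determined by the total degree, so distinct monomials of
  degree N stay distinct.\<close>

lemma dehom_inj:
  fixes h :: "(nat, 'a::comm_ring_1) mpoly"
  assumes "mhomogeneous N h" "dehom v h = 0"
  shows "h = 0"
proof (rule ccontr)
  interpret d: comm_ring_hom "dehom v :: (nat, 'a) mpoly \<Rightarrow> _" by (rule comm_ring_hom_dehom)
  define m where "m \<alpha> = \<alpha> - psingle v (coef \<alpha> v)" for \<alpha> :: "nat \<Rightarrow>\<^sub>0 nat"
  have am: "\<alpha> = psingle v (coef \<alpha> v) + m \<alpha>" for \<alpha>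
    by (rule poly_mapping_eqI) (auto simp: m_def lookup_add lookup_minus lookup_single when_def)
  have inj: "inj_on m (supp h)"
  proof (rule inj_onI)
    fix \<alpha> \<beta> assume ab: "\<alpha> \<in> supp h" "\<beta> \<in> supp h" "m \<alpha> = m \<beta>"
    then have "mdeg \<alpha> = mdeg \<beta>" using assms(1) by (simp add: mhomogeneous_def)
    moreover have "mdeg \<alpha> = coef \<alpha> v + mdeg (m \<alpha>)" "mdeg \<beta> = coef \<beta> v + mdeg (m \<beta>)"
      using arg_cong[OF am[of \<alpha>], of mdeg] arg_cong[OF am[of \<beta>], of mdeg] by (auto simp: mdeg_add)
    ultimately have "coef \<alpha> v = coef \<beta> v" using ab by simp
    then show "\<alpha> = \<beta>" using am[of \<alpha>] am[of \<beta>] ab by simp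
  qed
  assume "h \<noteq> 0"
  then obtain a where a: "a \<in> supp h" by fastforce
  have "dehom v h = dehom v (\<Sum>\<alpha>\<in>supp h. psingle \<alpha> (coef h \<alpha>))" by (simp add: sum_single_coef)
  also have "\<dots> = (\<Sum>\<alpha>\<in>supp h. psingle (m \<alpha>) (coef h \<alpha>))"
    by (simp add: d.hom_sum dehom_psingle m_def)
  finally have "coef h a = 0"
    using coef_sum_inj[OF finite_keys inj a, of "coef h"] assms(2) by simp
  then show False using a by (simp add: in_keys_iff)
qed

lemma mconst_of_int: "mconst (of_int c) = (of_int c :: ('i, 'a::comm_ring_1) mpoly)"
  by (simp add: mconst_def)

lemma mconst_int: "mconst (c :: int) = of_int c"
  using mconst_of_int[of c, where 'a = int] by simp

lemma int_mpoly_induct [case_names const var add mult]: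
  fixes p :: "('i, int) mpoly"
  assumes "\<And>c. P (of_int c)" "\<And>i. P (mvar i)" "\<And>p q. P p \<Longrightarrow> P q \<Longrightarrow> P (p + q)"
    "\<And>p q. P p \<Longrightarrow> P q \<Longrightarrow> P (p * q)"
  shows "P p"
proof -
  have P1: "P 1" using assms(1)[of 1] by simp
  have pw: "P (mvar i ^ k)" for i k
    by (induction k) (auto intro: assms P1)
  have pr: "P (\<Prod>i\<in>S. mvar i ^ f i)" for S f
    by (induction S rule: infinite_finite_induct) (auto intro: assms P1 pw)
  have c: "P (mconst c)" for c using assms(1)[of c] by (simp add: mconst_int)
  show ?thesis
  proof (induction p rule: poly_mapping_induct)
    case zero then show ?case using c[of 0] by simp
  next
    case (single a c)
    then show ?case unfolding psingle_eq mmonom_eq_mon_eval mon_eval_def by (intro assms(4) c pr)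
  qed (rule assms)
qed

lemma comm_ring_hom_int_meval: "comm_ring_hom (meval (of_int :: int \<Rightarrow> 'a::comm_ring_1) \<phi>)"
  by (intro comm_ring_hom_meval comm_ring_hom_of_int)

lemma meval_of_int_mvar [simp]: "meval (of_int :: int \<Rightarrow> 'a::comm_ring_1) \<phi> (mvar i) = \<phi> i"
  by (simp add: comm_ring_hom_of_int)

text \<open>The generic forms have the common zero with \<open>x\<^sub>v = 1\<close> and the other
  coordinates generic, once the coefficients of \<open>x\<^sub>v ^ ds i\<close> are solved for.\<close>

definition generic_zero :: "nat set \<Rightarrow> (nat \<Rightarrow> nat) \<Rightarrow> nat \<Rightarrow> ures \<Rightarrow> (nat, ures) mpoly" where
  "generic_zero V ds v = meval of_int (\<lambda>(i, \<alpha>).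
     if i \<in> V \<and> \<alpha> = psingle v (ds i)
     then - (\<Sum>\<beta>\<in>monoms V (ds i) - {\<alpha>}. mconst (mvar (i, \<beta>)) * dehom v (mmonom \<beta>))
     else mconst (mvar (i, \<alpha>)))"

lemma mhomogeneous_gform: "mhomogeneous k (gform V k i)"
  unfolding gform_def
  by (intro mhomogeneous_sum mhomogeneous_mconst_mult) (auto simp: monoms_def mhomogeneous_def mmonom_def)

lemma polys_gform: "gform V k i \<in> polys V"
  unfolding gform_def by (intro polys_sum polys_mult polys_mmonom) (auto simp: monoms_def)

lemma coef_gform: "finite V \<Longrightarrow> coef (gform V k i) \<alpha> = (if \<alpha> \<in> monoms V k then mvar (i, \<alpha>) else 0)"
  unfolding gform_def lookup_sum coef_mconst_mult coef_mmonom
  by (subst sum.mono_neutral_cong_right[of _ "{\<alpha>} \<inter> monoms V k"]) (auto simp: finite_monoms)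

section \<open>The ideal of inertia forms as the kernel of a ring morphism\<close>

locale forms =
  fixes V :: "nat set" and ds :: "nat \<Rightarrow> nat"
  assumes finite_V: "finite V" and V_nonempty: "V \<noteq> {}" and ds_pos: "i \<in> V \<Longrightarrow> ds i > 0"
begin

lemma single_mem_monoms: "v \<in> V \<Longrightarrow> psingle v k \<in> monoms V k"
  by (auto simp: monoms_def)

lemma comm_ring_hom_generic_zero: "comm_ring_hom (generic_zero V ds v)"
  unfolding generic_zero_def by (rule comm_ring_hom_int_meval)

lemma generic_zero_mvar: "generic_zero V ds v (mvar (i, \<alpha>)) =
   (if i \<in> V \<and> \<alpha> = psingle v (ds i)
     then - (\<Sum>\<beta>\<in>monoms V (ds i) - {\<alpha>}. mconst (mvar (i, \<beta>)) * dehom v (mmonom \<beta>))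
     else mconst (mvar (i, \<alpha>)))"
  unfolding generic_zero_def by simp

lemma gform_split:
  assumes "v \<in> V"
  shows "gforms V ds i = mconst (mvar (i, psingle v (ds i))) * mvar v ^ ds i +
     (\<Sum>\<beta>\<in>monoms V (ds i) - {psingle v (ds i)}. mconst (mvar (i, \<beta>)) * mmonom \<beta>)"
  unfolding gform_def
  by (subst sum.remove[OF finite_monoms[OF finite_V] single_mem_monoms[OF assms]])
     (simp add: mmonom_power)

text \<open>Extends the generic zero from the coefficients to polynomials in the x-variables, so
  that the ideal of the generic forms lies in the kernel.\<close>

definition eval_zero :: "nat \<Rightarrow> (nat, ures) mpoly \<Rightarrow> (nat, ures) mpoly" where
  "eval_zero v = meval (generic_zero V ds v) (\<lambda>j. if j = v then 1 else mvar j)"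

lemma comm_ring_hom_eval_zero: "comm_ring_hom (eval_zero v)"
  unfolding eval_zero_def by (intro comm_ring_hom_meval comm_ring_hom_generic_zero)

lemma eval_zero_mconst: "eval_zero v (mconst r) = generic_zero V ds v r"
proof -
  interpret z: comm_ring_hom "generic_zero V ds v" by (rule comm_ring_hom_generic_zero)
  show ?thesis by (simp add: eval_zero_def)
qed

lemma eval_zero_mvar: "eval_zero v (mvar j) = (if j = v then 1 else mvar j)"
  by (simp add: eval_zero_def comm_ring_hom_generic_zero)

lemma eval_zero_mmonom: "eval_zero v (mmonom \<beta>) = dehom v (mmonom \<beta>)"
  by (simp add: mmonom_eq_mon_eval mon_eval_hom[OF comm_ring_hom_eval_zero] mon_eval_hom[OF comm_ring_hom_dehom]
      eval_zero_mvar dehom_mvar)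

lemma eval_zero_gform:
  assumes "v \<in> V" "i \<in> V"
  shows "eval_zero v (gforms V ds i) = 0"
proof -
  interpret e: comm_ring_hom "eval_zero v" by (rule comm_ring_hom_eval_zero)
  have "eval_zero v (mconst (mvar (i, \<beta>)) * mmonom \<beta>) = mconst (mvar (i, \<beta>)) * dehom v (mmonom \<beta>)"
    if "\<beta> \<noteq> psingle v (ds i)" for \<beta>
    using that by (simp only: e.hom_mult eval_zero_mconst generic_zero_mvar eval_zero_mmonom) simp
  then have "(\<Sum>\<beta>\<in>monoms V (ds i) - {psingle v (ds i)}. eval_zero v (mconst (mvar (i, \<beta>)) * mmonom \<beta>)) =
     (\<Sum>\<beta>\<in>monoms V (ds i) - {psingle v (ds i)}. mconst (mvar (i, \<beta>)) * dehom v (mmonom \<beta>))"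
    by (intro sum.cong) auto
  then show ?thesis using assms
    by (simp add: gform_split[OF assms(1)] e.hom_add e.hom_sum e.hom_mult[of "mconst _" "mvar _ ^ _"] e.hom_power eval_zero_mvar
        eval_zero_mconst generic_zero_mvar)
qed

lemma eval_zero_form_ideal:
  assumes "v \<in> V" "p \<in> form_ideal V (gforms V ds)"
  shows "eval_zero v p = 0"
proof -
  interpret e: comm_ring_hom "eval_zero v" by (rule comm_ring_hom_eval_zero)
  obtain h where "p = (\<Sum>i\<in>V. h i * gforms V ds i)" using assms(2) by (auto simp: form_ideal_def)
  then show ?thesis using assms(1) by (simp add: e.hom_sum e.hom_mult eval_zero_gform)
qed

text \<open>Modulo the k-th form, the coefficient of x_v ^ ds k times x_v ^ ds k equals minus the
  sum of the other terms. So these coefficients can be removed from r at the cost of a power of x_v,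
  and setting x_v = 1 in the outcome gives the value of r at the generic zero.\<close>

lemma homogenized_zero:
  assumes v: "v \<in> V"
  shows "\<exists>N h. mhomogeneous N h \<and> mvar v ^ N * mconst r - h \<in> form_ideal V (gforms V ds) \<and>
     dehom v h = generic_zero V ds v r"
proof (induction r rule: int_mpoly_induct)
  interpret d: comm_ring_hom "dehom v :: (nat, ures) mpoly \<Rightarrow> _" by (rule comm_ring_hom_dehom)
  interpret z: comm_ring_hom "generic_zero V ds v" by (rule comm_ring_hom_generic_zero)
  have vp: "mhomogeneous N (mvar v ^ N :: (nat, ures) mpoly)" for N
    using mhomogeneous_power[OF mhomogeneous_mvar, of N v] by simp
  have dv: "dehom v (mvar v) = (1 :: (nat, ures) mpoly)" by (simp add: dehom_mvar)
  {
    case (const c)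
    have "dehom v (mconst (of_int c)) = generic_zero V ds v (of_int c)"
      by (simp only: z.hom_of_int mconst_of_int d.hom_of_int)
    moreover have "mvar v ^ 0 * mconst (of_int c) - mconst (of_int c) \<in> form_ideal V (gforms V ds)"
      by simp
    ultimately show ?case using mhomogeneous_mconst by blast
  next
    case (var i)
    obtain k \<alpha> where i: "i = (k, \<alpha>)" by force
    show ?case
    proof (cases "k \<in> V \<and> \<alpha> = psingle v (ds k)")
      case False
      then show ?thesis
        by (intro exI[of _ 0] exI[of _ "mconst (mvar i)"]) (auto simp: i generic_zero_mvar)
    next
      case True
      define h :: "(nat, ures) mpoly" where "h = - (\<Sum>\<beta>\<in>monoms V (ds k) - {psingle v (ds k)}. mconst (mvar (k, \<beta>)) * mmonom \<beta>)"
      have "mhomogeneous (ds k) h" unfolding h_def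
        by (intro mhomogeneous_uminus mhomogeneous_sum mhomogeneous_mconst_mult) (auto simp: monoms_def mhomogeneous_def mmonom_def)
      moreover have "mvar v ^ ds k * mconst (mvar i) - h = gforms V ds k"
        using True by (simp add: gform_split[OF v] h_def i mult.commute)
      then have "mvar v ^ ds k * mconst (mvar i) - h \<in> form_ideal V (gforms V ds)"
        using True form_ideal_gen[OF finite_V, of k "gforms V ds"] by simp
      moreover have "dehom v h = generic_zero V ds v (mvar i)"
        using True by (simp add: i generic_zero_mvar h_def d.hom_uminus d.hom_sum d.hom_mult)
      ultimately show ?thesis by blast
    qed
  next
    case (add p q)
    then obtain N h M k where
      *: "mhomogeneous N h" "mvar v ^ N * mconst p - h \<in> form_ideal V (gforms V ds)" "dehom v h = generic_zero V ds v p"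
         "mhomogeneous M k" "mvar v ^ M * mconst q - k \<in> form_ideal V (gforms V ds)" "dehom v k = generic_zero V ds v q"
      by blast
    have "mhomogeneous (N + M) (h * mvar v ^ M + mvar v ^ N * k)"
      by (intro mhomogeneous_add mhomogeneous_mult * vp)
    moreover have "mvar v ^ M * (mvar v ^ N * mconst p - h) + mvar v ^ N * (mvar v ^ M * mconst q - k) \<in> form_ideal V (gforms V ds)"
      by (intro form_ideal_add form_ideal_mult *)
    then have "mvar v ^ (N + M) * mconst (p + q) - (h * mvar v ^ M + mvar v ^ N * k) \<in> form_ideal V (gforms V ds)"
      by (simp add: mconst_add power_add algebra_simps)
    moreover have "dehom v (h * mvar v ^ M + mvar v ^ N * k) = generic_zero V ds v (p + q)"
      using * by (simp add: d.hom_add d.hom_mult d.hom_power dv z.hom_add)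
    ultimately show ?case by blast
  next
    case (mult p q)
    then obtain N h M k where
      *: "mhomogeneous N h" "mvar v ^ N * mconst p - h \<in> form_ideal V (gforms V ds)" "dehom v h = generic_zero V ds v p"
         "mhomogeneous M k" "mvar v ^ M * mconst q - k \<in> form_ideal V (gforms V ds)" "dehom v k = generic_zero V ds v q"
      by blast
    have "mhomogeneous (N + M) (h * k)"
      by (intro mhomogeneous_mult *)
    moreover have "mvar v ^ N * mconst p * (mvar v ^ M * mconst q - k) + k * (mvar v ^ N * mconst p - h) \<in> form_ideal V (gforms V ds)"
      by (intro form_ideal_add form_ideal_mult *)
    then have "mvar v ^ (N + M) * mconst (p * q) - h * k \<in> form_ideal V (gforms V ds)"
      by (simp add: mconst_mult power_add algebra_simps)
    moreover have "dehom v (h * k) = generic_zero V ds v (p * q)"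
      using * by (simp add: d.hom_mult z.hom_mult)
    ultimately show ?case by blast
  }
qed

lemma generic_zero_imp_power:
  assumes "v \<in> V" "generic_zero V ds v r = 0"
  shows "\<exists>N. mvar v ^ N * mconst r \<in> form_ideal V (gforms V ds)"
proof -
  obtain N h where *: "mhomogeneous N h" "mvar v ^ N * mconst r - h \<in> form_ideal V (gforms V ds)"
     "dehom v h = generic_zero V ds v r" using homogenized_zero[OF assms(1)] by blast
  then have "h = 0" using dehom_inj assms by metis
  then show ?thesis using * by auto
qed

text \<open>Vanishing at the zero built from v puts a power of x_v times r into the ideal, and x_v
  does not vanish at the zero built from w.\<close>

lemma generic_zero_indep:
  assumes "v \<in> V" "w \<in> V" "generic_zero V ds v r = 0"
  shows "generic_zero V ds w r = 0"
proof -
  interpret e: comm_ring_hom "eval_zero w" by (rule comm_ring_hom_eval_zero)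
  obtain N where "mvar v ^ N * mconst r \<in> form_ideal V (gforms V ds)"
    using generic_zero_imp_power assms by blast
  from eval_zero_form_ideal[OF assms(2) this]
  have "eval_zero w (mvar v) ^ N * generic_zero V ds w r = 0"
    by (simp add: e.hom_mult e.hom_power eval_zero_mconst)
  moreover have "eval_zero w (mvar v) \<noteq> 0"
  proof
    assume "eval_zero w (mvar v) = 0"
    moreover have "(mvar v :: (nat, ures) mpoly) \<noteq> 0"
      by (metis coef_mmonom lookup_zero mvar_def zero_neq_one)
    ultimately show False by (simp add: eval_zero_mvar split: if_splits)
  qed
  ultimately show ?thesis by simp
qed

lemma inertia_iff:
  assumes v: "v \<in> V"
  shows "inertia V (gforms V ds) r \<longleftrightarrow> generic_zero V ds v r = 0"
proof
  interpret e: comm_ring_hom "eval_zero v" by (rule comm_ring_hom_eval_zero)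
  assume "inertia V (gforms V ds) r"
  then obtain N where "\<And>\<beta>. \<beta> \<in> monoms V N \<Longrightarrow> mmonom \<beta> * mconst r \<in> form_ideal V (gforms V ds)"
    by (auto simp: inertia_def)
  from this[OF single_mem_monoms[OF v]] eval_zero_form_ideal[OF v]
  have "eval_zero v (mmonom (psingle v N) * mconst r) = 0" by blast
  then show "generic_zero V ds v r = 0"
    by (simp add: mmonom_power e.hom_mult e.hom_power eval_zero_mvar eval_zero_mconst)
next
  assume "generic_zero V ds v r = 0"
  then have "\<forall>w\<in>V. \<exists>N. mvar w ^ N * mconst r \<in> form_ideal V (gforms V ds)"
    using generic_zero_imp_power generic_zero_indep[OF v] by blast
  from bchoice[OF this] obtain N where
    N: "\<And>w. w \<in> V \<Longrightarrow> mvar w ^ N w * mconst r \<in> form_ideal V (gforms V ds)"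
    by blast
  show "inertia V (gforms V ds) r" unfolding inertia_def
  proof (intro exI ballI)
    fix \<beta> assume b: "\<beta> \<in> monoms V (sum N V)"
    \<comment> \<open>In degree \<open>sum N V\<close> every monomial is divisible by some x_w ^ N
      w, since smaller exponents throughout would have a smaller sum.\<close>
    have "\<exists>w\<in>V. N w \<le> coef \<beta> w"
    proof (rule ccontr)
      assume "\<not> ?thesis"
      then have "(\<Sum>w\<in>V. coef \<beta> w) < sum N V"
        using finite_V V_nonempty by (intro sum_strict_mono) auto
      moreover have "mdeg \<beta> = (\<Sum>w\<in>V. coef \<beta> w)"
        using b by (intro mdeg_superset finite_V) (auto simp: monoms_def)
      ultimately show False using b by (simp add: monoms_def)
    qed
    then obtain w where w: "w \<in> V" "N w \<le> coef \<beta> w" by blast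
    obtain \<gamma> where g: "\<beta> = \<gamma> + psingle w (N w)"
    proof
      show "\<beta> = (\<beta> - psingle w (N w)) + psingle w (N w)"
        using w by (intro poly_mapping_eqI) (auto simp: lookup_add lookup_minus lookup_single when_def)
    qed
    have eq: "mmonom \<beta> * mconst r = mmonom \<gamma> * (mvar w ^ N w * mconst r)"
      unfolding g mmonom_add mmonom_power by (simp only: mult_ac)
    show "mmonom \<beta> * mconst r \<in> form_ideal V (gforms V ds)"
      unfolding eq by (rule form_ideal_mult[OF N[OF w(1)]])
  qed
qed

end

section \<open>Principality of the ideal of inertia forms\<close>

lemma coeff_mult_bound:
  fixes p q :: "'a::comm_semiring_0 poly"
  assumes "degree p \<le> m" "degree q \<le> n"
  shows "coeff (p * q) (m + n) = coeff p m * coeff q n"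
proof -
  have "coeff p i * coeff q (m + n - i) = 0" if "i \<noteq> m" "i \<le> m + n" for i
  proof (cases "i < m")
    case True
    then have "degree q < m + n - i" using assms by linarith
    then show ?thesis by (simp add: coeff_eq_0)
  next
    case False
    then have "degree p < i" using assms that by linarith
    then show ?thesis by (simp add: coeff_eq_0)
  qed
  then have "(\<Sum>i\<le>m + n. coeff p i * coeff q (m + n - i)) = (\<Sum>i\<in>{m}. coeff p i * coeff q (m + n - i))"
    by (intro sum.mono_neutral_right) auto
  then show ?thesis by (simp add: coeff_mult)
qed

lemma coeff_power_bound:
  fixes p :: "'a::comm_semiring_1 poly"
  assumes "degree p \<le> m"
  shows "degree (p ^ k) \<le> m * k \<and> coeff (p ^ k) (m * k) = coeff p m ^ k"
proof (induction k)
  case (Suc k)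
  then show ?case
    using coeff_mult_bound[OF assms, of "p ^ k" "m * k"] degree_mult_le[of p "p ^ k"] assms by auto
qed simp

lemma coeff_prod_bound:
  fixes f :: "_ \<Rightarrow> 'a::comm_semiring_1 poly"
  assumes "\<And>x. x \<in> S \<Longrightarrow> degree (f x) \<le> m x"
  shows "degree (prod f S) \<le> sum m S \<and> coeff (prod f S) (sum m S) = (\<Prod>x\<in>S. coeff (f x) (m x))"
  using assms
proof (induction S rule: infinite_finite_induct)
  case (insert x F)
  then have "degree (prod f F) \<le> sum m F" "degree (f x) \<le> m x" by auto
  then show ?case
    using insert coeff_mult_bound[of "f x" "m x" "prod f F" "sum m F"] degree_mult_le[of "f x" "prod f F"]
    by (auto intro: order_trans add_mono)
qed auto

text \<open>Variables in X may go to linear polynomials and the others go to constants. So the top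
  coefficient comes from the monomials of maximal weight, each image being replaced by its own top
  coefficient.\<close>

lemma coeff_hom_top:
  fixes \<Theta> :: "('i, int) mpoly \<Rightarrow> 'b::comm_ring_1 poly"
  assumes hom: "comm_ring_hom \<Theta>" and r: "r \<in> polys U"
    and deg: "\<And>u. u \<in> U \<Longrightarrow> degree (\<Theta> (mvar u)) \<le> (if u \<in> X then 1 else 0)"
    and n: "\<And>\<alpha>. \<alpha> \<in> supp r \<Longrightarrow> wt X \<alpha> \<le> n"
  shows "coeff (\<Theta> r) n = (\<Sum>\<alpha> | \<alpha> \<in> supp r \<and> wt X \<alpha> = n.
     of_int (coef r \<alpha>) * mon_eval (\<lambda>u. coeff (\<Theta> (mvar u)) (if u \<in> X then 1 else 0)) \<alpha>)"
proof -
  interpret T: comm_ring_hom \<Theta> by fact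
  have top: "degree (mon_eval (\<lambda>u. \<Theta> (mvar u)) \<alpha>) \<le> wt X \<alpha>"
    "coeff (mon_eval (\<lambda>u. \<Theta> (mvar u)) \<alpha>) (wt X \<alpha>) = mon_eval (\<lambda>u. coeff (\<Theta> (mvar u)) (if u \<in> X then 1 else 0)) \<alpha>"
    if a: "\<alpha> \<in> supp r" for \<alpha>
  proof -
    have d: "degree (\<Theta> (mvar u)) \<le> (if u \<in> X then 1 else 0)" if "u \<in> supp \<alpha>" for u
      by (rule deg) (use r a that in \<open>auto simp: polys_iff\<close>)
    have w: "wt X \<alpha> = (\<Sum>u\<in>supp \<alpha>. (if u \<in> X then 1 else 0) * coef \<alpha> u)"
      unfolding wt_def by (intro sum.cong) auto
    have 1: "degree (\<Theta> (mvar u) ^ coef \<alpha> u) \<le> (if u \<in> X then 1 else 0) * coef \<alpha> u"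
      "coeff (\<Theta> (mvar u) ^ coef \<alpha> u) ((if u \<in> X then 1 else 0) * coef \<alpha> u) = coeff (\<Theta> (mvar u)) (if u \<in> X then 1 else 0) ^ coef \<alpha> u"
      if "u \<in> supp \<alpha>" for u
      using coeff_power_bound[OF d[OF that], of "coef \<alpha> u"] by auto
    from coeff_prod_bound[of "supp \<alpha>" "\<lambda>u. \<Theta> (mvar u) ^ coef \<alpha> u" "\<lambda>u. (if u \<in> X then 1 else 0) * coef \<alpha> u"] 1
    show "degree (mon_eval (\<lambda>u. \<Theta> (mvar u)) \<alpha>) \<le> wt X \<alpha>"
      "coeff (mon_eval (\<lambda>u. \<Theta> (mvar u)) \<alpha>) (wt X \<alpha>) = mon_eval (\<lambda>u. coeff (\<Theta> (mvar u)) (if u \<in> X then 1 else 0)) \<alpha>"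
      unfolding mon_eval_def w by (simp_all cong: prod.cong)
  qed
  have c: "\<Theta> (mconst c) = [:of_int c:]" for c
    by (simp add: mconst_int T.hom_of_int of_int_poly)
  have "coeff (\<Theta> r) n = (\<Sum>\<alpha>\<in>supp r. of_int (coef r \<alpha>) * coeff (mon_eval (\<lambda>u. \<Theta> (mvar u)) \<alpha>) n)"
    unfolding mpoly_hom_expand[OF hom, of r] by (simp add: coeff_sum c)
  also have "\<dots> = (\<Sum>\<alpha> | \<alpha> \<in> supp r \<and> wt X \<alpha> = n. of_int (coef r \<alpha>) * coeff (mon_eval (\<lambda>u. \<Theta> (mvar u)) \<alpha>) n)"
  proof (intro sum.mono_neutral_right ballI)
    fix \<alpha> assume a: "\<alpha> \<in> supp r - {\<alpha>. \<alpha> \<in> supp r \<and> wt X \<alpha> = n}"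
    then have "wt X \<alpha> < n" using n[of \<alpha>] by auto
    then have "coeff (mon_eval (\<lambda>u. \<Theta> (mvar u)) \<alpha>) n = 0"
      using top(1)[of \<alpha>] a by (intro coeff_eq_0) auto
    then show "of_int (coef r \<alpha>) * coeff (mon_eval (\<lambda>u. \<Theta> (mvar u)) \<alpha>) n = 0" by simp
  qed auto
  also have "\<dots> = (\<Sum>\<alpha> | \<alpha> \<in> supp r \<and> wt X \<alpha> = n.
     of_int (coef r \<alpha>) * mon_eval (\<lambda>u. coeff (\<Theta> (mvar u)) (if u \<in> X then 1 else 0)) \<alpha>)"
    by (intro sum.cong refl) (use top(2) in auto)
  finally show ?thesis .
qed

lemma prod_psingle:
  "(\<Prod>x\<in>S. psingle (m x) (c x)) = psingle (\<Sum>x\<in>S. m x) (\<Prod>x\<in>S. c x)"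
  for m :: "_ \<Rightarrow> 'k::comm_monoid_add" and c :: "_ \<Rightarrow> 'a::comm_semiring_1"
  by (induction S rule: infinite_finite_induct) (auto simp: mult_single)

context forms
begin

text \<open>The grading giving weight one to the coefficients of \<open>x\<^sub>v ^ ds i\<close> and of \<open>x\<^sub>i ^ ds i\<close> makes
  the leading part of the parametrization by the generic zero a monomial map, which is injective.\<close>

lemma generic_zero_inj:
  assumes v: "v \<in> V" and r: "r \<in> polys (- {(v, psingle v (ds v))})" and z0: "generic_zero V ds v r = 0"
  shows "r = 0"
proof (rule ccontr)
  assume r0: "r \<noteq> 0"
  define y where "y i = (i, psingle v (ds i))" for i
  define z where "z i = (i, psingle i (ds i))" for i
  define Y where "Y = y ` (V - {v})"
  define Z where "Z = z ` (V - {v})"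
  have single_neq: "psingle i (ds i) \<noteq> psingle v (ds j)" if "i \<in> V - {v}" for i j
  proof
    assume "psingle i (ds i) = psingle v (ds j)"
    then have "coef (psingle i (ds i)) i = coef (psingle v (ds j)) i" by simp
    then show False using that ds_pos[of i] by (auto simp: lookup_single when_def)
  qed
  have YZ: "Y \<inter> Z = {}" using single_neq by (auto simp: Y_def Z_def y_def z_def) metis
  \<comment> \<open>For i other than v, \<open>y i\<close>, the coefficient of x_v ^ ds i, has been
    solved for and is absent from the generic zero; it is free to serve as the coordinate x_i. The
    variables of Z carry the grading.\<close>
  define \<Lambda> :: "(nat, ures) mpoly \<Rightarrow> ures poly" where "\<Lambda> = meval (scale_vars Z) (\<lambda>j. [:mvar (y j):])"
  have hL: "comm_ring_hom \<Lambda>" unfolding \<Lambda>_def by (intro comm_ring_hom_meval comm_ring_hom_scale_vars)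
  then interpret L: comm_ring_hom \<Lambda> .
  interpret sc: comm_ring_hom "scale_vars Z :: ures \<Rightarrow> _" by (rule comm_ring_hom_scale_vars)
  interpret g: comm_ring_hom "generic_zero V ds v" by (rule comm_ring_hom_generic_zero)
  define \<Theta> where "\<Theta> r = \<Lambda> (generic_zero V ds v r)" for r
  have hT: "comm_ring_hom \<Theta>" unfolding \<Theta>_def by (rule comm_ring_hom_comp[OF hL comm_ring_hom_generic_zero])
  have Lc: "\<Lambda> (mconst c) = scale_vars Z c" for c by (simp add: \<Lambda>_def)
  have Lv: "\<Lambda> (mvar j) = [:mvar (y j):]" for j by (simp add: \<Lambda>_def comm_ring_hom_scale_vars)
  define e where "e \<beta> = mon_eval (\<lambda>j. if j = v then 1 else mvar (y j) :: ures) \<beta>" for \<beta>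
  have Ld: "\<Lambda> (dehom v (mmonom \<beta>)) = [:e \<beta>:]" for \<beta>
  proof -
    have "\<Lambda> (dehom v (mmonom \<beta>)) = mon_eval (\<lambda>j. \<Lambda> (dehom v (mvar j))) \<beta>"
      by (simp add: mmonom_eq_mon_eval mon_eval_hom[OF comm_ring_hom_dehom] mon_eval_hom[OF hL])
    also have "\<dots> = mon_eval (\<lambda>j. [:if j = v then 1 else mvar (y j):]) \<beta>"
      by (intro mon_eval_cong) (simp add: dehom_mvar Lv one_pCons)
    also have "\<dots> = [:e \<beta>:]" unfolding e_def
      by (simp add: mon_eval_hom[OF comm_ring_hom_const_poly])
    finally show ?thesis .
  qed
  define X where "X = Y \<union> Z"
  define U where "U = - {(v, psingle v (ds v))}"
  have Ty: "\<Theta> (mvar (y i)) = - (\<Sum>\<beta>\<in>monoms V (ds i) - {psingle v (ds i)}. scale_vars Z (mvar (i, \<beta>)) * [:e \<beta>:])"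
    if "i \<in> V" for i
    using that by (simp add: \<Theta>_def y_def generic_zero_mvar L.hom_uminus L.hom_sum L.hom_mult Lc Ld del: mult_pCons_right)
  have Tn: "\<Theta> (mvar u) = scale_vars Z (mvar u)" if "u \<in> U" "u \<notin> Y" for u
  proof -
    obtain i \<alpha> where u: "u = (i, \<alpha>)" by force
    have "\<not> (i \<in> V \<and> \<alpha> = psingle v (ds i))" using that by (auto simp: U_def Y_def y_def u)
    then show ?thesis by (auto simp: \<Theta>_def u generic_zero_mvar Lc)
  qed
  have inZ: "(i, \<beta>) \<in> Z \<longleftrightarrow> \<beta> = psingle i (ds i)" if "i \<in> V - {v}" for i \<beta>
    using that by (auto simp: Z_def z_def)
  have degT: "degree (\<Theta> (mvar u)) \<le> (if u \<in> X then 1 else 0)" if u: "u \<in> U" for u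
  proof (cases "u \<in> Y")
    case True
    then obtain i where i: "i \<in> V - {v}" "u = y i" by (auto simp: Y_def)
    have "degree (scale_vars Z (mvar (i, \<beta>)) * [:e \<beta>:]) \<le> 1" for \<beta>
      by (rule order_trans[OF degree_mult_le]) (simp add: scale_vars_mvar)
    then show ?thesis using True i by (auto simp: Ty X_def intro!: degree_sum_le finite_monoms[OF finite_V])
  next
    case False
    then show ?thesis using u by (auto simp: Tn X_def scale_vars_mvar)
  qed
  \<comment> \<open>The top coefficient of the image of \<open>y i\<close> is minus
    \<open>z i\<close> times the power \<open>ds i\<close> of \<open>y i\<close>; it stems from the
    term x_i ^ ds i of the i-th form. Every other variable of r has itself as top coefficient. Hence
    the signs \<open>sg\<close> and the exponents \<open>m\<close>.\<close>
  define sg :: "uvar \<Rightarrow> int" where "sg u = (if u \<in> Y then -1 else 1)" for u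
  define m where "m u k = (if u \<in> Y then psingle (z (fst u)) k + psingle u (ds (fst u) * k) else psingle u k)" for u and k :: nat
  define ps where "ps u = coeff (\<Theta> (mvar u)) (if u \<in> X then 1 else 0)" for u
  have ps: "ps u ^ k = psingle (m u k) (sg u ^ k)" if u: "u \<in> U" for u k
  proof (cases "u \<in> Y")
    case True
    then obtain i where i: "i \<in> V - {v}" "u = y i" by (auto simp: Y_def)
    have fu: "fst u = i" by (simp add: i y_def)
    have mem: "psingle i (ds i) \<in> monoms V (ds i) - {psingle v (ds i)}"
      using i single_mem_monoms single_neq by auto
    have top: "coeff (scale_vars Z (mvar (i, \<beta>)) * [:e \<beta>:]) (Suc 0) = (if \<beta> = psingle i (ds i) then mvar (z i) * e \<beta> else 0)" for \<beta>
      using inZ[OF i(1)] by (cases "\<beta> = psingle i (ds i)") (simp_all add: scale_vars_mvar z_def)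
    have "ps u = - (\<Sum>\<beta>\<in>monoms V (ds i) - {psingle v (ds i)}. if \<beta> = psingle i (ds i) then mvar (z i) * e \<beta> else 0)"
      using i True by (simp add: ps_def X_def Ty coeff_sum top del: mult_pCons_right)
    also have "\<dots> = - (mvar (z i) * e (psingle i (ds i)))"
      using mem by (simp add: sum.delta finite_monoms[OF finite_V])
    also have "e (psingle i (ds i)) = mvar u ^ ds i" using i by (simp add: e_def)
    finally have "ps u = - (mvar (z i) * mvar u ^ ds i)" .
    then have "ps u ^ k = (-1) ^ k * (mvar (z i) ^ k * mvar u ^ (ds i * k))"
      by (simp add: power_mult_distrib power_mult power_minus[of "_ * _"])
    also have "\<dots> = mconst ((-1) ^ k) * mmonom (m u k)"
      using True by (simp add: m_def fu mmonom_add mmonom_power mconst_int)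
    also have "\<dots> = psingle (m u k) (sg u ^ k)" using True by (simp add: psingle_eq sg_def)
    finally show ?thesis .
  next
    case False
    then have "ps u = mvar u" using u by (auto simp: ps_def X_def Tn scale_vars_mvar)
    then show ?thesis using False by (simp add: m_def sg_def mmonom_power[symmetric] mmonom_def)
  qed
  define M where "M \<alpha> = (\<Sum>u\<in>supp \<alpha>. m u (coef \<alpha> u))" for \<alpha>
  define s where "s \<alpha> = (\<Prod>u\<in>supp \<alpha>. sg u ^ coef \<alpha> u)" for \<alpha>
  have s0: "s \<alpha> \<noteq> 0" for \<alpha> by (auto simp: s_def sg_def)
  have me: "mon_eval ps \<alpha> = psingle (M \<alpha>) (s \<alpha>)" if "supp \<alpha> \<subseteq> U" for \<alpha>
    unfolding mon_eval_def M_def s_def prod_psingle[symmetric]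
    by (intro prod.cong refl ps) (use that in auto)
  \<comment> \<open>On Y the exponents are multiplied by a positive \<open>ds i\<close> and can be
    recovered there. What they contribute to Z is then known, and the remaining exponents
    follow.\<close>
  have inj: "\<alpha> = \<beta>" if MM: "M \<alpha> = M \<beta>" for \<alpha> \<beta>
  proof -
    define S where "S = supp \<alpha> \<union> supp \<beta>"
    have fS: "finite S" by (simp add: S_def)
    have m0: "m u 0 = 0" for u by (simp add: m_def)
    have "M \<alpha> = (\<Sum>u\<in>S. m u (coef \<alpha> u))" "M \<beta> = (\<Sum>u\<in>S. m u (coef \<beta> u))"
      unfolding M_def by (intro sum.mono_neutral_left; auto simp: S_def in_keys_iff m0)+
    then have eq: "(\<Sum>u\<in>S. coef (m u (coef \<alpha> u)) w) = (\<Sum>u\<in>S. coef (m u (coef \<beta> u)) w)" for w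
      using MM by (simp flip: lookup_sum)
    have on_Y: "coef \<alpha> w = coef \<beta> w" if w: "w \<in> Y" for w
    proof -
      have "coef (m u k) w = (if u = w then ds (fst w) * k else 0)" for u k
      proof -
        have "z (fst u) \<noteq> w" if "u \<in> Y"
        proof -
          have "z (fst u) \<in> Z" using that by (auto simp: Y_def Z_def y_def)
          then show ?thesis using YZ w by auto
        qed
        then show ?thesis using w by (auto simp: m_def lookup_add lookup_single when_def)
      qed
      then have "(\<Sum>u\<in>S. if u = w then ds (fst w) * coef \<alpha> u else 0) = (\<Sum>u\<in>S. if u = w then ds (fst w) * coef \<beta> u else 0)"
        using eq[of w] by simp
      moreover have "ds (fst w) > 0" using w ds_pos[of "fst w"] by (auto simp: Y_def y_def)
      moreover have "w \<notin> S \<Longrightarrow> coef \<alpha> w = 0 \<and> coef \<beta> w = 0" by (auto simp: S_def in_keys_iff)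
      ultimately show ?thesis using fS by (cases "w \<in> S") auto
    qed
    have "coef \<alpha> w = coef \<beta> w" for w
    proof (cases "w \<in> Y \<or> w \<notin> S")
      case True
      then show ?thesis using on_Y[of w] by (auto simp: S_def in_keys_iff)
    next
      case False
      have "(\<Sum>u\<in>S - {w}. coef (m u (coef \<alpha> u)) w) = (\<Sum>u\<in>S - {w}. coef (m u (coef \<beta> u)) w)"
      proof (intro sum.cong refl)
        fix u assume u: "u \<in> S - {w}"
        show "coef (m u (coef \<alpha> u)) w = coef (m u (coef \<beta> u)) w"
          using on_Y[of u] u by (cases "u \<in> Y") (auto simp: m_def lookup_single when_def)
      qed
      then have "coef (m w (coef \<alpha> w)) w = coef (m w (coef \<beta> w)) w"
        using eq[of w] False fS by (simp add: sum.remove[of S w])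
      then show ?thesis using False by (simp add: m_def)
    qed
    then show ?thesis by (rule poly_mapping_eqI)
  qed
  define n where "n = Max (wt X ` supp r)"
  have ne: "supp r \<noteq> {}" using r0 by simp
  have n: "wt X \<alpha> \<le> n" if "\<alpha> \<in> supp r" for \<alpha> using that by (simp add: n_def)
  have "n \<in> wt X ` supp r" unfolding n_def using ne by (intro Max_in) auto
  then obtain a where a: "a \<in> supp r" "wt X a = n" by auto
  have supU: "supp \<alpha> \<subseteq> U" if "\<alpha> \<in> supp r" for \<alpha> using r that by (auto simp: polys_iff U_def)
  have "coeff (\<Theta> r) n = (\<Sum>\<alpha> | \<alpha> \<in> supp r \<and> wt X \<alpha> = n. of_int (coef r \<alpha>) * mon_eval ps \<alpha>)"
    unfolding ps_def by (rule coeff_hom_top[OF hT r[folded U_def] degT n])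
  also have "\<dots> = (\<Sum>\<alpha> | \<alpha> \<in> supp r \<and> wt X \<alpha> = n. psingle (M \<alpha>) (coef r \<alpha> * s \<alpha>))"
    by (intro sum.cong refl) (auto simp: me supU mconst_int[symmetric] mconst_def mult_single)
  finally have "coef (coeff (\<Theta> r) n) (M a) = coef r a * s a"
    using coef_sum_inj[of "{\<alpha>. \<alpha> \<in> supp r \<and> wt X \<alpha> = n}" M a "\<lambda>\<alpha>. coef r \<alpha> * s \<alpha>"] a inj by (auto simp: inj_on_def)
  moreover have "\<Theta> r = 0" by (simp add: \<Theta>_def z0)
  ultimately show False using s0[of a] a by (simp add: in_keys_iff)
qed

text \<open>By \<open>generic_zero_inj\<close> the ideal contains no nonzero element free of the
  variable u. Let h have least degree in u. Pseudo-division shows that h divides every element up to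
  a power of its leading coefficient \<open>lc\<close>, and R does not divide \<open>lc\<close>,
  which is free of u. In \<open>lc ^ k * R = Q * h\<close> the prime R cannot divide Q, for then h
  would be free of u; so R divides h, hence \<open>lc ^ k * g\<close> for some k, hence g.\<close>

lemma principal:
  assumes v: "v \<in> V" and R: "prime_elem R" "generic_zero V ds v R = 0" and g: "generic_zero V ds v g = 0"
  shows "R dvd g"
proof -
  define u where "u = (v, psingle v (ds v))"
  define A where "A = (polys (- {u}) :: ures set)"
  interpret A: factor_closed A unfolding A_def by (rule factor_closed_polys)
  interpret P: factor_closed "polys_over A" by (rule A.factor_closed_polys_over)
  interpret z: comm_ring_hom "generic_zero V ds v" by (rule comm_ring_hom_generic_zero)
  interpret e: comm_ring_hom "as_poly u :: ures \<Rightarrow> _" by (rule comm_ring_hom_as_poly)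
  have asA: "as_poly u p \<in> polys_over A" for p :: ures
    unfolding A_def by (rule as_poly_polys_over) (auto simp: polys_iff)
  have A0: "p = 0" if "p \<in> A" "generic_zero V ds v p = 0" for p
    using generic_zero_inj[OF v _ that(2)] that(1) by (simp add: A_def u_def)
  define J where "J = {q \<in> polys_over A. generic_zero V ds v (poly q (mvar u)) = 0}"
  have asJ: "as_poly u p \<in> J" if "generic_zero V ds v p = 0" for p
    using that asA by (simp add: J_def)
  define d where "d = (LEAST k. \<exists>h\<in>J. h \<noteq> 0 \<and> degree h = k)"
  have R0: "R \<noteq> 0" using R(1) by auto
  have asR: "as_poly u R \<noteq> 0" using R0 poly_as_poly[of u R] by (metis poly_0)
  have "\<exists>k. \<exists>h\<in>J. h \<noteq> 0 \<and> degree h = k" using asJ[OF R(2)] asR by blast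
  from LeastI_ex[OF this] obtain h where h: "h \<in> J" "h \<noteq> 0" "degree h = d" unfolding d_def by blast
  have least: "d \<le> degree q" if "q \<in> J" "q \<noteq> 0" for q
    unfolding d_def by (rule Least_le) (use that in blast)
  have hA: "h \<in> polys_over A" using h by (simp add: J_def)
  define lc where "lc = lead_coeff h"
  have lc: "lc \<in> A" "lc \<noteq> 0" using hA h(2) by (auto simp: lc_def A.polys_over_coeff)
  have key: "\<exists>k Q. lc ^ k * p = Q * poly h (mvar u)" if p: "generic_zero V ds v p = 0" for p
  proof -
    obtain k q r where *: "q \<in> polys_over A" "r \<in> polys_over A"
      "[:lc ^ k:] * as_poly u p = q * h + r" "r = 0 \<or> degree r < degree h"
      using A.pseudo_division[OF hA h(2) asA[of p]] unfolding lc_def by blast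
    have ev: "lc ^ k * p = poly q (mvar u) * poly h (mvar u) + poly r (mvar u)"
      using arg_cong[OF *(3), of "\<lambda>q. poly q (mvar u)"] by simp
    then have "poly r (mvar u) = lc ^ k * p - poly q (mvar u) * poly h (mvar u)" by simp
    then have "generic_zero V ds v (poly r (mvar u)) = 0"
      using p h(1) by (simp add: z.hom_minus z.hom_mult J_def)
    then have "r \<in> J" using * by (simp add: J_def)
    then have "r = 0" using least[of r] *(4) h(3) by linarith
    then show ?thesis using ev by auto
  qed
  have RA: "R \<notin> A" using A0 R(2) R0 by blast
  have R_lc: "\<not> R dvd lc ^ k" for k
  proof
    assume "R dvd lc ^ k"
    then have "R dvd lc" using prime_elem_dvd_power R(1) by blast
    then have "generic_zero V ds v lc = 0" using R(2) by (auto simp: z.hom_mult)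
    then show False using A0 lc by blast
  qed
  have "R dvd poly h (mvar u)"
  proof -
    obtain k Q where kQ: "lc ^ k * R = Q * poly h (mvar u)" using key[OF R(2)] by blast
    then have "R dvd Q * poly h (mvar u)" by (metis dvd_triv_right)
    then consider "R dvd Q" | "R dvd poly h (mvar u)" using R(1) by (auto simp: prime_elem_dvd_mult_iff)
    then show ?thesis
    proof cases
      case 1
      then obtain Q' where "Q = R * Q'" by blast
      then have "R * lc ^ k = R * (Q' * poly h (mvar u))" using kQ by (simp add: mult_ac)
      then have "lc ^ k = Q' * poly h (mvar u)" using R0 by simp
      then have "as_poly u (lc ^ k) = as_poly u Q' * h"
        using as_poly_poly[OF hA[unfolded A_def], of u] by (simp add: e.hom_mult)
      moreover have "as_poly u (lc ^ k) = [:lc ^ k:]"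
        using A.power_closed[OF lc(1), of k] by (intro as_poly_const[of _ "- {u}"]) (auto simp: A_def)
      ultimately have eq: "[:lc ^ k:] = as_poly u Q' * h" by simp
      then have "as_poly u Q' \<noteq> 0" using lc by auto
      then have "degree h = 0" using arg_cong[OF eq, of degree] h(2) by (simp add: degree_mult_eq)
      then obtain a where a: "h = [:a:]" by (rule degree_eq_zeroE)
      then have "a \<in> A" "generic_zero V ds v a = 0" using h(1) A.polys_over_const_iff by (auto simp: J_def)
      then show ?thesis using A0 a h(2) by auto
    qed
  qed
  then have "R dvd lc ^ k * g" if "lc ^ k * g = Q * poly h (mvar u)" for k Q using that by simp
  then have "R dvd lc ^ k * g" if "\<exists>Q. lc ^ k * g = Q * poly h (mvar u)" for k using that by blast
  then obtain k where "R dvd lc ^ k * g" using key[OF g] by blast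
  then show ?thesis using R(1) R_lc by (auto simp: prime_elem_dvd_mult_iff)
qed

end

section \<open>The resultant\<close>

lemma degree_det_le:
  fixes A :: "'a::comm_ring_1 poly mat"
  assumes A: "A \<in> carrier_mat n n" and d: "\<And>i j. i < n \<Longrightarrow> j < n \<Longrightarrow> degree (A $$ (i, j)) \<le> \<rho> i"
  shows "degree (det A) \<le> (\<Sum>i<n. \<rho> i)"
  unfolding det_def'[OF A]
proof (rule degree_sum_le)
  show "finite {p. p permutes {0..<n}}" by (simp add: finite_permutations)
  fix p assume "p \<in> {p. p permutes {0..<n}}"
  then have p: "p i < n" if "i < n" for i using that by (auto dest: permutes_in_image[of p _ i])
  have "degree (\<Prod>i = 0..<n. A $$ (i, p i)) \<le> (\<Sum>i = 0..<n. \<rho> i)"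
    using coeff_prod_bound[of "{0..<n}" "\<lambda>i. A $$ (i, p i)" \<rho>] d p by auto
  moreover have "degree (signof p * q) \<le> degree q" for q :: "'a poly"
    by (cases "sign p = 1") (auto simp: sign_def)
  ultimately show "degree (signof p * (\<Prod>i = 0..<n. A $$ (i, p i))) \<le> (\<Sum>i<n. \<rho> i)"
    by (metis atLeast0LessThan order_trans)
qed

definition at_powers :: "(nat \<Rightarrow> nat) \<Rightarrow> ures \<Rightarrow> int" where
  "at_powers ds = meval of_int (\<lambda>(i, \<alpha>). if \<alpha> = psingle i (ds i) then 1 else 0)"

lemma comm_ring_hom_at_powers: "comm_ring_hom (at_powers ds)"
  unfolding at_powers_def by (rule comm_ring_hom_int_meval)

lemma at_powers_mvar: "at_powers ds (mvar (i, \<alpha>)) = (if \<alpha> = psingle i (ds i) then 1 else 0)"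
  unfolding at_powers_def by (subst meval_of_int_mvar) simp

context forms
begin

lemma gform_polys: "gforms V ds i \<in> polys V"
  by (rule polys_gform)

text \<open>Macaulay's determinant in degree \<open>1 + (\<Sum>j\<in>V. ds j - 1)\<close>; as few rows as possible
  are multiples of the \<open>i\<close>-th form.\<close>

lemma macaulay:
  assumes i: "i \<in> V"
  shows "\<exists>D. inertia V (gforms V ds) D \<and> at_powers ds D = 1 \<and> D \<in> polys (coefvars V ds) \<and>
     degX (xvars i) D \<le> (\<Prod>j\<in>V - {i}. ds j)"
proof -
  \<comment> \<open>The least degree in which every monomial in V is divisible by some x_j ^ ds
    j.\<close>
  define N where "N = (\<Sum>j\<in>V. ds j - 1) + 1"
  \<comment> \<open>Such a j is chosen different from i whenever possible, which keeps the degree in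
    the i-th form low.\<close>
  define c where "c \<alpha> = (if \<exists>j\<in>V - {i}. ds j \<le> coef \<alpha> j then SOME j. j \<in> V - {i} \<and> ds j \<le> coef \<alpha> j else i)" for \<alpha>
  have c1: "c \<alpha> \<in> V - {i} \<and> ds (c \<alpha>) \<le> coef \<alpha> (c \<alpha>)" if "\<exists>j\<in>V - {i}. ds j \<le> coef \<alpha> j" for \<alpha>
    using someI_ex[of "\<lambda>j. j \<in> V - {i} \<and> ds j \<le> coef \<alpha> j"] that by (auto simp: c_def)
  have mdegV: "mdeg \<alpha> = (\<Sum>w\<in>V. coef \<alpha> w)" if "\<alpha> \<in> monoms V k" for \<alpha> k
    using that by (intro mdeg_superset finite_V) (auto simp: monoms_def)
  have c: "c \<alpha> \<in> V" "ds (c \<alpha>) \<le> coef \<alpha> (c \<alpha>)" if a: "\<alpha> \<in> monoms V N" for \<alpha>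
  proof -
    have "c \<alpha> \<in> V \<and> ds (c \<alpha>) \<le> coef \<alpha> (c \<alpha>)"
    proof (cases "\<exists>j\<in>V - {i}. ds j \<le> coef \<alpha> j")
      case True then show ?thesis using c1 by blast
    next
      case False
      have "(\<Sum>w\<in>V - {i}. coef \<alpha> w) \<le> (\<Sum>w\<in>V - {i}. ds w - 1)"
        using False by (intro sum_mono) (force simp: not_le)
      moreover have "(\<Sum>w\<in>V. coef \<alpha> w) = N" using mdegV[OF a] a by (simp add: monoms_def)
      ultimately have "ds i \<le> coef \<alpha> i"
        using i finite_V ds_pos[OF i] by (simp add: N_def sum.remove[of V i])
      then show ?thesis using False i by (simp add: c_def)
    qed
    then show "c \<alpha> \<in> V" "ds (c \<alpha>) \<le> coef \<alpha> (c \<alpha>)" by auto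
  qed
  define S where "S = monoms V N"
  define n where "n = card S"
  have fS: "finite S" unfolding S_def by (rule finite_monoms[OF finite_V])
  obtain e where e: "bij_betw e {..<n} S"
    using ex_bij_betw_nat_finite[OF fS] unfolding n_def lessThan_atLeast0 by blast
  have eS: "e a \<in> S" if "a < n" for a using e that by (auto simp: bij_betw_def)
  define row where "row \<alpha> = mmonom (\<alpha> - psingle (c \<alpha>) (ds (c \<alpha>))) * gforms V ds (c \<alpha>)" for \<alpha>
  have split: "\<alpha> = (\<alpha> - psingle (c \<alpha>) (ds (c \<alpha>))) + psingle (c \<alpha>) (ds (c \<alpha>))" if "\<alpha> \<in> S" for \<alpha>
    using c(2)[of \<alpha>] that by (intro poly_mapping_eqI) (auto simp: S_def lookup_add lookup_minus lookup_single when_def)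
  have row_hom: "mhomogeneous N (row \<alpha>)" if a: "\<alpha> \<in> S" for \<alpha>
  proof -
    have "mdeg (\<alpha> - psingle (c \<alpha>) (ds (c \<alpha>))) + ds (c \<alpha>) = N"
      using arg_cong[OF split[OF a], of mdeg] a by (simp add: mdeg_add S_def monoms_def)
    then show ?thesis
      using mhomogeneous_mult[OF mhomogeneous_mmonom mhomogeneous_gform] by (metis row_def)
  qed
  have row_polys: "row \<alpha> \<in> polys V" if a: "\<alpha> \<in> S" for \<alpha>
    unfolding row_def
    by (intro polys_mult gform_polys polys_mmonom)
       (use a in \<open>auto simp: S_def monoms_def in_keys_iff lookup_minus\<close>)
  have row_ideal: "row \<alpha> \<in> form_ideal V (gforms V ds)" if a: "\<alpha> \<in> S" for \<alpha>
    unfolding row_def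
    by (intro form_ideal_mult form_ideal_gen[OF finite_V]) (use a c in \<open>auto simp: S_def\<close>)
  have row_coef: "coef (row \<alpha>) \<gamma> = (\<Sum>\<beta>\<in>monoms V (ds (c \<alpha>)). if \<alpha> - psingle (c \<alpha>) (ds (c \<alpha>)) + \<beta> = \<gamma> then mvar (c \<alpha>, \<beta>) else 0)" for \<alpha> \<gamma>
    unfolding row_def gform_def sum_distrib_left lookup_sum
  proof (intro sum.cong refl)
    fix \<beta>
    have "mmonom (\<alpha> - psingle (c \<alpha>) (ds (c \<alpha>))) * (mconst (mvar (c \<alpha>, \<beta>)) * mmonom \<beta>) =
      mconst (mvar (c \<alpha>, \<beta>)) * (mmonom (\<alpha> - psingle (c \<alpha>) (ds (c \<alpha>)) + \<beta>) :: (nat, ures) mpoly)"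
      by (simp add: mmonom_add mult_ac)
    note eq = this
    show "coef (mmonom (\<alpha> - psingle (c \<alpha>) (ds (c \<alpha>))) * (mconst (mvar (c \<alpha>, \<beta>)) * mmonom \<beta>) :: (nat, ures) mpoly) \<gamma> =
        (if \<alpha> - psingle (c \<alpha>) (ds (c \<alpha>)) + \<beta> = \<gamma> then mvar (c \<alpha>, \<beta>) else 0)"
      unfolding eq by (simp add: coef_mconst_mult coef_mmonom)
  qed
  define A where "A = mat n n (\<lambda>(a, b). coef (row (e a)) (e b))"
  have A: "A \<in> carrier_mat n n" by (simp add: A_def)
  define D where "D = det A"
  have "inertia V (gforms V ds) D"
    unfolding inertia_def
  proof (intro exI ballI)
    fix \<beta> assume "\<beta> \<in> monoms V N"
    then obtain b where b: "b < n" "\<beta> = e b" using e by (auto simp: bij_betw_def S_def)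
    \<comment> \<open>Cramer's rule: a row of the adjugate combines the rows of A, which are
      multiples of the forms, to D times a single monomial.\<close>
    define B where "B = adj_mat A"
    have B: "B \<in> carrier_mat n n" "B * A = D \<cdot>\<^sub>m 1\<^sub>m n"
      using adj_mat[OF A] by (auto simp: B_def D_def)
    have BA: "(\<Sum>a<n. B $$ (b, a) * coef (row (e a)) (e k)) = (if k = b then D else 0)" if k: "k < n" for k
    proof -
      have "(B * A) $$ (b, k) = (\<Sum>a<n. B $$ (b, a) * coef (row (e a)) (e k))"
        using A B(1) b k by (simp add: scalar_prod_def A_def atLeast0LessThan)
      then show ?thesis using B(2) b k by (auto split: if_splits)
    qed
    have ex: "row (e a) = (\<Sum>k<n. mconst (coef (row (e a)) (e k)) * mmonom (e k))" if "a < n" for a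
    proof -
      have "row (e a) = (\<Sum>\<alpha>\<in>S. mconst (coef (row (e a)) \<alpha>) * mmonom \<alpha>)"
        unfolding S_def by (rule form_expand[OF finite_V row_hom row_polys]) (use eS that in auto)
      also have "\<dots> = (\<Sum>k<n. mconst (coef (row (e a)) (e k)) * mmonom (e k))"
        by (rule sum.reindex_bij_betw[OF e, symmetric])
      finally show ?thesis .
    qed
    have "(\<Sum>a<n. mconst (B $$ (b, a)) * row (e a)) =
        (\<Sum>a<n. \<Sum>k<n. mconst (B $$ (b, a) * coef (row (e a)) (e k)) * mmonom (e k))"
    proof (rule sum.cong[OF refl])
      fix a assume "a \<in> {..<n}"
      then have a: "a < n" by simp
      show "mconst (B $$ (b, a)) * row (e a) = (\<Sum>k<n. mconst (B $$ (b, a) * coef (row (e a)) (e k)) * mmonom (e k))"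
        by (subst ex[OF a]) (simp add: sum_distrib_left mconst_mult mult.assoc)
    qed
    also have "\<dots> = (\<Sum>k<n. \<Sum>a<n. mconst (B $$ (b, a) * coef (row (e a)) (e k)) * mmonom (e k))"
      by (rule sum.swap)
    also have "\<dots> = (\<Sum>k<n. mconst (if k = b then D else 0) * mmonom (e k))"
    proof (rule sum.cong[OF refl])
      interpret mc: comm_ring_hom "mconst :: ures \<Rightarrow> (nat, ures) mpoly" by (rule comm_ring_hom_mconst)
      fix k assume "k \<in> {..<n}"
      then show "(\<Sum>a<n. mconst (B $$ (b, a) * coef (row (e a)) (e k)) * mmonom (e k)) = mconst (if k = b then D else 0) * mmonom (e k)"
        using BA[of k] by (simp add: sum_distrib_right[symmetric] mc.hom_sum[symmetric])
    qed
    also have "\<dots> = (\<Sum>k<n. if k = b then mmonom (e k) * mconst D else 0)"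
      by (intro sum.cong) (auto simp: mult.commute)
    also have "\<dots> = mmonom \<beta> * mconst D"
      using b by simp
    finally have eq: "mmonom \<beta> * mconst D = (\<Sum>a<n. mconst (B $$ (b, a)) * row (e a))" by simp
    show "mmonom \<beta> * mconst D \<in> form_ideal V (gforms V ds)"
      unfolding eq by (intro form_ideal_sum form_ideal_mult row_ideal eS) simp
  qed
  moreover have "at_powers ds D = 1"
  proof -
    interpret h: comm_ring_hom "at_powers ds" by (rule comm_ring_hom_at_powers)
    \<comment> \<open>At the powers of the variables the row of \<open>\<alpha>\<close> is the
      monomial \<open>\<alpha>\<close> itself, so the matrix becomes the identity.\<close>
    have ent: "at_powers ds (coef (row (e a)) (e b)) = (if a = b then 1 else 0)" if ab: "a < n" "b < n" for a b
    proof -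
      define \<gamma> where "\<gamma> = e a - psingle (c (e a)) (ds (c (e a)))"
      have "at_powers ds (coef (row (e a)) (e b)) =
        (\<Sum>\<beta>\<in>monoms V (ds (c (e a))). if \<beta> = psingle (c (e a)) (ds (c (e a))) then if \<gamma> + \<beta> = e b then 1 else 0 else 0)"
        unfolding row_coef h.hom_sum \<gamma>_def[symmetric]
        by (intro sum.cong refl) (simp add: at_powers_mvar)
      also have "\<dots> = (if \<gamma> + psingle (c (e a)) (ds (c (e a))) = e b then 1 else 0)"
        using single_mem_monoms[OF c(1)[OF eS[OF ab(1), unfolded S_def]]] by (simp add: sum.delta finite_monoms[OF finite_V])
      also have "\<dots> = (if e a = e b then 1 else 0)"
        using split[OF eS[OF ab(1)]] by (simp add: \<gamma>_def)
      also have "\<dots> = (if a = b then 1 else 0)"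
        using e ab by (auto simp: bij_betw_def inj_on_def)
      finally show ?thesis .
    qed
    have "map_mat (at_powers ds) A = 1\<^sub>m n"
      by (rule eq_matI) (auto simp: A_def ent)
    then show ?thesis unfolding D_def by (metis h.hom_det det_one)
  qed
  moreover have degE: "degX X (coef (row (e a)) (e b)) \<le> (if \<exists>\<beta>\<in>monoms V (ds (c (e a))). (c (e a), \<beta>) \<in> X then 1 else 0)" for X a b
    unfolding row_coef
  proof (rule degX_sum_le)
    fix \<beta> assume "\<beta> \<in> monoms V (ds (c (e a)))"
    then show "degX X (if e a - psingle (c (e a)) (ds (c (e a))) + \<beta> = e b then mvar (c (e a), \<beta>) else 0) \<le>
      (if \<exists>\<beta>\<in>monoms V (ds (c (e a))). (c (e a), \<beta>) \<in> X then 1 else 0)"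
      using degX_mvar_le[of X "(c (e a), \<beta>)"] by (auto split: if_splits)
  qed
  have degD: "degX X D \<le> (\<Sum>a<n. if \<exists>\<beta>\<in>monoms V (ds (c (e a))). (c (e a), \<beta>) \<in> X then 1 else 0)" for X
  proof -
    interpret s: comm_ring_hom "scale_vars X :: ures \<Rightarrow> _" by (rule comm_ring_hom_scale_vars)
    have "degX X D = degree (det (map_mat (scale_vars X) A))"
      unfolding degX_def D_def by (simp add: s.hom_det)
    also have "\<dots> \<le> (\<Sum>a<n. if \<exists>\<beta>\<in>monoms V (ds (c (e a))). (c (e a), \<beta>) \<in> X then 1 else 0)"
      by (rule degree_det_le) (use A degE[unfolded degX_def] in \<open>auto simp: A_def\<close>)
    finally show ?thesis .
  qed
  have "D \<in> polys (coefvars V ds)"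
  proof -
    have "degX (- coefvars V ds) D \<le> (\<Sum>a<n. 0)"
    proof (rule order_trans[OF degD], rule sum_mono)
      fix a assume "a \<in> {..<n}"
      then have "c (e a) \<in> V" using c(1)[of "e a"] eS by (auto simp: S_def)
      then show "(if \<exists>\<beta>\<in>monoms V (ds (c (e a))). (c (e a), \<beta>) \<in> - coefvars V ds then 1 else 0) \<le> (0::nat)"
        by (auto simp: coefvars_def)
    qed
    then show ?thesis by (simp add: degX_eq_0_iff)
  qed
  moreover have "degX (xvars i) D \<le> (\<Prod>j\<in>V - {i}. ds j)"
  proof -
    have "degX (xvars i) D \<le> (\<Sum>a<n. if c (e a) = i then 1 else 0)"
      by (rule order_trans[OF degD], rule sum_mono) (auto simp: xvars_def)
    also have "\<dots> = (\<Sum>\<alpha>\<in>S. if c \<alpha> = i then 1 else 0)"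
      using sum.reindex_bij_betw[OF e, of "\<lambda>\<alpha>. if c \<alpha> = i then 1 else 0"] by simp
    also have "\<dots> = card {\<alpha> \<in> S. c \<alpha> = i}"
      using fS by (simp add: sum.If_cases Int_def)
    \<comment> \<open>If \<open>c \<alpha> = i\<close>, the exponent of every other x_j is below
      \<open>ds j\<close>, and the exponent of x_i is fixed by the total degree.\<close>
    also have "\<dots> \<le> card (PiE (V - {i}) (\<lambda>j. {..<ds j}))"
    proof (rule card_inj_on_le[where f = "\<lambda>\<alpha>. restrict (coef \<alpha>) (V - {i})"])
      show "inj_on (\<lambda>\<alpha>. restrict (coef \<alpha>) (V - {i})) {\<alpha> \<in> S. c \<alpha> = i}"
      proof (rule inj_onI)
        fix \<alpha> \<beta> assume ab: "\<alpha> \<in> {\<alpha> \<in> S. c \<alpha> = i}" "\<beta> \<in> {\<alpha> \<in> S. c \<alpha> = i}"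
          "restrict (coef \<alpha>) (V - {i}) = restrict (coef \<beta>) (V - {i})"
        have off: "coef \<alpha> j = coef \<beta> j" if "j \<in> V - {i}" for j
          using fun_cong[OF ab(3), of j] that by simp
        have "(\<Sum>w\<in>V. coef \<alpha> w) = (\<Sum>w\<in>V. coef \<beta> w)"
          using ab mdegV[of \<alpha> N] mdegV[of \<beta> N] by (auto simp: S_def monoms_def)
        moreover have "(\<Sum>w\<in>V - {i}. coef \<alpha> w) = (\<Sum>w\<in>V - {i}. coef \<beta> w)"
          using off by (intro sum.cong) auto
        ultimately have "coef \<alpha> i = coef \<beta> i" using i finite_V by (simp add: sum.remove[of V i])
        then have "coef \<alpha> j = coef \<beta> j" for j
        proof (cases "j \<in> V")
          case False
          then have "j \<notin> supp \<alpha>" "j \<notin> supp \<beta>" using ab by (auto simp: S_def monoms_def)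
          then show ?thesis by (simp add: in_keys_iff)
        qed (use off in \<open>cases "j = i"; auto\<close>)
        then show "\<alpha> = \<beta>" by (rule poly_mapping_eqI)
      qed
      show "(\<lambda>\<alpha>. restrict (coef \<alpha>) (V - {i})) ` {\<alpha> \<in> S. c \<alpha> = i} \<subseteq> (\<Pi>\<^sub>E j\<in>V - {i}. {..<ds j})"
      proof clarify
        fix \<alpha> assume "\<alpha> \<in> S" "i = c \<alpha>"
        then have "\<not> (\<exists>j\<in>V - {i}. ds j \<le> coef \<alpha> j)" using c1[of \<alpha>] by auto
        then show "restrict (coef \<alpha>) (V - {c \<alpha>}) \<in> (\<Pi>\<^sub>E j\<in>V - {c \<alpha>}. {..<ds j})"
          using \<open>i = c \<alpha>\<close> by (auto simp: not_le)
      qed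
    qed (use finite_V in \<open>auto intro: finite_PiE\<close>)
    also have "\<dots> = (\<Prod>j\<in>V - {i}. ds j)" using finite_V by (simp add: card_PiE)
    finally show ?thesis .
  qed
  ultimately show ?thesis by blast
qed

end

section \<open>Existence and uniqueness of the universal resultant\<close>

definition is_resultant :: "nat set \<Rightarrow> (nat \<Rightarrow> nat) \<Rightarrow> ures \<Rightarrow> bool" where
  "is_resultant V ds R \<longleftrightarrow> R \<in> polys (coefvars V ds) \<and>
     (\<forall>r. inertia V (gforms V ds) r \<longleftrightarrow> R dvd r) \<and> at_powers ds R = 1"

definition uresultant :: "nat set \<Rightarrow> (nat \<Rightarrow> nat) \<Rightarrow> ures" where
  "uresultant V ds = (THE R. is_resultant V ds R)"

lemma degX_dvd_le:
  fixes p q :: "('i::linorder, 'a::idom) mpoly"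
  assumes "p dvd q" "q \<noteq> 0"
  shows "degX X p \<le> degX X q"
proof -
  obtain r where "q = p * r" using assms by blast
  then show ?thesis using degX_mult[of p r X] assms(2) by auto
qed

lemma at_powers_unit: "q dvd (1 :: ures) \<Longrightarrow> at_powers ds q = 1 \<Longrightarrow> q = 1"
proof -
  interpret h: comm_ring_hom "at_powers ds" by (rule comm_ring_hom_at_powers)
  assume "q dvd 1" "at_powers ds q = 1"
  then show "q = 1" by (elim unit_is_const) (auto simp: mconst_int h.hom_uminus h.hom_of_int)
qed

context forms
begin

text \<open>A Macaulay determinant is a nonzero inertia form; since the ideal is prime, it contains
  a prime factor of that determinant, and by \<open>principal\<close> this factor is a
  generator.\<close>

lemma resultant_exists: "\<exists>R. is_resultant V ds R \<and> prime_elem R"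
proof -
  obtain v where v: "v \<in> V" using V_nonempty by blast
  interpret z: comm_ring_hom "generic_zero V ds v" by (rule comm_ring_hom_generic_zero)
  interpret h: comm_ring_hom "at_powers ds" by (rule comm_ring_hom_at_powers)
  obtain D where D: "inertia V (gforms V ds) D" "at_powers ds D = 1" "D \<in> polys (coefvars V ds)"
    using macaulay[OF v] by blast
  have D0: "D \<noteq> 0" using D(2) by auto
  have unit: "\<not> generic_zero V ds v x = 0" if x: "x dvd 1" for x
  proof
    assume 0: "generic_zero V ds v x = 0"
    have "generic_zero V ds v x dvd 1" using z.hom_dvd[OF x] by simp
    then show False using 0 by simp
  qed
  have "\<exists>p. prime_elem p \<and> generic_zero V ds v p = 0 \<and> p dvd D"
    by (rule exists_prime_factor_in) (use D0 D(1) inertia_iff[OF v] unit in \<open>auto simp: z.hom_mult\<close>)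
  then obtain p where p: "prime_elem p" "generic_zero V ds v p = 0" "p dvd D" by blast
  \<comment> \<open>D has value 1 at the powers, so its factor p has value 1 or -1 there;
    \<open>s\<close> corrects the sign.\<close>
  have "at_powers ds p dvd 1" using h.hom_dvd[OF p(3)] D(2) by simp
  then have sq: "at_powers ds p * at_powers ds p = 1" by (auto simp: zmult_eq_1_iff abs_if split: if_splits)
  define s where "s = (of_int (at_powers ds p) :: ures)"
  have ss: "s * s = 1" unfolding s_def using sq by (metis of_int_1 of_int_mult)
  define R where "R = s * p"
  have assoc: "R dvd r \<longleftrightarrow> p dvd r" for r
  proof
    show "R dvd r \<Longrightarrow> p dvd r" unfolding R_def by (metis dvd_mult_right)
    assume "p dvd r"
    moreover have "R * s = (s * s) * p" unfolding R_def by (simp only: mult_ac)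
    then have "p = R * s" by (simp only: ss mult_1)
    then have "R dvd p" by (rule dvdI)
    ultimately show "R dvd r" by (rule dvd_trans[rotated])
  qed
  have R0: "R \<noteq> 0" unfolding R_def using p(1) ss by auto
  have "prime_elem R"
    by (rule prime_elemI) (use R0 p(1) prime_elem_not_unit[OF p(1)] in \<open>auto simp: assoc prime_elem_dvd_mult_iff\<close>)
  moreover have "inertia V (gforms V ds) r \<longleftrightarrow> R dvd r" for r
    using principal[OF v p(1,2), of r] p(2) by (auto simp: inertia_iff[OF v] assoc z.hom_mult)
  moreover have "at_powers ds R = 1"
    using sq by (simp add: R_def s_def h.hom_mult h.hom_of_int)
  moreover have "R \<in> polys (coefvars V ds)"
    using degX_dvd_le[of R D "- coefvars V ds"] p(3) assoc D0 D(3) degX_eq_0_iff[of "- coefvars V ds" D]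
    by (simp add: degX_eq_0_iff[symmetric]) (metis (no_types, lifting) degX_eq_0_iff double_complement le_zero_eq)
  ultimately show ?thesis unfolding is_resultant_def by blast
qed

lemma is_resultant_unique: "is_resultant V ds R \<Longrightarrow> is_resultant V ds R' \<Longrightarrow> R = R'"
proof -
  interpret h: comm_ring_hom "at_powers ds" by (rule comm_ring_hom_at_powers)
  assume RR: "is_resultant V ds R" "is_resultant V ds R'"
  then have d: "R dvd R'" "R' dvd R"
    using dvd_refl[of R] dvd_refl[of R'] unfolding is_resultant_def by blast+
  then obtain q q' where q: "R' = R * q" "R = R' * q'" by blast
  have R0: "R \<noteq> 0" using RR(1) by (auto simp: is_resultant_def)
  have "R * (q * q') = R' * q'" by (simp only: q(1) mult.assoc)
  also have "\<dots> = R * 1" by (simp only: q(2)[symmetric] mult_1_right)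
  finally have "R * 1 = R * (q * q')" by (rule sym)
  then have "1 = q * q'" using R0 unfolding mult_cancel_left by blast
  then have "q dvd 1" by (rule dvdI)
  moreover have "at_powers ds R = 1" "at_powers ds R' = 1" using RR unfolding is_resultant_def by blast+
  then have "at_powers ds q = 1" using arg_cong[OF q(1), of "at_powers ds"] by (simp add: h.hom_mult)
  ultimately have "q = 1" by (rule at_powers_unit)
  then show ?thesis using q(1) by simp
qed

lemma is_resultant_uresultant: "is_resultant V ds (uresultant V ds)"
  unfolding uresultant_def
proof (rule theI')
  show "\<exists>!R. is_resultant V ds R"
    using resultant_exists is_resultant_unique by (blast intro: ex_ex1I)
qed

lemma uresultant_polys: "uresultant V ds \<in> polys (coefvars V ds)"
  and inertia_iff_dvd: "inertia V (gforms V ds) r \<longleftrightarrow> uresultant V ds dvd r"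
  and at_powers_uresultant: "at_powers ds (uresultant V ds) = 1"
  using is_resultant_uresultant unfolding is_resultant_def by auto

lemma prime_elem_uresultant: "prime_elem (uresultant V ds)"
  using resultant_exists is_resultant_unique[OF is_resultant_uresultant] by blast

lemma uresultant_nonzero: "uresultant V ds \<noteq> 0"
  using prime_elem_uresultant by auto

lemma degX_uresultant_le: "i \<in> V \<Longrightarrow> degX (xvars i) (uresultant V ds) \<le> (\<Prod>j\<in>V - {i}. ds j)"
proof -
  interpret h: comm_ring_hom "at_powers ds" by (rule comm_ring_hom_at_powers)
  assume "i \<in> V"
  from macaulay[OF this] obtain D where
    D: "inertia V (gforms V ds) D" "at_powers ds D = 1" "degX (xvars i) D \<le> (\<Prod>j\<in>V - {i}. ds j)" by blast
  have "D \<noteq> 0" using D(2) by auto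
  then show ?thesis using degX_dvd_le[of "uresultant V ds" D "xvars i"] D inertia_iff_dvd by auto
qed

text \<open>Otherwise the resultant would be free of the coefficient of x_i ^ ds i in the i-th form
  and hence zero by \<open>generic_zero_inj\<close>.\<close>

lemma degX_uresultant_pos: "i \<in> V \<Longrightarrow> degX (xvars i) (uresultant V ds) > 0"
proof (rule ccontr)
  assume i: "i \<in> V" "\<not> ?thesis"
  then have "uresultant V ds \<in> polys (- xvars i)" by (simp add: degX_eq_0_iff)
  then have "uresultant V ds \<in> polys (- {(i, psingle i (ds i))})"
    by (rule polys_mono) (auto simp: xvars_def)
  moreover have "inertia V (gforms V ds) (uresultant V ds)"
    by (simp add: inertia_iff_dvd)
  then have "generic_zero V ds i (uresultant V ds) = 0"
    by (simp add: inertia_iff[OF i(1)])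
  ultimately have "uresultant V ds = 0" by (rule generic_zero_inj[OF i(1)])
  then show False using uresultant_nonzero by simp
qed

end

section \<open>Resultants of forms over an arbitrary ring\<close>

definition is_form :: "'i set \<Rightarrow> nat \<Rightarrow> ('i, 'a::zero) mpoly \<Rightarrow> bool" where
  "is_form V k p \<longleftrightarrow> mhomogeneous k p \<and> p \<in> polys V"

lemma is_form_coef_0: "is_form V k p \<Longrightarrow> \<alpha> \<notin> monoms V k \<Longrightarrow> coef p \<alpha> = 0"
  by (auto simp: is_form_def mhomogeneous_def polys_iff monoms_def in_keys_iff)

lemma is_form_gform: "is_form V k (gform V k i)"
  by (simp add: is_form_def mhomogeneous_gform polys_gform)

lemma is_form_0 [simp]: "is_form V k 0"
  by (simp add: is_form_def)

lemma is_form_add: "is_form V k p \<Longrightarrow> is_form V k q \<Longrightarrow> is_form V k (p + q)"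
  for p q :: "('i, 'a::comm_monoid_add) mpoly"
  by (simp add: is_form_def mhomogeneous_add polys_add)

lemma is_form_diff: "is_form V k p \<Longrightarrow> is_form V k q \<Longrightarrow> is_form V k (p - q)"
  for p q :: "('i, 'a::ab_group_add) mpoly"
  by (simp add: is_form_def mhomogeneous_diff polys_diff)

lemma is_form_uminus: "is_form V k p \<Longrightarrow> is_form V k (- p)"
  for p :: "('i, 'a::ab_group_add) mpoly"
  by (simp add: is_form_def mhomogeneous_uminus polys_uminus)

lemma is_form_mult: "is_form V k p \<Longrightarrow> is_form V l q \<Longrightarrow> is_form V (k + l) (p * q)"
  for p q :: "('i, 'a::comm_semiring_1) mpoly"
  by (simp add: is_form_def mhomogeneous_mult polys_mult)

lemma is_form_mconst [simp]: "is_form V 0 (mconst c)"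
  by (simp add: is_form_def)

lemma is_form_1 [simp]: "is_form V 0 (1 :: ('i, 'a::comm_semiring_1) mpoly)"
  by (simp add: is_form_def)

lemma is_form_mconst_mult: "is_form V k p \<Longrightarrow> is_form V k (mconst c * p)"
  for p :: "('i, 'a::comm_semiring_1) mpoly"
  using is_form_mult[of V 0 "mconst c" k p] by simp

lemma is_form_sum: "(\<And>x. x \<in> S \<Longrightarrow> is_form V k (f x)) \<Longrightarrow> is_form V k (sum f S)"
  for f :: "_ \<Rightarrow> ('i, 'a::comm_monoid_add) mpoly"
  by (simp add: is_form_def mhomogeneous_sum polys_sum)

lemma is_form_mvar: "i \<in> V \<Longrightarrow> is_form V 1 (mvar i)"
  by (simp add: is_form_def polys_mvar)

lemma is_form_power: "is_form V k p \<Longrightarrow> is_form V (k * n) (p ^ n)"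
  for p :: "('i, 'a::comm_semiring_1) mpoly"
  by (simp add: is_form_def mhomogeneous_power polys_power)

lemma is_form_mvar_power: "i \<in> V \<Longrightarrow> is_form V n (mvar i ^ n :: ('i, 'a::comm_semiring_1) mpoly)"
  using is_form_power[OF is_form_mvar, of i V n] by simp

lemma is_form_mono: "is_form V k p \<Longrightarrow> V \<subseteq> W \<Longrightarrow> is_form W k p"
  by (auto simp: is_form_def intro: polys_mono)

lemma is_form_subst:
  fixes p :: "('i, 'a::comm_ring_1) mpoly"
  assumes "is_form V k p" "\<And>i. i \<in> V \<Longrightarrow> is_form W 1 (\<phi> i)"
  shows "is_form W k (meval mconst \<phi> p)"
  using assms by (auto simp: is_form_def intro!: mhomogeneous_subst polys_meval)

definition map_coef :: "('a \<Rightarrow> 'b) \<Rightarrow> ('i, 'a::comm_ring_1) mpoly \<Rightarrow> ('i, 'b::comm_ring_1) mpoly" where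
  "map_coef f = meval (\<lambda>c. mconst (f c)) mvar"

lemma comm_ring_hom_map_coef: "comm_ring_hom f \<Longrightarrow> comm_ring_hom (map_coef f)"
  unfolding map_coef_def by (intro comm_ring_hom_meval comm_ring_hom_comp[OF comm_ring_hom_mconst])

lemma map_coef_mconst: "comm_ring_hom f \<Longrightarrow> map_coef f (mconst c) = mconst (f c)"
proof -
  assume "comm_ring_hom f"
  then interpret f: comm_ring_hom f .
  show ?thesis by (simp add: map_coef_def)
qed

lemma map_coef_mvar: "comm_ring_hom f \<Longrightarrow> map_coef f (mvar i) = mvar i"
  unfolding map_coef_def by (rule meval_mvar) (rule comm_ring_hom_comp[OF comm_ring_hom_mconst])

lemma map_coef_mmonom: "comm_ring_hom f \<Longrightarrow> map_coef f (mmonom \<alpha>) = mmonom \<alpha>"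
  unfolding map_coef_def
  by (subst meval_mmonom) (auto simp: mmonom_eq_mon_eval intro: comm_ring_hom_comp[OF comm_ring_hom_mconst])

lemma coef_map_coef:
  assumes "comm_ring_hom f"
  shows "coef (map_coef f p) \<alpha> = f (coef p \<alpha>)"
proof -
  interpret f: comm_ring_hom f by fact
  interpret m: comm_ring_hom "map_coef f" by (rule comm_ring_hom_map_coef) fact
  show ?thesis
  proof (induction p rule: poly_mapping_induct)
    case (single a c)
    then show ?case
      by (simp add: psingle_eq m.hom_mult map_coef_mconst assms map_coef_mmonom coef_mconst_mult coef_mmonom)
  qed (auto simp: lookup_add f.hom_add m.hom_add)
qed

lemma supp_map_coef: "comm_ring_hom f \<Longrightarrow> supp (map_coef f p) \<subseteq> supp p"
proof
  fix \<alpha> assume f: "comm_ring_hom f" and a: "\<alpha> \<in> supp (map_coef f p)"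
  interpret f: comm_ring_hom f by fact
  show "\<alpha> \<in> supp p" using a f by (auto simp: in_keys_iff coef_map_coef)
qed

definition Res :: "nat set \<Rightarrow> (nat \<Rightarrow> nat) \<Rightarrow> (nat \<Rightarrow> (nat, 'a::comm_ring_1) mpoly) \<Rightarrow> 'a" where
  "Res V ds g = meval of_int (\<lambda>(i, \<alpha>). coef (g i) \<alpha>) (uresultant V ds)"

text \<open>Acts on all labels, so that labels outside V can be specialized to factors or cofactors
  in the same step.\<close>

definition spec :: "(nat \<Rightarrow> (nat, 'a::comm_ring_1) mpoly) \<Rightarrow> ures \<Rightarrow> 'a" where
  "spec g = meval of_int (\<lambda>(i, \<alpha>). coef (g i) \<alpha>)"

lemma comm_ring_hom_spec: "comm_ring_hom (spec g)"
  unfolding spec_def by (rule comm_ring_hom_int_meval)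

lemma spec_mvar: "spec g (mvar (i, \<alpha>)) = coef (g i) \<alpha>"
  unfolding spec_def by simp

lemma Res_eq_spec: "Res V ds g = spec g (uresultant V ds)"
  by (simp add: Res_def spec_def)

lemma map_coef_spec_gform:
  assumes "finite V" "is_form V k (g i)"
  shows "map_coef (spec g) (gform V k i) = g i"
proof (rule poly_mapping_eqI)
  interpret s: comm_ring_hom "spec g" by (rule comm_ring_hom_spec)
  fix \<alpha> show "coef (map_coef (spec g) (gform V k i)) \<alpha> = coef (g i) \<alpha>"
    using is_form_coef_0[OF assms(2), of \<alpha>]
    by (simp add: coef_map_coef comm_ring_hom_spec coef_gform assms spec_mvar)
qed

lemma uresultant_cong:
  assumes "\<And>i. i \<in> V \<Longrightarrow> ds i = ds' i"
  shows "uresultant V ds = uresultant V ds'"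
proof -
  have cv: "coefvars V ds = coefvars V ds'"
    unfolding coefvars_def using assms by (intro Sigma_cong) auto
  have fi: "form_ideal V (gforms V ds) = form_ideal V (gforms V ds')"
  proof -
    have "(\<Sum>i\<in>V. h i * gforms V ds i) = (\<Sum>i\<in>V. h i * gforms V ds' i)" for h
      by (intro sum.cong) (auto simp: assms)
    then show ?thesis unfolding form_ideal_def by simp
  qed
  have ap: "at_powers ds R = at_powers ds' R" if "R \<in> polys (coefvars V ds)" for R
    unfolding at_powers_def
  proof (rule meval_cong)
    fix \<alpha> v assume "\<alpha> \<in> supp R" "v \<in> supp \<alpha>"
    then have "v \<in> coefvars V ds" using that by (auto simp: polys_iff)
    then have "fst v \<in> V" by (auto simp: coefvars_def)
    then show "(case v of (i, \<alpha>) \<Rightarrow> if \<alpha> = psingle i (ds i) then 1 else 0) =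
        (case v of (i, \<alpha>) \<Rightarrow> if \<alpha> = psingle i (ds' i) then 1 else 0)"
      using assms by (auto split: prod.split)
  qed simp
  have "is_resultant V ds = is_resultant V ds'"
    unfolding is_resultant_def inertia_def fi cv[symmetric] using ap by (auto simp: fun_eq_iff)
  then show ?thesis unfolding uresultant_def by simp
qed

lemma map_coef_form_ideal: "comm_ring_hom f \<Longrightarrow> p \<in> form_ideal V g \<Longrightarrow> map_coef f p \<in> form_ideal V (\<lambda>i. map_coef f (g i))"
  by (rule form_ideal_hom[OF comm_ring_hom_map_coef])

lemma inertia_map_coef:
  assumes f: "comm_ring_hom f" and i: "inertia V g r"
  shows "inertia V (\<lambda>i. map_coef f (g i)) (f r)"
proof -
  interpret m: comm_ring_hom "map_coef f" by (rule comm_ring_hom_map_coef[OF f])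
  obtain N where N: "\<And>\<beta>. \<beta> \<in> monoms V N \<Longrightarrow> mmonom \<beta> * mconst r \<in> form_ideal V g"
    using i by (auto simp: inertia_def)
  show ?thesis unfolding inertia_def
  proof (intro exI ballI)
    fix \<beta> assume "\<beta> \<in> monoms V N"
    from map_coef_form_ideal[OF f N[OF this]]
    show "mmonom \<beta> * mconst (f r) \<in> form_ideal V (\<lambda>i. map_coef f (g i))"
      by (simp add: m.hom_mult map_coef_mmonom[OF f] map_coef_mconst[OF f])
  qed
qed

lemma inertia_mono:
  "inertia V g r \<Longrightarrow> (\<And>i. i \<in> V \<Longrightarrow> g i \<in> form_ideal V g') \<Longrightarrow> inertia V g' r"
  unfolding inertia_def using form_ideal_mono by blast

lemma inertia_cong: "(\<And>i. i \<in> V \<Longrightarrow> g i = g' i) \<Longrightarrow> inertia V g r \<longleftrightarrow> inertia V g' r"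
proof -
  assume "\<And>i. i \<in> V \<Longrightarrow> g i = g' i"
  then have "(\<Sum>i\<in>V. h i * g i) = (\<Sum>i\<in>V. h i * g' i)" for h by (intro sum.cong) auto
  then have "form_ideal V g = form_ideal V g'" unfolding form_ideal_def by simp
  then show ?thesis by (simp add: inertia_def)
qed

lemma const_of_degX:
  fixes q :: ures
  assumes "\<And>k. k \<in> K \<Longrightarrow> degX (xvars k) q = 0" "q \<in> polys (\<Union>k\<in>K. xvars k)"
  obtains c where "q = of_int c"
proof -
  have "q \<in> polys {}"
  proof (unfold polys_iff, intro ballI subsetI)
    fix \<alpha> v assume av: "\<alpha> \<in> supp q" "v \<in> supp \<alpha>"
    then obtain k where "k \<in> K" "v \<in> xvars k" using assms(2) by (auto simp: polys_iff)
    then show "v \<in> {}" using assms(1)[of k] av by (auto simp: degX_eq_0_iff polys_iff)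
  qed
  then show ?thesis using polys_empty_iff that mconst_int by metis
qed

context forms
begin

lemma uresultant_supp:
  "\<alpha> \<in> supp (uresultant V ds) \<Longrightarrow> (i, \<beta>) \<in> supp \<alpha> \<Longrightarrow> i \<in> V \<and> \<beta> \<in> monoms V (ds i)"
  using uresultant_polys by (auto simp: polys_iff coefvars_def)

lemma Res_cong:
  assumes "\<And>i. i \<in> V \<Longrightarrow> g i = g' i"
  shows "Res V ds g = Res V ds g'"
  unfolding Res_def
  by (rule meval_cong) (auto simp: assms dest: uresultant_supp)

lemma Res_hom:
  assumes f: "comm_ring_hom f"
    and "\<And>i \<alpha>. i \<in> V \<Longrightarrow> \<alpha> \<in> monoms V (ds i) \<Longrightarrow> coef (g' i) \<alpha> = f (coef (g i) \<alpha>)"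
  shows "f (Res V ds g) = Res V ds g'"
proof -
  interpret f: comm_ring_hom f by fact
  have "f (Res V ds g) = meval (\<lambda>c. f (of_int c)) (\<lambda>v. f ((\<lambda>(i, \<alpha>). coef (g i) \<alpha>) v)) (uresultant V ds)"
    unfolding Res_def by (rule hom_meval[OF f comm_ring_hom_of_int])
  also have "\<dots> = Res V ds g'"
    unfolding Res_def
  proof (rule meval_cong)
    fix \<alpha> i assume "\<alpha> \<in> supp (uresultant V ds)" "i \<in> supp \<alpha>"
    then have "i \<in> coefvars V ds" using uresultant_polys by (auto simp: polys_iff)
    then show "f ((\<lambda>(i, \<alpha>). coef (g i) \<alpha>) i) = (\<lambda>(i, \<alpha>). coef (g' i) \<alpha>) i"
      using assms(2) by (auto simp: coefvars_def)
  qed (simp add: f.hom_of_int)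
  finally show ?thesis .
qed

lemma Res_map_coef: "comm_ring_hom f \<Longrightarrow> f (Res V ds g) = Res V ds (\<lambda>i. map_coef f (g i))"
  by (rule Res_hom) (auto simp: coef_map_coef)

lemma Res_gforms: "Res V ds (gforms V ds) = uresultant V ds"
proof -
  have "Res V ds (gforms V ds) = meval of_int mvar (uresultant V ds)"
    unfolding Res_def
    by (rule meval_cong) (auto simp: coef_gform finite_V dest: uresultant_supp)
  also have "\<dots> = uresultant V ds"
    using int_mpoly_hom[OF comm_ring_hom_id] by metis
  finally show ?thesis .
qed

lemma inertia_Res:
  assumes "\<And>i. i \<in> V \<Longrightarrow> is_form V (ds i) (g i)"
  shows "inertia V g (Res V ds g)"
proof -
  have "inertia V (gforms V ds) (uresultant V ds)" by (simp add: inertia_iff_dvd)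
  from inertia_map_coef[OF comm_ring_hom_spec this, of g]
  have "inertia V (\<lambda>i. map_coef (spec g) (gforms V ds i)) (Res V ds g)" by (simp add: Res_eq_spec)
  then show ?thesis
    by (subst inertia_cong[of V g "\<lambda>i. map_coef (spec g) (gforms V ds i)"])
       (auto simp: map_coef_spec_gform finite_V assms)
qed

lemma Res_powers: "Res V ds (\<lambda>i. mvar i ^ ds i) = 1"
proof -
  have "Res V ds (\<lambda>i. mvar i ^ ds i) = at_powers ds (uresultant V ds)"
    unfolding Res_def at_powers_def
    by (rule meval_cong) (auto simp: mmonom_power[symmetric] coef_mmonom)
  then have int: "Res V ds (\<lambda>i. mvar i ^ ds i) = (1 :: int)" by (simp add: at_powers_uresultant)
  have "of_int (Res V ds (\<lambda>i. mvar i ^ ds i) :: int) = (Res V ds (\<lambda>i. mvar i ^ ds i) :: 'b::comm_ring_1)"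
    by (rule Res_hom[OF comm_ring_hom_of_int]) (auto simp: mmonom_power[symmetric] coef_mmonom)
  then show "Res V ds (\<lambda>i. mvar i ^ ds i) = (1 :: 'b::comm_ring_1)" by (simp add: int)
qed

lemma degX_Res_le_gen:
  assumes "\<And>i \<alpha>. i \<in> V \<Longrightarrow> \<alpha> \<in> monoms V (ds i) \<Longrightarrow> degX Y (coef (g i) \<alpha>) \<le> (if (i, \<alpha>) \<in> X then 1 else 0)"
  shows "degX Y (Res V ds g :: ('j, 'b::comm_ring_1) mpoly) \<le> degX X (uresultant V ds)"
proof -
  have "Res V ds g = meval of_int (\<lambda>v. if v \<in> coefvars V ds then case v of (i, \<alpha>) \<Rightarrow> coef (g i) \<alpha> else 0) (uresultant V ds)"
    unfolding Res_def by (rule meval_cong) (auto simp: coefvars_def dest: uresultant_supp)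
  also have "degX Y \<dots> \<le> degX X (uresultant V ds)"
  proof (rule degX_meval_le)
    fix v show "degX Y (if v \<in> coefvars V ds then case v of (i, \<alpha>) \<Rightarrow> coef (g i) \<alpha> else 0) \<le> (if v \<in> X then 1 else 0)"
      using assms[of "fst v" "snd v"] by (cases v) (auto simp: coefvars_def split: if_splits)
  qed
  finally show ?thesis .
qed

lemma degX_Res_le:
  assumes "i \<in> V" "\<And>\<alpha>. degX Y (coef (g i) \<alpha>) \<le> 1" "\<And>k \<alpha>. k \<in> V - {i} \<Longrightarrow> degX Y (coef (g k) \<alpha>) = 0"
  shows "degX Y (Res V ds g :: ('j, 'b::comm_ring_1) mpoly) \<le> degX (xvars i) (uresultant V ds)"
  by (rule degX_Res_le_gen) (use assms in \<open>auto simp: xvars_def\<close>)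

lemma degX_Res_eq_0:
  assumes "\<And>k \<alpha>. k \<in> V \<Longrightarrow> degX Y (coef (g k) \<alpha>) = 0"
  shows "degX Y (Res V ds g :: ('j, 'b::comm_ring_1) mpoly) = 0"
proof -
  have "degX Y (Res V ds g) \<le> degX {} (uresultant V ds)"
    by (rule degX_Res_le_gen) (simp add: assms)
  also have "degX {} (uresultant V ds) = 0" by (simp add: degX_eq_0_iff polys_iff)
  finally show ?thesis by simp
qed

lemma Res_polys:
  assumes "\<And>k \<alpha>. k \<in> V \<Longrightarrow> coef (g k) \<alpha> \<in> polys W"
  shows "(Res V ds g :: ('j, 'b::comm_ring_1) mpoly) \<in> polys W"
  using degX_Res_eq_0[of "- W" g] assms by (simp add: degX_eq_0_iff)

end

section \<open>Divisibility and multiplicativity of resultants\<close>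

lemma coef_gform_mem: "finite V \<Longrightarrow> coef (gform V k i) \<alpha> \<in> polys (xvars i)"
  by (auto simp: coef_gform xvars_def intro: polys_mvar)

lemma degX_coef_gform: "finite V \<Longrightarrow> degX Y (coef (gform V k i) \<alpha>) \<le> (if xvars i \<inter> Y \<noteq> {} then 1 else 0)"
  using degX_mvar_le[of Y "(i, \<alpha>)"] by (auto simp: coef_gform xvars_def split: if_splits)

text \<open>The multiple is an inertia form of the larger ideal.\<close>

lemma Res_dvd:
  fixes g g' :: "nat \<Rightarrow> (nat, 'a::comm_ring_1) mpoly"
  assumes "forms V ds" "forms V ds'"
    and g: "\<And>j. j \<in> V \<Longrightarrow> is_form V (ds j) (g j)"
    and h: "\<And>i j :: nat. i \<in> V \<Longrightarrow> j \<in> V \<Longrightarrow> is_form V (ds' i - ds j) (h i j)"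
    and h0: "\<And>i j. i \<in> V \<Longrightarrow> j \<in> V \<Longrightarrow> ds' i < ds j \<Longrightarrow> h i j = 0"
    and g': "\<And>i. i \<in> V \<Longrightarrow> g' i = (\<Sum>j\<in>V. h i j * g j)"
  shows "Res V ds g dvd Res V ds' g'"
proof -
  interpret F: forms V ds by fact
  interpret F': forms V ds' by fact
  note fin = F.finite_V
  define s where "s = Suc (Max V)"
  have s: "j < s" if "j \<in> V" for j using that fin by (simp add: s_def less_Suc_eq_le)
  \<comment> \<open>Labels for generic cofactors, chosen beyond those of V so that their
    coefficients are independent of those of the forms. The claim then follows by specialization
    from a divisibility over the integers, where the characterization of inertia forms is
    available.\<close>
  define c where "c i j = s + prod_encode (i, j)" for i j :: nat
  define G where "G k = (if k < s then g k else case prod_decode (k - s) of (i, j) \<Rightarrow> h i j)" for k :: nat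
  have Gc: "G (c i j) = h i j" for i j by (simp add: G_def c_def)
  have Gg: "G j = g j" if "j \<in> V" for j using s[OF that] by (simp add: G_def)
  define H where "H i j = (if ds' i < ds j then 0 else gform V (ds' i - ds j) (c i j))" for i j
  define f' where "f' i = (\<Sum>j\<in>V. H i j * gforms V ds j)" for i
  have form': "is_form V (ds' i) (f' i)" for i
    unfolding f'_def
  proof (rule is_form_sum)
    fix j
    show "is_form V (ds' i) (H i j * gforms V ds j)"
    proof (cases "ds' i < ds j")
      case False
      then show ?thesis
        using is_form_mult[OF is_form_gform[of V "ds' i - ds j" "c i j"] is_form_gform[of V "ds j" j]] by (simp add: H_def)
    qed (simp add: H_def)
  qed
  have "inertia V f' (Res V ds' f')" by (rule F'.inertia_Res[OF form'])
  then have "inertia V (gforms V ds) (Res V ds' f')"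
    by (rule inertia_mono) (auto simp: f'_def form_ideal_def)
  then have dvd: "uresultant V ds dvd Res V ds' f'" by (simp add: F.inertia_iff_dvd)
  interpret m: comm_ring_hom "spec G" by (rule comm_ring_hom_spec)
  interpret mc: comm_ring_hom "map_coef (spec G)" by (rule comm_ring_hom_map_coef[OF comm_ring_hom_spec])
  have "map_coef (spec G) (f' i) = g' i" if i: "i \<in> V" for i
  proof -
    have "map_coef (spec G) (H i j) * map_coef (spec G) (gforms V ds j) = h i j * g j" if j: "j \<in> V" for j
    proof -
      have "map_coef (spec G) (gforms V ds j) = g j"
        using map_coef_spec_gform[OF fin, of "ds j" G j] Gg[OF j] g[OF j] by simp
      moreover have "map_coef (spec G) (H i j) = h i j"
        using map_coef_spec_gform[OF fin, of "ds' i - ds j" G "c i j"] h[OF i j] h0[OF i j] by (simp add: H_def Gc)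
      ultimately show ?thesis by simp
    qed
    then show ?thesis by (simp add: f'_def g'[OF i] mc.hom_sum mc.hom_mult)
  qed
  then have "spec G (Res V ds' f') = Res V ds' g'"
    using F'.Res_map_coef[OF comm_ring_hom_spec, of G f'] F'.Res_cong[of "\<lambda>i. map_coef (spec G) (f' i)" g'] by simp
  moreover have "spec G (uresultant V ds) = Res V ds g"
    using F.Res_cong[of G g] Gg by (simp add: Res_eq_spec[symmetric])
  ultimately show ?thesis using m.hom_dvd[OF dvd] by simp
qed

lemma Res_dvd_diag:
  fixes g :: "nat \<Rightarrow> (nat, 'a::comm_ring_1) mpoly"
  assumes "forms V ds" "forms V ds'" "i \<in> V"
    and g: "\<And>j. j \<in> V \<Longrightarrow> is_form V (ds j) (g j)"
    and ds': "\<And>j. j \<in> V - {i} \<Longrightarrow> ds' j = ds j" "ds' i = k + ds i"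
    and p: "is_form V k p"
  shows "Res V ds g dvd Res V ds' (g(i := p * g i))"
proof (rule Res_dvd[OF assms(1,2) g, where h = "\<lambda>a b. if a = b then if a = i then p else 1 else 0"])
  fix a b assume "a \<in> V" "b \<in> V"
  then show "is_form V (ds' a - ds b) (if a = b then if a = i then p else 1 else 0)"
    using ds' p by auto
next
  fix a b assume "a \<in> V" "b \<in> V" "ds' a < ds b"
  then show "(if a = b then if a = i then p else 1 else 0) = 0" using ds' by (cases "a = i") auto
next
  interpret forms V ds by fact
  fix a assume "a \<in> V"
  then show "(g(i := p * g i)) a = (\<Sum>j\<in>V. (if a = j then if a = i then p else 1 else 0) * g j)"
    using finite_V by (auto simp: if_distrib[of "\<lambda>x. x * _"] sum.delta' cong: if_cong)
qed

lemma forms_update: "forms V ds \<Longrightarrow> a > 0 \<Longrightarrow> forms V (ds(i := a))"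
  by (auto simp: forms_def)

lemma degX_spec_le:
  fixes r :: ures
  assumes "\<And>k \<alpha>. degX Y (coef (g k) \<alpha> :: ('j, 'a::comm_ring_1) mpoly) \<le> (if (k, \<alpha>) \<in> X then 1 else 0)"
  shows "degX Y (spec g r) \<le> degX X r"
  unfolding spec_def
proof (rule degX_meval_le)
  fix v show "degX Y (case v of (i, \<alpha>) \<Rightarrow> coef (g i) \<alpha>) \<le> (if v \<in> X then 1 else 0)"
    using assms[of "fst v" "snd v"] by (cases v) simp
qed

lemma xvars_disjoint: "i \<noteq> j \<Longrightarrow> xvars i \<inter> xvars j = {}"
  by (auto simp: xvars_def)

lemma coef_gform_mult:
  "coef (gform V a i * gform V b s) \<alpha> = (\<Sum>\<beta>\<in>monoms V a. \<Sum>\<gamma>\<in>monoms V b.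
     mvar (i, \<beta>) * mvar (s, \<gamma>) * (if \<beta> + \<gamma> = \<alpha> then 1 else 0))"
  unfolding gform_def sum_product lookup_sum
proof (intro sum.cong refl)
  fix \<beta> \<gamma>
  have "mconst (mvar (i, \<beta>)) * mmonom \<beta> * (mconst (mvar (s, \<gamma>)) * mmonom \<gamma>) =
     (mconst (mvar (i, \<beta>) * mvar (s, \<gamma>)) * mmonom (\<beta> + \<gamma>) :: (nat, ures) mpoly)"
    by (simp add: mconst_mult mmonom_add mult_ac)
  then show "coef (mconst (mvar (i, \<beta>)) * mmonom \<beta> * (mconst (mvar (s, \<gamma>)) * mmonom \<gamma>) :: (nat, ures) mpoly) \<alpha> =
      mvar (i, \<beta>) * mvar (s, \<gamma>) * (if \<beta> + \<gamma> = \<alpha> then 1 else 0)"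
    by (simp add: coef_mconst_mult coef_mmonom)
qed

text \<open>A factorization up to a cofactor suffices to determine the degrees.\<close>

lemma Res_mult_cofactor:
  assumes F: "forms V ds" and i: "i \<in> V" and ab: "a > 0" "b > 0" "ds i = a + b" and s: "s \<notin> V"
    and C: "C = Res V ds ((gforms V ds)(i := gform V a i * gform V b s))"
    and A: "A = uresultant V (ds(i := a))"
    and B: "B = Res V (ds(i := b)) ((gforms V ds)(i := gform V b s))"
  shows "(\<exists>q. C = A * B * q) \<and> C \<noteq> 0"
    and "\<And>k. k \<in> V - {i} \<Longrightarrow> degX (xvars k) B \<ge> degX (xvars k) (uresultant V (ds(i := b)))"
    and "degX (xvars s) B \<ge> degX (xvars i) (uresultant V (ds(i := b)))"
    and "\<And>k. k \<in> V \<Longrightarrow> degX (xvars k) C \<le> degX (xvars k) (uresultant V ds)"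
    and "degX (xvars s) C \<le> degX (xvars i) (uresultant V ds)"
proof -
  interpret F: forms V ds by fact
  interpret FA: forms V "ds(i := a)" by (rule forms_update[OF F ab(1)])
  interpret FB: forms V "ds(i := b)" by (rule forms_update[OF F ab(2)])
  note fin = F.finite_V
  have si: "s \<noteq> i" using s i by auto
  have gA: "(gforms V (ds(i := a))) k = ((gforms V ds)(i := gform V a i)) k" for k by simp
  have A': "A = Res V (ds(i := a)) ((gforms V ds)(i := gform V a i))"
    unfolding A FA.Res_gforms[symmetric] by (rule FA.Res_cong) simp
  have AC: "A dvd C"
  proof -
    have "Res V (ds(i := a)) ((gforms V ds)(i := gform V a i)) dvd
      Res V ds (((gforms V ds)(i := gform V a i))(i := gform V b s * ((gforms V ds)(i := gform V a i)) i))"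
      by (rule Res_dvd_diag[OF FA.forms_axioms F i, where k = b]) (use ab in \<open>auto simp: is_form_gform\<close>)
    then show ?thesis by (simp add: A' C mult.commute)
  qed
  have BC: "B dvd C"
  proof -
    have "Res V (ds(i := b)) ((gforms V ds)(i := gform V b s)) dvd
      Res V ds (((gforms V ds)(i := gform V b s))(i := gform V a i * ((gforms V ds)(i := gform V b s)) i))"
      by (rule Res_dvd_diag[OF FB.forms_axioms F i, where k = a]) (use ab in \<open>auto simp: is_form_gform\<close>)
    then show ?thesis by (simp add: B C)
  qed
  \<comment> \<open>At this specialization the product form becomes x_i ^ ds i and the other forms
    become powers too; C has value 1 there and is therefore nonzero.\<close>
  define Pw :: "nat \<Rightarrow> (nat, int) mpoly" where
    "Pw k = (if k = s then mvar i ^ b else if k = i then mvar i ^ a else mvar k ^ ds k)" for k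
  have "map_coef (spec Pw) (gform V a i * gform V b s) = mvar i ^ ds i"
  proof -
    interpret mc: comm_ring_hom "map_coef (spec Pw)" by (rule comm_ring_hom_map_coef[OF comm_ring_hom_spec])
    have "map_coef (spec Pw) (gform V a i) = mvar i ^ a"
      using map_coef_spec_gform[OF fin, of a Pw i] is_form_mvar_power[OF i, of a] si by (simp add: Pw_def)
    moreover have "map_coef (spec Pw) (gform V b s) = mvar i ^ b"
      using map_coef_spec_gform[OF fin, of b Pw s] is_form_mvar_power[OF i, of b] by (simp add: Pw_def)
    ultimately show ?thesis by (simp add: mc.hom_mult ab power_add)
  qed
  moreover have "map_coef (spec Pw) (gforms V ds k) = mvar k ^ ds k" if "k \<in> V - {i}" for k
  proof -
    have "Pw k = mvar k ^ ds k" using that s by (auto simp: Pw_def)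
    then show ?thesis
      using that map_coef_spec_gform[OF fin, of "ds k" Pw k] is_form_mvar_power[of k V "ds k"] by auto
  qed
  ultimately have "spec Pw C = Res V ds (\<lambda>k. mvar k ^ ds k)"
    unfolding C F.Res_map_coef[OF comm_ring_hom_spec] by (intro F.Res_cong) auto
  then have "spec Pw C = 1" by (simp add: F.Res_powers)
  then have C0: "C \<noteq> 0" by (metis comm_ring_hom_spec comm_ring_hom.axioms(1) ring_hom.axioms(1) semiring_hom.axioms(1)
      comm_monoid_add_hom.axioms(1) monoid_add_hom.axioms(1) zero_hom.hom_zero zero_neq_one)
  obtain C' where C': "C = B * C'" using BC by blast
  have B0: "B \<noteq> 0" using C0 C' by auto
  \<comment> \<open>B does not involve the coefficients with label i while A does. So the prime A
    cannot divide B and must divide the cofactor C'.\<close>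
  have "degX (xvars i) B = 0" unfolding B
    by (rule FB.degX_Res_eq_0) (use si in \<open>auto simp: degX_coef_gform xvars_disjoint intro: le_antisym[OF order_trans[OF degX_coef_gform[OF fin]]]\<close>)
  moreover have "degX (xvars i) A > 0" unfolding A by (rule FA.degX_uresultant_pos[OF i])
  ultimately have "\<not> A dvd B" using degX_dvd_le[of A B "xvars i"] B0 by auto
  then have "A dvd C'" using AC FA.prime_elem_uresultant unfolding C' A[symmetric] by (auto simp: prime_elem_dvd_mult_iff)
  then obtain q where "C' = A * q" by blast
  then show "(\<exists>q. C = A * B * q) \<and> C \<noteq> 0" using C' C0 by (auto simp: mult_ac)
  \<comment> \<open>Renames the label s to i and so turns B into a universal resultant. As this
    specialization cannot raise degrees, those of B are bounded from below.\<close>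
  define gg where "gg k = (if k = s then gform V b i else if k \<in> V - {i} then gforms V ds k else 0)" for k
  have degG: "degX (xvars l) (coef (gg k) \<alpha>) \<le> (if (k, \<alpha>) \<in> (if l = i then xvars s else xvars l) then 1 else 0)"
    if "l \<in> V" for l k \<alpha>
    using that s si degX_coef_gform[OF fin, of "xvars l" b i \<alpha>] degX_coef_gform[OF fin, of "xvars l" "ds k" k \<alpha>]
      xvars_disjoint[of i l] xvars_disjoint[of k l]
    by (auto simp: gg_def) (auto simp: xvars_def)
  have "spec gg B = Res V (ds(i := b)) (gforms V (ds(i := b)))"
    unfolding B FB.Res_map_coef[OF comm_ring_hom_spec]
  proof (rule FB.Res_cong)
    fix k assume k: "k \<in> V"
    have ks: "k \<noteq> s" using k s by auto
    show "map_coef (spec gg) (((gforms V ds)(i := gform V b s)) k) = gforms V (ds(i := b)) k"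
      using map_coef_spec_gform[OF fin, of b gg s] map_coef_spec_gform[OF fin, of "ds k" gg k] k ks
      by (auto simp: gg_def is_form_gform)
  qed
  then have sB: "spec gg B = uresultant V (ds(i := b))" by (simp only: FB.Res_gforms)
  show "degX (xvars k) B \<ge> degX (xvars k) (uresultant V (ds(i := b)))" if "k \<in> V - {i}" for k
    unfolding sB[symmetric] using that degG[of k] by (intro degX_spec_le) auto
  show "degX (xvars s) B \<ge> degX (xvars i) (uresultant V (ds(i := b)))"
    unfolding sB[symmetric] using degG[OF i] by (intro degX_spec_le) auto
  have cp: "degX (xvars k) (coef (gform V a i * gform V b s) \<alpha>) \<le> (if k = i \<or> k = s then 1 else 0)" for k \<alpha>
  proof -
    have l: "degX (xvars k) (mvar v :: ures) \<le> (if v \<in> xvars k then 1 else 0)" for v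
      by (rule degX_mvar_le)
    show ?thesis unfolding coef_gform_mult
    proof (intro degX_sum_le)
      fix \<beta> \<gamma>
      have "degX (xvars k) (mvar (i, \<beta>) * mvar (s, \<gamma>) :: ures) \<le> (if k = i then 1 else 0) + (if k = s then 1 else 0)"
        using degX_mult_le[of "xvars k" "mvar (i, \<beta>) :: ures" "mvar (s, \<gamma>)"]
          l[of "(i, \<beta>)"] l[of "(s, \<gamma>)"]
        by (auto simp: xvars_def split: if_splits)
      then show "degX (xvars k) (mvar (i, \<beta>) * mvar (s, \<gamma>) * (if \<beta> + \<gamma> = \<alpha> then 1 else 0) :: ures) \<le> (if k = i \<or> k = s then 1 else 0)"
        using si by (auto split: if_splits)
    qed
  qed
  show "degX (xvars k) C \<le> degX (xvars k) (uresultant V ds)" if k: "k \<in> V" for k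
    unfolding C
  proof (rule F.degX_Res_le[OF k])
    fix \<alpha> show "degX (xvars k) (coef (((gforms V ds)(i := gform V a i * gform V b s)) k) \<alpha>) \<le> 1"
      using cp[of k \<alpha>] degX_coef_gform[OF fin, of "xvars k" "ds k" k \<alpha>] by (auto split: if_splits)
  next
    fix l \<alpha> assume l: "l \<in> V - {k}"
    have "k \<noteq> s" using k s by auto
    then show "degX (xvars k) (coef (((gforms V ds)(i := gform V a i * gform V b s)) l) \<alpha>) = 0"
      using cp[of k \<alpha>] degX_coef_gform[OF fin, of "xvars k" "ds l" l \<alpha>] xvars_disjoint[of l k] l
      by (auto split: if_splits)
  qed
  show "degX (xvars s) C \<le> degX (xvars i) (uresultant V ds)"
    unfolding C
  proof (rule F.degX_Res_le[OF i])
    fix \<alpha> show "degX (xvars s) (coef (((gforms V ds)(i := gform V a i * gform V b s)) i) \<alpha>) \<le> 1"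
      using cp[of s \<alpha>] by auto
  next
    fix l \<alpha> assume l: "l \<in> V - {i}"
    then have "l \<noteq> s" using s by auto
    then show "degX (xvars s) (coef (((gforms V ds)(i := gform V a i * gform V b s)) l) \<alpha>) = 0"
      using degX_coef_gform[OF fin, of "xvars s" "ds l" l \<alpha>] xvars_disjoint[of l s] l by auto
  qed
qed

lemma forms_fresh: "forms V ds \<Longrightarrow> \<exists>s. s \<notin> V"
  using ex_new_if_finite[of V] by (auto simp: forms_def)

lemma prod_update_other:
  fixes f :: "nat \<Rightarrow> 'a::comm_monoid_mult"
  assumes "finite S" "p \<in> S"
  shows "(\<Prod>j\<in>S. (f(p := x)) j) = x * (\<Prod>j\<in>S - {p}. f j)"
  using assms by (simp add: prod.remove[of S p])

lemma degX_dvd_split: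
  fixes A B q C :: ures
  assumes "C = A * B * q" "C \<noteq> 0"
  shows "degX X C = degX X A + degX X B + degX X q"
  using assms degX_mult[of "A * B" q X] degX_mult[of A B X] by auto

text \<open>The upper bound is Macaulay's, the lower one comes by induction on the sum of the
  degrees: when a form is specialized to a product of one of degree \<open>ds p - 1\<close> and a
  linear one, the degrees of the two resultants that divide the outcome add up to the wanted
  product. If all forms are linear, positivity and the upper bound 1 suffice.\<close>

theorem degX_uresultant:
  assumes "forms V ds" "i \<in> V"
  shows "degX (xvars i) (uresultant V ds) = (\<Prod>j\<in>V - {i}. ds j)"
  using assms
proof (induction "sum ds V" arbitrary: ds i rule: less_induct)
  case less
  interpret F: forms V ds by fact
  note fin = F.finite_V
  show ?case
  proof (cases "\<forall>j\<in>V. ds j = 1")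
    case True
    then show ?thesis
      using F.degX_uresultant_le[OF less.prems(2)] F.degX_uresultant_pos[OF less.prems(2)] by simp
  next
    case False
    then obtain p where p: "p \<in> V" "ds p \<noteq> 1" by blast
    define a where "a = ds p - 1"
    have a: "a > 0" "ds p = a + 1" using p F.ds_pos[OF p(1)] by (auto simp: a_def)
    obtain s where s: "s \<notin> V" using forms_fresh[OF less.prems(1)] by blast
    define A where "A = uresultant V (ds(p := a))"
    define B where "B = Res V (ds(p := 1)) ((gforms V ds)(p := gform V 1 s))"
    define C where "C = Res V ds ((gforms V ds)(p := gform V a p * gform V 1 s))"
    have "0 < (1::nat)" by simp
    note M = Res_mult_cofactor[OF less.prems(1) p(1) a(1) this a(2) s C_def A_def B_def]
    from M(1) obtain q where q: "C = A * B * q" "C \<noteq> 0" by blast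
    have sm: "sum (ds(p := x)) V < sum ds V" if "x < ds p" for x
      using fin p(1) that by (intro sum_strict_mono_ex1) auto
    have IH: "degX (xvars j) (uresultant V (ds(p := x))) = (\<Prod>l\<in>V - {j}. (ds(p := x)) l)"
      if "x < ds p" "x > 0" "j \<in> V" for x j
      by (rule less.hyps[OF sm[OF that(1)] forms_update[OF less.prems(1) that(2)] that(3)])
    have "(\<Prod>j\<in>V - {i}. ds j) \<le> degX (xvars i) C"
    proof (cases "i = p")
      case True
      have "degX (xvars i) A = (\<Prod>l\<in>V - {p}. (ds(p := a)) l)"
        unfolding A_def True by (rule IH) (use a p in auto)
      also have "\<dots> = (\<Prod>j\<in>V - {i}. ds j)" unfolding True by (intro prod.cong) auto
      finally show ?thesis using degX_dvd_split[OF q, of "xvars i"] by simp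
    next
      case False
      have "degX (xvars i) A = (\<Prod>l\<in>V - {i}. (ds(p := a)) l)"
        unfolding A_def by (rule IH) (use a less.prems in auto)
      moreover have "degX (xvars i) B \<ge> (\<Prod>l\<in>V - {i}. (ds(p := 1)) l)"
        using M(2)[of i] IH[of 1 i] a less.prems(2) False by simp
      moreover have "p \<in> V - {i}" "finite (V - {i})" using False p fin by auto
      ultimately have "(a + 1) * (\<Prod>j\<in>V - {i} - {p}. ds j) \<le> degX (xvars i) A + degX (xvars i) B"
        using prod_update_other[of "V - {i}" p ds a] prod_update_other[of "V - {i}" p ds 1] by simp
      moreover have "(\<Prod>j\<in>V - {i}. ds j) = (a + 1) * (\<Prod>j\<in>V - {i} - {p}. ds j)"
        using \<open>p \<in> V - {i}\<close> \<open>finite (V - {i})\<close> a by (simp add: prod.remove[of "V - {i}" p])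
      ultimately show ?thesis using degX_dvd_split[OF q, of "xvars i"] by simp
    qed
    then show ?thesis
      using M(4)[OF less.prems(2)] F.degX_uresultant_le[OF less.prems(2)] by simp
  qed
qed

lemma spec_mult:
  fixes G :: "nat \<Rightarrow> (nat, 'a::comm_ring_1) mpoly"
  assumes F: "forms V ds" and i: "i \<in> V" and ab: "a > 0" "b > 0" "ds i = a + b" and s: "s \<notin> V"
    and G: "\<And>k. k \<in> V - {i} \<Longrightarrow> is_form V (ds k) (G k)" "is_form V a (G i)" "is_form V b (G s)"
  shows "spec G (Res V ds ((gforms V ds)(i := gform V a i * gform V b s))) = Res V ds (G(i := G i * G s))"
    and "spec G (uresultant V (ds(i := a))) = Res V (ds(i := a)) G"
    and "spec G (Res V (ds(i := b)) ((gforms V ds)(i := gform V b s))) = Res V (ds(i := b)) (G(i := G s))"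
proof -
  interpret F: forms V ds by fact
  interpret FB: forms V "ds(i := b)" by (rule forms_update[OF F ab(2)])
  interpret mc: comm_ring_hom "map_coef (spec G)" by (rule comm_ring_hom_map_coef[OF comm_ring_hom_spec])
  note fin = F.finite_V
  have g: "map_coef (spec G) (gforms V ds k) = G k" if "k \<in> V - {i}" for k
    using map_coef_spec_gform[where g = G, OF fin G(1)[OF that]] .
  have ga: "map_coef (spec G) (gform V a i) = G i" "map_coef (spec G) (gform V b s) = G s"
    using map_coef_spec_gform[where g = G, OF fin G(2)] map_coef_spec_gform[where g = G, OF fin G(3)] by auto
  show "spec G (Res V ds ((gforms V ds)(i := gform V a i * gform V b s))) = Res V ds (G(i := G i * G s))"
    unfolding F.Res_map_coef[OF comm_ring_hom_spec]
    by (rule F.Res_cong) (auto simp: g ga mc.hom_mult)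
  show "spec G (uresultant V (ds(i := a))) = Res V (ds(i := a)) G"
    by (simp add: Res_eq_spec)
  show "spec G (Res V (ds(i := b)) ((gforms V ds)(i := gform V b s))) = Res V (ds(i := b)) (G(i := G s))"
    unfolding FB.Res_map_coef[OF comm_ring_hom_spec]
    by (rule FB.Res_cong) (auto simp: g ga)
qed

text \<open>With the degrees known, the cofactor q of \<open>Res_mult_cofactor\<close> has degree 0
  in every group of coefficients, that of the second factor with label s included, so q is an
  integer.\<close>

theorem Res_mult:
  fixes g :: "nat \<Rightarrow> (nat, 'a::comm_ring_1) mpoly"
  assumes F: "forms V ds" and i: "i \<in> V" and ab: "a > 0" "b > 0" "ds i = a + b"
    and g: "\<And>k. k \<in> V - {i} \<Longrightarrow> is_form V (ds k) (g k)" and p: "is_form V a p" "is_form V b p'"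
  shows "Res V ds (g(i := p * p')) = Res V (ds(i := a)) (g(i := p)) * Res V (ds(i := b)) (g(i := p'))"
proof -
  interpret F: forms V ds by fact
  interpret FA: forms V "ds(i := a)" by (rule forms_update[OF F ab(1)])
  interpret FB: forms V "ds(i := b)" by (rule forms_update[OF F ab(2)])
  note fin = F.finite_V
  obtain s where s: "s \<notin> V" using forms_fresh[OF F] by blast
  have si: "s \<noteq> i" using s i by auto
  define A where "A = uresultant V (ds(i := a))"
  define B where "B = Res V (ds(i := b)) ((gforms V ds)(i := gform V b s))"
  define C where "C = Res V ds ((gforms V ds)(i := gform V a i * gform V b s))"
  note M = Res_mult_cofactor[OF F i ab s C_def A_def B_def]
  from M(1) obtain q where q: "C = A * B * q" "C \<noteq> 0" by blast
  define W where "W = (\<Union>k\<in>insert s V. xvars k)"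
  have "C \<in> polys W"
    unfolding C_def
  proof (rule F.Res_polys)
    fix k \<alpha> assume k: "k \<in> V"
    have xv: "xvars k \<subseteq> W" if "k \<in> insert s V" for k using that by (auto simp: W_def)
    have c: "coef (gform V l k) \<alpha> \<in> polys W" if "k \<in> insert s V" for l k \<alpha>
      using polys_mono[OF coef_gform_mem[OF fin] xv[OF that]] .
    show "coef (((gforms V ds)(i := gform V a i * gform V b s)) k) \<alpha> \<in> polys W"
    proof (cases "k = i")
      case True
      have "coef (gform V a i * gform V b s) \<alpha> \<in> polys W"
        unfolding coef_gform_mult
      proof (intro polys_sum)
        fix \<beta> \<gamma>
        have "(i, \<beta>) \<in> W" "(s, \<gamma>) \<in> W" using i by (auto simp: W_def xvars_def)
        then show "mvar (i, \<beta>) * mvar (s, \<gamma>) * (if \<beta> + \<gamma> = \<alpha> then 1 else 0) \<in> (polys W :: ures set)"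
          by (simp add: polys_mult polys_mvar)
      qed
      then show ?thesis using True by simp
    qed (use k c in auto)
  qed
  then have CW: "degX (- W) C = 0" by (simp add: degX_eq_0_iff)
  have qW: "q \<in> polys W"
    using degX_dvd_split[OF q, of "- W"] CW by (simp add: degX_eq_0_iff)
  have dA: "degX (xvars k) A = (\<Prod>l\<in>V - {k}. (ds(i := a)) l)" if "k \<in> V" for k
    unfolding A_def by (rule degX_uresultant[OF FA.forms_axioms that])
  have dR: "degX (xvars k) (uresultant V ds) = (\<Prod>l\<in>V - {k}. ds l)" if "k \<in> V" for k
    by (rule degX_uresultant[OF F that])
  have dB: "degX (xvars k) (uresultant V (ds(i := b))) = (\<Prod>l\<in>V - {k}. (ds(i := b)) l)" if "k \<in> V" for k
    by (rule degX_uresultant[OF FB.forms_axioms that])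
  have same: "(\<Prod>l\<in>V - {i}. (ds(i := x)) l) = (\<Prod>l\<in>V - {i}. ds l)" for x by (intro prod.cong) auto
  have "degX (xvars k) q = 0" if k: "k \<in> insert s V" for k
  proof -
    consider "k = s" | "k = i" | "k \<in> V - {i}" using k by blast
    then show ?thesis
    proof cases
      case 1
      then show ?thesis
        using degX_dvd_split[OF q, of "xvars s"] M(3) M(5) dR[OF i] dB[OF i] same[of b] by simp
    next
      case 2
      then show ?thesis
        using degX_dvd_split[OF q, of "xvars i"] M(4)[OF i] dR[OF i] dA[OF i] same[of a] by simp
    next
      case 3
      then have ik: "i \<in> V - {k}" "finite (V - {k})" using i fin by auto
      have "(\<Prod>j\<in>V - {k}. ds j) = (a + b) * (\<Prod>j\<in>V - {k} - {i}. ds j)"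
        using ik ab by (simp add: prod.remove[of "V - {k}" i])
      moreover have "k \<in> V" using 3 by simp
      ultimately show ?thesis
        using degX_dvd_split[OF q, of "xvars k"] M(4)[of k] M(2)[OF 3] dR[of k] dA[of k] dB[of k]
          prod_update_other[OF ik(2,1), of ds a] prod_update_other[OF ik(2,1), of ds b]
        by (simp add: add_mult_distrib)
    qed
  qed
  from const_of_degX[OF this qW[unfolded W_def]] obtain c where c: "q = of_int c" by auto
  have spec_q: "Res V ds (G(i := G i * G s)) = Res V (ds(i := a)) G * Res V (ds(i := b)) (G(i := G s)) * of_int c"
    if "\<And>k. k \<in> V - {i} \<Longrightarrow> is_form V (ds k) (G k)" "is_form V a (G i)" "is_form V b (G s)"
    for G :: "nat \<Rightarrow> (nat, 'c::comm_ring_1) mpoly"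
  proof -
    interpret m: comm_ring_hom "spec G" by (rule comm_ring_hom_spec)
    have "spec G C = spec G A * spec G B * of_int c" unfolding q(1) c by (simp add: m.hom_mult m.hom_of_int)
    then show ?thesis using spec_mult[OF F i ab s that] unfolding A_def B_def C_def by simp
  qed
  \<comment> \<open>At powers of the variables all three resultants are 1.\<close>
  have "c = 1"
  proof -
    define P :: "nat \<Rightarrow> (nat, int) mpoly" where
      "P k = (if k = s then mvar i ^ b else if k = i then mvar i ^ a else mvar k ^ ds k)" for k
    have "Res V ds (P(i := P i * P s)) = Res V ds (\<lambda>k. mvar k ^ ds k)"
      by (rule F.Res_cong) (use s si ab in \<open>auto simp: P_def power_add\<close>)
    moreover have "Res V (ds(i := a)) P = Res V (ds(i := a)) (\<lambda>k. mvar k ^ (ds(i := a)) k)"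
      by (rule FA.Res_cong) (use s si in \<open>auto simp: P_def\<close>)
    moreover have "Res V (ds(i := b)) (P(i := P s)) = Res V (ds(i := b)) (\<lambda>k. mvar k ^ (ds(i := b)) k)"
      by (rule FB.Res_cong) (use s si in \<open>auto simp: P_def\<close>)
    moreover have "is_form V (ds k) (P k)" if "k \<in> V - {i}" for k
    proof -
      have "P k = mvar k ^ ds k" using that s by (auto simp: P_def)
      then show ?thesis using that by (simp add: is_form_mvar_power)
    qed
    moreover have "is_form V a (P i)" "is_form V b (P s)"
      using si i by (auto simp: P_def is_form_mvar_power)
    ultimately show ?thesis
      using spec_q[of P] unfolding F.Res_powers FA.Res_powers FB.Res_powers by simp
  qed
  define G where "G = g(i := p, s := p')"
  have "Res V ds (G(i := G i * G s)) = Res V (ds(i := a)) G * Res V (ds(i := b)) (G(i := G s)) * of_int c"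
    by (rule spec_q) (use g p s si in \<open>auto simp: G_def\<close>)
  moreover have "Res V ds (G(i := G i * G s)) = Res V ds (g(i := p * p'))"
    by (rule F.Res_cong) (use s si in \<open>auto simp: G_def\<close>)
  moreover have "Res V (ds(i := a)) G = Res V (ds(i := a)) (g(i := p))"
    by (rule FA.Res_cong) (use s si in \<open>auto simp: G_def\<close>)
  moreover have "Res V (ds(i := b)) (G(i := G s)) = Res V (ds(i := b)) (g(i := p'))"
    by (rule FB.Res_cong) (use s si in \<open>auto simp: G_def\<close>)
  ultimately show ?thesis using \<open>c = 1\<close> by simp
qed

section \<open>Homogeneity in the coefficients of each form\<close>

lemma mon_eval_scale:
  "mon_eval (\<lambda>v. if v \<in> X then c * \<phi> v else \<phi> v) \<alpha> = c ^ wt X \<alpha> * mon_eval \<phi> \<alpha>"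
proof -
  have "(if v \<in> X then c * \<phi> v else \<phi> v) ^ n = c ^ (if v \<in> X then n else 0) * \<phi> v ^ n" for v n
    by (simp add: power_mult_distrib)
  then show ?thesis unfolding mon_eval_def wt_def by (simp add: prod.distrib power_sum)
qed

lemma comm_ring_hom_scale_at: "comm_ring_hom (\<lambda>p. poly (scale_vars X p) c)"
  by (rule comm_ring_hom_comp[OF comm_ring_hom_poly comm_ring_hom_scale_vars])

lemma coef_scale_at_int:
  "coef (poly (scale_vars X p) (of_int c)) \<alpha> = of_int c ^ wt X \<alpha> * coef p \<alpha>"
  for p :: "('i, 'a::comm_ring_1) mpoly"
proof -
  interpret h: comm_ring_hom "\<lambda>p :: ('i, 'a) mpoly. poly (scale_vars X p) (of_int c)" by (rule comm_ring_hom_scale_at)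
  show ?thesis
  proof (induction p rule: poly_mapping_induct)
    case (single a d)
    have "(of_int c :: ('i, 'a) mpoly) ^ k = mconst (of_int c ^ k)" for k
      by (metis mconst_of_int of_int_power)
    then show ?case by (simp add: scale_vars_psingle poly_monom mult.commute[of "psingle _ _"] coef_mconst_mult lookup_single when_def)
  qed (auto simp: h.hom_add lookup_add distrib_left)
qed

text \<open>Doubling the i-th form yields a multiple of the resultant of no larger degrees, hence an
  integer multiple. As every monomial is multiplied by 2 to the power of its weight, all weights
  agree, and they equal the degree.\<close>

lemma uresultant_wt:
  assumes F: "forms V ds" and i: "i \<in> V" and a: "\<alpha> \<in> supp (uresultant V ds)"
  shows "wt (xvars i) \<alpha> = (\<Prod>j\<in>V - {i}. ds j)"
proof -
  interpret F: forms V ds by fact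
  note fin = F.finite_V
  define R where "R = uresultant V ds"
  define r where "r = Res V ds ((gforms V ds)(i := mconst 2 * gforms V ds i))"
  have two: "(2 :: ures) = mconst 2" by (simp add: mconst_int)
  have r_eq: "r = poly (scale_vars (xvars i) R) (of_int 2)"
  proof -
    interpret h: comm_ring_hom "\<lambda>p :: ures. poly (scale_vars (xvars i) p) (of_int 2)" by (rule comm_ring_hom_scale_at)
    have "(\<lambda>p :: ures. poly (scale_vars (xvars i) p) (of_int 2)) (Res V ds (gforms V ds)) = r"
      unfolding r_def
    proof (rule F.Res_hom[OF comm_ring_hom_scale_at])
      fix k \<alpha> assume k: "k \<in> V" "\<alpha> \<in> monoms V (ds k)"
      show "coef (((gforms V ds)(i := mconst 2 * gforms V ds i)) k) \<alpha> = poly (scale_vars (xvars i) (coef (gforms V ds k) \<alpha>)) (of_int 2)"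
        using k fin by (auto simp: coef_gform coef_mconst_mult scale_vars_mvar xvars_def)
    qed
    then show ?thesis by (simp add: F.Res_gforms R_def)
  qed
  have rc: "coef r \<alpha> = 2 ^ wt (xvars i) \<alpha> * coef R \<alpha>" for \<alpha>
    unfolding r_eq coef_scale_at_int by simp
  have R0: "R \<noteq> 0" unfolding R_def by (rule F.uresultant_nonzero)
  have "R dvd r"
    unfolding r_def R_def F.Res_gforms[symmetric]
    by (rule Res_dvd_diag[OF F F i, where k = 0]) (auto simp: is_form_gform)
  then obtain q where q: "r = R * q" by blast
  have r0: "r \<noteq> 0"
  proof
    assume "r = 0"
    then have "coef R \<alpha> = 0" for \<alpha> using rc[of \<alpha>] by simp
    then show False using R0 by (auto intro: poly_mapping_eqI)
  qed
  then have deg: "degX X r = degX X R + degX X q" for X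
    using q degX_mult[of R q X] by auto
  have cf: "coef (((gforms V ds)(i := mconst 2 * gforms V ds i)) k) \<alpha> = (if k = i then 2 else 1) * coef (gforms V ds k) \<alpha>" for k \<alpha>
    by (simp add: coef_mconst_mult)
  have dc: "degX Y (coef (((gforms V ds)(i := mconst 2 * gforms V ds i)) k) \<alpha>) \<le> degX Y (coef (gforms V ds k) \<alpha>)" for Y k \<alpha>
    unfolding cf using degX_mult_le[of Y 2 "coef (gforms V ds k) \<alpha>"] by (auto simp: two)
  have "degX (xvars k) q = 0" if k: "k \<in> V" for k
  proof -
    have "degX (xvars k) r \<le> degX (xvars k) R"
      unfolding r_def R_def
    proof (rule F.degX_Res_le[OF k])
      show "degX (xvars k) (coef (((gforms V ds)(i := mconst 2 * gforms V ds i)) k) \<alpha>) \<le> 1" for \<alpha>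
        using dc[of "xvars k" k \<alpha>] degX_coef_gform[OF fin, of "xvars k" "ds k" k \<alpha>] by (auto split: if_splits)
      show "degX (xvars k) (coef (((gforms V ds)(i := mconst 2 * gforms V ds i)) l) \<alpha>) = 0" if "l \<in> V - {k}" for l \<alpha>
        using dc[of "xvars k" l \<alpha>] degX_coef_gform[OF fin, of "xvars k" "ds l" l \<alpha>] xvars_disjoint[of l k] that by auto
    qed
    then show ?thesis using deg[of "xvars k"] by simp
  qed
  moreover have "q \<in> polys (\<Union>k\<in>V. xvars k)"
  proof -
    have "r \<in> polys (\<Union>k\<in>V. xvars k)"
      unfolding r_def
    proof (rule F.Res_polys)
      fix k \<alpha> assume k: "k \<in> V"
      have "coef (gforms V ds k) \<alpha> \<in> polys (\<Union>k\<in>V. xvars k)"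
        by (rule polys_mono[OF coef_gform_mem[OF fin]]) (use k in auto)
      then show "coef (((gforms V ds)(i := mconst 2 * gforms V ds i)) k) \<alpha> \<in> polys (\<Union>k\<in>V. xvars k)"
        unfolding cf by (intro polys_mult) (auto simp: two)
    qed
    then show ?thesis using deg[of "- (\<Union>k\<in>V. xvars k)"] by (auto simp: degX_eq_0_iff[of "- (\<Union>k\<in>V. xvars k)", simplified, symmetric])
  qed
  ultimately obtain c where c: "q = of_int c" using const_of_degX by blast
  have wtc: "(2 :: int) ^ wt (xvars i) \<alpha> = c" if "\<alpha> \<in> supp R" for \<alpha>
  proof -
    have "coef r \<alpha> = c * coef R \<alpha>"
      using coef_mconst_mult[of c R \<alpha>] by (simp add: q c mconst_int mult.commute)
    then show ?thesis using rc[of \<alpha>] that by (simp add: in_keys_iff)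
  qed
  have all: "wt (xvars i) \<beta> = wt (xvars i) \<alpha>" if "\<beta> \<in> supp R" for \<beta>
    using wtc[OF that] wtc[OF a[folded R_def]] by (metis power_inject_exp one_less_numeral_iff semiring_norm(76))
  have "degX (xvars i) R \<le> wt (xvars i) \<alpha>" by (rule degX_leI) (simp add: all)
  moreover have "wt (xvars i) \<alpha> \<le> degX (xvars i) R" by (rule wt_le_degX) (use a R_def in simp)
  ultimately show ?thesis using degX_uresultant[OF F i] by (simp add: R_def)
qed

theorem Res_scale:
  fixes g :: "nat \<Rightarrow> (nat, 'a::comm_ring_1) mpoly"
  assumes F: "forms V ds" and i: "i \<in> V"
  shows "Res V ds (g(i := mconst c * g i)) = c ^ (\<Prod>j\<in>V - {i}. ds j) * Res V ds g"
proof -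
  have "(\<lambda>(k, \<alpha>). coef ((g(i := mconst c * g i)) k) \<alpha>) =
      (\<lambda>v. if v \<in> xvars i then c * (\<lambda>(k, \<alpha>). coef (g k) \<alpha>) v else (\<lambda>(k, \<alpha>). coef (g k) \<alpha>) v)"
    by (auto simp: fun_eq_iff xvars_def coef_mconst_mult)
  then have "Res V ds (g(i := mconst c * g i)) = (\<Sum>\<alpha>\<in>supp (uresultant V ds). of_int (coef (uresultant V ds) \<alpha>) *
      (c ^ wt (xvars i) \<alpha> * mon_eval (\<lambda>(k, \<alpha>). coef (g k) \<alpha>) \<alpha>))"
    unfolding Res_def meval_def mon_eval_def[symmetric] by (simp only: mon_eval_scale)
  also have "\<dots> = (\<Sum>\<alpha>\<in>supp (uresultant V ds). c ^ (\<Prod>j\<in>V - {i}. ds j) * (of_int (coef (uresultant V ds) \<alpha>) *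
      mon_eval (\<lambda>(k, \<alpha>). coef (g k) \<alpha>) \<alpha>))"
    by (intro sum.cong refl) (simp add: uresultant_wt[OF F i] mult_ac)
  also have "\<dots> = c ^ (\<Prod>j\<in>V - {i}. ds j) * Res V ds g"
    unfolding Res_def meval_def mon_eval_def[symmetric] by (simp add: sum_distrib_left)
  finally show ?thesis .
qed

section \<open>Adding multiples of a form and exchanging two forms\<close>

lemma unit_eq_1:
  fixes q :: ures and \<nu> :: "ures \<Rightarrow> int"
  assumes "q dvd 1" "comm_ring_hom \<nu>" "\<nu> q = 1"
  shows "q = 1"
proof -
  interpret h: comm_ring_hom \<nu> by fact
  show ?thesis using assms(1,3) by (elim unit_is_const) (auto simp: mconst_int h.hom_uminus h.hom_of_int)
qed

lemma mutual_dvd_cofactor: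
  fixes r R :: "'a::idom"
  assumes "r dvd R" "R dvd r" "R \<noteq> 0"
  obtains q where "r = R * q" "q dvd 1"
proof -
  obtain q p where q: "r = R * q" "R = r * p" using assms by blast
  then have "R * 1 = R * (q * p)" by (simp add: mult.assoc[symmetric])
  then have "1 = q * p" using assms(3) unfolding mult_cancel_left by blast
  then show ?thesis using q(1) that by (metis dvd_triv_left)
qed

text \<open>Both systems generate the same ideal, so for generic forms and multipliers the two
  resultants divide each other and differ by a unit. Setting the multipliers to zero and the forms
  to powers shows that the unit is 1.\<close>

theorem Res_add_multiple:
  fixes g :: "nat \<Rightarrow> (nat, 'a::comm_ring_1) mpoly"
  assumes F: "forms V ds" and i: "i \<in> V"
    and g: "\<And>k. k \<in> V \<Longrightarrow> is_form V (ds k) (g k)"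
    and h: "\<And>k. k \<in> V - {i} \<Longrightarrow> is_form V (ds k - ds i) (h k)"
    and h0: "\<And>k. k \<in> V - {i} \<Longrightarrow> ds k < ds i \<Longrightarrow> h k = 0"
  shows "Res V ds (\<lambda>k. if k = i then g i else g k + h k * g i) = Res V ds g"
proof -
  interpret F: forms V ds by fact
  note fin = F.finite_V
  \<comment> \<open>The generic multipliers get the labels s + k, all outside V.\<close>
  define s where "s = Suc (Max V)"
  have s: "j < s" if "j \<in> V" for j using that fin by (simp add: s_def less_Suc_eq_le)
  define H where "H k = (if ds k < ds i \<or> k = i then 0 else gform V (ds k - ds i) (s + k))" for k
  define f where "f k = gforms V ds k + H k * gforms V ds i" for k
  have Hform: "is_form V (ds k - ds i) (H k)" for k by (auto simp: H_def is_form_gform)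
  have fform: "is_form V (ds k) (f k)" for k
  proof -
    have "is_form V (ds k) (H k * gforms V ds i)"
    proof (cases "ds k < ds i \<or> k = i")
      case False
      then show ?thesis using is_form_mult[OF Hform[of k] is_form_gform[of V "ds i" i]] by simp
    qed (simp add: H_def)
    then show ?thesis unfolding f_def by (intro is_form_add is_form_gform)
  qed
  define R where "R = uresultant V ds"
  define r where "r = Res V ds f"
  have comb: "(\<Sum>j\<in>V. (if j = k then 1 else if j = i then x else 0) * u j) = (if k = i then u k else u k + x * u i)"
    if "k \<in> V" for k x and u :: "nat \<Rightarrow> (nat, ures) mpoly"
  proof -
    have "(\<Sum>j\<in>V. (if j = k then 1 else if j = i then x else 0) * u j) =
        (\<Sum>j\<in>V. (if j = k then u j else 0) + (if j = i then if j = k then 0 else x * u j else 0))"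
      by (intro sum.cong) auto
    then show ?thesis using that i fin by (simp add: sum.distrib)
  qed
  have fH: "is_form V (ds k - ds j) (if j = k then 1 else if j = i then x else 0)"
    if "is_form V (ds k - ds i) x" for k j and x :: "(nat, ures) mpoly"
    using that by auto
  have "Res V ds (gforms V ds) dvd Res V ds f"
  proof (rule Res_dvd[OF F F is_form_gform, where h = "\<lambda>k j. if j = k then 1 else if j = i then H k else 0"])
    fix k assume k: "k \<in> V"
    show "f k = (\<Sum>j\<in>V. (if j = k then 1 else if j = i then H k else 0) * gforms V ds j)"
      using comb[OF k, of "H k" "gforms V ds"] by (auto simp: f_def H_def)
  qed (auto simp: Hform, auto simp: H_def)
  moreover have "Res V ds f dvd Res V ds (gforms V ds)"
  proof (rule Res_dvd[OF F F fform, where h = "\<lambda>k j. if j = k then 1 else if j = i then - H k else 0"])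
    fix k assume k: "k \<in> V"
    have "f i = gforms V ds i" by (simp add: f_def H_def)
    then show "gforms V ds k = (\<Sum>j\<in>V. (if j = k then 1 else if j = i then - H k else 0) * f j)"
      using comb[OF k, of "- H k" f] by (auto simp: f_def)
  qed (auto simp: Hform is_form_uminus, auto simp: H_def)
  ultimately obtain q where q: "r = R * q" "q dvd 1"
    using mutual_dvd_cofactor[of r R] F.uresultant_nonzero unfolding r_def R_def F.Res_gforms by blast
  have sp: "spec G r = Res V ds (\<lambda>k. if k = i then G i else G k + G (s + k) * G i)"
    if G: "\<And>k. k \<in> V \<Longrightarrow> is_form V (ds k) (G k)" "\<And>k. k \<in> V - {i} \<Longrightarrow> is_form V (ds k - ds i) (G (s + k))"
      "\<And>k. k \<in> V - {i} \<Longrightarrow> ds k < ds i \<Longrightarrow> G (s + k) = 0"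
    for G :: "nat \<Rightarrow> (nat, 'c::comm_ring_1) mpoly"
    unfolding r_def F.Res_map_coef[OF comm_ring_hom_spec]
  proof (rule F.Res_cong)
    fix k assume k: "k \<in> V"
    interpret mc: comm_ring_hom "map_coef (spec G)" by (rule comm_ring_hom_map_coef[OF comm_ring_hom_spec])
    have gk: "map_coef (spec G) (gforms V ds k) = G k" if "k \<in> V" for k
      by (rule map_coef_spec_gform[where g = G, OF fin G(1)[OF that]])
    have "map_coef (spec G) (H k) = (if k = i then 0 else G (s + k))"
      using map_coef_spec_gform[where g = G, OF fin G(2)[of k]] G(3)[of k] k by (auto simp: H_def)
    then show "map_coef (spec G) (f k) = (if k = i then G i else G k + G (s + k) * G i)"
      using k i by (simp add: f_def mc.hom_add mc.hom_mult gk)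
  qed
  have "q = 1"
  proof (rule unit_eq_1[OF q(2) comm_ring_hom_spec])
    define P :: "nat \<Rightarrow> (nat, int) mpoly" where "P k = (if k \<in> V then mvar k ^ ds k else 0)" for k
    interpret m: comm_ring_hom "spec P" by (rule comm_ring_hom_spec)
    have "s + k \<notin> V" for k using s by fastforce
    then have P0: "P (s + k) = 0" for k by (simp add: P_def)
    have "spec P r = Res V ds (\<lambda>k. if k = i then P i else P k + P (s + k) * P i)"
      by (rule sp) (auto simp: P0, auto simp: P_def is_form_mvar_power)
    also have "\<dots> = Res V ds (\<lambda>k. mvar k ^ ds k)"
      by (rule F.Res_cong) (auto simp: P0, auto simp: P_def)
    finally have "spec P r = 1" by (simp add: F.Res_powers)
    moreover have "spec P R = Res V ds (\<lambda>k. mvar k ^ ds k)"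
      unfolding R_def Res_eq_spec[symmetric] by (rule F.Res_cong) (auto simp: P_def)
    ultimately show "spec P q = 1" using arg_cong[OF q(1), of "spec P"] by (simp add: m.hom_mult F.Res_powers)
  qed
  then have rR: "r = R" using q by simp
  define G where "G k = (if k < s then g k else h (k - s))" for k
  have Gh: "G (s + k) = h k" for k by (simp add: G_def)
  have Gg: "G k = g k" if "k \<in> V" for k using s[OF that] by (simp add: G_def)
  have "spec G r = Res V ds (\<lambda>k. if k = i then G i else G k + G (s + k) * G i)"
    by (rule sp) (auto simp: Gh Gg g h h0)
  also have "\<dots> = Res V ds (\<lambda>k. if k = i then g i else g k + h k * g i)"
    by (rule F.Res_cong) (auto simp: Gh Gg i)
  finally have "spec G r = Res V ds (\<lambda>k. if k = i then g i else g k + h k * g i)" .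
  moreover have "spec G R = Res V ds g"
    unfolding R_def Res_eq_spec[symmetric] by (rule F.Res_cong) (simp add: Gg)
  ultimately show ?thesis using rR by simp
qed

lemma map_coef_is_form_spec:
  "forms V ds \<Longrightarrow> (\<And>k. k \<in> V \<Longrightarrow> is_form V (ds k) (g k)) \<Longrightarrow> k \<in> V \<Longrightarrow> map_coef (spec g) (gforms V ds k) = g k"
  by (rule map_coef_spec_gform) (auto simp: forms_def)

text \<open>The permuted system generates the same ideal, which determines the resultant up to a
  sign; this sign depends on V, the degrees and the two positions alone.\<close>

lemma Res_swap_sign:
  assumes F: "forms V ds" and ab: "a \<in> V" "b \<in> V"
  obtains e :: int where "e = 1 \<or> e = -1"
    "Res V (ds \<circ> transpose a b) (gforms V ds \<circ> transpose a b) = of_int e * uresultant V ds"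
proof -
  interpret F: forms V ds by fact
  define \<tau> where "\<tau> = transpose a b"
  have t: "\<tau> k \<in> V" if "k \<in> V" for k using that ab by (auto simp: \<tau>_def transpose_def)
  have tt: "\<tau> (\<tau> k) = k" for k by (simp add: \<tau>_def)
  have F': "forms V (ds \<circ> \<tau>)" using F t by (auto simp: forms_def)
  have d1: "Res V ds (gforms V ds) dvd Res V (ds \<circ> \<tau>) (gforms V ds \<circ> \<tau>)"
  proof (rule Res_dvd[OF F F' is_form_gform, where h = "\<lambda>k j. if j = \<tau> k then 1 else 0"])
    fix k assume "k \<in> V"
    then show "(gforms V ds \<circ> \<tau>) k = (\<Sum>j\<in>V. (if j = \<tau> k then 1 else 0) * gforms V ds j)"
      using t F.finite_V by (auto simp: if_distrib[of "\<lambda>x. x * _"] cong: if_cong)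
  qed auto
  have d2: "Res V (ds \<circ> \<tau>) (gforms V ds \<circ> \<tau>) dvd Res V ds (gforms V ds)"
  proof (rule Res_dvd[OF F' F, where h = "\<lambda>k j. if j = \<tau> k then 1 else 0"])
    fix k assume "k \<in> V"
    then show "gforms V ds k = (\<Sum>j\<in>V. (if j = \<tau> k then 1 else 0) * (gforms V ds \<circ> \<tau>) j)"
      using t F.finite_V by (auto simp: if_distrib[of "\<lambda>x. x * _"] tt cong: if_cong)
  qed (auto simp: is_form_gform tt)
  obtain q where q: "Res V (ds \<circ> \<tau>) (gforms V ds \<circ> \<tau>) = uresultant V ds * q" "q dvd 1"
    using mutual_dvd_cofactor[OF d2 d1] F.uresultant_nonzero unfolding F.Res_gforms by blast
  from unit_is_const[OF q(2)] obtain c where "q = mconst c" "c = 1 \<or> c = -1" by blast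
  then show ?thesis using that[of c] q(1) by (simp add: \<tau>_def mconst_int mult.commute)
qed

lemma Res_swap_sign_spec:
  fixes g :: "nat \<Rightarrow> (nat, 'a::comm_ring_1) mpoly"
  assumes F: "forms V ds" and ab: "a \<in> V" "b \<in> V"
    and e: "Res V (ds \<circ> transpose a b) (gforms V ds \<circ> transpose a b) = of_int e * uresultant V ds"
    and g: "\<And>k. k \<in> V \<Longrightarrow> is_form V (ds k) (g k)"
  shows "Res V (ds \<circ> transpose a b) (g \<circ> transpose a b) = of_int e * Res V ds g"
proof -
  interpret F: forms V ds by fact
  have t: "transpose a b k \<in> V" if "k \<in> V" for k using that ab by (auto simp: transpose_def)
  interpret F': forms V "ds \<circ> transpose a b" using F t by (auto simp: forms_def)
  interpret m: comm_ring_hom "spec g" by (rule comm_ring_hom_spec)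
  have "spec g (Res V (ds \<circ> transpose a b) (gforms V ds \<circ> transpose a b)) = Res V (ds \<circ> transpose a b) (g \<circ> transpose a b)"
    unfolding F'.Res_map_coef[OF comm_ring_hom_spec]
    by (rule F'.Res_cong) (simp add: map_coef_is_form_spec[OF F g] t)
  then show ?thesis unfolding e m.hom_mult m.hom_of_int Res_eq_spec[of V ds g] by simp
qed

text \<open>The sign can be computed at powers of the variables. There x_a ^ (2 m) is a product of
  two equal factors, so by multiplicativity the sign is the square of a sign that belongs to smaller
  degrees.\<close>

theorem Res_swap:
  fixes g :: "nat \<Rightarrow> (nat, 'a::comm_ring_1) mpoly"
  assumes F: "forms V ds" and ab: "a \<in> V" "b \<in> V" "a \<noteq> b" and ev: "even (ds a)"
    and g: "\<And>k. k \<in> V \<Longrightarrow> is_form V (ds k) (g k)"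
  shows "Res V (ds \<circ> transpose a b) (g \<circ> transpose a b) = Res V ds g"
proof -
  interpret F: forms V ds by fact
  define \<tau> where "\<tau> = transpose a b"
  have t: "\<tau> k \<in> V" if "k \<in> V" for k using that ab by (auto simp: \<tau>_def transpose_def)
  have tsimp: "\<tau> a = b" "\<tau> b = a" "\<And>k. k \<noteq> a \<Longrightarrow> k \<noteq> b \<Longrightarrow> \<tau> k = k"
    using ab by (auto simp: \<tau>_def)
  obtain m where m: "ds a = m + m" using ev by (metis evenE mult_2)
  have m0: "m > 0" using F.ds_pos[OF ab(1)] m by simp
  obtain e where e: "e = 1 \<or> e = -1" "Res V (ds \<circ> \<tau>) (gforms V ds \<circ> \<tau>) = of_int e * uresultant V ds"
    using Res_swap_sign[OF F ab(1,2)] unfolding \<tau>_def by blast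
  define ds2 where "ds2 = ds(a := m)"
  have F2: "forms V ds2" unfolding ds2_def by (rule forms_update[OF F m0])
  interpret F2: forms V ds2 by (rule F2)
  have Ft: "forms V (ds \<circ> \<tau>)" using F t by (auto simp: forms_def)
  interpret Ft: forms V "ds \<circ> \<tau>" by (rule Ft)
  have F2t: "forms V (ds2 \<circ> \<tau>)" using F2 t by (auto simp: forms_def)
  interpret F2t: forms V "ds2 \<circ> \<tau>" by (rule F2t)
  obtain e2 where e2: "e2 = 1 \<or> e2 = -1" "Res V (ds2 \<circ> \<tau>) (gforms V ds2 \<circ> \<tau>) = of_int e2 * uresultant V ds2"
    using Res_swap_sign[OF F2 ab(1,2)] unfolding \<tau>_def by blast
  define P :: "nat \<Rightarrow> (nat, int) mpoly" where "P k = mvar k ^ ds k" for k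
  define P2 :: "nat \<Rightarrow> (nat, int) mpoly" where "P2 k = mvar k ^ ds2 k" for k
  have "Res V ds P = 1" unfolding P_def by (rule F.Res_powers)
  then have eP: "Res V (ds \<circ> \<tau>) (P \<circ> \<tau>) = e"
    using Res_swap_sign_spec[OF F ab(1,2) e(2)[unfolded \<tau>_def], of P] by (simp add: P_def is_form_mvar_power \<tau>_def)
  have "Res V ds2 P2 = 1" unfolding P2_def by (rule F2.Res_powers)
  then have eP2: "Res V (ds2 \<circ> \<tau>) (P2 \<circ> \<tau>) = e2"
    using Res_swap_sign_spec[OF F2 ab(1,2) e2(2)[unfolded \<tau>_def], of P2] by (simp add: P2_def is_form_mvar_power \<tau>_def)
  have dt: "(ds \<circ> \<tau>)(b := m) = ds2 \<circ> \<tau>"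
  proof
    fix k show "((ds \<circ> \<tau>)(b := m)) k = (ds2 \<circ> \<tau>) k"
      using tsimp ab by (cases "k = b"; cases "k = a") (auto simp: ds2_def)
  qed
  have "Res V (ds \<circ> \<tau>) (P \<circ> \<tau>) = Res V (ds \<circ> \<tau>) ((P \<circ> \<tau>)(b := mvar a ^ m * mvar a ^ m))"
    by (rule Ft.Res_cong) (auto simp: P_def tsimp m power_add)
  also have "\<dots> = Res V ((ds \<circ> \<tau>)(b := m)) ((P \<circ> \<tau>)(b := mvar a ^ m)) * Res V ((ds \<circ> \<tau>)(b := m)) ((P \<circ> \<tau>)(b := mvar a ^ m))"
    by (rule Res_mult[OF Ft ab(2) m0 m0]) (use t in \<open>auto simp: P_def tsimp m is_form_mvar_power ab\<close>)
  also have "Res V ((ds \<circ> \<tau>)(b := m)) ((P \<circ> \<tau>)(b := mvar a ^ m)) = Res V (ds2 \<circ> \<tau>) (P2 \<circ> \<tau>)"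
    unfolding dt
  proof (rule F2t.Res_cong)
    fix k show "((P \<circ> \<tau>)(b := mvar a ^ m)) k = (P2 \<circ> \<tau>) k"
      using tsimp ab by (cases "k = b"; cases "k = a") (auto simp: P_def P2_def ds2_def)
  qed
  finally have "e = e2 * e2" by (simp only: eP eP2)
  then have "e = 1" using e2(1) by auto
  then show ?thesis using Res_swap_sign_spec[OF F ab(1,2) e(2)[unfolded \<tau>_def] g] by simp
qed

section \<open>Recognition of the resultant and renaming of variables\<close>

definition coefs_degX :: "'j set \<Rightarrow> nat \<Rightarrow> ('i, ('j, 'a::comm_ring_1) mpoly) mpoly \<Rightarrow> bool" where
  "coefs_degX Y n p \<longleftrightarrow> (\<forall>\<alpha>. degX Y (coef p \<alpha>) \<le> n)"

lemma coefs_degX_add: "coefs_degX Y n p \<Longrightarrow> coefs_degX Y n q \<Longrightarrow> coefs_degX Y n (p + q)"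
  by (simp add: coefs_degX_def lookup_add degX_add_le)

lemma coefs_degX_0 [simp]: "coefs_degX Y n 0"
  by (simp add: coefs_degX_def)

lemma coefs_degX_sum: "(\<And>x. x \<in> S \<Longrightarrow> coefs_degX Y n (f x)) \<Longrightarrow> coefs_degX Y n (sum f S)"
  by (induction S rule: infinite_finite_induct) (auto intro: coefs_degX_add)

lemma coefs_degX_psingle: "degX Y c \<le> n \<Longrightarrow> coefs_degX Y n (psingle \<alpha> c)"
  by (simp add: coefs_degX_def lookup_single when_def)

lemma coefs_degX_mult:
  assumes "coefs_degX Y n p" "coefs_degX Y m q"
  shows "coefs_degX Y (n + m) (p * q)"
proof -
  have "p * q = (\<Sum>\<alpha>\<in>supp p. psingle \<alpha> (coef p \<alpha>)) * (\<Sum>\<beta>\<in>supp q. psingle \<beta> (coef q \<beta>))"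
    by (simp add: sum_single_coef)
  also have "\<dots> = (\<Sum>\<alpha>\<in>supp p. \<Sum>\<beta>\<in>supp q. psingle (\<alpha> + \<beta>) (coef p \<alpha> * coef q \<beta>))"
    by (simp add: sum_product mult_single)
  also have "coefs_degX Y (n + m) \<dots>"
    by (intro coefs_degX_sum coefs_degX_psingle order_trans[OF degX_mult_le] add_mono)
       (use assms in \<open>auto simp: coefs_degX_def\<close>)
  finally show ?thesis .
qed

lemma coefs_degX_1 [simp]: "coefs_degX Y n 1"
  using coefs_degX_psingle[of Y 1 n 0] by simp

lemma coefs_degX_mmonom [simp]: "coefs_degX Y n (mmonom \<alpha>)"
  unfolding mmonom_def by (rule coefs_degX_psingle) simp

lemma coefs_degX_mvar [simp]: "coefs_degX Y n (mvar i)"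
  by (simp add: mvar_def)

lemma coefs_degX_diff: "coefs_degX Y n p \<Longrightarrow> coefs_degX Y n q \<Longrightarrow> coefs_degX Y n (p - q)"
  using coefs_degX_add[of Y n p "- q"] by (simp add: coefs_degX_def)

lemma coefs_degX_power0: "coefs_degX Y 0 p \<Longrightarrow> coefs_degX Y 0 (p ^ k)"
  by (induction k) (auto dest: coefs_degX_mult)

lemma coefs_degX_prod0: "(\<And>x. x \<in> S \<Longrightarrow> coefs_degX Y 0 (f x)) \<Longrightarrow> coefs_degX Y 0 (prod f S)"
proof (induction S rule: infinite_finite_induct)
  case (insert x F)
  then show ?case using coefs_degX_mult[of Y 0 "f x" 0 "prod f F"] by simp
qed auto

lemma coefs_degX_subst:
  assumes "coefs_degX Y n p" "\<And>i. coefs_degX Y 0 (\<phi> i)"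
  shows "coefs_degX Y n (meval mconst \<phi> p)"
  unfolding meval_def
proof (rule coefs_degX_sum)
  fix \<alpha>
  have "coefs_degX Y 0 (\<Prod>i\<in>supp \<alpha>. \<phi> i ^ coef \<alpha> i)"
    by (intro coefs_degX_prod0 coefs_degX_power0 assms)
  moreover have "coefs_degX Y n (mconst (coef p \<alpha>))"
    using assms(1) by (auto simp: coefs_degX_def coef_mconst)
  ultimately show "coefs_degX Y n (mconst (coef p \<alpha>) * (\<Prod>i\<in>supp \<alpha>. \<phi> i ^ coef \<alpha> i))"
    using coefs_degX_mult[of Y n _ 0] by fastforce
qed

lemma coefs_degX_gform: "finite V \<Longrightarrow> coefs_degX Y (if xvars i \<inter> Y \<noteq> {} then 1 else 0) (gform V k i)"
  unfolding coefs_degX_def using degX_coef_gform by blast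

text \<open>An inertia form is a multiple of the resultant; the degree bounds make the cofactor an
  integer, and the normalization makes it 1.\<close>

lemma uresultant_eqI:
  assumes F: "forms V ds"
    and r: "inertia V (gforms V ds) r" "degX (- (\<Union>k\<in>V. xvars k)) r = 0"
      "\<And>k. k \<in> V \<Longrightarrow> degX (xvars k) r \<le> (\<Prod>j\<in>V - {k}. ds j)"
    and n: "at_powers ds r = 1"
  shows "r = uresultant V ds"
proof -
  interpret F: forms V ds by fact
  interpret h: comm_ring_hom "at_powers ds" by (rule comm_ring_hom_at_powers)
  obtain q where q: "r = uresultant V ds * q" using r(1) F.inertia_iff_dvd by blast
  have "r \<noteq> 0" using n by auto
  then have deg: "degX X r = degX X (uresultant V ds) + degX X q" for X
    using q degX_mult[of "uresultant V ds" q X] by auto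
  have "degX (xvars k) q = 0" if "k \<in> V" for k
    using deg[of "xvars k"] r(3)[OF that] degX_uresultant[OF F that] by simp
  moreover have "q \<in> polys (\<Union>k\<in>V. xvars k)"
    using deg[of "- (\<Union>k\<in>V. xvars k)"] r(2) degX_eq_0_iff[of "- (\<Union>k\<in>V. xvars k)" q] by simp
  ultimately obtain c where c: "q = of_int c" using const_of_degX by blast
  have "at_powers ds r = at_powers ds (uresultant V ds) * c" by (simp add: q c h.hom_mult h.hom_of_int)
  then show ?thesis using q c n F.at_powers_uresultant by simp
qed

lemma inertia_form:
  assumes "\<And>\<beta>. \<beta> \<in> monoms V N \<Longrightarrow> mmonom \<beta> * mconst r \<in> form_ideal W g"
    and "finite V" "is_form V N p"
  shows "p * mconst r \<in> form_ideal W g"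
proof -
  have p: "p = (\<Sum>\<alpha>\<in>monoms V N. mconst (coef p \<alpha>) * mmonom \<alpha>)"
    using assms(2,3) by (intro form_expand) (auto simp: is_form_def)
  have "(\<Sum>\<alpha>\<in>monoms V N. mconst (coef p \<alpha>) * (mmonom \<alpha> * mconst r)) \<in> form_ideal W g"
    by (intro form_ideal_sum form_ideal_mult assms(1))
  then show ?thesis by (subst p) (simp add: sum_distrib_right mult.assoc)
qed

text \<open>Carries an inertia form along a substitution. The last assumption ensures that all
  monomials of V arise from forms of the same degree in V'.\<close>

lemma inertia_subst:
  fixes \<phi> :: "nat \<Rightarrow> (nat, 'a::comm_ring_1) mpoly"
  assumes i: "inertia V' g' r" and fin: "finite V'"
    and g: "\<And>j. j \<in> V' \<Longrightarrow> meval mconst \<phi> (g' j) \<in> form_ideal V g"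
    and lift: "\<And>N \<beta>. \<beta> \<in> monoms V N \<Longrightarrow> \<exists>p. is_form V' N p \<and> meval mconst \<phi> p = mmonom \<beta>"
  shows "inertia V g r"
proof -
  have hom: "comm_ring_hom (meval mconst \<phi>)" by (rule comm_ring_hom_meval[OF comm_ring_hom_mconst])
  interpret s: comm_ring_hom "meval mconst \<phi>" by (rule hom)
  obtain N where N: "\<And>\<beta>. \<beta> \<in> monoms V' N \<Longrightarrow> mmonom \<beta> * mconst r \<in> form_ideal V' g'"
    using i by (auto simp: inertia_def)
  show ?thesis unfolding inertia_def
  proof (intro exI ballI)
    fix \<beta> assume "\<beta> \<in> monoms V N"
    then obtain p where p: "is_form V' N p" "meval mconst \<phi> p = mmonom \<beta>" using lift by blast
    have "p * mconst r \<in> form_ideal V' g'" by (rule inertia_form[OF N fin p(1)])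
    from form_ideal_hom[OF hom this] have "mmonom \<beta> * mconst r \<in> form_ideal V' (\<lambda>i. meval mconst \<phi> (g' i))"
      by (simp add: s.hom_mult p)
    then show "mmonom \<beta> * mconst r \<in> form_ideal V g"
      by (rule form_ideal_mono) (rule g)
  qed
qed

lemma is_form_mmonom: "\<beta> \<in> monoms V N \<Longrightarrow> is_form V N (mmonom \<beta>)"
  by (auto simp: is_form_def monoms_def mhomogeneous_def mmonom_def polys_iff)

lemma subst_subst:
  fixes p :: "('i, 'a::comm_ring_1) mpoly"
  shows "meval mconst \<psi> (meval mconst \<phi> p) = meval mconst (\<lambda>i. meval mconst \<psi> (\<phi> i)) p"
  by (subst meval_meval) (auto simp: comm_ring_hom_mconst)

lemma subst_ident:
  fixes p :: "('i, 'a::comm_ring_1) mpoly"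
  assumes "p \<in> polys V" "\<And>i. i \<in> V \<Longrightarrow> \<phi> i = mvar i"
  shows "meval mconst \<phi> p = p"
proof -
  have "meval mconst \<phi> p = meval mconst mvar p"
    by (rule meval_cong) (use assms in \<open>auto simp: polys_iff\<close>)
  then show ?thesis by simp
qed

lemma map_coef_subst:
  assumes f: "comm_ring_hom f"
  shows "map_coef f (meval mconst \<phi> p) = meval mconst (\<lambda>j. map_coef f (\<phi> j)) (map_coef f p)"
proof -
  interpret f: comm_ring_hom f by fact
  have m: "comm_ring_hom (map_coef f)" by (rule comm_ring_hom_map_coef[OF f])
  have fp: "map_coef f p = meval (\<lambda>c. mconst (f c)) mvar p" by (simp add: map_coef_def)
  have "map_coef f (meval mconst \<phi> p) = meval (\<lambda>c. map_coef f (mconst c)) (\<lambda>j. map_coef f (\<phi> j)) p"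
    by (rule hom_meval[OF m comm_ring_hom_mconst])
  also have "\<dots> = meval (\<lambda>c. meval mconst (\<lambda>j. map_coef f (\<phi> j)) (mconst (f c))) (\<lambda>j. meval mconst (\<lambda>j. map_coef f (\<phi> j)) (mvar j)) p"
    by (simp add: map_coef_mconst[OF f] comm_ring_hom_mconst)
  also have "\<dots> = meval mconst (\<lambda>j. map_coef f (\<phi> j)) (map_coef f p)"
    unfolding fp
    by (rule meval_meval[symmetric, OF comm_ring_hom_mconst comm_ring_hom_comp[OF comm_ring_hom_mconst f]])
  finally show ?thesis .
qed

theorem Res_rename:
  fixes g g' :: "nat \<Rightarrow> (nat, 'a::comm_ring_1) mpoly"
  assumes F: "forms V ds" and inj: "inj_on \<pi> V" and V': "V' = \<pi> ` V"
    and ds': "\<And>i. i \<in> V \<Longrightarrow> ds' (\<pi> i) = ds i"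
    and g: "\<And>i. i \<in> V \<Longrightarrow> is_form V (ds i) (g i)"
    and g': "\<And>i. i \<in> V \<Longrightarrow> g' (\<pi> i) = meval mconst (\<lambda>j. mvar (\<pi> j)) (g i)"
  shows "Res V' ds' g' = Res V ds g"
proof -
  interpret F: forms V ds by fact
  note fin = F.finite_V
  define \<rho> where "\<rho> = inv_into V \<pi>"
  have rp: "\<rho> (\<pi> i) = i" if "i \<in> V" for i using inj that by (simp add: \<rho>_def)
  have rV: "\<rho> j \<in> V" "\<pi> (\<rho> j) = j" if "j \<in> V'" for j
    using that by (auto simp: V' \<rho>_def inv_into_into f_inv_into_f)
  have F': "forms V' ds'" using F by (auto simp: forms_def V' ds')
  interpret F': forms V' ds' by (rule F')
  \<comment> \<open>Only the x-variables are renamed. The coefficients keep their labels, so that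
    the resultant of \<open>f\<close> can be recognized as that of the old system.\<close>
  define f where "f j = meval mconst (\<lambda>j. mvar (\<pi> j)) (gforms V ds (\<rho> j))" for j
  have fform: "is_form V' (ds' j) (f j)" if "j \<in> V'" for j
    unfolding f_def
  proof (rule is_form_subst[of V])
    show "is_form V (ds' j) (gforms V ds (\<rho> j))" using rV[OF that] ds'[of "\<rho> j"] by (simp add: is_form_gform)
    show "is_form V' 1 (mvar (\<pi> i))" if "i \<in> V" for i using that by (intro is_form_mvar) (auto simp: V')
  qed
  define r where "r = Res V' ds' f"
  have "r = uresultant V ds"
  proof (rule uresultant_eqI[OF F])
    have i: "inertia V' f r" unfolding r_def by (rule F'.inertia_Res[OF fform])
    show "inertia V (gforms V ds) r"
    proof (rule inertia_subst[OF i F'.finite_V])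
      fix j assume j: "j \<in> V'"
      have "meval mconst (\<lambda>j. mvar (\<rho> j)) (f j) = gforms V ds (\<rho> j)"
        unfolding f_def subst_subst
        by (rule subst_ident[OF polys_gform]) (simp add: comm_ring_hom_mconst rp)
      then show "meval mconst (\<lambda>j. mvar (\<rho> j)) (f j) \<in> form_ideal V (gforms V ds)"
        using form_ideal_gen[OF fin, of "\<rho> j" "gforms V ds"] rV[OF j] by simp
    next
      fix N \<beta> assume b: "\<beta> \<in> monoms V N"
      have "is_form V' N (meval mconst (\<lambda>j. mvar (\<pi> j)) (mmonom \<beta> :: (nat, ures) mpoly))"
        by (rule is_form_subst[OF is_form_mmonom[OF b]], rule is_form_mvar) (simp add: V')
      moreover have "meval mconst (\<lambda>j. mvar (\<rho> j)) (meval mconst (\<lambda>j. mvar (\<pi> j)) (mmonom \<beta> :: (nat, ures) mpoly)) = mmonom \<beta>"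
        unfolding subst_subst
        by (rule subst_ident[OF polys_mmonom[of \<beta> V]]) (use b in \<open>auto simp: comm_ring_hom_mconst rp monoms_def\<close>)
      ultimately show "\<exists>p. is_form V' N p \<and> meval mconst (\<lambda>j. mvar (\<rho> j)) p = (mmonom \<beta> :: (nat, ures) mpoly)" by blast
    qed
    have cf: "coefs_degX Y (if xvars (\<rho> j) \<inter> Y \<noteq> {} then 1 else 0) (f j)" for Y j
      unfolding f_def by (rule coefs_degX_subst[OF coefs_degX_gform[OF fin]]) simp
    show "degX (- (\<Union>k\<in>V. xvars k)) r = 0" unfolding r_def
    proof (rule F'.degX_Res_eq_0)
      fix k \<alpha> assume "k \<in> V'"
      then have "xvars (\<rho> k) \<inter> - (\<Union>k\<in>V. xvars k) = {}" using rV by auto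
      then show "degX (- (\<Union>k\<in>V. xvars k)) (coef (f k) \<alpha>) = 0"
        using cf[of "- (\<Union>k\<in>V. xvars k)" k] by (simp add: coefs_degX_def)
    qed
    fix k assume k: "k \<in> V"
    have pk: "\<pi> k \<in> V'" using k by (simp add: V')
    have "degX (xvars k) r \<le> degX (xvars (\<pi> k)) (uresultant V' ds')" unfolding r_def
    proof (rule F'.degX_Res_le[OF pk])
      show "degX (xvars k) (coef (f (\<pi> k)) \<alpha>) \<le> 1" for \<alpha>
        using cf[of "xvars k" "\<pi> k"] unfolding coefs_degX_def by (rule allE[of _ \<alpha>]) (erule order_trans, simp)
      fix l \<alpha> assume l: "l \<in> V' - {\<pi> k}"
      then have "\<rho> l \<noteq> k" using rV[of l] by auto
      then show "degX (xvars k) (coef (f l) \<alpha>) = 0"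
        using cf[of "xvars k" l] xvars_disjoint[of "\<rho> l" k] by (simp add: coefs_degX_def)
    qed
    also have "\<dots> = (\<Prod>j\<in>V' - {\<pi> k}. ds' j)" by (rule degX_uresultant[OF F' pk])
    also have "V' - {\<pi> k} = \<pi> ` (V - {k})" using inj k by (auto simp: V' dest: inj_onD)
    also have "(\<Prod>j\<in>\<pi> ` (V - {k}). ds' j) = (\<Prod>j\<in>V - {k}. ds j)"
      using ds' by (subst prod.reindex) (auto intro: inj_on_subset[OF inj])
    finally show "degX (xvars k) r \<le> (\<Prod>j\<in>V - {k}. ds j)" .
  next
    define P :: "nat \<Rightarrow> (nat, int) mpoly" where "P k = mvar k ^ ds k" for k
    have Pf: "is_form V (ds k) (P k)" if "k \<in> V" for k using that by (simp add: P_def is_form_mvar_power)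
    have "spec P r = Res V' ds' (\<lambda>k. mvar k ^ ds' k)"
      unfolding r_def F'.Res_map_coef[OF comm_ring_hom_spec]
    proof (rule F'.Res_cong)
      fix j assume j: "j \<in> V'"
      interpret m: comm_ring_hom "meval mconst (\<lambda>j. mvar (\<pi> j)) :: (nat, int) mpoly \<Rightarrow> (nat, int) mpoly"
        by (rule comm_ring_hom_meval[OF comm_ring_hom_mconst])
      have "map_coef (spec P) (f j) = meval mconst (\<lambda>j. mvar (\<pi> j)) (map_coef (spec P) (gforms V ds (\<rho> j)))"
        unfolding f_def map_coef_subst[OF comm_ring_hom_spec] map_coef_mvar[OF comm_ring_hom_spec] ..
      also have "map_coef (spec P) (gforms V ds (\<rho> j)) = P (\<rho> j)"
        by (rule map_coef_is_form_spec[OF F Pf]) (use rV[OF j] in auto)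
      also have "meval mconst (\<lambda>j. mvar (\<pi> j)) (P (\<rho> j)) = mvar j ^ ds' j"
        using rV[OF j] ds'[of "\<rho> j"] by (simp add: P_def m.hom_power comm_ring_hom_mconst)
      finally show "map_coef (spec P) (f j) = mvar j ^ ds' j" .
    qed
    moreover have "at_powers ds r = spec P r"
      unfolding at_powers_def spec_def P_def
      by (rule meval_cong) (auto simp: mmonom_power[symmetric] coef_mmonom)
    ultimately show "at_powers ds r = 1" by (simp add: F'.Res_powers)
  qed
  then have "Res V ds g = spec g r" by (simp add: Res_eq_spec)
  also have "\<dots> = Res V' ds' g'"
    unfolding r_def F'.Res_map_coef[OF comm_ring_hom_spec]
  proof (rule F'.Res_cong)
    fix j assume j: "j \<in> V'"
    have "map_coef (spec g) (f j) = meval mconst (\<lambda>j. mvar (\<pi> j)) (map_coef (spec g) (gforms V ds (\<rho> j)))"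
      unfolding f_def map_coef_subst[OF comm_ring_hom_spec] map_coef_mvar[OF comm_ring_hom_spec] ..
    also have "map_coef (spec g) (gforms V ds (\<rho> j)) = g (\<rho> j)"
      by (rule map_coef_is_form_spec[OF F g]) (use rV[OF j] in auto)
    also have "meval mconst (\<lambda>j. mvar (\<pi> j)) (g (\<rho> j)) = g' j" using g'[of "\<rho> j"] rV[OF j] by simp
    finally show "map_coef (spec g) (f j) = g' j" .
  qed
  finally show ?thesis by simp
qed

section \<open>Elimination of a variable by a linear form\<close>

lemma subst_linear_diff:
  fixes p :: "(nat, 'a::comm_ring_1) mpoly"
  assumes p: "is_form V k p" "k > 0" and fin: "finite V" and i: "i \<in> V" and s: "is_form V 1 s"
  shows "\<exists>h. is_form V (k - 1) h \<and> p = meval mconst (\<lambda>j. if j = i then s else mvar j) p + h * (mvar i - s)"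
proof -
  define \<sigma> where "\<sigma> = (meval mconst (\<lambda>j. if j = i then s else mvar j) :: (nat, 'a) mpoly \<Rightarrow> _)"
  interpret s: comm_ring_hom \<sigma> unfolding \<sigma>_def by (rule comm_ring_hom_meval[OF comm_ring_hom_mconst])
  have mono: "\<exists>h. is_form V (k - 1) h \<and> mmonom \<alpha> = \<sigma> (mmonom \<alpha>) + h * (mvar i - s)" if a: "\<alpha> \<in> monoms V k" for \<alpha>
  proof -
    define m where "m = coef \<alpha> i"
    define \<beta> where "\<beta> = \<alpha> - psingle i m"
    have ab: "\<alpha> = \<beta> + psingle i m"
      by (rule poly_mapping_eqI) (auto simp: \<beta>_def m_def lookup_add lookup_minus lookup_single when_def)
    have bi: "i \<notin> supp \<beta>" by (simp add: \<beta>_def m_def in_keys_iff lookup_minus)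
    have bV: "supp \<beta> \<subseteq> V" using a by (auto simp: \<beta>_def monoms_def in_keys_iff lookup_minus)
    have bm: "mdeg \<beta> + m = k" using a arg_cong[OF ab, of mdeg] by (simp add: mdeg_add monoms_def)
    have sb: "\<sigma> (mmonom \<beta>) = mmonom \<beta>"
      unfolding \<sigma>_def by (rule subst_ident[of _ "- {i}"]) (use bi in \<open>auto simp: polys_iff mmonom_def\<close>)
    have ma: "mmonom \<alpha> = mmonom \<beta> * (mvar i ^ m :: (nat, 'a) mpoly)" by (subst ab) (simp add: mmonom_add mmonom_power)
    have sa: "\<sigma> (mmonom \<alpha>) = mmonom \<beta> * s ^ m"
      unfolding ma s.hom_mult sb s.hom_power by (simp add: \<sigma>_def comm_ring_hom_mconst)
    define h where "h = mmonom \<beta> * (\<Sum>t<m. s ^ (m - Suc t) * mvar i ^ t)"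
    have "mvar i ^ m - s ^ m = (mvar i - s) * (\<Sum>t<m. s ^ (m - Suc t) * mvar i ^ t)"
      by (rule power_diff_sumr2)
    then have "mmonom \<beta> * (mvar i ^ m - s ^ m) = h * (mvar i - s)"
      unfolding h_def by (simp only: mult_ac)
    then have "mmonom \<alpha> = \<sigma> (mmonom \<alpha>) + h * (mvar i - s)"
      unfolding sa by (simp add: ma algebra_simps)
    moreover have "is_form V (k - 1) h"
    proof (cases "m = 0")
      case False
      have "is_form V (m - 1) (\<Sum>t<m. s ^ (m - Suc t) * mvar i ^ t)"
      proof (rule is_form_sum)
        fix t assume "t \<in> {..<m}"
        then have "(m - Suc t) + t = m - 1" by simp
        then show "is_form V (m - 1) (s ^ (m - Suc t) * mvar i ^ t)"
          using is_form_mult[OF is_form_power[OF s, of "m - Suc t"] is_form_mvar_power[OF i, of t]] by simp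
      qed
      moreover have "is_form V (mdeg \<beta>) (mmonom \<beta>)" by (rule is_form_mmonom) (simp add: monoms_def bV)
      ultimately have "is_form V (mdeg \<beta> + (m - 1)) h" unfolding h_def by (rule is_form_mult[rotated])
      moreover have "mdeg \<beta> + (m - 1) = k - 1" using bm False by simp
      ultimately show ?thesis by simp
    qed (simp add: h_def)
    ultimately show ?thesis by blast
  qed
  then have "\<forall>\<alpha>\<in>monoms V k. \<exists>h. is_form V (k - 1) h \<and> mmonom \<alpha> = \<sigma> (mmonom \<alpha>) + h * (mvar i - s)" by blast
  from bchoice[OF this] obtain h where
    h: "\<And>\<alpha>. \<alpha> \<in> monoms V k \<Longrightarrow> is_form V (k - 1) (h \<alpha>)"
      "\<And>\<alpha>. \<alpha> \<in> monoms V k \<Longrightarrow> mmonom \<alpha> = \<sigma> (mmonom \<alpha>) + h \<alpha> * (mvar i - s)" by blast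
  have pe: "p = (\<Sum>\<alpha>\<in>monoms V k. mconst (coef p \<alpha>) * mmonom \<alpha>)"
    using fin p by (intro form_expand) (auto simp: is_form_def)
  define H where "H = (\<Sum>\<alpha>\<in>monoms V k. mconst (coef p \<alpha>) * h \<alpha>)"
  have sc: "\<sigma> (mconst c) = mconst c" for c by (simp add: \<sigma>_def)
  have "\<sigma> p = (\<Sum>\<alpha>\<in>monoms V k. mconst (coef p \<alpha>) * \<sigma> (mmonom \<alpha>))"
    by (subst pe) (simp add: s.hom_sum s.hom_mult sc)
  moreover have "p = (\<Sum>\<alpha>\<in>monoms V k. mconst (coef p \<alpha>) * (\<sigma> (mmonom \<alpha>) + h \<alpha> * (mvar i - s)))"
    by (subst pe, rule sum.cong[OF refl]) (simp only: h(2)[symmetric])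
  ultimately have "p = \<sigma> p + H * (mvar i - s)"
    by (simp add: H_def sum_distrib_right sum.distrib distrib_left mult.assoc)
  moreover have "is_form V (k - 1) H" unfolding H_def using h by (intro is_form_sum is_form_mconst_mult) auto
  ultimately show ?thesis unfolding \<sigma>_def by blast
qed

text \<open>For s = x_j the power of x_j is split into linear factors by multiplicativity; when the
  j-th form is x_j itself, adding it to x_i - x_j gives x_i.\<close>

lemma Res_powers_linear:
  assumes F: "forms V ds" and i: "i \<in> V" "ds i = 1" and s: "s = 0 \<or> (\<exists>j\<in>V - {i}. s = mvar j)"
  shows "Res V ds ((\<lambda>k. mvar k ^ ds k)(i := mvar i - s)) = (1 :: 'a::comm_ring_1)"
proof -
  interpret F: forms V ds by fact
  from s show ?thesis
  proof
    assume "s = 0"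
    then have "Res V ds ((\<lambda>k. mvar k ^ ds k)(i := mvar i - s)) = Res V ds (\<lambda>k. mvar k ^ ds k)"
      by (intro F.Res_cong) (auto simp: i)
    then show ?thesis by (simp add: F.Res_powers)
  next
    assume "\<exists>j\<in>V - {i}. s = mvar j"
    then obtain j where j: "j \<in> V" "j \<noteq> i" "s = mvar j" by blast
    define g :: "nat \<Rightarrow> nat \<Rightarrow> (nat, 'a) mpoly" where
      "g m = (\<lambda>k. mvar k ^ ds k)(i := mvar i - mvar j, j := mvar j ^ m)" for m
    have gf: "is_form V ((ds(j := m)) k) (g m k)" if "k \<in> V" for k m
    proof -
      have "is_form V 1 (mvar i - mvar j :: (nat, 'a) mpoly)"
        using i j by (intro is_form_diff is_form_mvar)
      moreover have "is_form V (ds k) (mvar k ^ ds k :: (nat, 'a) mpoly)" "is_form V m (mvar j ^ m :: (nat, 'a) mpoly)"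
        using that j by (auto intro: is_form_mvar_power)
      ultimately show ?thesis using i by (auto simp: g_def)
    qed
    have one: "Res V (ds(j := 1)) (g 1) = 1"
    proof -
      define e where "e = ds(j := 1)"
      have Fe: "forms V e" unfolding e_def by (rule forms_update[OF F]) simp
      interpret Fe: forms V e by (rule Fe)
      have "Res V e (\<lambda>k. if k = j then g 1 j else g 1 k + (if k = i then 1 else 0) * g 1 j) = Res V e (g 1)"
      proof (rule Res_add_multiple[OF Fe j(1)])
        show "is_form V (e k) (g 1 k)" if "k \<in> V" for k unfolding e_def by (rule gf[OF that])
      qed (use i j in \<open>auto simp: e_def\<close>)
      moreover have "Res V e (\<lambda>k. if k = j then g 1 j else g 1 k + (if k = i then 1 else 0) * g 1 j) = Res V e (\<lambda>k. mvar k ^ e k)"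
        by (rule Fe.Res_cong) (use i j in \<open>auto simp: g_def e_def\<close>)
      ultimately have "Res V e (g 1) = Res V e (\<lambda>k. mvar k ^ e k)" by (rule trans[OF sym])
      then have "Res V e (g 1) = 1" unfolding Fe.Res_powers .
      then show ?thesis unfolding e_def .
    qed
    have "Res V (ds(j := Suc m)) (g (Suc m)) = 1" for m
    proof (induction m)
      case 0
      show ?case using one by (simp only: One_nat_def)
    next
      case (Suc m)
      define e where "e = ds(j := Suc (Suc m))"
      have Fe: "forms V e" unfolding e_def by (rule forms_update[OF F]) simp
      interpret Fe: forms V e by (rule Fe)
      have up: "e(j := x) = ds(j := x)" for x by (simp add: e_def)
      have gup: "(g (Suc (Suc m)))(j := mvar j ^ x) = g x" for x by (simp add: g_def)
      have "Res V e ((g (Suc (Suc m)))(j := mvar j ^ 1 * mvar j ^ Suc m)) =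
          Res V (e(j := 1)) ((g (Suc (Suc m)))(j := mvar j ^ 1)) * Res V (e(j := Suc m)) ((g (Suc (Suc m)))(j := mvar j ^ Suc m))"
      proof (rule Res_mult[OF Fe j(1)])
        show "is_form V (e k) (g (Suc (Suc m)) k)" if "k \<in> V - {j}" for k
          using gf[of k "Suc (Suc m)"] that unfolding e_def by simp
        show "is_form V 1 (mvar j ^ 1 :: (nat, 'a) mpoly)" by (rule is_form_mvar_power[OF j(1)])
        show "is_form V (Suc m) (mvar j ^ Suc m :: (nat, 'a) mpoly)" by (rule is_form_mvar_power[OF j(1)])
      qed (auto simp: e_def)
      also have "\<dots> = 1" unfolding up gup Suc.IH one by simp
      finally have "Res V e ((g (Suc (Suc m)))(j := mvar j ^ 1 * mvar j ^ Suc m)) = 1" .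
      moreover have "(g (Suc (Suc m)))(j := mvar j ^ 1 * mvar j ^ Suc m) = g (Suc (Suc m))"
        by (auto simp: g_def fun_eq_iff)
      ultimately show ?case unfolding e_def by (simp only:)
    qed
    from this[of "ds j - 1"] have "Res V ds (g (ds j)) = 1"
      using F.ds_pos[OF j(1)] by simp
    moreover have "g (ds j) = ((\<lambda>k. mvar k ^ ds k)(i := mvar i - s) :: nat \<Rightarrow> (nat, 'a) mpoly)"
      using j by (auto simp: fun_eq_iff g_def)
    ultimately show ?thesis by simp
  qed
qed

lemma Res_linear_generic:
  assumes F: "forms V ds" and i: "i \<in> V" "ds i = 1" and W: "W = V - {i}" "W \<noteq> {}"
    and s: "s = 0 \<or> (\<exists>j\<in>V - {i}. s = mvar j)"
  shows "Res V ds ((gforms W ds)(i := mvar i - s)) = uresultant W ds"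
proof -
  interpret F: forms V ds by fact
  have FW: "forms W ds" using F W by (auto simp: forms_def)
  interpret FW: forms W ds by (rule FW)
  define f where "f = (gforms W ds)(i := mvar i - s)"
  have sW: "is_form W 1 s" using s W(1) by (auto simp: is_form_mvar[simplified])
  have WV: "W \<subseteq> V" using W by auto
  have fform: "is_form V (ds k) (f k)" if "k \<in> V" for k
  proof (cases "k = i")
    case True
    then show ?thesis using i is_form_diff[OF is_form_mvar[OF i(1)] is_form_mono[OF sW WV]] by (simp add: f_def)
  next
    case False
    then show ?thesis using is_form_mono[OF is_form_gform WV] by (simp add: f_def)
  qed
  have cf: "coefs_degX Y (if k \<noteq> i \<and> xvars k \<inter> Y \<noteq> {} then 1 else 0) (f k)" for Y k
  proof (cases "k = i")
    case True
    have "coefs_degX Y 0 s" using s by auto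
    then show ?thesis using True by (auto simp: f_def intro: coefs_degX_diff)
  next
    case False
    then show ?thesis using coefs_degX_gform[OF FW.finite_V, of Y k] by (simp add: f_def)
  qed
  show ?thesis unfolding f_def[symmetric]
  proof (rule uresultant_eqI[OF FW])
    show "inertia W (gforms W ds) (Res V ds f)"
    proof (rule inertia_subst[OF F.inertia_Res[OF fform] F.finite_V, where \<phi> = "\<lambda>j. if j = i then s else mvar j"])
      interpret s: comm_ring_hom "meval mconst (\<lambda>j. if j = i then s else mvar j) :: (nat, ures) mpoly \<Rightarrow> _"
        by (rule comm_ring_hom_meval[OF comm_ring_hom_mconst])
      fix j assume j: "j \<in> V"
      show "meval mconst (\<lambda>j. if j = i then s else mvar j) (f j) \<in> form_ideal W (gforms W ds)"
      proof (cases "j = i")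
        case True
        have "meval mconst (\<lambda>j. if j = i then s else mvar j) s = s"
          by (rule subst_ident[of _ W]) (use sW W in \<open>auto simp: is_form_def\<close>)
        then show ?thesis using True by (simp add: f_def s.hom_minus comm_ring_hom_mconst)
      next
        case False
        have "meval mconst (\<lambda>j. if j = i then s else mvar j) (f j) = gforms W ds j"
          using False unfolding f_def by simp (rule subst_ident[OF polys_gform], use W in auto)
        then show ?thesis using False j W form_ideal_gen[OF FW.finite_V, of j "gforms W ds"] by simp
      qed
    next
      fix N \<beta> assume b: "\<beta> \<in> monoms W N"
      have "is_form V N (mmonom \<beta> :: (nat, ures) mpoly)" by (rule is_form_mono[OF is_form_mmonom[OF b] WV])
      moreover have "meval mconst (\<lambda>j. if j = i then s else mvar j) (mmonom \<beta>) = (mmonom \<beta> :: (nat, ures) mpoly)"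
        by (rule subst_ident[OF polys_mmonom[of \<beta> W]]) (use b W in \<open>auto simp: monoms_def\<close>)
      ultimately show "\<exists>p. is_form V N p \<and> meval mconst (\<lambda>j. if j = i then s else mvar j) p = (mmonom \<beta> :: (nat, ures) mpoly)"
        by blast
    qed
    show "degX (- (\<Union>k\<in>W. xvars k)) (Res V ds f) = 0"
    proof (rule F.degX_Res_eq_0)
      fix k \<alpha> assume "k \<in> V"
      then have "k \<noteq> i \<Longrightarrow> xvars k \<inter> - (\<Union>k\<in>W. xvars k) = {}" using W by auto
      then show "degX (- (\<Union>k\<in>W. xvars k)) (coef (f k) \<alpha>) = 0"
        using cf[of "- (\<Union>k\<in>W. xvars k)" k] by (auto simp: coefs_degX_def split: if_splits)
    qed
    fix k assume k: "k \<in> W"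
    then have kV: "k \<in> V" "k \<noteq> i" using W by auto
    have "degX (xvars k) (Res V ds f) \<le> degX (xvars k) (uresultant V ds)"
    proof (rule F.degX_Res_le[OF kV(1)])
      show "degX (xvars k) (coef (f k) \<alpha>) \<le> 1" for \<alpha>
        using cf[of "xvars k" k] unfolding coefs_degX_def by (rule allE[of _ \<alpha>]) (erule order_trans, simp)
      show "degX (xvars k) (coef (f l) \<alpha>) = 0" if "l \<in> V - {k}" for l \<alpha>
        using cf[of "xvars k" l] xvars_disjoint[of l k] that by (auto simp: coefs_degX_def)
    qed
    also have "\<dots> = (\<Prod>j\<in>V - {k}. ds j)" by (rule degX_uresultant[OF F kV(1)])
    also have "\<dots> = ds i * (\<Prod>j\<in>V - {k} - {i}. ds j)"
      using i kV F.finite_V by (intro prod.remove) auto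
    also have "V - {k} - {i} = W - {k}" using W by auto
    finally show "degX (xvars k) (Res V ds f) \<le> (\<Prod>j\<in>W - {k}. ds j)" using i by simp
  next
    define P :: "nat \<Rightarrow> (nat, int) mpoly" where "P k = mvar k ^ ds k" for k
    have Pf: "is_form W (ds k) (P k)" if "k \<in> W" for k using that by (simp add: P_def is_form_mvar_power)
    have sp: "comm_ring_hom (spec P)" by (rule comm_ring_hom_spec)
    interpret mc: comm_ring_hom "map_coef (spec P)" by (rule comm_ring_hom_map_coef[OF sp])
    have "spec P (Res V ds f) = Res V ds ((\<lambda>k. mvar k ^ ds k)(i := mvar i - map_coef (spec P) s))"
      unfolding F.Res_map_coef[OF sp]
    proof (rule F.Res_cong)
      fix k assume k: "k \<in> V"
      show "map_coef (spec P) (f k) = ((\<lambda>k. mvar k ^ ds k)(i := mvar i - map_coef (spec P) s)) k"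
      proof (cases "k = i")
        case True
        then show ?thesis by (simp add: f_def mc.hom_minus map_coef_mvar[OF sp])
      next
        case False
        then have "map_coef (spec P) (gforms W ds k) = P k"
          by (intro map_coef_is_form_spec[OF FW Pf]) (use k W in auto)
        then show ?thesis using False by (simp add: f_def P_def)
      qed
    qed
    also have "\<dots> = 1"
      by (rule Res_powers_linear[OF F i]) (use s in \<open>auto simp: map_coef_mvar[OF sp]\<close>)
    finally have "spec P (Res V ds f) = 1" .
    moreover have "at_powers ds r = spec P r" for r
      unfolding at_powers_def spec_def P_def
      by (rule meval_cong) (auto simp: mmonom_power[symmetric] coef_mmonom)
    ultimately show "at_powers ds (Res V ds f) = 1" by simp
  qed
qed

text \<open>Subtracting multiples of the linear form replaces every other form by its image under
  x_i := s, which is free of x_i. This reduces the claim to generic forms in the variables W, where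
  the resultant is recognized by its degrees.\<close>

theorem Res_eliminate:
  fixes g :: "nat \<Rightarrow> (nat, 'a::comm_ring_1) mpoly"
  assumes F: "forms V ds" and i: "i \<in> V" "ds i = 1" and W: "W = V - {i}" "W \<noteq> {}"
    and s: "s = 0 \<or> (\<exists>j\<in>V - {i}. s = mvar j)"
    and g: "\<And>k. k \<in> W \<Longrightarrow> is_form V (ds k) (g k)"
  shows "Res V ds (g(i := mvar i - s)) = Res W ds (\<lambda>k. meval mconst (\<lambda>j. if j = i then s else mvar j) (g k))"
proof -
  interpret F: forms V ds by fact
  have FW: "forms W ds" using F W by (auto simp: forms_def)
  interpret FW: forms W ds by (rule FW)
  have WV: "W \<subseteq> V" using W by auto
  have sW: "is_form W 1 s" using s W(1) by (auto simp: is_form_mvar[simplified])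
  have sV: "is_form V 1 s" by (rule is_form_mono[OF sW WV])
  define p where "p k = meval mconst (\<lambda>j. if j = i then s else mvar j) (g k)" for k
  have pf: "is_form W (ds k) (p k)" if "k \<in> W" for k
    unfolding p_def by (rule is_form_subst[OF g[OF that]]) (use sW W in \<open>auto intro: is_form_mvar[simplified]\<close>)
  have "\<forall>k\<in>W. \<exists>h. is_form V (ds k - 1) h \<and> g k = p k + h * (mvar i - s)"
    unfolding p_def using subst_linear_diff[OF g _ F.finite_V i(1) sV] FW.ds_pos by blast
  from bchoice[OF this] obtain h where h: "\<And>k. k \<in> W \<Longrightarrow> is_form V (ds k - 1) (h k)"
    "\<And>k. k \<in> W \<Longrightarrow> g k = p k + h k * (mvar i - s)" by blast
  define P where "P = p(i := mvar i - s)"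
  have Pf: "is_form V (ds k) (P k)" if "k \<in> V" for k
  proof (cases "k = i")
    case True
    then show ?thesis using i is_form_diff[OF is_form_mvar[OF i(1)] sV] by (simp add: P_def)
  next
    case False
    then show ?thesis using is_form_mono[OF pf WV] that W by (simp add: P_def)
  qed
  have "Res V ds (g(i := mvar i - s)) = Res V ds (\<lambda>k. if k = i then P i else P k + h k * P i)"
  proof (rule F.Res_cong)
    fix k assume "k \<in> V"
    then show "(g(i := mvar i - s)) k = (if k = i then P i else P k + h k * P i)"
      using h(2)[of k] W by (cases "k = i") (simp_all add: P_def)
  qed
  also have "\<dots> = Res V ds P"
  proof (rule Res_add_multiple[OF F i(1) Pf])
    show "is_form V (ds k - ds i) (h k)" if "k \<in> V - {i}" for k using h(1)[of k] that W i by simp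
    show "h k = 0" if "k \<in> V - {i}" "ds k < ds i" for k using F.ds_pos[of k] that i by simp
  qed
  finally have RP: "Res V ds (g(i := mvar i - s)) = Res V ds P" .
  \<comment> \<open>\<open>s'\<close> is a copy of s over the ring of generic coefficients, since s
    itself has coefficients in another ring.\<close>
  have PS: "Res V ds P = spec p (Res V ds ((gforms W ds)(i := mvar i - s')))"
    if s': "s' = 0 \<and> s = 0 \<or> (\<exists>j\<in>V - {i}. s' = mvar j \<and> s = mvar j)" for s'
  proof -
    have sp: "comm_ring_hom (spec p)" by (rule comm_ring_hom_spec)
    interpret mc: comm_ring_hom "map_coef (spec p)" by (rule comm_ring_hom_map_coef[OF sp])
    show ?thesis unfolding F.Res_map_coef[OF sp]
    proof (rule F.Res_cong)
      fix k assume k: "k \<in> V"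
      show "P k = map_coef (spec p) (((gforms W ds)(i := mvar i - s')) k)"
      proof (cases "k = i")
        case True
        then show ?thesis using s' by (auto simp: P_def mc.hom_minus map_coef_mvar[OF sp])
      next
        case False
        then have "map_coef (spec p) (gforms W ds k) = p k"
          by (intro map_coef_is_form_spec[OF FW pf]) (use k W in auto)
        then show ?thesis using False by (simp add: P_def)
      qed
    qed
  qed
  have "\<exists>s'. (s' = 0 \<and> s = 0 \<or> (\<exists>j\<in>V - {i}. s' = mvar j \<and> s = mvar j)) \<and>
     Res V ds ((gforms W ds)(i := mvar i - s')) = uresultant W ds"
  proof (cases "s = 0")
    case True
    then show ?thesis using Res_linear_generic[OF F i W, of 0] by (intro exI[of _ 0]) simp
  next
    case False
    then obtain j where j: "j \<in> V - {i}" "s = mvar j" using s by blast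
    then show ?thesis using Res_linear_generic[OF F i W, of "mvar j"] by (intro exI[of _ "mvar j"]) auto
  qed
  then obtain s' where "s' = 0 \<and> s = 0 \<or> (\<exists>j\<in>V - {i}. s' = mvar j \<and> s = mvar j)"
    "Res V ds ((gforms W ds)(i := mvar i - s')) = uresultant W ds" by blast
  from RP PS[OF this(1)] this(2) have "Res V ds (g(i := mvar i - s)) = spec p (uresultant W ds)" by simp
  then show ?thesis by (simp add: Res_eq_spec p_def[abs_def])
qed

section \<open>Systems whose resultant is a unit\<close>

lemma form_ideal_cofactors:
  fixes g :: "nat \<Rightarrow> (nat, 'a::comm_ring_1) mpoly"
  assumes p: "p \<in> form_ideal V g" "is_form V N p" and g: "\<And>j. j \<in> V \<Longrightarrow> is_form V (ds j) (g j)"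
  shows "\<exists>h. (\<forall>j\<in>V. is_form V (N - ds j) (h j) \<and> (N < ds j \<longrightarrow> h j = 0)) \<and> p = (\<Sum>j\<in>V. h j * g j)"
proof -
  obtain h where h: "p = (\<Sum>j\<in>V. h j * g j)" using p(1) by (auto simp: form_ideal_def)
  interpret pr: comm_ring_hom "mproj V :: (nat, 'a) mpoly \<Rightarrow> _" by (rule comm_ring_hom_mproj)
  \<comment> \<open>The retraction removes stray variables, and components of any other degree
    cancel in the sum.\<close>
  define k where "k j = (if ds j \<le> N then hom_part (N - ds j) (mproj V (h j)) else 0)" for j
  have "p = mproj V p" using p(2) by (simp add: mproj_ident is_form_def)
  also have "\<dots> = (\<Sum>j\<in>V. mproj V (h j) * g j)"
    unfolding h pr.hom_sum pr.hom_mult by (intro sum.cong refl) (use g in \<open>simp add: mproj_ident is_form_def\<close>)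
  finally have "p = (\<Sum>j\<in>V. mproj V (h j) * g j)" .
  moreover have "p = hom_part N p" using p(2) by (simp add: hom_part_self is_form_def)
  ultimately have "p = (\<Sum>j\<in>V. hom_part N (mproj V (h j) * g j))" by (simp add: hom_part_sum[symmetric])
  also have "\<dots> = (\<Sum>j\<in>V. k j * g j)"
  proof (intro sum.cong refl)
    fix j assume "j \<in> V"
    then have "mhomogeneous (ds j) (g j)" using g by (simp add: is_form_def)
    from hom_part_mult[OF this] show "hom_part N (mproj V (h j) * g j) = k j * g j" by (simp add: k_def)
  qed
  finally have "p = (\<Sum>j\<in>V. k j * g j)" .
  moreover have "is_form V (N - ds j) (k j)" for j
    by (simp add: k_def is_form_def mhomogeneous_hom_part polys_hom_part)
  ultimately show ?thesis by (intro exI[of _ k]) (auto simp: k_def)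
qed

text \<open>Some exponent N works for all variables. The forms x_i ^ N then lie in the ideal, so the
  resultant divides theirs, which is 1.\<close>

theorem Res_unit:
  fixes g :: "nat \<Rightarrow> (nat, 'a::comm_ring_1) mpoly"
  assumes F: "forms V ds" and g: "\<And>j. j \<in> V \<Longrightarrow> is_form V (ds j) (g j)"
    and nil: "\<And>i. i \<in> V \<Longrightarrow> \<exists>m. mvar i ^ m \<in> form_ideal V g"
  shows "Res V ds g dvd 1"
proof -
  interpret F: forms V ds by fact
  obtain m where m: "\<And>i. i \<in> V \<Longrightarrow> mvar i ^ m i \<in> form_ideal V g" using nil by metis
  define N where "N = Suc (sum m V)"
  have mN: "m i \<le> N" if "i \<in> V" for i
    using member_le_sum[OF that, of m] F.finite_V by (simp add: N_def)
  have FN: "forms V (\<lambda>_. N)" using F by (auto simp: forms_def N_def)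
  interpret FN: forms V "\<lambda>_. N" by (rule FN)
  have "\<forall>i\<in>V. \<exists>h. (\<forall>j\<in>V. is_form V (N - ds j) (h j) \<and> (N < ds j \<longrightarrow> h j = 0)) \<and>
      mvar i ^ N = (\<Sum>j\<in>V. h j * g j)"
  proof
    fix i assume i: "i \<in> V"
    have "mvar i ^ N = mvar i ^ (N - m i) * (mvar i ^ m i :: (nat, 'a) mpoly)"
      using mN[OF i] by (simp flip: power_add)
    then have "mvar i ^ N \<in> form_ideal V g" using form_ideal_mult[OF m[OF i]] by simp
    from form_ideal_cofactors[OF this is_form_mvar_power[OF i] g]
    show "\<exists>h. (\<forall>j\<in>V. is_form V (N - ds j) (h j) \<and> (N < ds j \<longrightarrow> h j = 0)) \<and>
      mvar i ^ N = (\<Sum>j\<in>V. h j * g j)" .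
  qed
  from bchoice[OF this] obtain h where
    h: "\<And>i. i \<in> V \<Longrightarrow> (\<forall>j\<in>V. is_form V (N - ds j) (h i j) \<and> (N < ds j \<longrightarrow> h i j = 0)) \<and>
      mvar i ^ N = (\<Sum>j\<in>V. h i j * g j)" by blast
  have "Res V ds g dvd Res V (\<lambda>_. N) (\<lambda>i. mvar i ^ N)"
    by (rule Res_dvd[OF F FN g, where h = h]) (use h in auto)
  then show ?thesis using FN.Res_powers by metis
qed

section \<open>Agreement with the universal resultant defined by saturation\<close>

lemma generic_form_eq: "generic_form m ds i = gforms {1..m} ds i"
  by (simp add: generic_form_def gform_def)

lemma coeff_ring_eq: "coeff_ring m ds = polys (coefvars {1..m} ds)"
  by (simp add: coeff_ring_def coefvars_def)

text \<open>The definition by saturation demands cofactors in the right variables over the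
  coefficient ring, whereas \<open>inertia\<close> does not. The retraction \<open>prj\<close> on
  variables and coefficients fixes the forms and turns arbitrary cofactors into admissible
  ones.\<close>

lemma generic_saturation_iff:
  assumes r: "r \<in> coeff_ring m ds"
  shows "mconst r \<in> generic_saturation m ds \<longleftrightarrow> inertia {1..m} (gforms {1..m} ds) r"
proof -
  define W where "W = coefvars {1..m} ds"
  define prj :: "(nat, ures) mpoly \<Rightarrow> (nat, ures) mpoly" where "prj p = map_coef (mproj W) (mproj {1..m} p)" for p
  have homW: "comm_ring_hom (mproj W :: ures \<Rightarrow> ures)" by (rule comm_ring_hom_mproj)
  have hom: "comm_ring_hom prj"
    unfolding prj_def by (rule comm_ring_hom_comp[OF comm_ring_hom_map_coef[OF homW] comm_ring_hom_mproj])
  interpret prj: comm_ring_hom prj by (rule hom)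
  have mem: "prj p \<in> mpolys (coeff_ring m ds) {1..m}" for p
  proof -
    have "supp (prj p) \<subseteq> supp (mproj {1..m} p)" unfolding prj_def by (rule supp_map_coef[OF homW])
    moreover have "mproj {1..m} p \<in> polys {1..m}" by simp
    ultimately have "\<forall>\<alpha>\<in>supp (prj p). supp \<alpha> \<subseteq> {1..m}" unfolding polys_iff by blast
    moreover have "coef (prj p) \<alpha> \<in> coeff_ring m ds" for \<alpha>
      unfolding prj_def coef_map_coef[OF homW] coeff_ring_eq W_def[symmetric] by simp
    ultimately show ?thesis by (simp add: mpolys_def)
  qed
  have fix_form: "prj p = p" if p: "p \<in> polys {1..m}" "\<And>\<alpha>. coef p \<alpha> \<in> polys W" for p
    using that by (intro poly_mapping_eqI) (simp add: prj_def mproj_ident coef_map_coef homW)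
  have fr: "prj (mconst r) = mconst r"
    by (rule fix_form) (use r in \<open>auto simp: coef_mconst coeff_ring_eq W_def\<close>)
  have fm: "prj (mmonom \<beta>) = mmonom \<beta>" if "\<beta> \<in> monoms {1..m} N" for \<beta> N
    by (rule fix_form) (use that in \<open>auto simp: coef_mmonom monoms_def intro: polys_mmonom\<close>)
  have fg: "prj (gforms {1..m} ds i) = gforms {1..m} ds i" if "i \<in> {1..m}" for i
    by (rule fix_form[OF polys_gform]) (use that in \<open>auto simp: coef_gform W_def coefvars_def intro: polys_mvar\<close>)
  have eq: "mmonom \<beta> * mconst r \<in> generic_ideal m ds \<longleftrightarrow> mmonom \<beta> * mconst r \<in> form_ideal {1..m} (gforms {1..m} ds)"
    if b: "\<beta> \<in> monoms {1..m} N" for \<beta> N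
  proof
    assume "mmonom \<beta> * mconst r \<in> generic_ideal m ds"
    then show "mmonom \<beta> * mconst r \<in> form_ideal {1..m} (gforms {1..m} ds)"
      unfolding generic_ideal_def form_ideal_def generic_form_eq by blast
  next
    assume "mmonom \<beta> * mconst r \<in> form_ideal {1..m} (gforms {1..m} ds)"
    then obtain h where h: "mmonom \<beta> * mconst r = (\<Sum>i=1..m. h i * gforms {1..m} ds i)"
      by (auto simp: form_ideal_def)
    have "mmonom \<beta> * mconst r = prj (mmonom \<beta> * mconst r)"
      by (simp add: prj.hom_mult fm[OF b] fr)
    also have "\<dots> = (\<Sum>i=1..m. prj (h i) * gforms {1..m} ds i)"
      unfolding h prj.hom_sum prj.hom_mult by (rule sum.cong[OF refl]) (simp only: fg)
    finally show "mmonom \<beta> * mconst r \<in> generic_ideal m ds"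
      unfolding generic_ideal_def generic_form_eq
      by (intro CollectI exI[of _ "\<lambda>i. prj (h i)"] conjI ballI mem)
  qed
  have "mconst r \<in> mpolys (coeff_ring m ds) {1..m}"
    using mem[of "mconst r"] by (simp add: fr)
  then show ?thesis unfolding generic_saturation_def inertia_def using eq by blast
qed

theorem universal_resultant_eq:
  assumes F: "forms {1..m} ds"
  shows "universal_resultant m ds = uresultant {1..m} ds"
proof -
  interpret F: forms "{1..m}" ds by fact
  define R where "R = uresultant {1..m} ds"
  define A where "A = coeff_ring m ds"
  have A: "A = polys (coefvars {1..m} ds)" by (simp add: A_def coeff_ring_eq)
  interpret A: factor_closed A unfolding A by (rule factor_closed_polys)
  have RA: "R \<in> A" unfolding A R_def by (rule F.uresultant_polys)
  have R0: "R \<noteq> 0" unfolding R_def by (rule F.uresultant_nonzero)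
  have set: "{r \<in> A. mconst r \<in> generic_saturation m ds} = {r \<in> A. R dvd r}"
    using generic_saturation_iff[of _ m ds] F.inertia_iff_dvd unfolding A_def R_def by blast
  have ideal: "{r \<in> A. R dvd r} = {q * R | q. q \<in> A}"
  proof (intro equalityI subsetI)
    fix r assume "r \<in> {r \<in> A. R dvd r}"
    then have "r \<in> A" "R dvd r" by simp_all
    then obtain q where "r = R * q" by (elim dvdE)
    then have "r = q * R" "R * q \<in> A" using \<open>r \<in> A\<close> by (simp_all add: mult.commute)
    then show "r \<in> {q * R | q. q \<in> A}" using A.factor_mem[OF RA R0] by blast
  qed (auto intro: A.mult_closed RA)
  have norm: "meval of_int (\<lambda>(i, \<alpha>). if \<alpha> = psingle i (ds i) then 1 else 0) p = at_powers ds p" for p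
    by (simp add: at_powers_def)
  show ?thesis
    unfolding universal_resultant_def norm A_def[symmetric] R_def[symmetric] set
  proof (rule the_equality, goal_cases)
    case 1
    show ?case
      using RA ideal F.at_powers_uresultant by (auto simp: R_def)
  next
    case (2 R')
    then have R': "R' \<in> A \<and> {r \<in> A. R dvd r} = {q * R' |q. q \<in> A} \<and> at_powers ds R' = 1" by simp
    have "1 * R' \<in> {q * R' |q. q \<in> A}" using A.one_closed by blast
    then have "R' \<in> {r \<in> A. R dvd r}" using R' by (simp only: mult_1)
    then have 1: "R dvd R'" by simp
    have "R \<in> {q * R' |q. q \<in> A}" using R' RA by auto
    then have 2: "R' dvd R" by auto
    obtain q where q: "R' = R * q" "q dvd 1" using mutual_dvd_cofactor[OF 2 1 R0] by blast
    interpret h: comm_ring_hom "at_powers ds" by (rule comm_ring_hom_at_powers)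
    have "at_powers ds q = 1"
      using R' arg_cong[OF q(1), of "at_powers ds"] F.at_powers_uresultant by (simp add: h.hom_mult R_def)
    then have "q = 1" using unit_eq_1[OF q(2) comm_ring_hom_at_powers] by blast
    then show "R' = R" using q by simp
  qed
qed

lemma resultant_forms_eq:
  "forms {1..m} ds \<Longrightarrow> resultant_forms m ds g = Res {1..m} ds g"
  by (simp add: resultant_forms_def Res_def universal_resultant_eq)

section \<open>Partial derivatives\<close>

lemma mpderiv_superset:
  fixes p :: "('i, 'a::comm_semiring_1) mpoly"
  assumes "finite S" "supp p \<subseteq> S"
  shows "mpderiv i p = (\<Sum>\<alpha>\<in>S. psingle (\<alpha> - psingle i 1) (of_nat (coef \<alpha> i) * coef p \<alpha>))"
  unfolding mpderiv_def by (rule sum.mono_neutral_left) (use assms in \<open>auto simp: in_keys_iff\<close>)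

lemma mpderiv_add: "mpderiv i (p + q) = mpderiv i p + mpderiv i (q :: ('i, 'a::comm_semiring_1) mpoly)"
proof -
  define S where "S = supp p \<union> supp q"
  have "finite S" "supp (p + q) \<subseteq> S" "supp p \<subseteq> S" "supp q \<subseteq> S"
    using keys_add[of p q] by (auto simp: S_def)
  then show ?thesis
    by (simp add: mpderiv_superset[of S] lookup_add distrib_left single_add sum.distrib)
qed

lemma mpderiv_0 [simp]: "mpderiv i 0 = 0"
  by (simp add: mpderiv_def)

lemma mpderiv_sum: "mpderiv i (sum f S) = (\<Sum>x\<in>S. mpderiv i (f x))"
  by (induction S rule: infinite_finite_induct) (auto simp: mpderiv_add)

lemma mpderiv_psingle: "mpderiv i (psingle \<alpha> c) = psingle (\<alpha> - psingle i 1) (of_nat (coef \<alpha> i) * c)"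
  by (subst mpderiv_superset[of "{\<alpha>}"]) auto

lemma coef_mpderiv:
  "coef (mpderiv i p) \<beta> = of_nat (Suc (coef \<beta> i)) * coef p (\<beta> + psingle i 1)"
  for p :: "('i, 'a::comm_semiring_1) mpoly"
proof (induction p rule: poly_mapping_induct)
  case (single a c)
  show ?case
  proof (cases "a = \<beta> + psingle i 1")
    case True
    then have "a - psingle i 1 = \<beta>" by simp
    then show ?thesis using True by (simp add: mpderiv_psingle lookup_add)
  next
    case False
    have "coef a i = 0 \<or> a - psingle i 1 \<noteq> \<beta>"
    proof (rule ccontr)
      assume *: "\<not> ?thesis"
      then have "a = \<beta> + psingle i 1"
        by (intro poly_mapping_eqI) (auto simp: lookup_add lookup_minus lookup_single when_def)
      then show False using False by simp
    qed
    then show ?thesis using False by (auto simp: mpderiv_psingle lookup_single when_def)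
  qed
qed (auto simp: mpderiv_add lookup_add distrib_left)

lemma mpderiv_mult: "mpderiv i (p * q) = mpderiv i p * q + p * mpderiv i (q :: ('i, 'a::comm_semiring_1) mpoly)"
proof (induction p rule: poly_mapping_induct)
  case (single a c)
  show ?case
  proof (induction q rule: poly_mapping_induct)
    case (single b d)
    have 1: "a + b - psingle i 1 = (a - psingle i 1) + b" if "coef a i > 0"
      using that by (intro poly_mapping_eqI) (auto simp: lookup_add lookup_minus lookup_single when_def)
    have 2: "a + b - psingle i 1 = a + (b - psingle i 1)" if "coef b i > 0"
      using that by (intro poly_mapping_eqI) (auto simp: lookup_add lookup_minus lookup_single when_def)
    have "psingle (a + b - psingle i 1) (of_nat (coef a i) * c * d) = psingle (a - psingle i 1 + b) (of_nat (coef a i) * c * d)"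
      using 1 by (cases "coef a i = 0") auto
    moreover have "psingle (a + b - psingle i 1) (of_nat (coef b i) * (c * d)) = psingle (a + (b - psingle i 1)) (of_nat (coef b i) * (c * d))"
      using 2 by (cases "coef b i = 0") auto
    ultimately show ?case
      unfolding mult_single mpderiv_psingle lookup_add of_nat_add distrib_right single_add
      by (simp add: mult.assoc mult.left_commute[of c])
  qed (auto simp: mpderiv_add distrib_left add_ac)
qed (auto simp: mpderiv_add distrib_right add_ac)

lemma mpderiv_mconst [simp]: "mpderiv i (mconst c) = 0"
  by (simp add: mconst_def mpderiv_psingle)

lemma mpderiv_1 [simp]: "mpderiv i (1 :: ('i, 'a::comm_semiring_1) mpoly) = 0"
  using mpderiv_mconst[of i "1 :: 'a"] by simp

lemma mpderiv_mvar: "mpderiv i (mvar j) = (if i = j then 1 else (0 :: ('i, 'a::comm_semiring_1) mpoly))"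
  by (auto simp: mvar_def mmonom_def mpderiv_psingle lookup_single when_def)

lemma mpderiv_mconst_mult: "mpderiv i (mconst c * p) = mconst c * mpderiv i (p :: ('i, 'a::comm_semiring_1) mpoly)"
  by (simp add: mpderiv_mult)

lemma mpderiv_power: "mpderiv i (p ^ k) = of_nat k * p ^ (k - 1) * mpderiv i (p :: ('i, 'a::comm_semiring_1) mpoly)"
proof (induction k)
  case (Suc k)
  then show ?case by (cases k) (simp_all add: mpderiv_mult algebra_simps)
qed simp

lemma is_form_mpderiv:
  fixes p :: "('i, 'a::comm_semiring_1) mpoly"
  assumes "is_form V k p"
  shows "is_form V (k - 1) (mpderiv i p)"
  unfolding is_form_def mhomogeneous_def polys_iff
proof (intro conjI ballI)
  fix \<beta> assume "\<beta> \<in> supp (mpderiv i p)"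
  then have "\<beta> + psingle i 1 \<in> supp p" by (auto simp: in_keys_iff coef_mpderiv)
  then have "mdeg (\<beta> + psingle i 1) = k" "supp (\<beta> + psingle i 1) \<subseteq> V"
    using assms by (auto simp: is_form_def mhomogeneous_def polys_iff)
  then show "mdeg \<beta> = k - 1" "supp \<beta> \<subseteq> V"
    by (auto simp: mdeg_add in_keys_iff lookup_add)
qed

lemma map_coef_mpderiv:
  assumes "comm_ring_hom f"
  shows "map_coef f (mpderiv i p) = mpderiv i (map_coef f p)"
proof -
  interpret f: comm_ring_hom f by fact
  show ?thesis
    by (rule poly_mapping_eqI) (simp add: coef_map_coef assms coef_mpderiv f.hom_mult f.hom_of_nat f.hom_add)
qed

lemma euler_mpderiv:
  fixes p :: "('i, 'a::comm_semiring_1) mpoly"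
  assumes "finite V" "is_form V k p"
  shows "(\<Sum>i\<in>V. mvar i * mpderiv i p) = of_nat k * p"
proof -
  have mono: "(\<Sum>i\<in>V. mvar i * mpderiv i (psingle \<alpha> c)) = of_nat k * psingle \<alpha> c" if a: "\<alpha> \<in> supp p" for \<alpha> and c :: 'a
  proof -
    have aV: "supp \<alpha> \<subseteq> V" "mdeg \<alpha> = k" using assms a by (auto simp: is_form_def mhomogeneous_def polys_iff)
    have "mvar i * mpderiv i (psingle \<alpha> c) = psingle \<alpha> (of_nat (coef \<alpha> i) * c)" for i
    proof (cases "coef \<alpha> i = 0")
      case False
      then have "psingle i 1 + (\<alpha> - psingle i 1) = \<alpha>"
        by (intro poly_mapping_eqI) (auto simp: lookup_add lookup_minus lookup_single when_def)
      then show ?thesis by (simp add: mvar_def mmonom_def mpderiv_psingle mult_single)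
    qed (simp add: mpderiv_psingle)
    then have "(\<Sum>i\<in>V. mvar i * mpderiv i (psingle \<alpha> c)) = (\<Sum>i\<in>V. psingle \<alpha> (of_nat (coef \<alpha> i) * c))" by simp
    also have "\<dots> = psingle \<alpha> (\<Sum>i\<in>V. of_nat (coef \<alpha> i) * c)"
    proof -
      have "(\<Sum>i\<in>S. psingle \<alpha> (f i)) = psingle \<alpha> (\<Sum>i\<in>S. f i)" for S and f :: "'i \<Rightarrow> 'a"
        by (induction S rule: infinite_finite_induct) (auto simp: single_add)
      then show ?thesis .
    qed
    also have "(\<Sum>i\<in>V. of_nat (coef \<alpha> i) * c) = of_nat k * c"
      using mdeg_superset[OF assms(1) aV(1)] aV(2) by (simp flip: sum_distrib_right of_nat_sum)
    also have "psingle \<alpha> (of_nat k * c) = of_nat k * psingle \<alpha> c"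
      unfolding single_of_nat[symmetric] mult_single by simp
    finally show ?thesis .
  qed
  have "(\<Sum>i\<in>V. mvar i * mpderiv i (\<Sum>\<alpha>\<in>supp p. psingle \<alpha> (coef p \<alpha>))) =
      (\<Sum>\<alpha>\<in>supp p. \<Sum>i\<in>V. mvar i * mpderiv i (psingle \<alpha> (coef p \<alpha>)))"
    unfolding mpderiv_sum sum_distrib_left by (rule sum.swap)
  also have "\<dots> = of_nat k * (\<Sum>\<alpha>\<in>supp p. psingle \<alpha> (coef p \<alpha>))"
    by (simp add: mono sum_distrib_left)
  finally show ?thesis by (simp add: sum_single_coef)
qed

lemma Res_add_combination:
  fixes g :: "nat \<Rightarrow> (nat, 'a::comm_ring_1) mpoly"
  assumes F: "forms V ds" and n: "n \<in> V" and S: "finite S" "S \<subseteq> V - {n}"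
    and g: "\<And>k. k \<in> V \<Longrightarrow> is_form V (ds k) (g k)"
    and h: "\<And>k. k \<in> S \<Longrightarrow> ds k \<le> ds n \<and> is_form V (ds n - ds k) (h k)"
  shows "Res V ds (g(n := g n + (\<Sum>k\<in>S. h k * g k))) = Res V ds g"
  using S h
proof (induction S rule: finite_induct)
  case empty
  then show ?case by simp
next
  case (insert i S)
  interpret F: forms V ds by fact
  define g' where "g' = g(n := g n + (\<Sum>k\<in>S. h k * g k))"
  have g'f: "is_form V (ds k) (g' k)" if k: "k \<in> V" for k
  proof (cases "k = n")
    case True
    have "is_form V (ds n) (h l * g l)" if l: "l \<in> S" for l
    proof -
      have "ds l \<le> ds n" "is_form V (ds n - ds l) (h l)" "l \<in> V" using insert.prems l by auto
      then show ?thesis using is_form_mult[OF _ g[of l], of "ds n - ds l" "h l"] by simp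
    qed
    then have "is_form V (ds n) (g n + (\<Sum>k\<in>S. h k * g k))"
      using g[OF n] by (intro is_form_add is_form_sum)
    then show ?thesis using True by (simp add: g'_def)
  qed (use g k in \<open>simp add: g'_def\<close>)
  have iV: "i \<in> V" "i \<noteq> n" using insert.prems by auto
  have "Res V ds (\<lambda>k. if k = i then g' i else g' k + (if k = n then h i else 0) * g' i) = Res V ds g'"
    by (rule Res_add_multiple[OF F iV(1) g'f]) (use insert.prems(2)[of i] in auto)
  moreover have "(\<lambda>k. if k = i then g' i else g' k + (if k = n then h i else 0) * g' i) =
      g(n := g n + (\<Sum>k\<in>insert i S. h k * g k))"
    using iV insert.hyps by (auto simp: g'_def fun_eq_iff add_ac)
  moreover have "Res V ds g' = Res V ds g" unfolding g'_def by (rule insert.IH) (use insert.prems in auto)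
  ultimately show ?case by (simp only:)
qed

section \<open>The discriminant\<close>

text \<open>With an indeterminate in place of m the resultant is a univariate polynomial, whose
  values at m and at 0 differ by a multiple of m.\<close>

lemma Res_cong_mod:
  fixes g t :: "nat \<Rightarrow> (nat, int) mpoly"
  assumes "forms V ds"
  shows "m dvd Res V ds (\<lambda>i. g i + mconst m * t i) - Res V ds g"
proof -
  interpret F: forms V ds by fact
  have c: "comm_ring_hom (\<lambda>c :: int. [:c:])" by (rule comm_ring_hom_const_poly)
  define G where "G i = map_coef (\<lambda>c. [:c:]) (g i) + mconst [:0, 1:] * map_coef (\<lambda>c. [:c:]) (t i)" for i
  have ev: "poly (Res V ds G) x = Res V ds (\<lambda>i. g i + mconst x * t i)" for x
  proof -
    have p: "comm_ring_hom (\<lambda>q :: int poly. poly q x)" by (rule comm_ring_hom_poly)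
    interpret m: comm_ring_hom "map_coef (\<lambda>q :: int poly. poly q x)" by (rule comm_ring_hom_map_coef[OF p])
    have "map_coef (\<lambda>q :: int poly. poly q x) (map_coef (\<lambda>c. [:c:]) r) = r" for r :: "(nat, int) mpoly"
      by (rule poly_mapping_eqI) (simp add: coef_map_coef p c)
    then show ?thesis
      unfolding F.Res_map_coef[OF p] by (simp add: G_def m.hom_add m.hom_mult map_coef_mconst[OF p])
  qed
  obtain a q where "Res V ds G = pCons a q" by (cases "Res V ds G")
  then have "poly (Res V ds G) m - poly (Res V ds G) 0 = m * poly q m" by simp
  then show ?thesis by (simp add: ev)
qed

definition in_radical :: "nat set \<Rightarrow> (nat \<Rightarrow> (nat, 'a::comm_ring_1) mpoly) \<Rightarrow> (nat, 'a) mpoly \<Rightarrow> bool" where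
  "in_radical V g p \<longleftrightarrow> (\<exists>m. p ^ m \<in> form_ideal V g)"

lemma in_radical_ideal: "p \<in> form_ideal V g \<Longrightarrow> in_radical V g p"
  unfolding in_radical_def by (intro exI[of _ 1]) simp

lemma in_radical_add:
  assumes "in_radical V g p" "in_radical V g q"
  shows "in_radical V g (p + q)"
proof -
  obtain a b where ab: "p ^ a \<in> form_ideal V g" "q ^ b \<in> form_ideal V g"
    using assms by (auto simp: in_radical_def)
  have "(p + q) ^ (a + b) = (\<Sum>k\<le>a + b. of_nat ((a + b) choose k) * p ^ k * q ^ (a + b - k))"
    by (rule binomial_ring)
  also have "\<dots> \<in> form_ideal V g"
  proof (rule form_ideal_sum)
    fix k
    show "of_nat ((a + b) choose k) * p ^ k * q ^ (a + b - k) \<in> form_ideal V g"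
    proof (cases "a \<le> k")
      case True
      then have "p ^ k = p ^ (k - a) * p ^ a" by (simp flip: power_add)
      then have "of_nat ((a + b) choose k) * p ^ k * q ^ (a + b - k) =
          (of_nat ((a + b) choose k) * p ^ (k - a) * q ^ (a + b - k)) * p ^ a" by (simp only: mult_ac)
      then show ?thesis using form_ideal_mult[OF ab(1)] by simp
    next
      case False
      then have "a + b - k = (a - k) + b" by simp
      then have "q ^ (a + b - k) = q ^ (a - k) * q ^ b" by (simp only: power_add)
      then have "of_nat ((a + b) choose k) * p ^ k * q ^ (a + b - k) =
          (of_nat ((a + b) choose k) * p ^ k * q ^ (a - k)) * q ^ b" by (simp only: mult_ac)
      then show ?thesis using form_ideal_mult[OF ab(2)] by simp
    qed
  qed
  finally show ?thesis unfolding in_radical_def by blast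
qed

lemma in_radical_mult: "in_radical V g p \<Longrightarrow> in_radical V g (q * p)"
  unfolding in_radical_def using form_ideal_mult by (metis power_mult_distrib)

lemma in_radical_power: "in_radical V g (p ^ k) \<Longrightarrow> in_radical V g p"
  unfolding in_radical_def by (metis power_mult)

lemma in_radical_0: "in_radical V g 0"
  by (rule in_radical_ideal) simp

lemma in_radical_sum: "(\<And>x. x \<in> S \<Longrightarrow> in_radical V g (f x)) \<Longrightarrow> in_radical V g (sum f S)"
  by (induction S rule: infinite_finite_induct) (auto intro: in_radical_add in_radical_0)

lemma in_radical_uminus: "in_radical V g p \<Longrightarrow> in_radical V g (- p)"
  using in_radical_mult[of V g p "- 1"] by simp

lemma in_radical_add_iff:
  assumes "in_radical V g q" shows "in_radical V g (p + q) \<longleftrightarrow> in_radical V g p"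
  using in_radical_add[OF _ assms, of p] in_radical_add[OF _ in_radical_uminus[OF assms], of "p + q"] by auto

text \<open>The form \<open>x\<^sub>1 ^ d + \<Sum> x\<^sub>i x\<^sub>i\<^sub>+\<^sub>1 ^ (d - 1)\<close> and all but the last of its partial
  derivatives have no common zero modulo a divisor of \<open>d\<close>.\<close>

lemma katz_sarnak:
  assumes n: "n \<ge> 2" and d: "d \<ge> 2"
  shows "\<exists>f :: (nat, int) mpoly. is_form {1..n} d f \<and>
    (\<exists>u. u dvd 1 \<and> int d dvd Res {1..n} ((\<lambda>_. d - 1)(n := d)) ((\<lambda>i. mpderiv i f)(n := f)) - u)"
proof -
  define V where "V = {1..n}"
  define ds where "ds = (\<lambda>_. d - 1)(n := d)"
  have F: "forms V ds" using n d by (auto simp: forms_def V_def ds_def)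
  interpret F: forms V ds by (rule F)
  \<comment> \<open>\<open>y 1 = 1\<close> makes the first summand of f the power x_1 ^ d, while the
    others are x_(i - 1) x_i ^ (d - 1).\<close>
  define y where "y i = (if i = 1 then 1 else i - 1)" for i :: nat
  define x where "x i = (mvar i :: (nat, int) mpoly)" for i
  define f where "f = (\<Sum>i\<in>V. x (y i) * x i ^ (d - 1))"
  \<comment> \<open>Modulo d, the factor d - 1 in the derivative of x_k ^ (d - 1) is -1.
    \<open>g\<close> is the system reduced in this way, and \<open>t\<close> is what d was
    multiplied with in the dropped terms.\<close>
  define t where "t k = (if k = n then 0 else x (y k) * x k ^ (d - 2))" for k
  define g where "g k = (if k = n then f else if k = 1 then x 2 ^ (d - 1) else x (Suc k) ^ (d - 1) - x (k - 1) * x k ^ (d - 2))" for k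
  have yV: "y i \<in> V" if "i \<in> V" for i using that by (auto simp: y_def V_def)
  have xf: "is_form V k (x i ^ k)" if "i \<in> V" for i k unfolding x_def by (rule is_form_mvar_power[OF that])
  have x1: "is_form V 1 (x i)" if "i \<in> V" for i unfolding x_def by (rule is_form_mvar[OF that])
  have fform: "is_form V d f"
    unfolding f_def
  proof (rule is_form_sum)
    fix i assume i: "i \<in> V"
    show "is_form V d (x (y i) * x i ^ (d - 1))"
      using is_form_mult[OF x1[OF yV[OF i]] xf[OF i, of "d - 1"]] d by simp
  qed
  have gform: "is_form V (ds k) (g k)" if k: "k \<in> V" for k
  proof -
    consider "k = n" | "k = 1" "k \<noteq> n" | "k \<noteq> 1" "k \<noteq> n" by blast
    then show ?thesis
    proof cases
      case 1 then show ?thesis using fform by (simp add: g_def ds_def)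
    next
      case 2 then show ?thesis using xf[of 2 "d - 1"] n by (simp add: g_def ds_def V_def)
    next
      case 3
      then have "Suc k \<in> V" "k - 1 \<in> V" using k by (auto simp: V_def)
      then have "is_form V (d - 1) (x (Suc k) ^ (d - 1))" "is_form V (1 + (d - 2)) (x (k - 1) * x k ^ (d - 2))"
        using k by (blast intro: xf, blast intro: xf is_form_mult x1)
      moreover have "1 + (d - 2) = d - 1" using d by simp
      ultimately show ?thesis using 3 by (auto simp: g_def ds_def intro: is_form_diff)
    qed
  qed
  have deriv: "mpderiv k f = g k + mconst (int d) * t k" if k: "k \<in> V" "k \<noteq> n" for k
  proof -
    have trm: "mpderiv k (x (y i) * x i ^ (d - 1)) =
        (if y i = k then x i ^ (d - 1) else 0) + (if i = k then mconst (int (d - 1)) * (x (y k) * x k ^ (d - 2)) else 0)" for i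
    proof -
      have e: "d - 1 - 1 = d - 2" by simp
      show ?thesis
        by (auto simp: mpderiv_mult mpderiv_power x_def mpderiv_mvar e mconst_int mult_ac numeral_2_eq_2)
    qed
    have fin: "finite V" "k \<in> V" "Suc k \<in> V" "1 \<in> V" using k by (auto simp: V_def)
    have yk: "y i = k \<longleftrightarrow> i = Suc k \<or> (i = 1 \<and> k = 1)" if "i \<in> V" for i using that k by (auto simp: y_def V_def)
    have "(\<Sum>i\<in>V. if y i = k then x i ^ (d - 1) else 0) =
       (\<Sum>i\<in>V. (if i = Suc k then x i ^ (d - 1) else 0) + (if i = 1 then if k = 1 then x 1 ^ (d - 1) else 0 else 0))"
      by (intro sum.cong refl) (use k in \<open>auto simp: yk\<close>)
    also have "\<dots> = x (Suc k) ^ (d - 1) + (if k = 1 then x 1 ^ (d - 1) else 0)"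
      using fin by (simp add: sum.distrib)
    finally have D: "mpderiv k f = x (Suc k) ^ (d - 1) + (if k = 1 then x 1 ^ (d - 1) else 0) + mconst (int (d - 1)) * (x (y k) * x k ^ (d - 2))"
      unfolding f_def mpderiv_sum trm sum.distrib using fin by simp
    have dd: "mconst (int d) = 1 + (mconst (int (d - 1)) :: (nat, int) mpoly)"
      using d by (simp add: mconst_int)
    show ?thesis
    proof (cases "k = 1")
      case True
      have "x 1 * x 1 ^ (d - 2) = x 1 ^ (d - 1)" using d by (metis One_nat_def Suc_diff_Suc Suc_le_eq numeral_2_eq_2 power_Suc)
      then show ?thesis using True k unfolding D dd by (simp add: g_def t_def y_def numeral_2_eq_2 algebra_simps)
    next
      case False
      then show ?thesis using k unfolding D dd by (simp add: g_def t_def y_def algebra_simps)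
    qed
  qed
  have "Res V ds ((\<lambda>i. mpderiv i f)(n := f)) = Res V ds (\<lambda>i. g i + mconst (int d) * t i)"
  proof (rule F.Res_cong)
    fix k assume "k \<in> V"
    then show "((\<lambda>i. mpderiv i f)(n := f)) k = g k + mconst (int d) * t k"
      using deriv[of k] by (cases "k = n") (simp_all add: g_def t_def)
  qed
  then have dvd: "int d dvd Res V ds ((\<lambda>i. mpderiv i f)(n := f)) - Res V ds g"
    using Res_cong_mod[OF F, of "int d" g t] by simp
  have gI: "g k \<in> form_ideal V g" if "k \<in> V" for k by (rule form_ideal_gen[OF F.finite_V that])
  have rad: "in_radical V g (x i)" if i: "i \<in> V" for i
  proof -
    have nV: "n \<in> V" "1 \<in> V" using n by (auto simp: V_def)
    have fI: "f \<in> form_ideal V g" using gI[OF nV(1)] by (simp add: g_def)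
    have g1: "x 2 ^ (d - 1) \<in> form_ideal V g" using gI[OF nV(2)] n by (simp add: g_def)
    have gk: "x (Suc k) ^ (d - 1) - x (k - 1) * x k ^ (d - 2) \<in> form_ideal V g" if "2 \<le> k" "k < n" for k
      using gI[of k] that by (simp add: g_def V_def)
    have fsplit: "f = x 1 ^ d + (\<Sum>i\<in>{2..n}. x (i - 1) * x i ^ (d - 1))"
    proof -
      have V2: "V = insert 1 {2..n}" using n by (auto simp: V_def)
      have "x 1 * x 1 ^ (d - 1) = x 1 ^ d" using d by (metis One_nat_def Suc_diff_le Suc_le_eq diff_Suc_Suc diff_zero pos2 order_less_le_trans power_Suc)
      moreover have "(\<Sum>i\<in>{2..n}. x (y i) * x i ^ (d - 1)) = (\<Sum>i\<in>{2..n}. x (i - 1) * x i ^ (d - 1))"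
        by (intro sum.cong) (auto simp: y_def)
      ultimately show ?thesis unfolding f_def V2 by (simp add: y_def)
    qed
    have fr: "in_radical V g (x 1 ^ d + (\<Sum>i\<in>{2..n}. x (i - 1) * x i ^ (d - 1)))"
      using in_radical_ideal[OF fI] fsplit by simp
    show ?thesis
    \<comment> \<open>For d \<ge> 3 the relations put x_2, x_3 and so on into the radical one after
      the other. For d = 2 the factor x_k ^ (d - 2) is 1, and they only identify variables whose
      indices have the same parity.\<close>
    proof (cases "d = 2")
      case False
      then have d3: "d \<ge> 3" using d by simp
      have up: "in_radical V g (x (Suc (Suc k)))" if "Suc (Suc k) \<le> n" for k
        using that
      proof (induction k)
        case 0
        then show ?case using in_radical_power[OF in_radical_ideal[OF g1]] by (simp add: numeral_2_eq_2)
      next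
        case (Suc k)
        have "in_radical V g (x (Suc (Suc k)) ^ (d - 2))"
        proof -
          have "d - 2 = Suc (d - 3)" using d3 by simp
          then have "x (Suc (Suc k)) ^ (d - 2) = x (Suc (Suc k)) ^ (d - 3) * x (Suc (Suc k))" by (simp only: power_Suc2)
          then show ?thesis using Suc in_radical_mult by simp
        qed
        then have "in_radical V g (x (Suc k) * x (Suc (Suc k)) ^ (d - 2))" by (rule in_radical_mult)
        moreover have "in_radical V g (x (Suc (Suc (Suc k))) ^ (d - 1) - x (Suc k) * x (Suc (Suc k)) ^ (d - 2))"
          using in_radical_ideal[OF gk[of "Suc (Suc k)"]] Suc.prems by simp
        ultimately have "in_radical V g (x (Suc (Suc (Suc k))) ^ (d - 1))"
          using in_radical_add by fastforce
        then show ?case by (rule in_radical_power)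
      qed
      have up': "in_radical V g (x j)" if "2 \<le> j" "j \<le> n" for j
        using up[of "j - 2"] that by (simp add: Suc_diff_Suc numeral_2_eq_2)
      have "in_radical V g (\<Sum>i\<in>{2..n}. x (i - 1) * x i ^ (d - 1))"
      proof (rule in_radical_sum)
        fix i assume i: "i \<in> {2..n}"
        have "d - 1 = Suc (d - 2)" using d by simp
        then have "x (i - 1) * x i ^ (d - 1) = (x (i - 1) * x i ^ (d - 2)) * x i" by (simp only: power_Suc2 mult.assoc)
        then show "in_radical V g (x (i - 1) * x i ^ (d - 1))"
          unfolding \<open>x (i - 1) * x i ^ (d - 1) = _\<close> by (intro in_radical_mult up') (use i in auto)
      qed
      then have "in_radical V g (x 1 ^ d)" using fr in_radical_add_iff by blast
      then have "in_radical V g (x 1)" by (rule in_radical_power)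
      then show ?thesis using up'[of i] i by (cases "i = 1") (auto simp: V_def)
    next
      case True
      have par: "(even j \<longrightarrow> in_radical V g (x j)) \<and> (odd j \<longrightarrow> in_radical V g (x j - x 1))" if "1 \<le> j" "j \<le> n" for j
        using that
      proof (induction j rule: less_induct)
        case (less j)
        consider "j = 1" | "j = 2" | "j \<ge> 3" using less.prems by linarith
        then show ?case
        proof cases
          case 1 then show ?thesis using in_radical_0 by simp
        next
          case 2 then show ?thesis using in_radical_ideal[OF g1] True by simp
        next
          case 3
          have "in_radical V g (x j - x (j - 2))"
            using in_radical_ideal[OF gk[of "j - 1"]] 3 less.prems True by (simp add: numeral_2_eq_2)
          note * = in_radical_add[OF this]
          have IH: "(even (j - 2) \<longrightarrow> in_radical V g (x (j - 2))) \<and> (odd (j - 2) \<longrightarrow> in_radical V g (x (j - 2) - x 1))"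
            by (rule less.IH) (use 3 less.prems in auto)
          show ?thesis
          proof (intro conjI impI)
            assume "even j"
            then show "in_radical V g (x j)" using *[of "x (j - 2)"] IH 3 by simp
          next
            assume "odd j"
            then show "in_radical V g (x j - x 1)" using *[of "x (j - 2) - x 1"] IH 3 by simp
          qed
        qed
      qed
      \<comment> \<open>Of two neighbouring indices one is even, and the variables of even index lie
        in the radical.\<close>
      have "in_radical V g (\<Sum>i\<in>{2..n}. x (i - 1) * x i ^ (d - 1))"
      proof (rule in_radical_sum)
        fix i assume i: "i \<in> {2..n}"
        show "in_radical V g (x (i - 1) * x i ^ (d - 1))"
        proof (cases "even i")
          case True
          then show ?thesis using par[of i] i \<open>d = 2\<close> in_radical_mult by simp
        next
          case False
          then have "in_radical V g (x (i - 1))" using par[of "i - 1"] i by auto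
          then show ?thesis using in_radical_mult[of V g "x (i - 1)" "x i ^ (d - 1)"] by (simp add: mult.commute)
        qed
      qed
      then have "in_radical V g (x 1 ^ d)" using fr in_radical_add_iff by blast
      then have one: "in_radical V g (x 1)" by (rule in_radical_power)
      show ?thesis
        using par[of i] i in_radical_add[OF _ one, of "x i - x 1"] by (cases "even i") (auto simp: V_def)
    qed
  qed
  have "Res V ds g dvd 1"
    by (rule Res_unit[OF F gform]) (use rad in \<open>auto simp: in_radical_def x_def\<close>)
  then show ?thesis using fform dvd unfolding V_def ds_def by blast
qed

section \<open>The power of d in the resultant of the partial derivatives\<close>

lemma disc_exponent_rec:
  assumes "d \<ge> 2"
  shows "disc_exponent (Suc n) d + disc_exponent n d = (d - 1) ^ n"
proof -
  define A where "A n = (int d - 1) ^ n - (-1) ^ n" for n :: nat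
  have rec: "A (Suc n) + A n = int d * (int d - 1) ^ n" for n by (simp add: A_def algebra_simps)
  have dv: "int d dvd A n" for n
  proof (induction n)
    case (Suc n)
    have "A (Suc n) = int d * (int d - 1) ^ n - A n" using rec[of n] by simp
    then show ?case using Suc by simp
  qed (simp add: A_def)
  have nn: "A n \<ge> 0" for n
  proof -
    have "(int d - 1) ^ n \<ge> 1" using assms by (intro one_le_power) simp
    moreover have "(-1 :: int) ^ n \<le> 1" by (cases "even n") auto
    ultimately show ?thesis by (simp add: A_def)
  qed
  have e: "int (disc_exponent n d) = A n div int d" for n
  proof -
    have "A n div int d \<ge> 0" using nn[of n] assms by (subst pos_imp_zdiv_nonneg_iff) auto
    then show ?thesis by (simp add: disc_exponent_def A_def)
  qed
  have "int (disc_exponent (Suc n) d + disc_exponent n d) = (A (Suc n) + A n) div int d"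
    using dv by (simp add: e div_plus_div_distrib_dvd_left)
  also have "\<dots> = int ((d - 1) ^ n)" unfolding rec using assms by (simp add: of_nat_diff)
  finally show ?thesis by (simp only: of_nat_eq_iff)
qed

type_synonym dring = "(nat \<Rightarrow>\<^sub>0 nat, int) mpoly"

definition genform :: "nat \<Rightarrow> nat \<Rightarrow> (nat, dring) mpoly" where
  "genform n d = (\<Sum>\<alpha>\<in>monoms {1..n} d. mconst (mvar \<alpha>) * mmonom \<alpha>)"

definition grad_res :: "nat \<Rightarrow> nat \<Rightarrow> dring" where
  "grad_res n d = Res {1..n} (\<lambda>_. d - 1) (\<lambda>i. mpderiv i (genform n d))"

lemma coef_genform: "coef (genform n d) \<alpha> = (if \<alpha> \<in> monoms {1..n} d then mvar \<alpha> else 0)"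
  unfolding genform_def lookup_sum coef_mconst_mult coef_mmonom
  by (subst sum.mono_neutral_cong_right[of _ "{\<alpha>} \<inter> monoms {1..n} d"]) (auto simp: finite_monoms)

lemma is_form_genform: "is_form {1..n} d (genform n d)"
  unfolding genform_def by (intro is_form_sum is_form_mconst_mult is_form_mmonom)

lemma map_coef_genform:
  fixes f :: "(nat, 'a::comm_ring_1) mpoly"
  assumes "is_form {1..n} d f"
  shows "map_coef (meval of_int (coef f)) (genform n d) = f"
proof (rule poly_mapping_eqI)
  have h: "comm_ring_hom (meval of_int (coef f) :: dring \<Rightarrow> 'a)" by (rule comm_ring_hom_int_meval)
  interpret h: comm_ring_hom "meval of_int (coef f) :: dring \<Rightarrow> 'a" by (rule h)
  fix \<alpha> show "coef (map_coef (meval of_int (coef f)) (genform n d)) \<alpha> = coef f \<alpha>"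
    using is_form_coef_0[OF assms, of \<alpha>] by (simp add: coef_map_coef h coef_genform)
qed

lemma coef_mproj: "coef (mproj V p) \<alpha> = (if supp \<alpha> \<subseteq> V then coef p \<alpha> else 0)"
  for p :: "('i, 'a::comm_ring_1) mpoly"
proof -
  interpret m: comm_ring_hom "mproj V :: ('i, 'a) mpoly \<Rightarrow> _" by (rule comm_ring_hom_mproj)
  show ?thesis
  proof (induction p rule: poly_mapping_induct)
    case (single a c)
    show ?case
    proof (cases "supp a \<subseteq> V")
      case True
      then have "mproj V (psingle a c) = psingle a c" by (intro mproj_ident) (simp add: polys_iff)
      then show ?thesis using True by (auto simp: lookup_single when_def)
    next
      case False
      then have "mon_eval (\<lambda>i. if i \<in> V then mvar i else (0 :: ('i, 'a) mpoly)) a = 0"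
        unfolding mon_eval_def by (intro prod_zero) (auto simp: in_keys_iff zero_power_eq)
      then have "mproj V (psingle a c) = 0" by (simp add: mproj_def meval_psingle)
      then show ?thesis using False by (auto simp: lookup_single when_def)
    qed
  qed (auto simp: m.hom_add lookup_add)
qed

lemma mproj_mpderiv_genform:
  assumes k: "k \<in> {1..n}"
  shows "mproj (- {Suc n}) (mpderiv k (genform (Suc n) d)) = mpderiv k (genform n d)"
proof (rule poly_mapping_eqI)
  fix \<beta> :: "nat \<Rightarrow>\<^sub>0 nat"
  have "supp (\<beta> + psingle k 1) = insert k (supp \<beta>)"
  proof (intro equalityI subsetI)
    fix j assume "j \<in> supp (\<beta> + psingle k 1)"
    then show "j \<in> insert k (supp \<beta>)" using keys_add[of \<beta> "psingle k 1"] by (cases "j = k") auto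
  qed (auto simp: in_keys_iff lookup_add lookup_single when_def)
  then show "coef (mproj (- {Suc n}) (mpderiv k (genform (Suc n) d))) \<beta> = coef (mpderiv k (genform n d)) \<beta>"
    using k by (auto simp: coef_mproj coef_mpderiv coef_genform monoms_def atLeastAtMostSuc_conv le_Suc_eq subset_iff)
qed

lemma mconst_dvd_cancel:
  fixes X Y Z :: "('i::linorder, int) mpoly"
  assumes "c \<noteq> 0" "\<And>p. prime p \<Longrightarrow> p dvd c \<Longrightarrow> \<not> mconst p dvd Y" "mconst c * Z = X * Y"
  shows "mconst c dvd X"
  using assms
proof (induction c arbitrary: X Z rule: prime_divisors_induct)
  case (unit c)
  then have "mconst c dvd (mconst 1 :: ('i, int) mpoly)" by (simp only: mconst_dvd_iff)
  then show ?case by (simp add: dvd_trans[of _ 1])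
next
  case (factor p c)
  have "mconst p * (mconst c * Z) = X * Y" using factor.prems(3) by (simp add: mconst_mult mult.assoc)
  then have "mconst p dvd X * Y" by (metis dvd_triv_left)
  then have "mconst p dvd X"
    using prime_elem_mconst_int[OF factor.hyps, where 'i = 'i] factor.prems(2)[of p] factor.hyps by (simp add: prime_elem_dvd_mult_iff)
  then obtain X' where X': "X = mconst p * X'" by blast
  have "p \<noteq> 0" using factor.hyps by auto
  have "mconst p * (mconst c * Z) = mconst p * (X' * Y)" using factor.prems(3) by (simp add: X' mconst_mult mult.assoc)
  then have "mconst c * Z = X' * Y" using \<open>p \<noteq> 0\<close> by simp
  moreover have "c \<noteq> 0" using factor.prems(1) by auto
  ultimately have "mconst c dvd X'" using factor.IH factor.prems(2) by (meson dvd_mult)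
  then show ?case by (simp add: X' mconst_mult)
qed simp

text \<open>The resultant of the partial derivatives with the last one multiplied by x_n is computed
  in two ways. By multiplicativity it is X, the gradient resultant, times the gradient resultant in
  one variable less. By Euler's relation it is a power of d times Z, where f replaces the last
  derivative. By \<open>disc_exponent_rec\<close> this cancels to d ^ a * Z = X * D' with the
  discriminant D' in one variable less and a = \<open>disc_exponent n d\<close>. No prime factor of
  d divides D', and the last clause of the statement carries this along; so d ^ a divides X.\<close>

theorem disc_exists:
  assumes d: "d \<ge> 2"
  shows "\<exists>D \<in> polys (monoms {1..Suc n} d). of_nat d ^ disc_exponent (Suc n) d * D = grad_res (Suc n) d \<and>
    (\<forall>p :: int. prime p \<longrightarrow> p dvd int d \<longrightarrow> \<not> mconst p dvd D)"
proof (induction n)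
  case 0
  have F: "forms {1..1} (\<lambda>_. d - 1)" using d by (auto simp: forms_def)
  interpret F: forms "{1..1}" "\<lambda>_. d - 1" by (rule F)
  define u :: dring where "u = mvar (psingle 1 d)"
  have g: "mpderiv 1 (genform 1 d) = mconst (of_nat d * u) * mvar 1 ^ (d - 1)"
  proof -
    have "monoms {1..1::nat} d = {psingle 1 d}"
    proof (intro equalityI subsetI)
      fix \<alpha> assume a: "\<alpha> \<in> monoms {1..1::nat} d"
      then have "supp \<alpha> \<subseteq> {1}" "mdeg \<alpha> = d" unfolding monoms_def by (auto dest: subsetD)
      then have "coef \<alpha> 1 = d" using mdeg_superset[of "{1}" \<alpha>] by simp
      moreover have "coef \<alpha> j = 0" if "j \<noteq> 1" for j using a that by (auto simp: monoms_def in_keys_iff)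
      ultimately have "\<alpha> = psingle 1 d" by (intro poly_mapping_eqI) (auto simp: lookup_single when_def)
      then show "\<alpha> \<in> {psingle 1 d}" by simp
    qed (auto simp: monoms_def)
    then have "genform 1 d = mconst u * mvar 1 ^ d" by (simp add: genform_def u_def mmonom_power)
    moreover have "mconst (of_nat d) = (of_nat d :: (nat, dring) mpoly)" by (simp add: mconst_def)
    ultimately show ?thesis by (simp add: mpderiv_mult mpderiv_power mpderiv_mvar mconst_mult mult_ac)
  qed
  have "grad_res 1 d = Res {1..1} (\<lambda>_. d - 1) ((\<lambda>k. mvar k ^ (d - 1))(1 := mconst (of_nat d * u) * mvar 1 ^ (d - 1)))"
    unfolding grad_res_def by (rule F.Res_cong) (use g in auto)
  also have "\<dots> = of_nat d * u"
    using Res_scale[OF F, of 1 "\<lambda>k. mvar k ^ (d - 1)" "of_nat d * u"] by (simp add: F.Res_powers[simplified])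
  finally have X: "grad_res 1 d = of_nat d * u" .
  have a1: "disc_exponent 1 d = 1"
    using disc_exponent_rec[OF d, of 0] by (simp add: disc_exponent_def)
  have "\<not> mconst p dvd u" if p: "prime p" for p :: int
  proof
    assume "mconst p dvd u"
    interpret h: comm_ring_hom "meval of_int (\<lambda>_. 1) :: dring \<Rightarrow> int" by (rule comm_ring_hom_int_meval)
    have "meval of_int (\<lambda>_. 1) (mconst p :: dring) dvd meval of_int (\<lambda>_. 1 :: int) u"
      using \<open>mconst p dvd u\<close> by (rule h.hom_dvd)
    moreover have "meval of_int (\<lambda>_. 1 :: int) u = 1" unfolding u_def by (subst meval_of_int_mvar) simp
    moreover have "meval of_int (\<lambda>_. 1 :: int) (mconst p :: dring) = p" by (subst meval_mconst) auto
    ultimately show False using p by (auto dest: not_prime_unit)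
  qed
  moreover have "u \<in> polys (monoms {1..1} d)" unfolding u_def by (rule polys_mvar) (auto simp: monoms_def)
  ultimately show ?case using X a1 by (intro bexI[of _ u]) auto
next
  case (Suc m)
  define n where "n = Suc (Suc m)"
  define V where "V = {1..n}"
  define W where "W = {1..Suc m}"
  have WV: "W = V - {n}" "W \<noteq> {}" "n \<in> V" by (auto simp: W_def V_def n_def)
  define e where "e = d - 1"
  have e: "e > 0" "d = e + 1" using d by (auto simp: e_def)
  define ds where "ds = (\<lambda>_. e)(n := d)"
  have F: "forms V ds" using e by (auto simp: forms_def V_def ds_def n_def)
  interpret F: forms V ds by (rule F)
  have F1: "forms V (ds(n := 1))" by (rule forms_update[OF F]) simp
  have Fe: "forms V (\<lambda>_. e)" using e by (auto simp: forms_def V_def n_def)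
  interpret Fe: forms V "\<lambda>_. e" by (rule Fe)
  define f where "f = genform n d"
  have ff: "is_form V d f" unfolding f_def V_def by (rule is_form_genform)
  define g where "g = (\<lambda>i. mpderiv i f)"
  have gf: "is_form V e (g i)" for i unfolding g_def e_def by (rule is_form_mpderiv[OF ff])
  define Z where "Z = Res V ds (g(n := f))"
  define X where "X = grad_res n d"
  have X: "X = Res V (\<lambda>_. e) g" by (simp add: X_def grad_res_def V_def e_def g_def f_def)
  obtain D' where D': "of_nat d ^ disc_exponent (Suc m) d * D' = grad_res (Suc m) d"
    "\<And>p :: int. prime p \<Longrightarrow> p dvd int d \<Longrightarrow> \<not> mconst p dvd D'" using Suc by blast
  \<comment> \<open>Setting x_n = 0 in the other partial derivatives of the generic form gives those
    of the generic form in one variable less.\<close>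
  have "Res V ds (g(n := mvar n * g n)) = X * grad_res (Suc m) d"
  proof -
    have "Res V ds (g(n := g n * mvar n)) = Res V (ds(n := e)) (g(n := g n)) * Res V (ds(n := 1)) (g(n := mvar n))"
      by (rule Res_mult[OF F WV(3) e(1)]) (use gf e is_form_mvar[OF WV(3)] in \<open>auto simp: ds_def\<close>)
    also have "ds(n := e) = (\<lambda>_. e)" by (auto simp: ds_def)
    also have "g(n := g n) = g" by simp
    also have "Res V (ds(n := 1)) (g(n := mvar n)) = Res V (ds(n := 1)) (g(n := mvar n - 0))" by simp
    also have "\<dots> = Res W (ds(n := 1)) (\<lambda>k. meval mconst (\<lambda>j. if j = n then 0 else mvar j) (g k))"
      by (rule Res_eliminate[OF F1 WV(3) _ WV(1,2)])
         (use gf WV in \<open>auto simp: ds_def\<close>)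
    also have "\<dots> = Res W (\<lambda>_. e) (\<lambda>k. meval mconst (\<lambda>j. if j = n then 0 else mvar j) (g k))"
    proof -
      have "uresultant W (ds(n := 1)) = uresultant W (\<lambda>_. e)" by (rule uresultant_cong) (auto simp: ds_def WV)
      then show ?thesis by (simp add: Res_def)
    qed
    also have "\<dots> = grad_res (Suc m) d"
    proof -
      have FW: "forms W (\<lambda>_. e)" using e by (auto simp: forms_def W_def)
      interpret FW: forms W "\<lambda>_. e" by (rule FW)
      show ?thesis unfolding grad_res_def W_def[symmetric] e_def[symmetric]
      proof (rule FW.Res_cong)
        fix k assume k: "k \<in> W"
        have "(\<lambda>j. if j = n then 0 else mvar j) = (\<lambda>j. if j \<in> - {n} then mvar j else (0 :: (nat, dring) mpoly))" by auto
        then have "meval mconst (\<lambda>j. if j = n then 0 else mvar j) (g k) = mproj (- {n}) (g k)" by (simp add: mproj_def)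
        then show "meval mconst (\<lambda>j. if j = n then 0 else mvar j) (g k) = mpderiv k (genform (Suc m) d)"
          using mproj_mpderiv_genform[of k "Suc m" d] k by (simp add: g_def f_def n_def W_def)
      qed
    qed
    finally show ?thesis unfolding X by (simp only: mult.commute)
  qed
  moreover have "Res V ds (g(n := mvar n * g n)) = of_nat d ^ (e ^ Suc m) * Z"
  proof -
    define G where "G = g(n := mvar n * g n)"
    have Gf: "is_form V (ds k) (G k)" if "k \<in> V" for k
      using gf is_form_mult[OF is_form_mvar[OF WV(3)] gf[of n]] e by (auto simp: G_def ds_def)
    have "Res V ds (G(n := G n + (\<Sum>k\<in>W. mvar k * G k))) = Res V ds G"
    proof (rule Res_add_combination[OF F WV(3) _ _ Gf])
      fix k assume "k \<in> W"
      then show "ds k \<le> ds n \<and> is_form V (ds n - ds k) (mvar k :: (nat, dring) mpoly)"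
        using WV e is_form_mvar[of k V] by (auto simp: ds_def)
    qed (auto simp: WV W_def V_def)
    moreover have "G n + (\<Sum>k\<in>W. mvar k * G k) = (\<Sum>k\<in>V. mvar k * g k)"
    proof -
      have "(\<Sum>k\<in>W. mvar k * G k) = (\<Sum>k\<in>W. mvar k * g k)" by (intro sum.cong) (auto simp: G_def WV)
      then show ?thesis using WV F.finite_V by (simp add: G_def sum.remove[of V n])
    qed
    moreover have "(\<Sum>k\<in>V. mvar k * g k) = mconst (of_nat d) * f"
      unfolding g_def euler_mpderiv[OF F.finite_V ff] by (simp add: mconst_def)
    ultimately have "Res V ds G = Res V ds (g(n := mconst (of_nat d) * f))" by (simp add: G_def)
    also have "g(n := mconst (of_nat d) * f) = (g(n := f))(n := mconst (of_nat d) * (g(n := f)) n)" by simp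
    also have "Res V ds \<dots> = of_nat d ^ (\<Prod>j\<in>V - {n}. ds j) * Z"
      unfolding Z_def by (rule Res_scale[OF F WV(3)])
    also have "(\<Prod>j\<in>V - {n}. ds j) = e ^ Suc m"
    proof -
      have "(\<Prod>j\<in>V - {n}. ds j) = (\<Prod>j\<in>W. e)" unfolding WV(1) by (intro prod.cong) (auto simp: ds_def)
      then show ?thesis by (simp add: W_def)
    qed
    finally show ?thesis unfolding G_def .
  qed
  ultimately have "of_nat d ^ (e ^ Suc m) * Z = X * (of_nat d ^ disc_exponent (Suc m) d * D')"
    by (simp add: D')
  moreover have "e ^ Suc m = disc_exponent n d + disc_exponent (Suc m) d"
    using disc_exponent_rec[OF d, of "Suc m"] by (simp add: e_def n_def)
  ultimately have "of_nat d ^ disc_exponent (Suc m) d * (of_nat d ^ disc_exponent n d * Z) = of_nat d ^ disc_exponent (Suc m) d * (X * D')"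
    by (simp add: power_add mult_ac)
  then have ZX: "of_nat d ^ disc_exponent n d * Z = X * D'" using d by simp
  have dm: "of_nat d ^ k = (mconst (int d ^ k) :: dring)" for k by (simp add: mconst_int)
  have "mconst (int d ^ disc_exponent n d) dvd X"
  proof (rule mconst_dvd_cancel)
    show "int d ^ disc_exponent n d \<noteq> 0" using d by simp
    show "mconst (int d ^ disc_exponent n d) * Z = X * D'" using ZX by (simp add: dm)
    show "\<not> mconst p dvd D'" if "prime p" "p dvd int d ^ disc_exponent n d" for p
      using D'(2)[OF that(1)] that prime_dvd_power by blast
  qed
  then obtain D where D: "X = of_nat d ^ disc_exponent n d * D" by (auto simp: dm)
  have "of_nat d ^ disc_exponent n d * Z = of_nat d ^ disc_exponent n d * (D * D')"
    using ZX by (simp add: D mult.assoc)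
  then have ZD: "Z = D * D'" using d by simp
  \<comment> \<open>As Z = D * D', it suffices that p does not divide Z, and this can be seen modulo
    p at a single form.\<close>
  have "\<not> mconst p dvd D" if p: "prime p" "p dvd int d" for p :: int
  proof
    assume "mconst p dvd D"
    then have pZ: "mconst p dvd Z" by (simp add: ZD)
    obtain f0 :: "(nat, int) mpoly" and u where f0: "is_form {1..n} d f0" "u dvd 1"
      "int d dvd Res {1..n} ((\<lambda>_. d - 1)(n := d)) ((\<lambda>i. mpderiv i f0)(n := f0)) - u"
      using katz_sarnak[OF _ d, of n] by (auto simp: n_def)
    define \<theta> :: "dring \<Rightarrow> int" where "\<theta> = meval of_int (coef f0)"
    have h: "comm_ring_hom \<theta>" unfolding \<theta>_def by (rule comm_ring_hom_int_meval)
    interpret h: comm_ring_hom \<theta> by (rule h)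
    have mf: "map_coef \<theta> f = f0" unfolding \<theta>_def f_def by (rule map_coef_genform[OF f0(1)])
    have "\<theta> Z = Res V ds ((\<lambda>i. mpderiv i f0)(n := f0))"
      unfolding Z_def F.Res_map_coef[OF h] by (rule F.Res_cong) (auto simp: g_def map_coef_mpderiv[OF h] mf)
    then have "int d dvd \<theta> Z - u" using f0(3) by (simp add: V_def ds_def e_def)
    then have "p dvd \<theta> Z - u" using p(2) by (rule dvd_trans[rotated])
    moreover have "\<theta> (mconst p) = p" unfolding \<theta>_def by (subst meval_mconst) auto
    then have "p dvd \<theta> Z" using h.hom_dvd[OF pZ] by simp
    ultimately have "p dvd u" by (metis dvd_diff_right_iff)
    then have "p dvd 1" using f0(2) dvd_trans by blast
    then show False using p(1) by (auto dest: not_prime_unit)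
  qed
  moreover have "D \<in> polys (monoms {1..n} d)"
  proof -
    have "X \<in> polys (monoms {1..n} d)"
      unfolding X
    proof (rule Fe.Res_polys)
      fix k \<alpha>
      show "coef (g k) \<alpha> \<in> polys (monoms {1..n} d)"
        unfolding g_def coef_mpderiv f_def coef_genform
      proof (rule polys_mult)
        have "of_nat (Suc (coef \<alpha> k)) = (mconst (int (Suc (coef \<alpha> k))) :: dring)"
          unfolding mconst_int of_int_of_nat_eq ..
        then show "of_nat (Suc (coef \<alpha> k)) \<in> (polys (monoms {1..n} d) :: dring set)" by (simp only: polys_mconst)
        have "(0 :: dring) \<in> polys (monoms {1..n} d)" by (simp add: polys_iff)
        then show "(if \<alpha> + psingle k 1 \<in> monoms {1..n} d then mvar (\<alpha> + psingle k 1) else 0 :: dring) \<in> polys (monoms {1..n} d)"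
          by (simp add: polys_mvar)
      qed
    qed
    moreover interpret P: factor_closed "polys (monoms {1..n} d) :: dring set" by (rule factor_closed_polys)
    have "of_nat d ^ disc_exponent n d \<in> (polys (monoms {1..n} d) :: dring set)" unfolding dm by simp
    ultimately show ?thesis using P.factor_mem[of "of_nat d ^ disc_exponent n d" D] d D by simp
  qed
  moreover have "of_nat d ^ disc_exponent n d * D = grad_res n d" using D by (simp add: X_def)
  ultimately show ?case unfolding n_def by blast
qed

text \<open>In the integral ring of generic coefficients the power of d can be cancelled, so the
  universal discriminant is the polynomial of \<open>disc_exists\<close>; its defining identity then
  specializes.\<close>

theorem discriminant_form_eq:
  fixes f :: "(nat, 'a::comm_ring_1) mpoly"
  assumes n: "n \<ge> 1" and d: "d \<ge> 2" and f: "is_form {1..n} d f"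
  shows "of_nat d ^ disc_exponent n d * discriminant_form n d f = Res {1..n} (\<lambda>_. d - 1) (\<lambda>i. mpderiv i f)"
proof -
  have F: "forms {1..n} (\<lambda>_. d - 1)" using n d by (auto simp: forms_def)
  interpret F: forms "{1..n}" "\<lambda>_. d - 1" by (rule F)
  obtain m where m: "n = Suc m" using n by (cases n) auto
  obtain D where D: "D \<in> polys (monoms {1..n} d)" "of_nat d ^ disc_exponent n d * D = grad_res n d"
    using disc_exists[OF d, of m] unfolding m by blast
  have "universal_discriminant n d = D"
    unfolding universal_discriminant_def resultant_forms_eq[OF F] genform_def[symmetric] grad_res_def[symmetric]
  proof (rule the_equality)
    fix E assume "E \<in> polys (monoms {1..n} d) \<and> of_nat d ^ disc_exponent n d * E = grad_res n d"
    then have "of_nat d ^ disc_exponent n d * E = of_nat d ^ disc_exponent n d * D" using D by simp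
    then show "E = D" using d by simp
  qed (use D in simp)
  moreover have h: "comm_ring_hom (meval of_int (coef f) :: dring \<Rightarrow> 'a)" by (rule comm_ring_hom_int_meval)
  interpret h: comm_ring_hom "meval of_int (coef f) :: dring \<Rightarrow> 'a" by (rule h)
  have "meval of_int (coef f) (grad_res n d) = Res {1..n} (\<lambda>_. d - 1) (\<lambda>i. mpderiv i f)"
    unfolding grad_res_def F.Res_map_coef[OF h] map_coef_mpderiv[OF h] map_coef_genform[OF f] ..
  moreover have "meval of_int (coef f) (grad_res n d) = of_nat d ^ disc_exponent n d * meval of_int (coef f) D"
    unfolding D(2)[symmetric] h.hom_mult h.hom_power h.hom_of_nat ..
  ultimately show ?thesis by (simp add: discriminant_form_def)
qed

section \<open>Counting set partitions by type\<close>

text \<open>Partitions as multisets of parts, so that blocks can be added and removed without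
  sorting. \<open>mmult \<nu>\<close> below counts the partitions of a set into blocks of sizes
  \<open>\<nu>\<close>.\<close>

definition mpart :: "nat \<Rightarrow> nat multiset set" where
  "mpart m = {\<nu>. 0 \<notin># \<nu> \<and> \<Sum>\<^sub># \<nu> = m}"

definition mdenom :: "nat multiset \<Rightarrow> nat" where
  "mdenom \<nu> = (\<Prod>j\<in>set_mset \<nu>. fact (count \<nu> j)) * (\<Prod>j\<in>#\<nu>. fact j)"

definition mmult :: "nat multiset \<Rightarrow> nat" where
  "mmult \<nu> = fact (\<Sum>\<^sub># \<nu>) div mdenom \<nu>"

lemma bij_betw_mset_partitions: "bij_betw mset (partitions n) (mpart n)"
proof (rule bij_betwI[where g = "\<lambda>\<nu>. rev (sorted_list_of_multiset \<nu>)"])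
  show "mset \<in> partitions n \<rightarrow> mpart n"
    by (auto simp: partitions_def mpart_def sum_mset_sum_list)
  show "(\<lambda>\<nu>. rev (sorted_list_of_multiset \<nu>)) \<in> mpart n \<rightarrow> partitions n"
  proof
    fix \<nu> assume v: "\<nu> \<in> mpart n"
    have "sum_list (rev (sorted_list_of_multiset \<nu>)) = \<Sum>\<^sub># \<nu>"
      by (metis mset_rev mset_sorted_list_of_multiset sum_mset_sum_list)
    then show "rev (sorted_list_of_multiset \<nu>) \<in> partitions n"
      using v by (auto simp: partitions_def mpart_def sorted_wrt_rev intro!: gr0I)
  qed
  show "rev (sorted_list_of_multiset (mset \<mu>)) = \<mu>" if "\<mu> \<in> partitions n" for \<mu>
  proof -
    have "sorted (rev \<mu>)" using that by (simp add: partitions_def sorted_wrt_rev)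
    then have "sort \<mu> = rev \<mu>" by (intro properties_for_sort) auto
    then show ?thesis by (simp add: sorted_list_of_multiset_mset)
  qed
qed simp

lemma bij_betw_mset_partitions_less:
  "bij_betw mset {\<mu>. \<mu> \<in> partitions n \<and> length \<mu> < d} {\<nu>. \<nu> \<in> mpart n \<and> size \<nu> < d}"
proof (rule bij_betw_subset[OF bij_betw_mset_partitions[of n]])
  show "mset ` {\<mu>. \<mu> \<in> partitions n \<and> length \<mu> < d} = {\<nu>. \<nu> \<in> mpart n \<and> size \<nu> < d}"
  proof -
    have "{\<nu>. \<nu> \<in> mpart n \<and> size \<nu> < d} = {\<nu>. \<nu> \<in> mset ` partitions n \<and> size \<nu> < d}"
      unfolding bij_betw_imp_surj_on[OF bij_betw_mset_partitions[of n]] ..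
    show ?thesis unfolding \<open>{\<nu>. \<nu> \<in> mpart n \<and> size \<nu> < d} = _\<close> by auto
  qed
qed auto

lemma finite_mpart: "finite (mpart m)"
proof -
  have "mpart m \<subseteq> mset ` {xs. set xs \<subseteq> {1..m} \<and> length xs \<le> m}"
  proof
    fix \<nu> assume v: "\<nu> \<in> mpart m"
    obtain xs where xs: "\<nu> = mset xs" by (metis ex_mset)
    have pos: "x > 0" if "x \<in> set xs" for x using v that by (auto simp: mpart_def xs intro!: gr0I)
    have s: "sum_list xs = m" using v by (simp add: mpart_def xs sum_mset_sum_list)
    have "x \<le> m" if "x \<in> set xs" for x using member_le_sum_list[OF that] s by simp
    moreover have "length xs \<le> sum_list xs" using pos
    proof (induction xs)
      case (Cons a xs)
      then show ?case using Cons.prems[of a] by (fastforce simp: Suc_le_eq)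
    qed simp
    ultimately show "\<nu> \<in> mset ` {xs. set xs \<subseteq> {1..m} \<and> length xs \<le> m}"
      using pos s by (auto simp: xs Suc_le_eq)
  qed
  then show ?thesis by (rule finite_subset) (intro finite_imageI finite_lists_length_le, simp)
qed

lemma partition_mult_mset:
  assumes "\<mu> \<in> partitions n"
  shows "partition_mult \<mu> = mmult (mset \<mu>)"
proof -
  have sub: "set \<mu> \<subseteq> {1..sum_list \<mu>}"
    using assms member_le_sum_list[of _ \<mu>] by (auto simp: partitions_def Suc_le_eq)
  have "(\<Prod>j\<in>set \<mu>. fact (count_list \<mu> j)) = (\<Prod>j=1..sum_list \<mu>. fact (count_list \<mu> j) :: nat)"
    by (rule prod.mono_neutral_left[OF _ sub]) (auto simp: count_list_0_iff)
  then show ?thesis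
    unfolding partition_mult_def mmult_def mdenom_def
    by (simp add: sum_mset_sum_list count_mset prod_mset_prod_list flip: mset_map)
qed

lemma mdenom_pos: "mdenom \<nu> > 0"
  by (auto simp: mdenom_def intro!: prod_pos gr0I)

lemma mdenom_add: "mdenom (add_mset c \<nu>) = mdenom \<nu> * Suc (count \<nu> c) * fact c"
proof -
  let ?S = "insert c (set_mset \<nu>)"
  have "(\<Prod>j\<in>?S. fact (count (add_mset c \<nu>) j)) = fact (count (add_mset c \<nu>) c) * (\<Prod>j\<in>?S - {c}. fact (count (add_mset c \<nu>) j) :: nat)"
    by (subst prod.remove[of ?S c]) auto
  also have "(\<Prod>j\<in>?S - {c}. fact (count (add_mset c \<nu>) j)) = (\<Prod>j\<in>?S - {c}. fact (count \<nu> j) :: nat)"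
    by (intro prod.cong) auto
  also have "fact (count (add_mset c \<nu>) c) = Suc (count \<nu> c) * (fact (count \<nu> c) :: nat)" by simp
  also have "Suc (count \<nu> c) * fact (count \<nu> c) * (\<Prod>j\<in>?S - {c}. fact (count \<nu> j)) = Suc (count \<nu> c) * (\<Prod>j\<in>?S. fact (count \<nu> j) :: nat)"
    by (simp add: prod.remove[of ?S c "\<lambda>j. fact (count \<nu> j)"] algebra_simps del: insert_Diff_single)
  also have "(\<Prod>j\<in>?S. fact (count \<nu> j)) = (\<Prod>j\<in>set_mset \<nu>. fact (count \<nu> j) :: nat)"
    by (rule prod.mono_neutral_right) (auto simp: not_in_iff)
  finally show ?thesis by (simp add: mdenom_def mult_ac)
qed

text \<open>Fix an element of the underlying set; the block containing it has some size \<open>c\<close>.\<close>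

lemma real_mult_rec:
  assumes "\<nu> \<in> mpart (Suc m)"
  shows "real (fact (Suc m)) / mdenom \<nu> =
    (\<Sum>c\<in>set_mset \<nu>. real (m choose (c - 1)) * (fact (Suc m - c) / mdenom (\<nu> - {#c#})))"
proof -
  have "real (m choose (c - 1)) * (fact (Suc m - c) / mdenom (\<nu> - {#c#})) = real (fact m) / mdenom \<nu> * (count \<nu> c * c)"
    if c: "c \<in># \<nu>" for c
  proof -
    have v: "\<nu> = add_mset c (\<nu> - {#c#})" using c by simp
    have c0: "c > 0" using assms c by (auto simp: mpart_def intro!: gr0I)
    have "c \<le> Suc m" using v assms by (metis (mono_tags, lifting) mpart_def mem_Collect_eq sum_mset.add_mset le_add1)
    then have "real (m choose (c - 1)) = fact m / (fact (c - 1) * fact (Suc m - c))"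
      using c0 by (subst binomial_fact) auto
    moreover have "mdenom \<nu> = mdenom (\<nu> - {#c#}) * count \<nu> c * fact c"
      using mdenom_add[of c "\<nu> - {#c#}"] v c by (simp add: Suc_diff_1)
    moreover have "fact c = real c * fact (c - 1)" using c0 by (simp add: fact_reduce)
    moreover have "count \<nu> c > 0" using c by simp
    ultimately show ?thesis using mdenom_pos[of "\<nu> - {#c#}"] c0 by (simp add: field_simps)
  qed
  then have "(\<Sum>c\<in>set_mset \<nu>. real (m choose (c - 1)) * (fact (Suc m - c) / mdenom (\<nu> - {#c#})))
     = (\<Sum>c\<in>set_mset \<nu>. real (fact m) / mdenom \<nu> * (count \<nu> c * c))" by (intro sum.cong refl)
  also have "\<dots> = real (fact m) / mdenom \<nu> * real (\<Sum>c\<in>set_mset \<nu>. count \<nu> c * c)"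
    by (simp add: sum_distrib_left)
  also have "(\<Sum>c\<in>set_mset \<nu>. count \<nu> c * c) = Suc m"
  proof -
    obtain xs where xs: "\<nu> = mset xs" by (metis ex_mset)
    show ?thesis using assms sum_list_map_eq_sum_count[of "\<lambda>c. c" xs]
      by (simp add: mpart_def xs sum_mset_sum_list count_mset)
  qed
  finally show ?thesis by (simp add: field_simps)
qed

lemma mpart_remove:
  assumes "\<nu> \<in> mpart (Suc m)" "c \<in># \<nu>"
  shows "c > 0" "c \<le> Suc m" "\<nu> - {#c#} \<in> mpart (Suc m - c)"
proof -
  have v: "\<nu> = add_mset c (\<nu> - {#c#})" using assms by simp
  have s: "c + \<Sum>\<^sub># (\<nu> - {#c#}) = Suc m" using assms(1) v by (metis (mono_tags, lifting) mpart_def mem_Collect_eq sum_mset.add_mset)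
  show "c > 0" using assms by (auto simp: mpart_def intro!: gr0I)
  show "c \<le> Suc m" using s by simp
  show "\<nu> - {#c#} \<in> mpart (Suc m - c)" using s assms by (auto simp: mpart_def dest: in_diffD)
qed

text \<open>The recursion \<open>real_mult_rec\<close>, stated over the reals, exhibits the quotient
  as a sum of products of integers.\<close>

lemma mdenom_dvd: "\<nu> \<in> mpart m \<Longrightarrow> mdenom \<nu> dvd fact m"
proof (induction m arbitrary: \<nu> rule: less_induct)
  case (less m)
  show ?case
  proof (cases m)
    case 0
    then have "\<nu> = {#}" using less.prems by (cases \<nu>) (auto simp: mpart_def)
    then show ?thesis by (simp add: mdenom_def)
  next
    case (Suc k)
    define q where "q c = (fact (Suc k - c) :: nat) div mdenom (\<nu> - {#c#})" for c
    have q: "real (fact (Suc k - c)) / mdenom (\<nu> - {#c#}) = q c" if c: "c \<in># \<nu>" for c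
    proof -
      have "\<nu> - {#c#} \<in> mpart (Suc k - c)" "Suc k - c < m"
        using mpart_remove[of \<nu> k c] less.prems Suc c by auto
      then show ?thesis unfolding q_def by (subst real_of_nat_div) (auto intro: less.IH)
    qed
    have "real (fact (Suc k)) / mdenom \<nu> = real (\<Sum>c\<in>set_mset \<nu>. (k choose (c - 1)) * q c)"
      unfolding real_mult_rec[OF less.prems[unfolded Suc]] of_nat_sum of_nat_mult
      by (intro sum.cong refl) (simp add: q[symmetric])
    then have "real (fact (Suc k)) = real (mdenom \<nu> * (\<Sum>c\<in>set_mset \<nu>. (k choose (c - 1)) * q c))"
      using mdenom_pos[of \<nu>] by (simp add: field_simps)
    then show ?thesis unfolding Suc of_nat_eq_iff by (metis dvd_triv_left)
  qed
qed

lemma mmult_rec: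
  assumes "\<nu> \<in> mpart (Suc m)"
  shows "mmult \<nu> = (\<Sum>c\<in>set_mset \<nu>. (m choose (c - 1)) * mmult (\<nu> - {#c#}))"
proof -
  have r: "real (mmult \<nu>) = fact k / mdenom \<nu>" if "\<nu> \<in> mpart k" for \<nu> k
    using mdenom_dvd[OF that] that unfolding mmult_def by (subst real_of_nat_div) (auto simp: mpart_def)
  have "real (mmult \<nu>) = real (fact (Suc m)) / mdenom \<nu>" using r[OF assms] by (simp only: of_nat_fact)
  also have "\<dots> = (\<Sum>c\<in>set_mset \<nu>. real (m choose (c - 1)) * real (mmult (\<nu> - {#c#})))"
    unfolding real_mult_rec[OF assms]
    by (intro sum.cong refl) (simp add: r[OF mpart_remove(3)[OF assms]])
  finally have "real (mmult \<nu>) = real (\<Sum>c\<in>set_mset \<nu>. (m choose (c - 1)) * mmult (\<nu> - {#c#}))" by simp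
  then show ?thesis by (simp only: of_nat_eq_iff)
qed

text \<open>
  In \<open>Hval\<close> and \<open>Kval\<close>, \<open>W\<close> collects the sizes of the finished blocks and the head block has size
  \<open>c\<close>; each of \<open>q\<close> elements may still join the head block, \<open>q'\<close> elements are already separated
  from it. The exponent of \<open>C\<close> counts how often a form of degree 0 has been split off.
\<close>

fun cexp :: "nat \<Rightarrow> nat \<Rightarrow> nat \<Rightarrow> nat" where
  "cexp d l 0 = 0"
| "cexp d l (Suc m) = (if l + 2 < d then \<Sum>s\<le>m. (m choose s) * cexp d (Suc l) (m - s) else m * fact (d - 1))"

definition Hval :: "nat \<Rightarrow> 'a::comm_semiring_1 \<Rightarrow> (nat multiset \<Rightarrow> 'a) \<Rightarrow> nat multiset \<Rightarrow> nat \<Rightarrow> 'a" where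
  "Hval d C G W m = C ^ cexp d (size W) m * (\<Prod>\<nu> | \<nu> \<in> mpart m \<and> size W + size \<nu> < d. G (W + \<nu>) ^ mmult \<nu>)"

definition Kval :: "nat \<Rightarrow> 'a::comm_semiring_1 \<Rightarrow> (nat multiset \<Rightarrow> 'a) \<Rightarrow> nat multiset \<Rightarrow> nat \<Rightarrow> nat \<Rightarrow> nat \<Rightarrow> 'a" where
  "Kval d C G W c q q' = (if size W + 2 < d
     then \<Prod>s\<le>q. Hval d C G (add_mset (c + s) W) (q' + q - s) ^ (q choose s)
     else C ^ (q * fact (d - 1)) * G (add_mset (c + q) W))"

lemma mpart_0: "mpart 0 = {{#}}"
proof -
  have "\<nu> = {#}" if "\<nu> \<in> mpart 0" for \<nu> using that by (cases \<nu>) (auto simp: mpart_def)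
  then show ?thesis by (auto simp: mpart_def)
qed

lemma Hval_0: "size W < d \<Longrightarrow> Hval d C G W 0 = G W"
proof -
  assume "size W < d"
  then have "{\<nu>. \<nu> \<in> mpart 0 \<and> size W + size \<nu> < d} = {{#}}" by (auto simp: mpart_0)
  then show ?thesis by (simp add: Hval_def mmult_def mdenom_def)
qed

lemma Kval_0: "size W + 1 < d \<Longrightarrow> q' = 0 \<or> size W + 2 < d \<Longrightarrow> Kval d C G W c 0 q' = Hval d C G (add_mset c W) q'"
  by (auto simp: Kval_def Hval_0)

text \<open>The level at which the next divided difference has degree 0. Comparing an element with
  the head block then costs the constant to the power (d - 1)!, and the element always joins the
  block.\<close>

lemma Kval_last:
  assumes "size W + 2 = d"
  shows "Kval d C G W c (Suc q) 0 = C ^ fact (d - 1) * Kval d C G W (Suc c) q 0"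
  using assms by (simp add: Kval_def power_add mult_ac)

text \<open>An element either joins the head block or is separated from it; the two choices combine
  by Pascal's rule.\<close>

lemma Kval_split:
  assumes "size W + 2 < d"
  shows "Kval d C G W c (Suc q) q' = Kval d C G W (Suc c) q q' * Kval d C G W c q (Suc q')"
proof -
  define h where "h s = Hval d C G (add_mset (c + s) W) (Suc (q' + q) - s)" for s
  have "(\<Prod>s\<le>Suc q. h s ^ (Suc q choose s)) = h 0 * (\<Prod>s\<le>q. h (Suc s) ^ ((q choose s) + (q choose Suc s)))"
    by (simp add: prod.atMost_Suc_shift del: prod.atMost_Suc)
  also have "\<dots> = (\<Prod>s\<le>q. h (Suc s) ^ (q choose s)) * (h 0 * (\<Prod>s\<le>q. h (Suc s) ^ (q choose Suc s)))"
    by (simp add: power_add prod.distrib mult_ac)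
  also have "h 0 * (\<Prod>s\<le>q. h (Suc s) ^ (q choose Suc s)) = (\<Prod>s\<le>Suc q. h s ^ (q choose s))"
    by (simp add: prod.atMost_Suc_shift del: prod.atMost_Suc)
  also have "\<dots> = (\<Prod>s\<le>q. h s ^ (q choose s))" by (simp add: binomial_eq_0)
  finally show ?thesis using assms by (simp add: Kval_def h_def)
qed

text \<open>One of the m + 1 remaining elements starts a new block, which s of the other m elements
  complete; this is the recursion \<open>mmult_rec\<close> for the number of set partitions.\<close>

lemma Hval_Suc:
  assumes d: "size W + 1 < d"
  shows "Hval d C G W (Suc m) = Kval d C G W 1 m 0"
proof (cases "size W + 2 < d")
  case False
  then have d': "d = size W + 2" using d by simp
  have "{\<nu>. \<nu> \<in> mpart (Suc m) \<and> size W + size \<nu> < d} = {{#Suc m#}}"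
  proof (intro equalityI subsetI)
    fix \<nu> assume v: "\<nu> \<in> {\<nu>. \<nu> \<in> mpart (Suc m) \<and> size W + size \<nu> < d}"
    then have "size \<nu> \<le> 1" "\<nu> \<noteq> {#}" by (auto simp: d' mpart_def)
    then have "size \<nu> = 1" by (cases \<nu>) auto
    then obtain c where "\<nu> = {#c#}" by (metis size_1_singleton_mset)
    then show "\<nu> \<in> {{#Suc m#}}" using v by (simp add: mpart_def)
  qed (auto simp: mpart_def d')
  then show ?thesis using False by (simp add: Hval_def Kval_def d' mmult_def mdenom_def)
next
  case True
  define T where "T = (SIGMA s:{..m}. {\<nu>. \<nu> \<in> mpart (m - s) \<and> size W + 1 + size \<nu> < d})"
  define T' where "T' = (SIGMA \<nu>:{\<nu>. \<nu> \<in> mpart (Suc m) \<and> size W + size \<nu> < d}. set_mset \<nu>)"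
  have fin: "finite {\<nu>. \<nu> \<in> mpart k \<and> P \<nu>}" for k P using finite_mpart by (rule finite_subset[rotated]) auto
  have "(\<Prod>s\<le>m. Hval d C G (add_mset (1 + s) W) (m - s) ^ (m choose s)) =
     (\<Prod>s\<le>m. C ^ ((m choose s) * cexp d (Suc (size W)) (m - s))) *
     (\<Prod>s\<le>m. \<Prod>\<nu> | \<nu> \<in> mpart (m - s) \<and> size W + 1 + size \<nu> < d. G (add_mset (1 + s) (W + \<nu>)) ^ ((m choose s) * mmult \<nu>))"
    by (simp add: Hval_def power_mult_distrib prod.distrib flip: power_mult) (simp add: mult.commute prod_power_distrib flip: power_mult)
  also have "(\<Prod>s\<le>m. C ^ ((m choose s) * cexp d (Suc (size W)) (m - s))) = C ^ cexp d (size W) (Suc m)"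
    using True by (simp add: power_sum)
  also have "(\<Prod>s\<le>m. \<Prod>\<nu> | \<nu> \<in> mpart (m - s) \<and> size W + 1 + size \<nu> < d. G (add_mset (1 + s) (W + \<nu>)) ^ ((m choose s) * mmult \<nu>))
     = (\<Prod>(s, \<nu>)\<in>T. G (add_mset (1 + s) (W + \<nu>)) ^ ((m choose s) * mmult \<nu>))"
    unfolding T_def by (rule prod.Sigma) (auto simp: fin)
  \<comment> \<open>A pair of s and a partition of m - s corresponds to a partition of m + 1 with a
    marked part of size s + 1.\<close>
  also have "\<dots> = (\<Prod>(\<nu>, c)\<in>T'. G (W + \<nu>) ^ ((m choose (c - 1)) * mmult (\<nu> - {#c#})))"
  proof (rule prod.reindex_bij_witness[where j = "\<lambda>(s, \<nu>). (add_mset (Suc s) \<nu>, Suc s)" and i = "\<lambda>(\<nu>, c). (c - 1, \<nu> - {#c#})"])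
    fix p assume "p \<in> T'"
    then obtain \<nu> c where p: "p = (\<nu>, c)" "\<nu> \<in> mpart (Suc m)" "size W + size \<nu> < d" "c \<in># \<nu>" by (auto simp: T'_def)
    note r = mpart_remove[OF p(2,4)]
    have "size \<nu> = Suc (size (\<nu> - {#c#}))" using p(4) by (metis size_Suc_Diff1)
    then show "(case p of (\<nu>, c) \<Rightarrow> (c - 1, \<nu> - {#c#})) \<in> T" using r p by (auto simp: T_def)
    show "(case case p of (\<nu>, c) \<Rightarrow> (c - 1, \<nu> - {#c#}) of (s, \<nu>) \<Rightarrow> (add_mset (Suc s) \<nu>, Suc s)) = p" using r p by simp
  qed (auto simp: T_def T'_def mpart_def)
  also have "\<dots> = (\<Prod>\<nu> | \<nu> \<in> mpart (Suc m) \<and> size W + size \<nu> < d. \<Prod>c\<in>set_mset \<nu>. G (W + \<nu>) ^ ((m choose (c - 1)) * mmult (\<nu> - {#c#})))"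
    unfolding T'_def by (rule prod.Sigma[symmetric]) (auto simp: fin)
  also have "\<dots> = (\<Prod>\<nu> | \<nu> \<in> mpart (Suc m) \<and> size W + size \<nu> < d. G (W + \<nu>) ^ mmult \<nu>)"
    by (intro prod.cong refl) (auto simp: mmult_rec power_sum)
  finally show ?thesis using True by (simp add: Hval_def Kval_def)
qed

section \<open>The exponent of the constant\<close>

lemma fact_dvd_cexp: "fact (d - 1) dvd cexp d l m"
  by (induction d l m rule: cexp.induct) (auto intro!: dvd_sum dvd_mult)

lemma cexp_eq_0: "l + m < d \<Longrightarrow> cexp d l m = 0"
  by (induction d l m rule: cexp.induct) auto

lemma cexp_2: "cexp 2 0 n = n - 1"
  by (cases n) auto

text \<open>
  \<open>dsum\<close> of the degrees of a square system is the degree of its resultant. Resultants of generic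
  forms of these degrees would satisfy the recursion for \<open>Kval\<close>, whence the value of the exponent.
\<close>

fun dsum :: "nat list \<Rightarrow> nat" where
  "dsum [] = 0"
| "dsum (x # xs) = prod_list xs + x * dsum xs"

lemma dsum_append: "dsum (xs @ ys) = dsum xs * prod_list ys + prod_list xs * dsum ys"
  by (induction xs) (auto simp: algebra_simps)

definition degs :: "nat \<Rightarrow> nat \<Rightarrow> nat list" where
  "degs d l = map (\<lambda>t. d - t) (rev [1..<Suc l])"

lemma degs_Suc: "degs d (Suc l) = (d - Suc l) # degs d l"
  by (simp add: degs_def)

lemma degs_0 [simp]: "degs d 0 = []"
  by (simp add: degs_def)

lemma prod_degs: "l < d \<Longrightarrow> prod_list (degs d l) * fact (d - 1 - l) = fact (d - 1)"
proof (induction l)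
  case (Suc l)
  have "(fact (d - 1 - l) :: nat) = (d - Suc l) * fact (d - 1 - Suc l)"
    using Suc.prems by (simp add: fact_reduce)
  then show ?case using Suc by (simp add: degs_Suc mult_ac)
qed simp

text \<open>Powers of 2 are put for C and G, which turns the recursion into one for exponents. The
  exponent is the total degree of the resultant in the given state: q forms of degree d - 1 -
  \<open>size W\<close>, q' forms of degree one less, and the chain.\<close>

lemma Kval_dsum:
  assumes "size W + 1 < d" "q' = 0 \<or> size W + 2 < d"
  shows "Kval d 2 (\<lambda>W. 2 ^ dsum (degs d (size W))) W c q q' =
    (2 :: nat) ^ dsum (replicate q (d - Suc (size W)) @ replicate q' (d - Suc (Suc (size W))) @ degs d (Suc (size W)))"
  using assms
\<comment> \<open>Joining lowers q + q', separating keeps it and lowers q. A new head taken from the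
  separated elements turns (0, k + 1) into (k, 0), which is why q + q' enters by its square.\<close>
proof (induction "(q + q') * (q + q') + q" arbitrary: W c q q' rule: less_induct)
  case less
  define w where "w = size W"
  have w: "Suc w < d" using less.prems by (simp add: w_def)
  show ?case
  proof (cases q)
    case 0
    show ?thesis
    proof (cases q')
      case 0
      then show ?thesis using \<open>q = 0\<close> less.prems by (simp add: Kval_0 Hval_0)
    next
      case (Suc k)
      then have w2: "size W + 2 < d" using less.prems by simp
      have "Kval d 2 (\<lambda>W. 2 ^ dsum (degs d (size W))) W c 0 (Suc k) = Kval d (2 :: nat) (\<lambda>W. 2 ^ dsum (degs d (size W))) (add_mset c W) 1 k 0"
        using w2 by (simp add: Kval_0 Hval_Suc)
      also have "\<dots> = 2 ^ dsum (replicate k (d - Suc (Suc w)) @ degs d (Suc (Suc w)))"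
        using w2 less.hyps[of k 0 "add_mset c W" 1] \<open>q = 0\<close> Suc by (simp add: w_def)
      also have "replicate k (d - Suc (Suc w)) @ degs d (Suc (Suc w)) = replicate (Suc k) (d - Suc (Suc w)) @ degs d (Suc w)"
        by (simp add: degs_Suc[of d "Suc w"] replicate_app_Cons_same)
      finally show ?thesis using \<open>q = 0\<close> Suc by (simp add: w_def)
    qed
  next
    case (Suc k)
    have IH: "Kval d (2 :: nat) (\<lambda>W. 2 ^ dsum (degs d (size W))) W (Suc c) k q' = 2 ^ dsum (replicate k (d - Suc w) @ replicate q' (d - Suc (Suc w)) @ degs d (Suc w))"
      using less.hyps[of k q' W "Suc c"] less.prems Suc by (simp add: w_def)
    show ?thesis
    proof (cases "w + 2 < d")
      case True
      then have "Kval d (2 :: nat) (\<lambda>W. 2 ^ dsum (degs d (size W))) W c k (Suc q') = 2 ^ dsum (replicate k (d - Suc w) @ replicate (Suc q') (d - Suc (Suc w)) @ degs d (Suc w))"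
        using less.hyps[of k "Suc q'" W c] less.prems Suc by (simp add: w_def)
      moreover have "d - Suc w = Suc (d - Suc (Suc w))" using True by simp
      ultimately show ?thesis using IH Suc True
        by (simp add: w_def[symmetric] Kval_split dsum_append prod_list_replicate algebra_simps flip: power_add)
    next
      case False
      then have d: "size W + 2 = d" "q' = 0" using w less.prems by (auto simp: w_def)
      have "prod_list (degs d (Suc w)) = fact (d - 1)" using prod_degs[of "Suc w" d] w False by (simp add: w_def d(1)[symmetric])
      moreover have "d - Suc (size W) = 1" using d by simp
      ultimately show ?thesis using IH Suc d
        by (simp add: w_def[symmetric] Kval_last[OF d(1)] dsum_append prod_list_replicate flip: power_add)
    qed
  qed
qed

lemma dsum_degs:
  assumes "l < d"
  shows "int (dsum (degs d l)) = (\<Sum>j=1..l. (\<Prod>t=1..l. int d - int t) div (int d - int j))"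
  using assms
proof (induction l)
  case (Suc l)
  have p: "int (prod_list (degs d l)) = (\<Prod>t=1..l. int d - int t)" using Suc.prems
  proof (induction l)
    case (Suc l)
    moreover have "int (d - Suc l) = int d - int (Suc l)" using Suc.prems by simp
    ultimately show ?case by (simp add: degs_Suc mult.commute del: of_nat_Suc of_nat_diff)
  qed simp
  have "(\<Prod>t=1..Suc l. int d - int t) div (int d - int j) = (int d - int (Suc l)) * ((\<Prod>t=1..l. int d - int t) div (int d - int j))"
    if j: "j \<in> {1..l}" for j
  proof -
    have "int d - int j dvd (\<Prod>t=1..l. int d - int t)" using j by (intro dvd_prodI) auto
    then show ?thesis by (simp add: div_mult_swap mult.commute)
  qed
  then have "(\<Sum>j=1..l. (\<Prod>t=1..Suc l. int d - int t) div (int d - int j)) = (int d - int (Suc l)) * int (dsum (degs d l))"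
    using Suc by (simp add: sum_distrib_left del: of_nat_Suc)
  moreover have "(\<Prod>t=1..Suc l. int d - int t) div (int d - int (Suc l)) = int (prod_list (degs d l))"
    using Suc.prems by (simp add: p)
  ultimately show ?case using Suc.prems by (simp add: degs_Suc of_nat_diff)
qed simp

text \<open>At the start there are n forms of degree d - 1, of total degree n times (d - 1) ^ (n -
  1). Equating exponents of 2 with those in the product \<open>Hval\<close> isolates
  \<open>cexp\<close>.\<close>

lemma coeff_exponent_eq:
  assumes "d \<ge> 2" "n \<ge> 1"
  shows "coeff_exponent n d = int (cexp d 0 n)"
proof -
  let ?G = "\<lambda>W. 2 ^ dsum (degs d (size W)) :: nat"
  obtain m where m: "n = Suc m" using assms(2) by (cases n) auto
  have "degs d 1 = [d - 1]" by (simp add: degs_def)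
  then have "dsum (replicate m (d - 1) @ degs d 1) = n * (d - 1) ^ m"
  proof -
    have "dsum (replicate k e) * e + e ^ k = Suc k * e ^ k" for k e
      by (induction k) (auto simp: prod_list_replicate algebra_simps)
    from this[of m "d - 1"] show ?thesis using \<open>degs d 1 = [d - 1]\<close> by (simp add: dsum_append prod_list_replicate m)
  qed
  then have "2 ^ (n * (d - 1) ^ m) = Hval d 2 ?G {#} n"
    using Kval_dsum[of "{#}" d 0 1 m] assms Hval_Suc[of "{#}" d 2 ?G m] by (simp add: m)
  also have "\<dots> = 2 ^ (cexp d 0 n + (\<Sum>\<nu> | \<nu> \<in> mpart n \<and> size \<nu> < d. mmult \<nu> * dsum (degs d (size \<nu>))))"
    by (simp add: Hval_def power_add power_sum power_mult[symmetric] mult.commute)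
  also have "(\<Sum>\<nu> | \<nu> \<in> mpart n \<and> size \<nu> < d. mmult \<nu> * dsum (degs d (size \<nu>))) =
    (\<Sum>\<mu> | \<mu> \<in> partitions n \<and> length \<mu> < d. partition_mult \<mu> * dsum (degs d (length \<mu>)))"
    by (subst sum.reindex_bij_betw[OF bij_betw_mset_partitions_less, symmetric])
       (intro sum.cong, auto simp: partition_mult_mset)
  finally have "n * (d - 1) ^ m = cexp d 0 n + (\<Sum>\<mu> | \<mu> \<in> partitions n \<and> length \<mu> < d. partition_mult \<mu> * dsum (degs d (length \<mu>)))"
    by simp
  then have "int n * int (d - 1) ^ m = int (cexp d 0 n) + (\<Sum>\<mu> | \<mu> \<in> partitions n \<and> length \<mu> < d. int (partition_mult \<mu>) * int (dsum (degs d (length \<mu>))))"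
    by (metis (mono_tags, lifting) of_nat_add of_nat_mult of_nat_power of_nat_sum sum.cong)
  moreover have "int (d - 1) = int d - 1" using assms by simp
  ultimately show ?thesis by (simp add: coeff_exponent_def m dsum_degs)
qed

section \<open>Divided differences\<close>

text \<open>The complete homogeneous symmetric polynomials. They are the divided differences of
  powers: for x ^ k and l points, the one of degree k - l + 1.\<close>

fun hl :: "'a::comm_ring_1 list \<Rightarrow> nat \<Rightarrow> 'a" where
  "hl [] 0 = 1"
| "hl [] (Suc m) = 0"
| "hl (x # xs) 0 = 1"
| "hl (x # xs) (Suc m) = hl xs (Suc m) + x * hl (x # xs) m"

text \<open>\<open>dd \<beta> d xs\<close> is the divided difference of the polynomial \<open>\<Sum>k<d. \<beta> k * x ^ k\<close> at \<open>xs\<close>.\<close>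

definition dd :: "(nat \<Rightarrow> 'a::comm_ring_1) \<Rightarrow> nat \<Rightarrow> 'a list \<Rightarrow> 'a" where
  "dd \<beta> d xs = (\<Sum>m<Suc d - length xs. \<beta> (m + length xs - 1) * hl xs m)"

lemma hl_0 [simp]: "hl xs 0 = 1"
  by (cases xs) auto

lemma hl_single [simp]: "hl [x] m = x ^ m"
  by (induction m) auto

lemma hl_diff: "(x - y) * hl (x # y # xs) m = hl (x # xs) (Suc m) - hl (y # xs) (Suc m)"
proof (induction m)
  case (Suc m)
  have "(x - y) * hl (x # y # xs) (Suc m) = (x - y) * hl (y # xs) (Suc m) + x * ((x - y) * hl (x # y # xs) m)"
    by (simp add: algebra_simps)
  then show ?case unfolding Suc by (simp add: algebra_simps)
qed (simp add: algebra_simps)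

lemma hl_swap: "hl (x # y # xs) m = hl (y # x # xs) m"
proof (induction m)
  case (Suc m)
  have "x * hl (x # xs) m - y * hl (y # xs) m = (x - y) * hl (y # x # xs) m"
    using hl_diff[of x y xs m] Suc by (simp add: algebra_simps)
  then show ?case using Suc by (simp add: algebra_simps)
qed simp

lemma hl_append_swap: "hl (ys @ x # y # xs) m = hl (ys @ y # x # xs) m"
proof (induction ys arbitrary: m)
  case (Cons z ys)
  show ?case
  proof (induction m)
    case (Suc m)
    then show ?case using Cons.IH[of "Suc m"] by simp
  qed simp
qed (simp add: hl_swap)

lemma dd_append_swap: "dd \<beta> d (ys @ x # y # xs) = dd \<beta> d (ys @ y # x # xs)"
  by (simp add: dd_def hl_append_swap)

lemma dd_single: "dd \<beta> d [x] = (\<Sum>k<d. \<beta> k * x ^ k)"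
  by (simp add: dd_def)

lemma dd_diff: "(x - y) * dd \<beta> d (x # y # xs) = dd \<beta> d (x # xs) - dd \<beta> d (y # xs)"
proof (cases "length xs < d")
  case True
  then have *: "Suc d - length (z # xs) = Suc (Suc d - length (x # y # xs))" for z by simp
  have "(x - y) * dd \<beta> d (x # y # xs) =
      (\<Sum>m<Suc d - length (x # y # xs). \<beta> (m + Suc (length xs)) * ((x - y) * hl (x # y # xs) m))"
    by (simp add: dd_def sum_distrib_left mult_ac)
  then show ?thesis
    unfolding hl_diff dd_def * sum.lessThan_Suc_shift by (simp add: sum_subtractf right_diff_distrib del: hl.simps)
qed (simp add: dd_def)

lemma dd_full: "xs \<noteq> [] \<Longrightarrow> dd \<beta> (length xs) xs = \<beta> (length xs - 1)"
  by (simp add: dd_def Suc_diff_le)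

lemma dd_0: "d < length xs \<Longrightarrow> dd \<beta> d xs = 0"
  by (simp add: dd_def)

lemma hom_hl:
  assumes "comm_ring_hom h"
  shows "h (hl xs m) = hl (map h xs) m"
proof -
  interpret comm_ring_hom h by fact
  show ?thesis by (induction xs m rule: hl.induct) (simp_all add: hom_add hom_mult)
qed

lemma hom_dd: "comm_ring_hom h \<Longrightarrow> h (dd \<beta> d xs) = dd (\<lambda>k. h (\<beta> k)) d (map h xs)"
proof -
  assume h: "comm_ring_hom h"
  interpret comm_ring_hom h by fact
  show ?thesis by (simp add: dd_def hom_sum hom_mult hom_hl[OF h])
qed

lemma is_form_hl: "set L \<subseteq> V \<Longrightarrow> is_form V m (hl (map mvar L) m :: (nat, 'a::comm_ring_1) mpoly)"
proof (induction L arbitrary: m)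
  case Nil
  then show ?case by (cases m) auto
next
  case (Cons a L)
  show ?case
  proof (induction m)
    case (Suc m)
    have "is_form V (1 + m) (mvar a * hl (map mvar (a # L)) m :: (nat, 'a) mpoly)"
      using Cons.prems by (intro is_form_mult is_form_mvar Suc) auto
    then show ?case using Cons by (simp add: is_form_add)
  qed simp
qed

lemma is_form_dd:
  fixes \<beta> :: "nat \<Rightarrow> (nat, 'a::comm_ring_1) mpoly"
  assumes "set L \<subseteq> V" "L \<noteq> []" "\<And>k. k < d \<Longrightarrow> is_form V (d - 1 - k) (\<beta> k)"
  shows "is_form V (d - length L) (dd \<beta> d (map mvar L))"
  unfolding dd_def
proof (rule is_form_sum)
  fix m assume m: "m \<in> {..<Suc d - length (map mvar L :: (nat, 'a) mpoly list)}"
  have "is_form V ((d - 1 - (m + length L - 1)) + m) (\<beta> (m + length L - 1) * hl (map mvar L) m)"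
  proof (rule is_form_mult[OF _ is_form_hl[OF assms(1)]])
    have "m + length L - 1 < d" using m assms(2) by (cases L) auto
    then show "is_form V (d - 1 - (m + length L - 1)) (\<beta> (m + length L - 1))" by (rule assms(3))
  qed
  moreover have "(d - 1 - (m + length L - 1)) + m = d - length L"
    using m assms(2) by (cases L) auto
  ultimately show "is_form V (d - length L) (\<beta> (m + length (map mvar L) - 1) * hl (map mvar L) m)" by simp
qed

text \<open>Newton's interpolation formula with remainder. The nodes are listed in reverse because
  each new node is put in front.\<close>

lemma newton:
  "dd \<beta> d [y] = (\<Sum>j<k. (\<Prod>s<j. y - x s) * dd \<beta> d (map x (rev [0..<Suc j]))) +
     (\<Prod>s<k. y - x s) * dd \<beta> d (y # map x (rev [0..<k]))"
proof (induction k)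
  case (Suc k)
  have "dd \<beta> d (y # map x (rev [0..<k])) = dd \<beta> d (map x (rev [0..<Suc k])) + (y - x k) * dd \<beta> d (y # map x (rev [0..<Suc k]))"
    using dd_diff[of y "x k" \<beta> d "map x (rev [0..<k])"] by simp
  then show ?case unfolding Suc by (simp only: sum.lessThan_Suc prod.lessThan_Suc distrib_left mult.assoc add.assoc)
qed simp

text \<open>By Newton's formula the matrix is the product of a lower triangular one, whose diagonal
  gives the Vandermonde factor, and an upper triangular one of divided differences, whose diagonal
  is 1 up to the last entry.\<close>

lemma det_divided_difference:
  fixes x :: "nat \<Rightarrow> 'a::comm_ring_1"
  assumes "k > 0"
  shows "det (mat k k (\<lambda>(r, c). if c = k - 1 then dd \<beta> d [x r] else x r ^ c)) =
    (\<Prod>r<k. \<Prod>s<r. x r - x s) * dd \<beta> d (map x (rev [0..<k]))"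
proof -
  \<comment> \<open>Column c < k - 1 consists of values of the monomial X ^ c, which is encoded by
    the coefficients \<open>\<delta> c\<close> below the bound \<open>D c\<close>.\<close>
  define \<delta> where "\<delta> c = (if c = k - 1 then \<beta> else (\<lambda>j. if j = c then 1 else 0))" for c
  define D where "D c = (if c = k - 1 then d else k)" for c
  define Lw where "Lw = mat k k (\<lambda>(r, j). \<Prod>s<j. x r - x s)"
  define Up where "Up = mat k k (\<lambda>(j, c). dd (\<delta> c) (D c) (map x (rev [0..<Suc j])))"
  have "mat k k (\<lambda>(r, c). if c = k - 1 then dd \<beta> d [x r] else x r ^ c) = Lw * Up"
  proof (rule eq_matI)
    fix r c assume "r < dim_row (Lw * Up)" "c < dim_col (Lw * Up)"
    then have rc: "r < k" "c < k" by (auto simp: Lw_def Up_def)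
    have "dd (\<delta> c) (D c) [x r] = (\<Sum>j<k. (\<Prod>s<j. x r - x s) * dd (\<delta> c) (D c) (map x (rev [0..<Suc j])))"
    proof -
      have "(\<Prod>s<k. x r - x s) = 0" using rc by (intro prod_zero) auto
      then show ?thesis by (subst newton[where k = k and x = x]) simp
    qed
    also have "\<dots> = (Lw * Up) $$ (r, c)"
      using rc by (simp add: Lw_def Up_def scalar_prod_def atLeast0LessThan del: upt_Suc)
    also have "dd (\<delta> c) (D c) [x r] = (if c = k - 1 then dd \<beta> d [x r] else x r ^ c)"
      using rc by (auto simp: \<delta>_def D_def dd_single if_distrib[where f = "\<lambda>a. a * _"] cong: if_cong)
    finally show "mat k k (\<lambda>(r, c). if c = k - 1 then dd \<beta> d [x r] else x r ^ c) $$ (r, c) = (Lw * Up) $$ (r, c)"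
      using rc by simp
  qed (auto simp: Lw_def Up_def)
  moreover have "det (Lw * Up) = det Lw * det Up" by (rule det_mult[of _ k]) (auto simp: Lw_def Up_def)
  moreover have "det Lw = (\<Prod>r<k. \<Prod>s<r. x r - x s)"
  proof (subst det_lower_triangular[of k])
    show "Lw $$ (i, j) = 0" if "i < j" "j < k" for i j
      using that by (auto simp: Lw_def intro!: prod_zero)
  qed (auto simp: Lw_def prod_list_diag_prod atLeast0LessThan)
  moreover have "det Up = dd \<beta> d (map x (rev [0..<k]))"
  proof -
    \<comment> \<open>The divided difference of X ^ c at j + 1 points is 1 for j = c and 0 for j >
      c.\<close>
    have e: "dd (\<delta> c) (D c) (map x (rev [0..<Suc j])) = (if j = c then 1 else 0)" if jc: "c < k - 1" "c \<le> j" "j < k" for j c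
    proof -
      obtain l where l: "k - j = Suc l" using jc by (cases "k - j") auto
      show ?thesis using jc l by (simp add: dd_def \<delta>_def D_def sum.lessThan_Suc_shift del: upt_Suc sum.lessThan_Suc)
    qed
    have "upper_triangular Up" unfolding upper_triangular_def by (auto simp: Up_def e simp del: upt_Suc)
    then have "det Up = prod_list (diag_mat Up)" by (rule det_upper_triangular[of _ k]) (simp add: Up_def)
    also have "\<dots> = (\<Prod>j<k. Up $$ (j, j))" by (simp add: prod_list_diag_prod Up_def atLeast0LessThan)
    also have "\<dots> = (\<Prod>j<k - 1. Up $$ (j, j)) * Up $$ (k - 1, k - 1)"
      using assms by (cases k) auto
    also have "(\<Prod>j<k - 1. Up $$ (j, j)) = 1" by (intro prod.neutral) (simp add: Up_def e del: upt_Suc)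
    also have "Up $$ (k - 1, k - 1) = dd \<beta> d (map x (rev [0..<k]))" using assms by (simp add: Up_def \<delta>_def D_def del: upt_Suc)
    finally show ?thesis by simp
  qed
  ultimately show ?thesis by simp
qed

lemma divided_difference_eq:
  fixes P :: "nat \<Rightarrow> (nat, 'a::idom) mpoly"
  assumes js: "distinct js" "js \<noteq> []" and d: "d > 0"
    and \<beta>: "\<And>k. k < d \<Longrightarrow> mhomogeneous (d - 1 - k) (\<beta> k)"
    and P: "\<And>j. j \<in> set js \<Longrightarrow> P j = dd \<beta> d [mvar j]"
  shows "divided_difference (d - 1) P js = dd \<beta> d (map mvar (rev js))"
proof (cases "length js \<le> d")
  case False
  then show ?thesis using d by (simp add: divided_difference_def dd_0)
next
  case True
  define k where "k = length js"
  have k0: "k > 0" using js by (simp add: k_def)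
  define Q where "Q = dd \<beta> d (map mvar (rev js))"
  define v :: "(nat, 'a) mpoly" where "v = (\<Prod>r<k. \<Prod>s<r. mvar (js ! r) - mvar (js ! s))"
  \<comment> \<open>Over a domain this factor can be cancelled, which gives the uniqueness of the
    divided difference.\<close>
  have v0: "v \<noteq> 0"
  proof -
    have "mvar (js ! r) - mvar (js ! s) \<noteq> (0 :: (nat, 'a) mpoly)" if "r < k" "s < r" for r s
    proof -
      have "js ! r \<noteq> js ! s" using js that by (simp add: k_def nth_eq_iff_index_eq)
      then have "psingle (js ! r) (1 :: nat) \<noteq> psingle (js ! s) 1" by (metis lookup_single_eq lookup_single_not_eq zero_neq_one)
      then have "mvar (js ! r) \<noteq> (mvar (js ! s) :: (nat, 'a) mpoly)"
        unfolding mvar_def mmonom_def by (metis lookup_single_eq lookup_single_not_eq zero_neq_one)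
      then show ?thesis by simp
    qed
    then show ?thesis by (auto simp: v_def)
  qed
  have "mat k k (\<lambda>(r, c). if c = k - 1 then P (js ! r) else mvar (js ! r) ^ c) =
      mat k k (\<lambda>(r, c). if c = k - 1 then dd \<beta> d [mvar (js ! r)] else mvar (js ! r) ^ c)"
    by (rule eq_matI) (auto simp: P k_def)
  moreover have "map mvar (rev js) = map (\<lambda>r. mvar (js ! r) :: (nat, 'a) mpoly) (rev [0..<k])"
    unfolding k_def rev_map[symmetric] by (simp add: map_nth flip: map_map[unfolded comp_def])
  ultimately have det: "det (mat k k (\<lambda>(r, c). if c = k - 1 then P (js ! r) else mvar (js ! r) ^ c)) = v * Q"
    using det_divided_difference[OF k0, of \<beta> d "\<lambda>r. mvar (js ! r)"] by (simp add: v_def Q_def)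
  have "is_form UNIV (d - length js) Q"
    using is_form_dd[of "rev js" UNIV d \<beta>] \<beta> js by (auto simp: Q_def is_form_def polys_iff)
  then have "mhomogeneous (d - 1 + 1 - k) Q" using d by (simp add: is_form_def k_def)
  then show ?thesis
    using True d v0 unfolding divided_difference_def k_def[symmetric] v_def[symmetric] det Q_def[symmetric]
    by (auto intro!: the_equality)
qed

section \<open>Partial derivatives of symmetric forms\<close>

text \<open>Admits any set of variables, so that a single variable can be split off.\<close>

definition esym :: "nat set \<Rightarrow> nat \<Rightarrow> (nat, 'a::comm_ring_1) mpoly" where
  "esym V p = (\<Sum>S | S \<subseteq> V \<and> card S = p. \<Prod>i\<in>S. mvar i)"

lemma esym_0: "finite V \<Longrightarrow> esym V 0 = 1"
proof -
  assume "finite V"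
  then have "{S. S \<subseteq> V \<and> card S = 0} = {{}}" by (auto dest: finite_subset)
  then show ?thesis by (simp add: esym_def)
qed

lemma esym_insert:
  assumes "finite V" "i \<notin> V"
  shows "esym (insert i V) (Suc p) = esym V (Suc p) + mvar i * (esym V p :: (nat, 'a::comm_ring_1) mpoly)"
proof -
  have inj: "inj_on (insert i) {S. S \<subseteq> V \<and> card S = p}"
    using assms by (auto simp: inj_on_def)
  have "{S. S \<subseteq> insert i V \<and> card S = Suc p} = {S. S \<subseteq> V \<and> card S = Suc p} \<union> insert i ` {S. S \<subseteq> V \<and> card S = p}"
  proof (intro equalityI subsetI)
    fix S assume S: "S \<in> {S. S \<subseteq> insert i V \<and> card S = Suc p}"
    show "S \<in> {S. S \<subseteq> V \<and> card S = Suc p} \<union> insert i ` {S. S \<subseteq> V \<and> card S = p}"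
    proof (cases "i \<in> S")
      case True
      then have "S = insert i (S - {i})" "S - {i} \<subseteq> V" "card (S - {i}) = p" using S by auto
      then show ?thesis by blast
    qed (use S in auto)
  qed (use assms in \<open>auto intro!: card_insert_disjoint intro: finite_subset\<close>)
  then have "esym (insert i V) (Suc p) = (\<Sum>S\<in>{S. S \<subseteq> V \<and> card S = Suc p} \<union> insert i ` {S. S \<subseteq> V \<and> card S = p}. \<Prod>j\<in>S. mvar j :: (nat, 'a) mpoly)"
    by (simp add: esym_def)
  also have "\<dots> = esym V (Suc p) + (\<Sum>S\<in>insert i ` {S. S \<subseteq> V \<and> card S = p}. \<Prod>j\<in>S. mvar j)"
    unfolding esym_def using assms by (intro sum.union_disjoint) auto
  also have "(\<Sum>S\<in>insert i ` {S. S \<subseteq> V \<and> card S = p}. \<Prod>j\<in>S. mvar j) = (\<Sum>S | S \<subseteq> V \<and> card S = p. \<Prod>j\<in>insert i S. mvar j :: (nat, 'a) mpoly)"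
    using inj by (simp add: sum.reindex)
  also have "\<dots> = mvar i * esym V p"
    unfolding esym_def sum_distrib_left
    by (intro sum.cong refl, subst prod.insert) (use assms in \<open>auto dest: finite_subset\<close>)
  finally show ?thesis .
qed

lemma mpderiv_mvar_power_notin: "(\<And>\<alpha>. \<alpha> \<in> supp p \<Longrightarrow> i \<notin> supp \<alpha>) \<Longrightarrow> mpderiv i p = 0"
  for p :: "('i, 'a::comm_semiring_1) mpoly"
  unfolding mpderiv_def by (intro sum.neutral) (auto simp: in_keys_iff)

lemma polys_esym: "esym V p \<in> polys V"
  unfolding esym_def by (intro polys_sum polys_prod polys_mvar) auto

text \<open>The derivative is an elementary symmetric polynomial in the other variables. Solving
  \<open>esym_insert\<close> for it repeatedly expresses it by powers of x_i with coefficients that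
  are symmetric in all variables.\<close>

lemma mpderiv_esym:
  assumes V: "finite V" "i \<in> V"
  shows "mpderiv i (esym V p) = (\<Sum>k<p. (-1) ^ k * esym V (p - 1 - k) * mvar i ^ k :: (nat, 'a::comm_ring_1) mpoly)"
proof (cases p)
  case 0
  then show ?thesis using V by (simp add: esym_0)
next
  case (Suc q)
  define U where "U = V - {i}"
  have U: "finite U" "i \<notin> U" "V = insert i U" using V by (auto simp: U_def)
  have z: "mpderiv i (esym U r :: (nat, 'a) mpoly) = 0" for r
    using polys_esym[of U r] U by (intro mpderiv_mvar_power_notin) (auto simp: polys_iff)
  have "esym U q = (\<Sum>k\<le>q. (-1) ^ k * esym V (q - k) * mvar i ^ k :: (nat, 'a) mpoly)" for q
  proof (induction q)
    case (Suc q)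
    have "esym U (Suc q) = esym V (Suc q) - mvar i * (esym U q :: (nat, 'a) mpoly)"
      unfolding U(3) esym_insert[OF U(1,2)] by simp
    also have "\<dots> = (\<Sum>k\<le>Suc q. (-1) ^ k * esym V (Suc q - k) * mvar i ^ k)"
      unfolding Suc sum.atMost_Suc_shift by (simp add: sum_distrib_left mult_ac sum_negf)
    finally show ?case .
  qed (simp add: esym_0 U V)
  note e = this
  have "mpderiv i (esym V p) = (esym U q :: (nat, 'a) mpoly)"
    unfolding Suc U(3) esym_insert[OF U(1,2)] by (simp add: mpderiv_add mpderiv_mult z mpderiv_mvar)
  then show ?thesis by (simp add: e Suc lessThan_Suc_atMost)
qed

definition msym :: "nat \<Rightarrow> (nat, 'a::comm_ring_1) mpoly \<Rightarrow> bool" where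
  "msym n p \<longleftrightarrow> (\<forall>\<sigma>. \<sigma> permutes {1..n} \<longrightarrow> meval mconst (\<lambda>j. mvar (\<sigma> j)) p = p)"

lemma msym_esym: "msym n (esym {1..n} p)"
  unfolding msym_def
proof (intro allI impI)
  fix \<sigma> assume s: "\<sigma> permutes {1..n}"
  interpret h: comm_ring_hom "meval mconst (\<lambda>j. mvar (\<sigma> j)) :: (nat, 'a) mpoly \<Rightarrow> _"
    by (intro comm_ring_hom_meval comm_ring_hom_mconst)
  have "meval mconst (\<lambda>j. mvar (\<sigma> j)) (esym {1..n} p :: (nat, 'a) mpoly) = (\<Sum>S | S \<subseteq> {1..n} \<and> card S = p. \<Prod>i\<in>S. mvar (\<sigma> i))"
    by (simp add: esym_def h.hom_sum h.hom_prod comm_ring_hom_mconst)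
  also have "\<dots> = (\<Sum>S | S \<subseteq> {1..n} \<and> card S = p. \<Prod>i\<in>\<sigma> ` S. mvar i)"
    using permutes_inj[OF s] by (subst prod.reindex) (auto intro: inj_on_subset)
  also have "\<dots> = (\<Sum>S\<in>image \<sigma> ` {S. S \<subseteq> {1..n} \<and> card S = p}. \<Prod>i\<in>S. mvar i)"
    using permutes_inj[OF s] by (subst sum.reindex) (auto simp: inj_on_def inj_image_eq_iff)
  also have "image \<sigma> ` {S. S \<subseteq> {1..n} \<and> card S = p} = {S. S \<subseteq> {1..n} \<and> card S = p}"
  proof (intro equalityI subsetI)
    fix S assume "S \<in> image \<sigma> ` {S. S \<subseteq> {1..n} \<and> card S = p}"
    then obtain T where T: "S = \<sigma> ` T" "T \<subseteq> {1..n}" "card T = p" by auto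
    have "card S = p" using T permutes_inj[OF s] by (simp add: card_image inj_on_subset)
    moreover have "S \<subseteq> {1..n}" using T permutes_image[OF s] by blast
    ultimately show "S \<in> {S. S \<subseteq> {1..n} \<and> card S = p}" by blast
  next
    fix S assume S: "S \<in> {S. S \<subseteq> {1..n} \<and> card S = p}"
    note i = permutes_inv[OF s]
    have "inv_into UNIV \<sigma> ` S \<subseteq> {1..n}" using S permutes_image[OF i] by blast
    moreover have "card (inv_into UNIV \<sigma> ` S) = p" using S permutes_inj[OF i] by (simp add: card_image inj_on_subset)
    moreover have "S = \<sigma> ` inv_into UNIV \<sigma> ` S" using permutes_surj[OF s] by (simp add: image_f_inv_f)
    ultimately show "S \<in> image \<sigma> ` {S. S \<subseteq> {1..n} \<and> card S = p}" by blast
  qed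
  finally show "meval mconst (\<lambda>j. mvar (\<sigma> j)) (esym {1..n} p) = (esym {1..n} p :: (nat, 'a) mpoly)"
    by (simp add: esym_def)
qed

lemma msym_add: "msym n p \<Longrightarrow> msym n q \<Longrightarrow> msym n (p + q)"
  and msym_mult: "msym n p \<Longrightarrow> msym n q \<Longrightarrow> msym n (p * q)"
  and msym_mconst: "msym n (mconst c)"
proof -
  have h: "comm_ring_hom (meval mconst (\<lambda>j. mvar (\<sigma> j)) :: (nat, 'a) mpoly \<Rightarrow> _)" for \<sigma> :: "nat \<Rightarrow> nat"
    by (intro comm_ring_hom_meval comm_ring_hom_mconst)
  interpret h: comm_ring_hom "meval mconst (\<lambda>j. mvar (\<sigma> j)) :: (nat, 'a) mpoly \<Rightarrow> _" for \<sigma> :: "nat \<Rightarrow> nat"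
    by (rule h)
  show "msym n p \<Longrightarrow> msym n q \<Longrightarrow> msym n (p + q)" "msym n p \<Longrightarrow> msym n q \<Longrightarrow> msym n (p * q)" "msym n (mconst c)"
    by (simp_all add: msym_def h.hom_add h.hom_mult)
qed

lemma msym_sum: "(\<And>x. x \<in> S \<Longrightarrow> msym n (f x)) \<Longrightarrow> msym n (sum f S)"
proof (induction S rule: infinite_finite_induct)
  case (insert x S) then show ?case by (simp add: msym_add)
qed (use msym_mconst[of n 0] in simp_all)

definition sym_gradient :: "nat \<Rightarrow> nat \<Rightarrow> (nat, 'a::comm_ring_1) mpoly \<Rightarrow> (nat \<Rightarrow> (nat, 'a) mpoly) \<Rightarrow> bool" where
  "sym_gradient n d F B \<longleftrightarrow> is_form {1..n} d F \<and> msym n F \<and>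
     (\<forall>k<d. is_form {1..n} (d - 1 - k) (B k) \<and> msym n (B k)) \<and>
     (\<forall>i\<in>{1..n}. mpderiv i F = dd B d [mvar i])"

text \<open>The product rule; both families of coefficients are padded with zeros to the common
  length d + e.\<close>

lemma sym_gradient_mult:
  assumes F: "sym_gradient n d F B" and G: "sym_gradient n e G C"
  shows "sym_gradient n (d + e) (F * G) (\<lambda>k. (if k < d then B k * G else 0) + (if k < e then F * C k else 0))"
  unfolding sym_gradient_def
proof (intro conjI allI impI ballI)
  note F = F[unfolded sym_gradient_def] and G = G[unfolded sym_gradient_def]
  show "is_form {1..n} (d + e) (F * G)" "msym n (F * G)" using F G by (auto intro: is_form_mult msym_mult)
  fix k assume k: "k < d + e"
  have m0: "msym n (0 :: (nat, 'a) mpoly)" using msym_mconst[of n 0] by simp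
  have "is_form {1..n} (d + e - 1 - k) (B k * G)" if "k < d"
    using is_form_mult[of "{1..n}" "d - 1 - k" "B k" e G] F G that by (simp add: add.commute)
  moreover have "is_form {1..n} (d + e - 1 - k) (F * C k)" if "k < e"
    using is_form_mult[of "{1..n}" d F "e - 1 - k" "C k"] F G that by simp
  ultimately show "is_form {1..n} (d + e - 1 - k) ((if k < d then B k * G else 0) + (if k < e then F * C k else 0))"
    by (intro is_form_add) auto
  show "msym n ((if k < d then B k * G else 0) + (if k < e then F * C k else 0))"
    using F G by (intro msym_add) (auto intro: msym_mult m0)
next
  note F = F[unfolded sym_gradient_def] and G = G[unfolded sym_gradient_def]
  fix i assume i: "i \<in> {1..n}"
  have "(\<Sum>k<d + e. (if k < d then B k * G else 0) * mvar i ^ k) = dd B d [mvar i] * G"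
    unfolding dd_single sum_distrib_right by (rule sum.mono_neutral_cong_right) auto
  moreover have "(\<Sum>k<d + e. (if k < e then F * C k else 0) * mvar i ^ k) = F * dd C e [mvar i]"
    unfolding dd_single sum_distrib_left by (rule sum.mono_neutral_cong_right) auto
  ultimately show "mpderiv i (F * G) = dd (\<lambda>k. (if k < d then B k * G else 0) + (if k < e then F * C k else 0)) (d + e) [mvar i]"
    using F G i by (simp add: mpderiv_mult dd_single[of _ "d + e"] distrib_right sum.distrib)
qed

lemma mconst_sign: "(-1) ^ k = (mconst ((-1) ^ k) :: ('i, 'a::comm_ring_1) mpoly)"
proof -
  interpret comm_ring_hom "mconst :: 'a \<Rightarrow> ('i, 'a) mpoly" by (rule comm_ring_hom_mconst)
  show ?thesis by (simp add: hom_power hom_uminus)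
qed

lemma sym_gradient_esym:
  "sym_gradient n p (esym {1..n} p :: (nat, 'a::comm_ring_1) mpoly) (\<lambda>k. (-1) ^ k * esym {1..n} (p - 1 - k))"
proof -
  have f: "is_form {1..n} p (esym {1..n} p :: (nat, 'a) mpoly)" for p
  proof -
    have "mhomogeneous p (\<Prod>i\<in>S. mvar i :: (nat, 'a) mpoly)" if "card S = p" for S
      using mhomogeneous_prod[of S "\<lambda>_. 1" "mvar :: _ \<Rightarrow> (nat, 'a) mpoly"] that by simp
    then have "mhomogeneous p (esym {1..n} p :: (nat, 'a) mpoly)" unfolding esym_def by (intro mhomogeneous_sum) auto
    then show ?thesis by (simp add: is_form_def polys_esym)
  qed
  note s = mconst_sign[where 'i = nat and 'a = 'a]
  show ?thesis unfolding sym_gradient_def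
  proof (intro conjI allI impI ballI)
    fix k
    show "is_form {1..n} (p - 1 - k) ((-1) ^ k * esym {1..n} (p - 1 - k) :: (nat, 'a) mpoly)"
      "msym n ((-1) ^ k * esym {1..n} (p - 1 - k) :: (nat, 'a) mpoly)"
      unfolding s by (intro f is_form_mconst_mult msym_esym msym_mult msym_mconst)+
  qed (simp_all only: f msym_esym mpderiv_esym dd_single finite_atLeastAtMost)
qed

text \<open>In a product of two factors of positive degree, the index of the top coefficient lies
  beyond both ranges in \<open>sym_gradient_mult\<close>. So only partitions with a single part
  contribute to it, with the sign from \<open>mpderiv_esym\<close>.\<close>

lemma sym_gradient_prod_list:
  assumes "\<forall>k\<in>set \<mu>. k > 0"
  shows "\<exists>B. sym_gradient n (sum_list \<mu>) (prod_list (map (esym {1..n}) \<mu>)) B \<and>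
    (\<mu> \<noteq> [] \<longrightarrow> B (sum_list \<mu> - 1) = (if length \<mu> = 1 then (-1) ^ (sum_list \<mu> - 1) else 0 :: (nat, 'a::comm_ring_1) mpoly))"
  using assms
proof (induction \<mu>)
  case Nil
  have "sym_gradient n 0 (1 :: (nat, 'a) mpoly) (\<lambda>_. 0)"
    using msym_mconst[of n 1] by (simp add: sym_gradient_def dd_single)
  then show ?case by auto
next
  case (Cons p \<mu>)
  then obtain B where B: "sym_gradient n (sum_list \<mu>) (prod_list (map (esym {1..n}) \<mu>) :: (nat, 'a) mpoly) B"
    "\<mu> \<noteq> [] \<longrightarrow> B (sum_list \<mu> - 1) = (if length \<mu> = 1 then (-1) ^ (sum_list \<mu> - 1) else 0)" by auto
  note g = sym_gradient_mult[OF sym_gradient_esym[of n p] B(1)]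
  have "p > 0" using Cons.prems by simp
  moreover have "sum_list \<mu> > 0" if "\<mu> \<noteq> []" using that Cons.prems by (cases \<mu>) auto
  ultimately show ?case using g by (intro exI conjI, simp) (cases "\<mu> = []", auto simp: esym_0)
qed

lemma finite_partitions: "finite (partitions d)"
  using bij_betw_finite[OF bij_betw_mset_partitions[of d]] finite_mpart by blast

theorem sym_gradient_sym_generic:
  assumes "d > 0"
  shows "\<exists>B. sym_gradient n d (sym_generic n d) B \<and> B (d - 1) = mconst ((-1) ^ (d - 1) * mvar [d])"
proof -
  define M where "M \<mu> = (prod_list (map (esym {1..n}) \<mu>) :: (nat, cring) mpoly)" for \<mu>
  have "\<exists>B. sym_gradient n d (M \<mu>) B \<and> B (d - 1) = (if length \<mu> = 1 then (-1) ^ (d - 1) else 0)"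
    if "\<mu> \<in> partitions d" for \<mu>
    using sym_gradient_prod_list[of \<mu> n, where 'a = cring] that assms unfolding M_def by (cases "\<mu> = []") (auto simp: partitions_def)
  then obtain B where B: "\<And>\<mu>. \<mu> \<in> partitions d \<Longrightarrow> sym_gradient n d (M \<mu>) (B \<mu>) \<and> B \<mu> (d - 1) = (if length \<mu> = 1 then (-1) ^ (d - 1) else 0)"
    by metis
  note Bg = B[THEN conjunct1, unfolded sym_gradient_def]
  define B' where "B' k = (\<Sum>\<mu>\<in>partitions d. mconst (mvar \<mu>) * B \<mu> k)" for k
  have F: "sym_generic n d = (\<Sum>\<mu>\<in>partitions d. mconst (mvar \<mu>) * M \<mu>)"
  proof -
    have "elem_sym n = (esym {1..n} :: _ \<Rightarrow> (nat, cring) mpoly)" by (intro ext) (simp add: elem_sym_def esym_def)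
    then show ?thesis by (simp add: sym_generic_def M_def)
  qed
  have "sym_gradient n d (sym_generic n d) B'"
    unfolding sym_gradient_def
  proof (intro conjI allI impI ballI)
    show "is_form {1..n} d (sym_generic n d)" "msym n (sym_generic n d)"
      unfolding F using Bg by (auto intro!: is_form_sum is_form_mconst_mult msym_sum msym_mult msym_mconst)
    fix k assume "k < d"
    then show "is_form {1..n} (d - 1 - k) (B' k)" "msym n (B' k)"
      unfolding B'_def using Bg by (auto intro!: is_form_sum is_form_mconst_mult msym_sum msym_mult msym_mconst)
  next
    fix i assume i: "i \<in> {1..n}"
    have "mpderiv i (sym_generic n d) = (\<Sum>\<mu>\<in>partitions d. \<Sum>k<d. mconst (mvar \<mu>) * B \<mu> k * mvar i ^ k)"
      unfolding F mpderiv_sum mpderiv_mconst_mult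
    proof (rule sum.cong[OF refl])
      fix \<mu> assume "\<mu> \<in> partitions d"
      then have "mpderiv i (M \<mu>) = dd (B \<mu>) d [mvar i]" using Bg i by blast
      then show "mconst (mvar \<mu>) * mpderiv i (M \<mu>) = (\<Sum>k<d. mconst (mvar \<mu>) * B \<mu> k * mvar i ^ k)"
        by (simp add: dd_single sum_distrib_left mult.assoc)
    qed
    also have "\<dots> = dd B' d [mvar i]" unfolding dd_single B'_def sum_distrib_right by (rule sum.swap)
    finally show "mpderiv i (sym_generic n d) = dd B' d [mvar i]" .
  qed
  moreover have "B' (d - 1) = mconst ((-1) ^ (d - 1) * mvar [d])"
  proof -
    have p1: "length \<mu> = Suc 0 \<longleftrightarrow> \<mu> = [d]" if "\<mu> \<in> partitions d" for \<mu>
      using that by (auto simp: partitions_def length_Suc_conv)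
    have "B' (d - 1) = (\<Sum>\<mu>\<in>partitions d. if \<mu> = [d] then mconst (mvar [d]) * (-1) ^ (d - 1) else 0)"
      unfolding B'_def using B by (intro sum.cong) (auto simp: p1)
    also have "\<dots> = mconst (mvar [d]) * (-1) ^ (d - 1)"
      using finite_partitions assms by (simp add: partitions_def)
    also note mconst_sign
    finally show ?thesis by (simp add: mconst_mult mult.commute)
  qed
  ultimately show ?thesis by blast
qed

section \<open>Splitting off multiple variables\<close>

text \<open>In a chain, the form attached to v is the divided difference at v and all entries behind
  it; lists thus run from the latest block back to the first.\<close>

definition suffix_at :: "'a list \<Rightarrow> 'a \<Rightarrow> 'a list" where
  "suffix_at L v = dropWhile (\<lambda>u. u \<noteq> v) L"

lemma suffix_at_append: "suffix_at (xs @ ys) v = (if v \<in> set xs then suffix_at xs v @ ys else suffix_at ys v)"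
  by (auto simp: suffix_at_def dropWhile_append)

lemma suffix_at_Cons: "suffix_at (x # xs) v = (if x = v then x # xs else suffix_at xs v)"
  by (simp add: suffix_at_def)

lemma set_suffix_at: "set (suffix_at L v) \<subseteq> set L"
  unfolding suffix_at_def by (rule set_dropWhileD[THEN subsetI])

lemma suffix_at_eq_Cons: "v \<in> set L \<Longrightarrow> \<exists>M. suffix_at L v = v # M"
  by (induction L) (auto simp: suffix_at_Cons)

lemma length_suffix_at: "length (suffix_at L v) \<le> length L"
  by (simp add: suffix_at_def length_dropWhile_le)

lemma suffix_at_map: "inj_on f (insert v (set L)) \<Longrightarrow> suffix_at (map f L) (f v) = map f (suffix_at L v)"
  by (induction L) (auto simp: suffix_at_Cons inj_on_def, simp add: suffix_at_def)

definition fiber :: "nat \<Rightarrow> (nat \<Rightarrow> nat) \<Rightarrow> nat \<Rightarrow> nat" where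
  "fiber n b v = card {j \<in> {1..n}. b j = v}"

lemma Res_cong_all:
  assumes "\<And>i. i \<in> V \<Longrightarrow> ds i = ds' i" "\<And>i. i \<in> V \<Longrightarrow> g i = g' i" "forms V ds"
  shows "Res V ds g = Res V ds' g'"
  using uresultant_cong[OF assms(1)] forms.Res_cong[OF assms(3) assms(2)] by (simp add: Res_def)

text \<open>Invariance is required only on rearrangements of L, so that it may rely on the length
  and the distinctness of the list.\<close>

lemma adjacent_swaps_mset:
  assumes "\<And>xs u v ys. mset (xs @ u # v # ys) = mset L \<Longrightarrow> P (xs @ u # v # ys) = P (xs @ v # u # ys)"
    and "mset L = mset L'"
  shows "P L = P L'"
  using assms
proof (induction L arbitrary: P L')
  case (Cons x L)
  then have "x \<in> set L'" by (metis list.set_intros(1) mset_eq_setD)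
  then obtain A B where L': "L' = A @ x # B" by (meson split_list)
  have front: "P (A @ x # B) = P (x # A @ B)" if "mset (A @ x # B) = mset (x # L)" for A B
    using that
  proof (induction A arbitrary: B rule: rev_induct)
    case (snoc y A)
    have "P ((A @ [y]) @ x # B) = P (A @ x # y # B)" using Cons.prems(1)[of A y x B] snoc.prems by simp
    also have "\<dots> = P (x # A @ y # B)" using snoc.prems by (intro snoc.IH) simp
    finally show ?case by simp
  qed simp
  have "P (x # L) = P (x # A @ B)"
  proof (rule Cons.IH[of "\<lambda>ys. P (x # ys)"])
    fix xs u v ys assume "mset (xs @ u # v # ys) = mset L"
    then show "P (x # xs @ u # v # ys) = P (x # xs @ v # u # ys)" using Cons.prems(1)[of "x # xs" u v ys] by simp
  qed (use Cons.prems(2) L' in simp)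
  also have "\<dots> = P L'" using front[of A B] Cons.prems(2) by (simp add: L')
  finally show ?case .
qed simp

lemma exists_permutation_of_fibers:
  assumes "finite S" "\<And>j. j \<in> S \<Longrightarrow> b j \<in> V" "\<And>j. j \<in> S \<Longrightarrow> b' j \<in> V"
    and "\<And>v. v \<in> V \<Longrightarrow> card {j \<in> S. b j = v} = card {j \<in> S. b' j = v}"
  shows "\<exists>\<sigma>. \<sigma> permutes S \<and> (\<forall>j\<in>S. b' j = b (\<sigma> j))"
proof -
  have "\<exists>f. bij_betw f {j \<in> S. b' j = v} {j \<in> S. b j = v}" if "v \<in> V" for v
    using assms(1,4) that by (intro finite_same_card_bij) auto
  then obtain f where f: "\<And>v. v \<in> V \<Longrightarrow> bij_betw (f v) {j \<in> S. b' j = v} {j \<in> S. b j = v}" by metis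
  define \<sigma> where "\<sigma> j = (if j \<in> S then f (b' j) j else j)" for j
  have s: "\<sigma> j \<in> S \<and> b (\<sigma> j) = b' j" if "j \<in> S" for j
    using bij_betwE[OF f[of "b' j"]] that assms(3) by (auto simp: \<sigma>_def)
  have "inj_on \<sigma> S"
  proof (rule inj_onI)
    fix i j assume ij: "i \<in> S" "j \<in> S" "\<sigma> i = \<sigma> j"
    then have "b' i = b' j" using s by metis
    then show "i = j" using ij f[of "b' j"] assms(3) unfolding \<sigma>_def bij_betw_def inj_on_def by simp
  qed
  moreover have "\<sigma> ` S \<subseteq> S" using s by blast
  ultimately have "bij_betw \<sigma> S S" using endo_inj_surj[OF assms(1)] by (simp add: bij_betw_def)
  then have "\<sigma> permutes S" by (rule bij_imp_permutes) (simp add: \<sigma>_def)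
  then show ?thesis using s by (intro exI[of _ \<sigma>]) auto
qed

section \<open>Resultants of divided differences with identified variables\<close>

locale symmetric_coeffs =
  fixes n d :: nat and B :: "nat \<Rightarrow> (nat, 'a::comm_ring_1) mpoly"
  assumes B_form: "k < d \<Longrightarrow> is_form {1..n} (d - 1 - k) (B k)" and B_sym: "k < d \<Longrightarrow> msym n (B k)"
    and n_pos: "n \<ge> 1"
begin

text \<open>The map b identifies variables in the coefficients, while L lists the points of the
  divided difference.\<close>

definition pform :: "(nat \<Rightarrow> nat) \<Rightarrow> nat list \<Rightarrow> (nat, 'a) mpoly" where
  "pform b L = dd (\<lambda>k. meval mconst (\<lambda>j. mvar (b j)) (B k)) d (map mvar L)"

lemma is_form_pform:
  assumes "b ` {1..n} \<subseteq> V" "set L \<subseteq> V" "L \<noteq> []"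
  shows "is_form V (d - length L) (pform b L)"
  unfolding pform_def
proof (rule is_form_dd[OF assms(2,3)])
  have b: "is_form V 1 (mvar (b i) :: (nat, 'a) mpoly)" if "i \<in> {1..n}" for i
  proof (rule is_form_mvar)
    show "b i \<in> V" using assms(1) that by blast
  qed
  fix k assume "k < d"
  show "is_form V (d - 1 - k) (meval mconst (\<lambda>j. mvar (b j)) (B k))"
    by (rule is_form_subst[OF B_form[OF \<open>k < d\<close>] b])
qed

lemma pform_diff: "(mvar x - mvar y) * pform b (x # y # L) = pform b (x # L) - pform b (y # L)"
  by (simp add: pform_def dd_diff)

lemma pform_swap: "pform b (xs @ u # v # ys) = pform b (xs @ v # u # ys)"
  by (simp add: pform_def dd_append_swap)

lemma pform_subst: "meval mconst (\<lambda>j. mvar (\<tau> j)) (pform b L) = pform (\<lambda>j. \<tau> (b j)) (map \<tau> L)"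
proof -
  have h: "comm_ring_hom (meval mconst (\<lambda>j. mvar (\<tau> j)) :: (nat, 'a) mpoly \<Rightarrow> _)"
    by (intro comm_ring_hom_meval comm_ring_hom_mconst)
  show ?thesis unfolding pform_def hom_dd[OF h] by (simp add: subst_subst comm_ring_hom_mconst comp_def)
qed

lemma pform_eqI:
  assumes "L \<noteq> []" "\<And>k. k < d \<Longrightarrow> meval mconst (\<lambda>j. mvar (b j)) (B k) = meval mconst (\<lambda>j. mvar (b' j)) (B k)"
  shows "pform b L = pform b' L"
  unfolding pform_def dd_def
proof (intro sum.cong refl)
  fix m assume "m \<in> {..<Suc d - length (map mvar L :: (nat, 'a) mpoly list)}"
  then have "m + length L - 1 < d" using assms(1) by (cases L) auto
  then show "meval mconst (\<lambda>j. mvar (b j)) (B (m + length (map mvar L :: (nat, 'a) mpoly list) - 1)) * hl (map mvar L) m =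
      meval mconst (\<lambda>j. mvar (b' j)) (B (m + length (map mvar L :: (nat, 'a) mpoly list) - 1)) * hl (map mvar L) m"
    using assms(2) by simp
qed

lemma pform_cong:
  assumes "L \<noteq> []" "\<And>j. j \<in> {1..n} \<Longrightarrow> b j = b' j"
  shows "pform b L = pform b' L"
proof (rule pform_eqI[OF assms(1)])
  fix k assume "k < d"
  then have "B k \<in> polys {1..n}" using B_form by (simp add: is_form_def)
  then have supp: "i \<in> {1..n}" if "\<alpha> \<in> supp (B k)" "i \<in> supp \<alpha>" for \<alpha> i using that unfolding polys_iff by blast
  show "meval mconst (\<lambda>j. mvar (b j)) (B k) = meval mconst (\<lambda>j. mvar (b' j)) (B k)"
  proof (rule meval_cong)
    fix \<alpha> i assume "\<alpha> \<in> supp (B k)" "i \<in> supp \<alpha>"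
    then have "b i = b' i" using assms(2) supp by blast
    then show "mvar (b i) = mvar (b' i)" by simp
  qed simp
qed

lemma pform_permutes:
  assumes "L \<noteq> []" "\<sigma> permutes {1..n}"
  shows "pform (\<lambda>j. b (\<sigma> j)) L = pform b L"
proof (rule pform_eqI[OF assms(1)])
  fix k assume "k < d"
  then have "meval mconst (\<lambda>j. mvar (\<sigma> j)) (B k) = B k" using B_sym assms(2) by (simp add: msym_def)
  then have "meval mconst (\<lambda>j. mvar (b j)) (B k) = meval mconst (\<lambda>j. mvar (b j)) (meval mconst (\<lambda>j. mvar (\<sigma> j)) (B k))" by simp
  then show "meval mconst (\<lambda>j. mvar (b (\<sigma> j))) (B k) = meval mconst (\<lambda>j. mvar (b j)) (B k)"
    by (simp add: subst_subst comm_ring_hom_mconst)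
qed

definition RL :: "nat set \<Rightarrow> (nat \<Rightarrow> nat) \<Rightarrow> (nat \<Rightarrow> nat list) \<Rightarrow> 'a" where
  "RL V b l = Res V (\<lambda>v. d - length (l v)) (\<lambda>v. pform b (l v))"

definition admissible :: "nat set \<Rightarrow> (nat \<Rightarrow> nat) \<Rightarrow> (nat \<Rightarrow> nat list) \<Rightarrow> bool" where
  "admissible V b l \<longleftrightarrow> finite V \<and> b ` {1..n} \<subseteq> V \<and> (\<forall>v\<in>V. l v \<noteq> [] \<and> set (l v) \<subseteq> V \<and> length (l v) < d)"

lemma admissible_forms: "admissible V b l \<Longrightarrow> forms V (\<lambda>v. d - length (l v))"
  using n_pos by (auto simp: admissible_def forms_def)

lemma admissible_is_form: "admissible V b l \<Longrightarrow> v \<in> V \<Longrightarrow> is_form V (d - length (l v)) (pform b (l v))"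
  unfolding admissible_def by (intro is_form_pform) blast+

lemma RL_cong:
  assumes "admissible V b l" "\<And>v. v \<in> V \<Longrightarrow> l v = l' v" "\<And>j. j \<in> {1..n} \<Longrightarrow> b j = b' j"
  shows "RL V b l = RL V b' l'"
  unfolding RL_def
proof (rule Res_cong_all)
  fix v assume "v \<in> V"
  then show "pform b (l v) = pform b' (l' v)" "d - length (l v) = d - length (l' v)"
    using assms pform_cong[of "l v" b b'] by (auto simp: admissible_def)
qed (rule admissible_forms[OF assms(1)])

text \<open>For \<open>L = rev [1..<Suc l]\<close> and the block map of a partition with l parts
  this is the resultant in the theorem.\<close>

definition chain :: "(nat \<Rightarrow> nat) \<Rightarrow> nat list \<Rightarrow> 'a" where
  "chain b L = RL (set L) b (suffix_at L)"

lemma admissible_chain: "b ` {1..n} \<subseteq> set L \<Longrightarrow> length L < d \<Longrightarrow> admissible (set L) b (suffix_at L)"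
  unfolding admissible_def
proof (intro conjI ballI)
  fix v assume "v \<in> set L" "length L < d"
  then show "suffix_at L v \<noteq> []" "set (suffix_at L v) \<subseteq> set L" "length (suffix_at L v) < d"
    using suffix_at_eq_Cons[of v L] set_suffix_at[of L v] length_suffix_at[of L v] by auto
qed auto

lemma chain_swap:
  assumes L: "distinct (xs @ u # v # ys)" "length (xs @ u # v # ys) < d" "b ` {1..n} \<subseteq> set (xs @ u # v # ys)"
  shows "chain b (xs @ u # v # ys) = chain b (xs @ v # u # ys)"
proof -
  define V where "V = set (xs @ u # v # ys)"
  define T where "T = suffix_at (xs @ u # v # ys)"
  define T' where "T' = suffix_at (xs @ v # u # ys)"
  have V': "V = set (xs @ v # u # ys)" by (auto simp: V_def)
  have uv: "u \<noteq> v" "u \<in> V" "v \<in> V" using L by (auto simp: V_def)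
  have A: "admissible V b T" unfolding V_def T_def by (rule admissible_chain) (use L in auto)
  have A': "admissible V b T'" unfolding V' T'_def by (rule admissible_chain) (use L in auto)
  define ds where "ds w = d - length (T w)" for w
  define ds' where "ds' w = d - length (T' w)" for w
  have F: "forms V ds" unfolding ds_def[abs_def] by (rule admissible_forms[OF A])
  have F': "forms V ds'" unfolding ds'_def[abs_def] by (rule admissible_forms[OF A'])
  define g where "g w = pform b (T w)" for w
  define g' where "g' w = pform b (T' w)" for w
  have Tu: "T u = u # v # ys" "T v = v # ys" "T' u = u # ys" "T' v = v # u # ys"
    using L by (auto simp: T_def T'_def suffix_at_append suffix_at_Cons)
  have Tw: "pform b (T w) = pform b (T' w) \<and> length (T w) = length (T' w)" if "w \<noteq> u" "w \<noteq> v" for w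
    using that by (simp add: T_def T'_def suffix_at_append suffix_at_Cons pform_swap)
  have dsuv: "ds v = Suc (ds u)" "ds' v = ds u" "ds' u = ds v" using L(2) by (auto simp: ds_def ds'_def Tu)
  \<comment> \<open>x_u - x_v times the form at u is the divided difference at \<open>u # ys\<close>
    minus that at \<open>v # ys\<close>. Adding it to the form at v therefore produces the form that
    the other order attaches to u.\<close>
  define h :: "nat \<Rightarrow> (nat, 'a) mpoly" where "h k = (if k = v then mvar u - mvar v else 0)" for k
  have "Res V ds g = Res V ds (\<lambda>k. if k = u then g u else g k + h k * g u)"
  proof (rule Res_add_multiple[OF F uv(2), symmetric])
    show "is_form V (ds k) (g k)" if "k \<in> V" for k using admissible_is_form[OF A that] by (simp add: ds_def g_def)
    show "is_form V (ds k - ds u) (h k)" if "k \<in> V - {u}" for k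
      using dsuv uv by (auto simp: h_def intro!: is_form_diff is_form_mvar[simplified])
    show "h k = 0" if "k \<in> V - {u}" "ds k < ds u" for k using that dsuv by (auto simp: h_def)
  qed
  also have "\<dots> = Res V (ds' \<circ> transpose u v) (g' \<circ> transpose u v)"
  proof (rule Res_cong_all[OF _ _ F])
    fix k
    consider "k = u" | "k = v" | "k \<noteq> u" "k \<noteq> v" by blast
    then show "ds k = (ds' \<circ> transpose u v) k"
      by cases (use dsuv Tw in \<open>auto simp: ds_def ds'_def\<close>)
    have "g v + (mvar u - mvar v) * g u = g' u" using pform_diff[of u v b ys] by (simp add: g_def g'_def Tu)
    moreover have "g u = g' v" using pform_swap[of b "[]" u v ys] by (simp add: g_def g'_def Tu)
    moreover consider "k = u" | "k = v" | "k \<noteq> u" "k \<noteq> v" by blast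
    ultimately show "(if k = u then g u else g k + h k * g u) = (g' \<circ> transpose u v) k"
      by cases (use uv Tw in \<open>auto simp: h_def g_def g'_def\<close>)
  qed
  also have "\<dots> = Res V ds' g'"
  proof (cases "even (ds' u)")
    case True
    then show ?thesis using admissible_is_form[OF A'] by (intro Res_swap[OF F' uv(2,3,1)]) (auto simp: ds'_def g'_def)
  next
    case False
    then have "even (ds' v)" using dsuv by simp
    then show ?thesis using admissible_is_form[OF A'] unfolding transpose_commute[of u]
      by (intro Res_swap[OF F' uv(3,2) uv(1)[symmetric]]) (auto simp: ds'_def g'_def)
  qed
  finally show ?thesis
    unfolding chain_def RL_def V_def[symmetric] V'[symmetric] T_def[symmetric] T'_def[symmetric]
    by (simp add: ds_def[abs_def] ds'_def[abs_def] g_def[abs_def] g'_def[abs_def])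
qed

lemma chain_rename:
  assumes "inj_on \<pi> (set L)" "b ` {1..n} \<subseteq> set L" "length L < d"
  shows "chain (\<lambda>j. \<pi> (b j)) (map \<pi> L) = chain b L"
  unfolding chain_def RL_def
proof (rule Res_rename[OF _ assms(1)])
  note A = admissible_chain[OF assms(2,3)]
  show "forms (set L) (\<lambda>v. d - length (suffix_at L v))" by (rule admissible_forms[OF A])
  fix i assume i: "i \<in> set L"
  then have s: "suffix_at (map \<pi> L) (\<pi> i) = map \<pi> (suffix_at L i)"
    using assms(1) by (intro suffix_at_map) (simp add: insert_absorb)
  show "d - length (suffix_at (map \<pi> L) (\<pi> i)) = d - length (suffix_at L i)" by (simp add: s)
  show "is_form (set L) (d - length (suffix_at L i)) (pform b (suffix_at L i))" by (rule admissible_is_form[OF A i])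
  show "pform (\<lambda>j. \<pi> (b j)) (suffix_at (map \<pi> L) (\<pi> i)) = meval mconst (\<lambda>j. mvar (\<pi> j)) (pform b (suffix_at L i))"
    by (simp add: s pform_subst)
qed simp

text \<open>Three symmetries are combined: the order of L is adapted to the sizes, the labels are
  renamed, and a permutation of the original variables, under which the coefficients
  \<open>B k\<close> are invariant, matches the fibers.\<close>

lemma chain_type:
  assumes L: "distinct L" "length L < d" "b ` {1..n} \<subseteq> set L"
    and L': "distinct L'" "b' ` {1..n} \<subseteq> set L'"
    and fib: "mset (map (fiber n b) L) = mset (map (fiber n b') L')"
  shows "chain b L = chain b' L'"
proof -
  obtain p where p: "p permutes {..<length L}" "permute_list p (map (fiber n b) L) = map (fiber n b') L'"
    using mset_eq_permutation[OF fib[symmetric]] by (metis length_map)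
  define M where "M = permute_list p L"
  have M: "mset M = mset L" "map (fiber n b) M = map (fiber n b') L'"
    using p by (simp_all add: M_def permute_list_map)
  have "chain b L = chain b M"
  proof (rule adjacent_swaps_mset)
    fix xs u v ys assume *: "mset (xs @ u # v # ys) = mset L"
    have "set (xs @ u # v # ys) = set L" "length (xs @ u # v # ys) = length L" "distinct (xs @ u # v # ys)"
      using L(1) mset_eq_imp_distinct_iff[OF *] by (simp_all only: mset_eq_setD[OF *] mset_eq_length[OF *])
    then show "chain b (xs @ u # v # ys) = chain b (xs @ v # u # ys)" using L by (intro chain_swap) simp_all
  qed (simp add: M)
  also have "\<dots> = chain b' L'"
  proof -
    have MM: "distinct M" "length M < d" "b ` {1..n} \<subseteq> set M" "length M = length L'"
      using M(1) L mset_eq_imp_distinct_iff[OF M(1)] mset_eq_length[OF M(1)] mset_eq_setD[OF M(1)] arg_cong[OF M(2), of length]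
      by simp_all
    define \<pi> where "\<pi> v = the (map_of (zip M L') v)" for v
    have \<pi>: "\<pi> (M ! i) = L' ! i" if "i < length M" for i
      using that MM by (simp add: \<pi>_def map_of_zip_nth)
    have mp: "map \<pi> M = L'" using MM by (intro nth_equalityI) (auto simp: \<pi>)
    have inj: "inj_on \<pi> (set M)" using L'(1) unfolding mp[symmetric] distinct_map by blast
    have "fiber n b' w = fiber n (\<lambda>j. \<pi> (b j)) w" if wL: "w \<in> set L'" for w
    proof -
      obtain i where i: "i < length M" "w = L' ! i" using wL unfolding in_set_conv_nth MM(4) by blast
      have "b j = M ! i \<longleftrightarrow> \<pi> (b j) = w" if "j \<in> {1..n}" for j
      proof -
        have "b j \<in> set M" using MM(3) that by blast
        then show ?thesis using inj_on_eq_iff[OF inj, of "b j" "M ! i"] \<pi>[OF i(1)] i by simp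
      qed
      then have "{j \<in> {1..n}. \<pi> (b j) = w} = {j \<in> {1..n}. b j = M ! i}" by blast
      then have "fiber n (\<lambda>j. \<pi> (b j)) w = fiber n b (M ! i)" by (simp only: fiber_def)
      moreover have "fiber n b (M ! i) = fiber n b' w" using arg_cong[OF M(2), of "\<lambda>xs. xs ! i"] i MM(4) by simp
      ultimately show ?thesis by simp
    qed
    then obtain \<sigma> where \<sigma>: "\<sigma> permutes {1..n}" "\<And>j. j \<in> {1..n} \<Longrightarrow> b' j = \<pi> (b (\<sigma> j))"
      using exists_permutation_of_fibers[of "{1..n}" "\<lambda>j. \<pi> (b j)" "set L'" b'] L'(2) MM(3) mp
      unfolding fiber_def by (fastforce simp: image_subset_iff)
    have b1: "(\<lambda>j. \<pi> (b j)) ` {1..n} \<subseteq> set L'" using MM(3) mp by auto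
    have "chain b M = chain (\<lambda>j. \<pi> (b j)) L'" using chain_rename[OF inj MM(3,2)] mp by simp
    also have "\<dots> = chain (\<lambda>j. \<pi> (b (\<sigma> j))) L'"
      unfolding chain_def RL_def
    proof (rule Res_cong_all)
      show "forms (set L') (\<lambda>v. d - length (suffix_at L' v))"
        using MM by (intro admissible_forms[OF admissible_chain[OF b1]]) simp
      fix i assume "i \<in> set L'"
      then have "suffix_at L' i \<noteq> []" using suffix_at_eq_Cons by fastforce
      then show "pform (\<lambda>j. \<pi> (b j)) (suffix_at L' i) = pform (\<lambda>j. \<pi> (b (\<sigma> j))) (suffix_at L' i)"
        using pform_permutes[OF _ \<sigma>(1), of _ "\<lambda>j. \<pi> (b j)"] by simp
    qed simp
    also have "\<dots> = chain b' L'"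
    proof -
      have "admissible (set L') b' (suffix_at L')" using MM by (intro admissible_chain L'(2)) simp
      then show ?thesis unfolding chain_def using \<sigma>(2) by (intro RL_cong[symmetric]) auto
    qed
    finally show ?thesis .
  qed
  finally show ?thesis .
qed

text \<open>
  Subtracting the form at \<open>a\<close> from the form at \<open>q\<close> splits off the factor \<open>x\<^sub>q - x\<^sub>a\<close>.
\<close>

lemma RL_split:
  assumes A: "admissible V b l" and aq: "a \<in> V" "q \<in> V" "a \<noteq> q" and l: "l a = a # M" "l q = q # M"
    and q: "\<And>v. v \<in> V - {q} \<Longrightarrow> q \<notin> set (l v)"
  shows "length M + 2 < d \<Longrightarrow> RL V b l = RL (V - {q}) (\<lambda>j. if b j = q then a else b j) l * RL V b (l(q := q # a # M))"
    and "length M + 2 = d \<Longrightarrow> B (d - 1) = mconst C \<Longrightarrow>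
      RL V b l = C ^ (\<Prod>v\<in>V - {q}. d - length (l v)) * RL (V - {q}) (\<lambda>j. if b j = q then a else b j) l"
proof -
  define ds where "ds v = d - length (l v)" for v
  define g where "g v = pform b (l v)" for v
  define p where "p = pform b (q # a # M)"
  define W where "W = V - {q}"
  have F: "forms V ds" unfolding ds_def[abs_def] by (rule admissible_forms[OF A])
  have gf: "is_form V (ds v) (g v)" if "v \<in> V" for v
    using admissible_is_form[OF A that] by (simp add: ds_def g_def)
  have "set (l a) \<subseteq> V" "length (l a) < d" using A aq by (auto simp: admissible_def)
  then have Md: "length M + 1 < d" and MV: "set M \<subseteq> V" by (auto simp: l)
  have dsq: "ds q = d - Suc (length M)" "ds a = ds q" by (simp_all add: ds_def l)
  have "Res V ds g = Res V ds (\<lambda>k. if k = a then g a else g k + (if k = q then - 1 else 0) * g a)"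
    by (rule Res_add_multiple[OF F aq(1) gf, symmetric]) (auto simp: dsq intro: is_form_uminus)
  also have "\<dots> = Res V ds (g(q := (mvar q - mvar a) * p))"
    using aq pform_diff[of q a b M] by (intro forms.Res_cong[OF F]) (auto simp: g_def l p_def)
  finally have R: "Res V ds g = Res V ds (g(q := (mvar q - mvar a) * p))" .
  have F1: "forms V (ds(q := 1))" by (rule forms_update[OF F]) simp
  \<comment> \<open>The linear factor x_q - x_a eliminates x_q. The lists at the other indices do
    not contain q, so only the map b changes.\<close>
  have merge: "Res V (ds(q := 1)) (g(q := mvar q - mvar a)) = RL W (\<lambda>j. if b j = q then a else b j) l"
  proof -
    have W0: "W \<noteq> {}" using aq by (auto simp: W_def)
    have "Res V (ds(q := 1)) (g(q := mvar q - mvar a)) = Res W (ds(q := 1)) (\<lambda>k. meval mconst (\<lambda>j. if j = q then mvar a else mvar j) (g k))"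
      by (rule Res_eliminate[OF F1 aq(2) _ W_def W0]) (use aq gf W_def in auto)
    also have "\<dots> = RL W (\<lambda>j. if b j = q then a else b j) l"
      unfolding RL_def
    proof (rule Res_cong_all)
      show "forms W (ds(q := 1))" using F1 W0 unfolding W_def forms_def by auto
      fix v assume v: "v \<in> W"
      then show "(ds(q := 1)) v = d - length (l v)" by (simp add: W_def ds_def)
      have "map (\<lambda>j. if j = q then a else j) (l v) = l v" using q[of v] v by (intro map_idI) (auto simp: W_def)
      moreover have "(\<lambda>j. if j = q then mvar a else mvar j) = (\<lambda>j. mvar (if j = q then a else j) :: (nat, 'a) mpoly)" by auto
      ultimately show "meval mconst (\<lambda>j. if j = q then mvar a else mvar j) (g v) = pform (\<lambda>j. if b j = q then a else b j) (l v)"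
        by (simp add: g_def pform_subst)
    qed
    finally show ?thesis .
  qed
  show "RL V b l = RL (V - {q}) (\<lambda>j. if b j = q then a else b j) l * RL V b (l(q := q # a # M))" if "length M + 2 < d"
  proof -
    define e where "e = d - Suc (Suc (length M))"
    have "is_form V e p" unfolding p_def e_def
      using is_form_pform[of b V "q # a # M"] A aq MV by (simp add: admissible_def)
    moreover have "is_form V 1 (mvar q - mvar a :: (nat, 'a) mpoly)" using aq by (intro is_form_diff is_form_mvar)
    ultimately have "Res V ds (g(q := (mvar q - mvar a) * p)) = Res V (ds(q := 1)) (g(q := mvar q - mvar a)) * Res V (ds(q := e)) (g(q := p))"
      using that gf by (intro Res_mult[OF F aq(2)]) (auto simp: dsq e_def)
    moreover have "Res V (ds(q := e)) (g(q := p)) = RL V b (l(q := q # a # M))"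
      unfolding RL_def by (intro arg_cong2[where f = "Res V"]) (auto simp: ds_def e_def g_def p_def)
    ultimately show ?thesis using R merge unfolding RL_def W_def ds_def[abs_def] g_def[abs_def] by simp
  qed
  show "RL V b l = C ^ (\<Prod>v\<in>V - {q}. d - length (l v)) * RL (V - {q}) (\<lambda>j. if b j = q then a else b j) l"
    if d: "length M + 2 = d" and C: "B (d - 1) = mconst C"
  proof -
    have "p = mconst C"
      using dd_full[of "map mvar (q # a # M) :: (nat, 'a) mpoly list" "\<lambda>k. meval mconst (\<lambda>j. mvar (b j)) (B k)"] C
      unfolding p_def pform_def by (simp add: d[symmetric])
    then have "Res V ds g = Res V ds ((g(q := mvar q - mvar a))(q := mconst C * (g(q := mvar q - mvar a)) q))"
      by (simp add: R mult.commute)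
    also have "\<dots> = C ^ (\<Prod>v\<in>V - {q}. ds v) * Res V ds (g(q := mvar q - mvar a))"
      by (rule Res_scale[OF F aq(2)])
    also have "Res V ds (g(q := mvar q - mvar a)) = RL W (\<lambda>j. if b j = q then a else b j) l"
    proof -
      \<comment> \<open>The form at q is linear already, the divided difference being a
        constant.\<close>
      have "ds(q := 1) = ds" using d by (auto simp: dsq)
      then show ?thesis using merge by simp
    qed
    finally show ?thesis unfolding RL_def W_def ds_def g_def .
  qed
qed

text \<open>Q holds the elements still to be compared with the head a, Q' those separated from it,
  and the rest is the finished chain. The cardinalities of Q and Q' become the last two arguments of
  \<open>Kval\<close>.\<close>

definition state :: "nat \<Rightarrow> nat list \<Rightarrow> nat set \<Rightarrow> nat set \<Rightarrow> nat \<Rightarrow> nat list" where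
  "state a L Q Q' v = (if v \<in> Q then v # L else if v \<in> Q' then v # a # L else suffix_at (a # L) v)"

lemma prod_suffix_degs:
  "distinct L \<Longrightarrow> (\<Prod>v\<in>set L. d - length (suffix_at L v)) = prod_list (degs d (length L))"
proof (induction L)
  case (Cons x L)
  have "(\<Prod>v\<in>set L. d - length (suffix_at (x # L) v)) = (\<Prod>v\<in>set L. d - length (suffix_at L v))"
    using Cons.prems by (intro prod.cong) (auto simp: suffix_at_Cons)
  then show ?case using Cons by (simp add: degs_Suc suffix_at_Cons)
qed simp

text \<open>Follows the recursion of \<open>Kval\<close>: an element of Q is treated by
  \<open>RL_split\<close>, and once Q is empty an element of Q' becomes the next head. The measure
  is that of \<open>Kval_dsum\<close>.\<close>

lemma RL_state:
  assumes dist: "distinct (a # L)" "finite Q" "finite Q'" "Q \<inter> Q' = {}" "(Q \<union> Q') \<inter> set (a # L) = {}"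
    and b: "b ` {1..n} = set (a # L) \<union> Q \<union> Q'" and fib: "\<And>v. v \<in> Q \<union> Q' \<Longrightarrow> fiber n b v = 1"
    and d: "length L + 1 < d" "Q' = {} \<or> length L + 2 < d"
    and C: "B (d - 1) = mconst C"
    and G: "\<And>b L. distinct L \<Longrightarrow> b ` {1..n} = set L \<Longrightarrow> length L < d \<Longrightarrow> chain b L = G (mset (map (fiber n b) L))"
  shows "RL (set (a # L) \<union> Q \<union> Q') b (state a L Q Q') =
    Kval d C G (mset (map (fiber n b) L)) (fiber n b a) (card Q) (card Q')"
  using dist b fib d
proof (induction "(card Q + card Q') * (card Q + card Q') + card Q" arbitrary: a L Q Q' b rule: less_induct)
  case less
  note dist = less.prems(1-5) and b = less.prems(6) and fib = less.prems(7) and d = less.prems(8,9)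
  define V where "V = set (a # L) \<union> Q \<union> Q'"
  have A: "admissible V b (state a L Q Q')"
    unfolding admissible_def
  proof (intro conjI ballI)
    show "finite V" "b ` {1..n} \<subseteq> V" using dist b by (auto simp: V_def)
    fix v assume v: "v \<in> V"
    show "state a L Q Q' v \<noteq> []" using v suffix_at_eq_Cons[of v "a # L"] by (auto simp: state_def V_def)
    show "set (state a L Q Q' v) \<subseteq> V" using v set_suffix_at[of "a # L" v] by (auto simp: state_def V_def)
    show "length (state a L Q Q' v) < d" using v d length_suffix_at[of "a # L" v] by (auto simp: state_def)
  qed
  show ?case
  proof (cases "Q = {}")
    case True
    show ?thesis
    proof (cases "Q' = {}")
      case True
      have "RL V b (state a L Q Q') = chain b (a # L)"
        unfolding chain_def V_def \<open>Q = {}\<close> True by (simp add: state_def[abs_def] comp_def)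
      also have "\<dots> = G (mset (map (fiber n b) (a # L)))" using dist b d \<open>Q = {}\<close> True by (intro G) auto
      finally show ?thesis using d unfolding V_def[symmetric] by (simp add: \<open>Q = {}\<close> True Kval_0 Hval_0)
    next
      case False
      then obtain q where q: "q \<in> Q'" by blast
      define P where "P = Q' - {q}"
      have P: "Q' = insert q P" "q \<notin> P" "finite P" using q dist by (auto simp: P_def)
      have d2: "length L + 2 < d" using d False by simp
      \<comment> \<open>The elements of Q' carry a but not q in their lists. With q as head they
        count as not yet compared, and the assignment of lists stays the same.\<close>
      have "RL V b (state a L Q Q') = RL V b (state q (a # L) P {})"
      proof (rule RL_cong[OF A])
        show "state a L Q Q' v = state q (a # L) P {} v" if "v \<in> V" for v
          using that dist P \<open>Q = {}\<close> by (auto simp: state_def V_def suffix_at_Cons)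
      qed simp
      also have "\<dots> = RL (set (q # a # L) \<union> P \<union> {}) b (state q (a # L) P {})"
        by (rule arg_cong[where f = "\<lambda>V. RL V b _"]) (auto simp: V_def P \<open>Q = {}\<close>)
      also have "\<dots> = Kval d C G (mset (map (fiber n b) (a # L))) (fiber n b q) (card P) (card ({} :: nat set))"
        by (rule less.hyps) (use dist P b d2 fib \<open>Q = {}\<close> in auto)
      also have "\<dots> = Kval d C G (mset (map (fiber n b) L)) (fiber n b a) 0 (card Q')"
        using d2 fib[of q] q P by (simp add: Kval_0 Hval_Suc)
      finally show ?thesis by (simp add: V_def \<open>Q = {}\<close>)
    qed
  next
    case False
    then obtain q where q: "q \<in> Q" by blast
    define P where "P = Q - {q}"
    have P: "Q = insert q P" "q \<notin> P" "finite P" using q dist by (auto simp: P_def)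
    define b' where "b' j = (if b j = q then a else b j)" for j
    have aq: "a \<in> V" "q \<in> V" "a \<noteq> q" using q dist by (auto simp: V_def)
    have l: "state a L Q Q' a = a # L" "state a L Q Q' q = q # L"
      using q dist by (auto simp: state_def suffix_at_Cons)
    have qn: "q \<notin> set (state a L Q Q' v)" if "v \<in> V - {q}" for v
      using that q dist set_suffix_at[of "a # L" v] by (auto simp: state_def)
    have Vq: "V - {q} = set (a # L) \<union> P \<union> Q'" using dist P by (auto simp: V_def)
    have b'V: "b' ` {1..n} = V - {q}"
    proof -
      have "b' ` {1..n} = (\<lambda>v. if v = q then a else v) ` V" unfolding V_def b[symmetric] by (auto simp: b'_def image_image)
      then show ?thesis using aq by auto
    qed
    have fib': "fiber n b' v = fiber n b v" if "v \<noteq> a" "v \<noteq> q" for v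
      using that by (auto simp: fiber_def b'_def intro!: arg_cong[where f = card])
    have fiba: "fiber n b' a = Suc (fiber n b a)"
    proof -
      have "{j \<in> {1..n}. b' j = a} = {j \<in> {1..n}. b j = a} \<union> {j \<in> {1..n}. b j = q}" by (auto simp: b'_def)
      then have "fiber n b' a = fiber n b a + fiber n b q"
        using aq by (simp add: fiber_def) (subst card_Un_disjoint, auto)
      then show ?thesis using fib q by simp
    qed
    have fibL: "map (fiber n b') L = map (fiber n b) L" using dist q by (auto intro!: fib')
    have "RL (V - {q}) b' (state a L Q Q') = RL (V - {q}) b' (state a L P Q')"
    proof (rule RL_cong)
      show "admissible (V - {q}) b' (state a L Q Q')"
        unfolding admissible_def b'V
      proof (intro conjI ballI)
        fix v assume "v \<in> V - {q}"
        then show "state a L Q Q' v \<noteq> []" "set (state a L Q Q' v) \<subseteq> V - {q}" "length (state a L Q Q' v) < d"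
          using A qn[of v] unfolding admissible_def by blast+
      qed (use A in \<open>auto simp: admissible_def\<close>)
    qed (use P in \<open>auto simp: state_def\<close>)
    also have "\<dots> = Kval d C G (mset (map (fiber n b') L)) (fiber n b' a) (card P) (card Q')"
      unfolding Vq
    proof (rule less.hyps)
      show "fiber n b' v = 1" if "v \<in> P \<union> Q'" for v
        using that fib[of v] fib'[of v] dist P by auto
    qed (use dist P d b'V Vq in auto)
    finally have merged: "RL (V - {q}) b' (state a L Q Q') =
        Kval d C G (mset (map (fiber n b) L)) (Suc (fiber n b a)) (card P) (card Q')" by (simp add: fibL fiba)
    show ?thesis
    proof (cases "length L + 2 < d")
      case True
      have "RL V b ((state a L Q Q')(q := q # a # L)) = RL V b (state a L P (insert q Q'))"
      proof (rule RL_cong)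
        show "admissible V b ((state a L Q Q')(q := q # a # L))"
          using A aq True by (auto simp: admissible_def V_def)
        show "((state a L Q Q')(q := q # a # L)) v = state a L P (insert q Q') v" for v
          using P by (auto simp: state_def)
      qed simp
      also have "\<dots> = RL (set (a # L) \<union> P \<union> insert q Q') b (state a L P (insert q Q'))"
        by (rule arg_cong[where f = "\<lambda>V. RL V b _"]) (auto simp: V_def P)
      also have "\<dots> = Kval d C G (mset (map (fiber n b) L)) (fiber n b a) (card P) (card (insert q Q'))"
        by (rule less.hyps) (use dist P b d True fib in auto)
      finally have sep: "RL V b ((state a L Q Q')(q := q # a # L)) =
          Kval d C G (mset (map (fiber n b) L)) (fiber n b a) (card P) (Suc (card Q'))" using dist(3,4) q by (auto simp: card_insert_if)
      show ?thesis
        using RL_split(1)[OF A aq l qn True] True P merged sep unfolding V_def[symmetric] b'_def[symmetric, abs_def]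
        by (simp add: Kval_split)
    next
      case False
      then have L2: "length L + 2 = d" "Q' = {}" using d by auto
      \<comment> \<open>At this last level the pending forms are linear, so the exponent is the
        product of the degrees d - 1, ..., 1 along the chain.\<close>
      have "(\<Prod>v\<in>V - {q}. d - length (state a L Q Q' v)) = (\<Prod>v\<in>set (a # L). d - length (suffix_at (a # L) v)) * (\<Prod>v\<in>P. d - length (state a L Q Q' v))"
      proof -
        have "(\<Prod>v\<in>set (a # L). d - length (state a L Q Q' v)) = (\<Prod>v\<in>set (a # L). d - length (suffix_at (a # L) v))"
          by (rule prod.cong) (use dist L2(2) in \<open>auto simp: state_def\<close>)
        moreover have "set (a # L) \<inter> P = {}" using dist P by auto
        ultimately show ?thesis unfolding Vq L2(2) Un_empty_right using P(3)
          by (simp only: prod.union_disjoint finite_set)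
      qed
      also have "(\<Prod>v\<in>P. d - length (state a L Q Q' v)) = 1"
        using P L2 by (intro prod.neutral) (auto simp: state_def)
      also have "(\<Prod>v\<in>set (a # L). d - length (suffix_at (a # L) v)) = fact (d - 1)"
        using prod_suffix_degs[OF dist(1)] prod_degs[of "Suc (length L)" d] L2 by (simp add: L2(1)[symmetric])
      finally show ?thesis
        using RL_split(2)[OF A aq l qn L2(1) C] merged L2 P unfolding V_def[symmetric] b'_def[symmetric, abs_def]
        by (simp add: Kval_last)
    qed
  qed
qed

lemma RL_generic:
  assumes "d \<ge> 2" "B (d - 1) = mconst C"
    and "\<And>b L. distinct L \<Longrightarrow> b ` {1..n} = set L \<Longrightarrow> length L < d \<Longrightarrow> chain b L = G (mset (map (fiber n b) L))"
  shows "Res {1..n} (\<lambda>_. d - 1) (\<lambda>v. pform (\<lambda>j. j) [v]) = Hval d C G {#} n"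
proof -
  have f1: "fiber n (\<lambda>j. j) v = 1" if "v \<in> {1..n}" for v
  proof -
    have "{j \<in> {1..n}. j = v} = {v}" using that by auto
    then show ?thesis by (simp add: fiber_def)
  qed
  \<comment> \<open>The element 1 is taken as first head, and all others are still to be compared
    with it.\<close>
  have V: "set [1] \<union> {2..n} \<union> {} = {1..n}" using n_pos by auto
  have "Res {1..n} (\<lambda>_. d - 1) (\<lambda>v. pform (\<lambda>j. j) [v]) = RL (set [1] \<union> {2..n} \<union> {}) (\<lambda>j. j) (state 1 [] {2..n} {})"
    unfolding V RL_def
  proof (rule Res_cong_all)
    fix i assume "i \<in> {1..n}"
    then have "state 1 [] {2..n} {} i = [i]" by (cases "i = 1") (auto simp: state_def suffix_at_Cons)
    then show "d - 1 = d - length (state 1 [] {2..n} {} i)" "pform (\<lambda>j. j) [i] = pform (\<lambda>j. j) (state 1 [] {2..n} {} i)" by simp_all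
  qed (use assms(1) n_pos in \<open>auto simp: forms_def\<close>)
  also have "\<dots> = Kval d C G (mset (map (fiber n (\<lambda>j. j)) [])) (fiber n (\<lambda>j. j) 1) (card {2..n}) (card ({} :: nat set))"
    by (rule RL_state) (use assms n_pos f1 V in auto)
  also have "\<dots> = Hval d C G {#} n"
    using f1[of 1] n_pos assms(1) Hval_Suc[of "{#}" d C G "n - 1"] by simp
  finally show ?thesis .
qed

end

section \<open>Blocks of a partition and the resultants of the theorem\<close>

lemma suffix_at_rev_upt: "k \<in> {1..l} \<Longrightarrow> suffix_at (rev [1..<Suc l]) k = rev [1..<Suc k]"
proof (induction l)
  case (Suc l)
  then show ?case by (cases "k = Suc l") (auto simp: suffix_at_Cons)
qed simp

context
  fixes \<mu> :: "nat list" and n :: nat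
  assumes \<mu>: "\<mu> \<in> partitions n"
begin

lemma sum_list_take_mono: "i \<le> k \<Longrightarrow> sum_list (take i \<mu>) \<le> sum_list (take k \<mu>)"
  by (metis le_add1 sum_list_append take_add le_Suc_ex)

lemma le_take_block_of: "j \<le> n \<Longrightarrow> j \<le> sum_list (take (block_of \<mu> j) \<mu>)"
  unfolding block_of_def by (rule LeastI[of _ "length \<mu>"]) (use \<mu> in \<open>simp add: partitions_def\<close>)

lemma block_of_iff:
  assumes "j \<le> n"
  shows "block_of \<mu> j = Suc i \<longleftrightarrow> j \<in> {sum_list (take i \<mu>)<..sum_list (take (Suc i) \<mu>)}"
proof
  assume j: "j \<in> {sum_list (take i \<mu>)<..sum_list (take (Suc i) \<mu>)}"
  show "block_of \<mu> j = Suc i" unfolding block_of_def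
  proof (rule Least_equality)
    fix k assume "j \<le> sum_list (take k \<mu>)"
    then show "Suc i \<le> k" using j sum_list_take_mono[of k i] by (cases "k \<le> i") auto
  qed (use j in simp)
next
  assume b: "block_of \<mu> j = Suc i"
  have "\<not> j \<le> sum_list (take i \<mu>)"
    using not_less_Least[of i "\<lambda>i. j \<le> sum_list (take i \<mu>)"] b unfolding block_of_def by simp
  moreover have "j \<le> sum_list (take (Suc i) \<mu>)" using le_take_block_of[OF assms] b by simp
  ultimately show "j \<in> {sum_list (take i \<mu>)<..sum_list (take (Suc i) \<mu>)}" by simp
qed

lemma fiber_block_of:
  assumes "i < length \<mu>"
  shows "fiber n (block_of \<mu>) (Suc i) = \<mu> ! i"
proof -
  have "sum_list (take (Suc i) \<mu>) \<le> n"
    using sum_list_take_mono[of "Suc i" "length \<mu>"] assms \<mu> by (simp add: partitions_def)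
  then have "{j \<in> {1..n}. block_of \<mu> j = Suc i} = {sum_list (take i \<mu>)<..sum_list (take (Suc i) \<mu>)}"
    by (auto simp: block_of_iff)
  then show ?thesis using assms by (simp add: fiber_def take_Suc_conv_app_nth)
qed

lemma block_of_range: "block_of \<mu> ` {1..n} \<subseteq> {1..length \<mu>}"
proof (rule image_subsetI)
  fix j assume j: "j \<in> {1..n}"
  have "block_of \<mu> j \<noteq> 0" using le_take_block_of[of j] j by (intro notI) auto
  moreover have "block_of \<mu> j \<le> length \<mu>"
    unfolding block_of_def by (rule Least_le) (use j \<mu> in \<open>simp add: partitions_def\<close>)
  ultimately show "block_of \<mu> j \<in> {1..length \<mu>}" by simp
qed

lemma mset_fiber_block_of: "mset (map (fiber n (block_of \<mu>)) (rev [1..<Suc (length \<mu>)])) = mset \<mu>"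
proof -
  have "map (fiber n (block_of \<mu>)) [1..<Suc (length \<mu>)] = \<mu>"
    by (rule nth_equalityI) (auto simp: fiber_block_of nth_append simp del: upt_Suc)
  then show ?thesis by (metis mset_rev rev_map)
qed

end

lemma mset_fibers_mpart:
  assumes "distinct L" "b ` {1..n} = set L"
  shows "mset (map (fiber n b) L) \<in> mpart n"
proof -
  have "fiber n b v \<noteq> 0" if "v \<in> set L" for v
  proof -
    have "v \<in> b ` {1..n}" using that assms by simp
    then show ?thesis by (auto simp: fiber_def)
  qed
  then have "0 \<notin> fiber n b ` set L" by force
  moreover have "(\<Sum>v\<in>set L. fiber n b v) = n"
    using sum.group[of "{1..n}" "set L" b "\<lambda>_. 1 :: nat"] assms by (simp add: fiber_def)
  ultimately show ?thesis
    using assms(1) by (simp add: mpart_def sum_mset_sum_list sum_list_distinct_conv_sum_set del: mset_map)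
qed

context
  fixes n d :: nat and B :: "nat \<Rightarrow> (nat, cring) mpoly"
  assumes nd: "n \<ge> 1" "d \<ge> 2" and B: "sym_gradient n d (sym_generic n d) B"
begin

interpretation S: symmetric_coeffs n d B
  using B nd by unfold_locales (auto simp: sym_gradient_def)

lemma sym_partial_eq: "i \<in> {1..n} \<Longrightarrow> sym_partial n d i = S.pform (\<lambda>j. j) [i]"
  using B by (simp add: sym_partial_def sym_gradient_def S.pform_def)

lemma partition_resultant_eq:
  assumes \<mu>: "\<mu> \<in> partitions n" "length \<mu> < d"
  shows "partition_resultant n d \<mu> = S.chain (block_of \<mu>) (rev [1..<Suc (length \<mu>)])"
proof -
  define l where "l = length \<mu>"
  have l0: "l > 0" using \<mu> nd by (auto simp: l_def partitions_def)
  have F: "forms {1..l} (\<lambda>k. d - k)" using \<mu>(2) l0 unfolding forms_def l_def by (auto simp: Suc_le_eq)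
  \<comment> \<open>The chosen index of block i is legitimate because the block has positive size,
    and all indices of a block give the same form.\<close>
  have spec: "sym_partial_spec n d \<mu> i = S.pform (block_of \<mu>) [i]" if i: "i \<in> {1..l}" for i
  proof -
    have "fiber n (block_of \<mu>) i = \<mu> ! (i - 1)" using fiber_block_of[OF \<mu>(1), of "i - 1"] i by (cases i) (auto simp: l_def)
    moreover have "\<mu> ! (i - 1) \<in> set \<mu>" using i by (intro nth_mem) (auto simp: l_def)
    ultimately have "fiber n (block_of \<mu>) i > 0" using \<mu>(1) by (auto simp: partitions_def)
    then have "\<exists>j. j \<in> {1..n} \<and> block_of \<mu> j = i" unfolding fiber_def card_gt_0_iff by blast
    then have j: "(SOME j. j \<in> {1..n} \<and> block_of \<mu> j = i) \<in> {1..n}" "block_of \<mu> (SOME j. j \<in> {1..n} \<and> block_of \<mu> j = i) = i"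
      by (metis (mono_tags, lifting) someI_ex)+
    show ?thesis unfolding sym_partial_spec_def specialize_def sym_partial_eq[OF j(1)] S.pform_subst list.map j(2) ..
  qed
  have "divided_difference (d - 1) (sym_partial_spec n d \<mu>) [1..<k + 1] = S.pform (block_of \<mu>) (rev [1..<Suc k])"
    if k: "k \<in> {1..l}" for k
  proof -
    have "mhomogeneous (d - 1 - k) (meval mconst (\<lambda>j. mvar (block_of \<mu> j)) (B k))" if "k < d" for k
    proof -
      have "is_form UNIV (d - 1 - k) (meval mconst (\<lambda>j. mvar (block_of \<mu> j)) (B k))"
        by (rule is_form_subst[OF S.B_form[OF that]], rule is_form_mvar) simp
      then show ?thesis by (simp add: is_form_def)
    qed
    moreover have "sym_partial_spec n d \<mu> j = dd (\<lambda>k. meval mconst (\<lambda>j. mvar (block_of \<mu> j)) (B k)) d [mvar j]"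
      if "j \<in> set [1..<k + 1]" for j
    proof -
      have "j \<in> {1..l}" using that k by (auto simp del: upt_Suc)
      then show ?thesis by (simp only: spec S.pform_def list.map)
    qed
    ultimately show ?thesis
      using k nd unfolding S.pform_def Suc_eq_plus1 by (intro divided_difference_eq) (simp_all del: upt_Suc)
  qed
  then have "partition_resultant n d \<mu> = Res {1..l} (\<lambda>k. d - k) (\<lambda>k. S.pform (block_of \<mu>) (rev [1..<Suc k]))"
    unfolding partition_resultant_def l_def[symmetric] resultant_forms_eq[OF F] by (intro forms.Res_cong[OF F])
  also have "\<dots> = S.chain (block_of \<mu>) (rev [1..<Suc l])"
  proof -
    have s: "set (rev [1..<Suc l]) = {1..l}" by auto
    show ?thesis unfolding S.chain_def S.RL_def s
      by (rule Res_cong_all[OF _ _ F]) (simp_all only: suffix_at_rev_upt length_rev length_upt diff_Suc_1)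
  qed
  finally show ?thesis by (simp only: l_def)
qed

lemma grad_resultant_eq:
  assumes C: "B (d - 1) = mconst C"
  shows "of_nat d ^ disc_exponent n d * discriminant_form n d (sym_generic n d) =
    C ^ cexp d 0 n * (\<Prod>\<mu> | \<mu> \<in> partitions n \<and> length \<mu> < d. partition_resultant n d \<mu> ^ partition_mult \<mu>)"
proof -
  \<comment> \<open>\<open>Hval\<close> is indexed by multisets and the theorem by sorted lists;
    \<open>inv_into\<close> passes from the former to the latter.\<close>
  define G where "G W = partition_resultant n d (inv_into (partitions n) mset W)" for W
  note bij = bij_betw_mset_partitions[of n]
  have F: "forms {1..n} (\<lambda>_. d - 1)" using nd by (auto simp: forms_def)
  have "of_nat d ^ disc_exponent n d * discriminant_form n d (sym_generic n d) =
      Res {1..n} (\<lambda>_. d - 1) (\<lambda>i. mpderiv i (sym_generic n d))"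
    using B nd by (intro discriminant_form_eq) (auto simp: sym_gradient_def)
  also have "\<dots> = Res {1..n} (\<lambda>_. d - 1) (\<lambda>i. S.pform (\<lambda>j. j) [i])"
    by (rule forms.Res_cong[OF F]) (simp only: sym_partial_eq flip: sym_partial_def)
  also have "\<dots> = Hval d C G {#} n"
  proof (rule S.RL_generic[OF nd(2) C])
    fix b :: "nat \<Rightarrow> nat" and L assume L: "distinct L" "b ` {1..n} = set L" "length L < d"
    define W where "W = mset (map (fiber n b) L)"
    have "W \<in> mset ` partitions n"
      unfolding W_def using mset_fibers_mpart[OF L(1,2)] bij_betw_imp_surj_on[OF bij] by simp
    define \<mu> where "\<mu> = inv_into (partitions n) mset W"
    have \<mu>: "\<mu> \<in> partitions n" "mset \<mu> = W"
      using \<open>W \<in> mset ` partitions n\<close> by (simp_all add: \<mu>_def inv_into_into f_inv_into_f)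
    have len: "length \<mu> = length L" using arg_cong[OF \<mu>(2), of size] by (simp add: W_def)
    have "S.chain b L = S.chain (block_of \<mu>) (rev [1..<Suc (length \<mu>)])"
      by (rule S.chain_type) (use L block_of_range[OF \<mu>(1)] mset_fiber_block_of[OF \<mu>(1)] \<mu>(2) in \<open>auto simp: W_def\<close>)
    also have "\<dots> = G W" using partition_resultant_eq[OF \<mu>(1)] len L(3) by (simp add: G_def \<mu>_def)
    finally show "S.chain b L = G (mset (map (fiber n b) L))" by (simp only: W_def)
  qed
  also have "\<dots> = C ^ cexp d 0 n * (\<Prod>\<nu> | \<nu> \<in> mpart n \<and> size \<nu> < d. G \<nu> ^ mmult \<nu>)"
    by (simp add: Hval_def)
  also have "(\<Prod>\<nu> | \<nu> \<in> mpart n \<and> size \<nu> < d. G \<nu> ^ mmult \<nu>) =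
      (\<Prod>\<mu> | \<mu> \<in> partitions n \<and> length \<mu> < d. G (mset \<mu>) ^ mmult (mset \<mu>))"
    by (rule prod.reindex_bij_betw[OF bij_betw_mset_partitions_less, symmetric])
  also have "\<dots> = (\<Prod>\<mu> | \<mu> \<in> partitions n \<and> length \<mu> < d. partition_resultant n d \<mu> ^ partition_mult \<mu>)"
    using bij by (intro prod.cong refl) (auto simp: G_def partition_mult_mset bij_betw_def)
  finally show ?thesis .
qed

lemma divided_difference_sym_partial:
  assumes C: "B (d - 1) = mconst C" and "d \<le> n"
  shows "divided_difference (d - 1) (sym_partial n d) [1..<d + 1] = mconst C"
proof -
  have "divided_difference (d - 1) (sym_partial n d) [1..<d + 1] = dd B d (map mvar (rev [1..<d + 1]))"
  proof (rule divided_difference_eq)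
    show "mhomogeneous (d - 1 - k) (B k)" if "k < d" for k using S.B_form[OF that] by (simp add: is_form_def)
    show "sym_partial n d j = dd B d [mvar j]" if "j \<in> set [1..<d + 1]" for j
    proof -
      have "j \<in> {1..n}" using that assms(2) nd by (auto simp del: upt_Suc)
      then show ?thesis by (simp only: sym_partial_eq S.pform_def meval_mconst_mvar list.map)
    qed
  qed (use nd in \<open>simp_all del: upt_Suc\<close>)
  also have "\<dots> = B (d - 1)"
    using dd_full[of "map mvar (rev [1..<d + 1]) :: (nat, cring) mpoly list" B] nd by simp
  finally show ?thesis unfolding C .
qed

end

text \<open>By \<open>fact_dvd_cexp\<close> the exponent is a multiple of (d - 1)!, which is even
  for d \<ge> 3; for d = 2 it is n - 1.\<close>

lemma sign_power_cexp:
  assumes "d \<ge> 2" "n \<ge> 1"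
  shows "((-1) ^ (d - 1) :: 'a::comm_ring_1) ^ cexp d 0 n = (-1) ^ (if d = 2 then n - 1 else 0)"
proof (cases "d = 2")
  case True
  then show ?thesis by (simp add: cexp_2)
next
  case False
  then have d: "d \<ge> 3" using assms by simp
  have "even ((d - 1) * cexp d 0 n)"
  proof (cases "even (d - 1)")
    case False
    have "2 dvd (fact (d - 1) :: nat)" using d by (intro dvd_fact) auto
    then show ?thesis using dvd_trans[OF _ fact_dvd_cexp[of d 0 n]] by simp
  qed simp
  then show ?thesis using False by (simp flip: power_mult)
qed

theorem theorem4p2:
  fixes n d :: nat
  assumes "n \<ge> 2" and "d \<ge> 2"
  shows
    "(d > n \<longrightarrow>
        of_nat d ^ disc_exponent n d * discriminant_form n d (sym_generic n d) =
        (\<Prod>\<mu>\<in>partitions n. partition_resultant n d \<mu> ^ partition_mult \<mu>)) \<and>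
     (d \<le> n \<longrightarrow>
        coeff_exponent n d \<ge> 0 \<and>
        mconst (of_nat d ^ disc_exponent n d * discriminant_form n d (sym_generic n d)) =
          divided_difference (d - 1) (sym_partial n d) [1..<d + 1] ^ nat (coeff_exponent n d) *
          mconst (\<Prod>\<mu> | \<mu> \<in> partitions n \<and> length \<mu> < d.
                    partition_resultant n d \<mu> ^ partition_mult \<mu>) \<and>
        divided_difference (d - 1) (sym_partial n d) [1..<d + 1] =
          mconst ((-1) ^ (d - 1) * mvar [d]) \<and>
        of_nat d ^ disc_exponent n d * discriminant_form n d (sym_generic n d) =
          (-1) ^ (if d = 2 then n - 1 else 0) * mvar [d] ^ nat (coeff_exponent n d) *
          (\<Prod>\<mu> | \<mu> \<in> partitions n \<and> length \<mu> < d.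
             partition_resultant n d \<mu> ^ partition_mult \<mu>))"
proof -
  define C :: cring where "C = (-1) ^ (d - 1) * mvar [d]"
  define R where "R = (\<Prod>\<mu> | \<mu> \<in> partitions n \<and> length \<mu> < d. partition_resultant n d \<mu> ^ partition_mult \<mu>)"
  have nd: "n \<ge> 1" "d \<ge> 2" using assms by auto
  obtain B where B: "sym_gradient n d (sym_generic n d) B" "B (d - 1) = mconst C"
    using sym_gradient_sym_generic[of d n] assms unfolding C_def by auto
  have e: "nat (coeff_exponent n d) = cexp d 0 n" "coeff_exponent n d \<ge> 0" using coeff_exponent_eq[OF nd(2,1)] by simp_all
  have E: "of_nat d ^ disc_exponent n d * discriminant_form n d (sym_generic n d) = C ^ cexp d 0 n * R"
    unfolding R_def by (rule grad_resultant_eq[OF nd B])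
  have "R = (\<Prod>\<mu>\<in>partitions n. partition_resultant n d \<mu> ^ partition_mult \<mu>)" if "d > n"
  proof -
    have "length \<mu> \<le> n" if "\<mu> \<in> partitions n" for \<mu>
    proof -
      have "length \<mu> \<le> sum_list \<mu>" if "\<forall>k\<in>set \<mu>. k > 0" using that by (induction \<mu>) (auto simp: Suc_le_eq)
      then show ?thesis using that by (auto simp: partitions_def)
    qed
    then have "{\<mu>. \<mu> \<in> partitions n \<and> length \<mu> < d} = partitions n" using that by fastforce
    then show ?thesis by (simp add: R_def)
  qed
  moreover have "cexp d 0 n = 0" if "d > n" using that by (intro cexp_eq_0) simp
  moreover have "mconst (C ^ cexp d 0 n * R) = mconst C ^ cexp d 0 n * (mconst R :: (nat, cring) mpoly)"
  proof -
    interpret h: comm_ring_hom "mconst :: cring \<Rightarrow> (nat, cring) mpoly" by (rule comm_ring_hom_mconst)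
    show ?thesis by (simp add: h.hom_mult h.hom_power)
  qed
  moreover have "C ^ cexp d 0 n = (-1) ^ (if d = 2 then n - 1 else 0) * mvar [d] ^ cexp d 0 n"
    unfolding C_def power_mult_distrib sign_power_cexp[OF nd(2,1)] ..
  moreover have "divided_difference (d - 1) (sym_partial n d) [1..<d + 1] = mconst C" if "d \<le> n"
    by (rule divided_difference_sym_partial[OF nd B that])
  ultimately show ?thesis unfolding E R_def[symmetric] C_def[symmetric] e(1) using e(2) by simp
qed

end
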